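(* Let $S_0:\tilde H^{-1/2}(-1,1)\to H^{1/2}(-1,1)$ be the Laplace single-layer operator on the segment $[-1,1]$, let $\omega(x)=\sqrt{1-x^2}$, and let $S_{0,\omega}=S_0\frac1\omega : T^{-1/2}\to T^{1/2}$ be the weighted single-layer operator. Then $S_{0,\omega}$ is invertible and $$S_{0,\omega}^{-1}=2\sqrt{-(\omega\partial_x)^2}+\frac{2}{\ln 2}\,\pi_0,$$ or equivalently $$S_0^{-1}=\frac{2}{\omega}\sqrt{-(\omega\partial_x)^2}+\frac{2}{\ln 2}\,\frac{\pi_0}{\omega},$$ where $\pi_0$ is the $L^2_{1/\omega}$-orthogonal projection on $T_0\equiv 1$, that is $\pi_0\phi=\frac1\pi\int_{-1}^1\frac{\phi(y)}{\omega(y)}\,dy$.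
   Context: $T_n(x)=\cos(n\arccos x)$ are the Chebyshev polynomials of the first kind on $[-1,1]$. Set $\omega(x)=\sqrt{1-x^2}$; $\omega$ also denotes the operator of multiplication by $\omega(x)$, and $\partial_x$ is differentiation, so $(\omega\partial_x)^2u=\omega\,\frac{d}{dx}\big(\omega\,\frac{du}{dx}\big)$. $L^2_{1/\omega}$ is the space of $u\in L^1_{loc}(-1,1)$ with $\int_{-1}^1|u|^2/\omega\,dx<\infty$, with inner product $(u,v)_{1/\omega}=\frac1\pi\int_{-1}^1 \frac{u\bar v}{\omega}\,dx$. The family $(T_n)_{n\ge0}$ is a complete orthogonal family of it, and $\hat u_n=(u,T_n)_{1/\omega}/(T_n,T_n)_{1/\omega}$. For $s\ge 0$, $T^s=\{u\in L^2_{1/\omega}:\sum_{n\ge 0}(1+n^2)^s|\hat u_n|^2<\infty\}$. For $s<0$, $T^s$ is the analogous space of formal series $\sum \hat u_nT_n$ satisfying the same summability condition, identified with the dual of $T^{-s}$ through the extension of the bilinear form $\frac1\pi\int_{-1}^1 uv/\omega\,dx$. Formulas such as that for $\pi_0$ are understood in the sense of this extension. The operator $-(\omega\partial_x)^2$ is regarded as a nonnegative self-adjoint operator in $L^2_{1/\omega}$ (the realization having the $T_n$ as eigenfunctions); $\sqrt{-(\omega\partial_x)^2}$ is its square root defined by the spectral theorem, extended by continuity to an operator $T^s\to T^{s-1}$ for every real $s$. $H^{1/2}(-1,1)$ is the space of restrictions to $(-1,1)$ of elements of $H^{1/2}(\mathbb R)$ and $\tilde H^{-1/2}(-1,1)$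 is the space of elements of $H^{-1/2}(\mathbb R)$ supported in $[-1,1]$. One has $T^{1/2}=H^{1/2}(-1,1)$ and $T^{-1/2}=\omega\tilde H^{-1/2}(-1,1)$; for $\alpha\in T^{-1/2}$, $\alpha/\omega\in\tilde H^{-1/2}(-1,1)$ is defined by extension by continuity from smooth $\alpha$. The operator $S_0$ is the continuous extension $\tilde H^{-1/2}(-1,1)\to H^{1/2}(-1,1)$ of $$S_0\phi(x)=-\frac1{2\pi}\int_{-1}^1\ln|x-y|\,\phi(y)\,dy,$$ and $S_{0,\omega}\alpha=S_0(\alpha/\omega)$; for $\alpha\in C^\infty([-1,1])$, $S_{0,\omega}\alpha(x)=-\frac1{2\pi}\int_{-1}^1\frac{\ln|x-y|}{\omega(y)}\alpha(y)\,dy$. *)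

theory Defs
  imports "HOL-Analysis.Analysis"
begin

section \<open>Bounded operators between spaces of complex-valued functions\<close>

text \<open>
  All spaces below are sets of functions with values in \<^typ>\<open>complex\<close> (coefficient sequences, or
  distributions seen as functionals), with pointwise vector operations; the norm is a separate
  argument.
\<close>

definition bounded_op ::
  "('a \<Rightarrow> complex) set \<Rightarrow> (('a \<Rightarrow> complex) \<Rightarrow> real) \<Rightarrow>
   ('b \<Rightarrow> complex) set \<Rightarrow> (('b \<Rightarrow> complex) \<Rightarrow> real) \<Rightarrow>
   (('a \<Rightarrow> complex) \<Rightarrow> ('b \<Rightarrow> complex)) \<Rightarrow> bool" where
  "bounded_op X nX Y nY F \<longleftrightarrow>
     (\<forall>x\<in>X. F x \<in> Y) \<and>
     (\<forall>x\<in>X. \<forall>y\<in>X. F (\<lambda>i. x i + y i) = (\<lambda>j. F x j + F y j)) \<and>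
     (\<forall>c. \<forall>x\<in>X. F (\<lambda>i. c * x i) = (\<lambda>j. c * F x j)) \<and>
     (\<exists>C. \<forall>x\<in>X. nY (F x) \<le> C * nX x)"

definition bounded_iso ::
  "('a \<Rightarrow> complex) set \<Rightarrow> (('a \<Rightarrow> complex) \<Rightarrow> real) \<Rightarrow>
   ('b \<Rightarrow> complex) set \<Rightarrow> (('b \<Rightarrow> complex) \<Rightarrow> real) \<Rightarrow>
   (('a \<Rightarrow> complex) \<Rightarrow> ('b \<Rightarrow> complex)) \<Rightarrow> bool" where
  "bounded_iso X nX Y nY F \<longleftrightarrow>
     bounded_op X nX Y nY F \<and> bij_betw F X Y \<and> bounded_op Y nY X nX (inv_into X F)"

text \<open>
  The extension by continuity to \<open>X \<rightarrow> Y\<close> of an operator given by its graph \<open>R\<close> on a (dense)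
  part of \<open>X\<close>.
\<close>

definition continuous_extension ::
  "('a \<Rightarrow> complex) set \<Rightarrow> (('a \<Rightarrow> complex) \<Rightarrow> real) \<Rightarrow>
   ('b \<Rightarrow> complex) set \<Rightarrow> (('b \<Rightarrow> complex) \<Rightarrow> real) \<Rightarrow>
   (('a \<Rightarrow> complex) \<times> ('b \<Rightarrow> complex)) set \<Rightarrow> ('a \<Rightarrow> complex) \<Rightarrow> ('b \<Rightarrow> complex)" where
  "continuous_extension X nX Y nY R x =
     (THE y. \<exists>F. bounded_op X nX Y nY F \<and> (\<forall>(d, e)\<in>R. F d = e) \<and> y = F x)"

section \<open>Distributions and Sobolev spaces\<close>

definition smooth :: "(real \<Rightarrow> complex) \<Rightarrow> bool" where
  "smooth f \<longleftrightarrow> (\<forall>k x. ((\<lambda>g y. vector_derivative g (at y)) ^^ k) f differentiable (at x))"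

definition test_funs :: "real set \<Rightarrow> (real \<Rightarrow> complex) set" where
  "test_funs I = {\<phi>. smooth \<phi> \<and> (\<exists>K. compact K \<and> K \<subseteq> I \<and> (\<forall>x. x \<notin> K \<longrightarrow> \<phi> x = 0))}"

text \<open>
  A distribution on an open set \<open>I\<close> is a functional on \<^term>\<open>test_funs I\<close>, given the value \<open>0\<close>
  at all other functions so that equality of distributions is equality in HOL.
\<close>

type_synonym dist = "(real \<Rightarrow> complex) \<Rightarrow> complex"

definition regular_dist :: "real set \<Rightarrow> (real \<Rightarrow> complex) \<Rightarrow> dist" where
  "regular_dist I u = (\<lambda>\<phi>. if \<phi> \<in> test_funs I then (LINT x:I|lborel. u x * \<phi> x) else 0)"

definition restrict_dist :: "real set \<Rightarrow> dist \<Rightarrow> dist" where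
  "restrict_dist I u = (\<lambda>\<phi>. if \<phi> \<in> test_funs I then u \<phi> else 0)"

definition inv_fourier :: "(real \<Rightarrow> complex) \<Rightarrow> real \<Rightarrow> complex" where
  "inv_fourier \<phi> \<xi> = complex_of_real (1 / (2 * pi)) * (LINT x|lborel. cis (x * \<xi>) * \<phi> x)"

text \<open>
  \<open>g\<close> is the Fourier transform of \<open>u\<close>, i.e. \<open>u(\<phi>) = \<integral> g(\<xi>) (F\<inverse>\<phi>)(\<xi>) d\<xi>\<close> for all test
  functions, and \<open>(1 + \<xi>\<^sup>2)\<^bsup>s/2\<^esup> g\<close> is square integrable.
\<close>

definition sobolev_fourier :: "real \<Rightarrow> dist \<Rightarrow> (real \<Rightarrow> complex) \<Rightarrow> bool" where
  "sobolev_fourier s u g \<longleftrightarrow>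
     g \<in> borel_measurable lborel \<and>
     integrable lborel (\<lambda>\<xi>. (1 + \<xi>\<^sup>2) powr s * (cmod (g \<xi>))\<^sup>2) \<and>
     u = (\<lambda>\<phi>. if \<phi> \<in> test_funs UNIV then (LINT \<xi>|lborel. g \<xi> * inv_fourier \<phi> \<xi>) else 0)"

definition sobolev :: "real \<Rightarrow> dist set" where
  "sobolev s = {u. \<exists>g. sobolev_fourier s u g}"

text \<open>The transform \<open>g\<close> is determined by \<open>u\<close> almost everywhere, so the infimum is over one value.\<close>

definition sobolev_norm :: "real \<Rightarrow> dist \<Rightarrow> real" where
  "sobolev_norm s u =
     Inf {sqrt (LINT \<xi>|lborel. (1 + \<xi>\<^sup>2) powr s * (cmod (g \<xi>))\<^sup>2) | g. sobolev_fourier s u g}"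

definition H_half :: "dist set" where
  "H_half = restrict_dist {-1<..<1} ` sobolev (1/2)"

definition H_half_norm :: "dist \<Rightarrow> real" where
  "H_half_norm v = Inf {sobolev_norm (1/2) U | U. U \<in> sobolev (1/2) \<and> restrict_dist {-1<..<1} U = v}"

text \<open>Being supported in \<open>[-1,1]\<close> means vanishing on test functions of the complement.\<close>

definition H_tilde :: "dist set" where
  "H_tilde = {u \<in> sobolev (-1/2). \<forall>\<phi>\<in>test_funs (- {-1..1}). u \<phi> = 0}"

definition H_tilde_norm :: "dist \<Rightarrow> real" where
  "H_tilde_norm = sobolev_norm (-1/2)"

section \<open>The weighted space and the Chebyshev scale\<close>

definition weight :: "real \<Rightarrow> real" where
  "weight x = sqrt (1 - x\<^sup>2)"

definition cheb :: "nat \<Rightarrow> real \<Rightarrow> complex" where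
  "cheb n x = complex_of_real (cos (real n * arccos x))"

text \<open>
  Elements of the weighted space are functions, not classes modulo null sets; values outside
  \<open>(-1,1)\<close> are irrelevant. Local integrability follows from the two conditions.
\<close>

definition L2w :: "(real \<Rightarrow> complex) set" where
  "L2w = {u. set_borel_measurable lborel {-1<..<1} u \<and>
             set_integrable lborel {-1<..<1} (\<lambda>x. (cmod (u x))\<^sup>2 / weight x)}"

definition innerw :: "(real \<Rightarrow> complex) \<Rightarrow> (real \<Rightarrow> complex) \<Rightarrow> complex" where
  "innerw u v =
     complex_of_real (1 / pi) *
       (LINT x:{-1<..<1}|lborel. u x * cnj (v x) / complex_of_real (weight x))"

definition cheb_coeff :: "(real \<Rightarrow> complex) \<Rightarrow> nat \<Rightarrow> complex" where
  "cheb_coeff u n = innerw u (cheb n) / innerw (cheb n) (cheb n)"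

text \<open>
  An element of \<open>T\<^sup>s\<close> is written as the coefficient sequence of its Chebyshev series. For
  \<open>s \<ge> 0\<close> the sequence has to be the one of a function \<open>u\<close> of the weighted space; \<open>u\<close> is then
  unique almost everywhere. For \<open>s < 0\<close> the series is formal.
\<close>

definition cheb_space :: "real \<Rightarrow> (nat \<Rightarrow> complex) set" where
  "cheb_space s =
     {a. summable (\<lambda>n. (1 + (real n)\<^sup>2) powr s * (cmod (a n))\<^sup>2) \<and>
         (s \<ge> 0 \<longrightarrow> a \<in> cheb_coeff ` L2w)}"

definition cheb_norm :: "real \<Rightarrow> (nat \<Rightarrow> complex) \<Rightarrow> real" where
  "cheb_norm s a = sqrt (\<Sum>n. (1 + (real n)\<^sup>2) powr s * (cmod (a n))\<^sup>2)"

text \<open>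
  The coefficient sequence of a distribution on \<open>(-1,1)\<close> that is a function of the weighted space.
\<close>

definition cheb_series :: "dist \<Rightarrow> nat \<Rightarrow> complex" where
  "cheb_series d = (THE a. \<exists>u\<in>L2w. regular_dist {-1<..<1} u = d \<and> a = cheb_coeff u)"

section \<open>The square root of the weighted second derivative\<close>

text \<open>
  Unbounded operators in the weighted space are represented by their graphs. A graph equal to its
  adjoint contains with a pair of functions every pair equal to it almost everywhere; being densely
  defined (the orthogonal complement of the domain is trivial), it is single-valued modulo null
  sets.
\<close>

type_synonym graph = "((real \<Rightarrow> complex) \<times> (real \<Rightarrow> complex)) set"

definition adjoint_graph :: "graph \<Rightarrow> graph" where
  "adjoint_graph G = {(v, w). v \<in> L2w \<and> w \<in> L2w \<and> (\<forall>(u, f)\<in>G. innerw f v = innerw u w)}"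

definition densely_defined :: "graph \<Rightarrow> bool" where
  "densely_defined G \<longleftrightarrow>
     (\<forall>v\<in>L2w. (\<forall>u\<in>Domain G. innerw u v = 0) \<longrightarrow> innerw v v = 0)"

definition nonneg_selfadjoint :: "graph \<Rightarrow> bool" where
  "nonneg_selfadjoint G \<longleftrightarrow>
     densely_defined G \<and> adjoint_graph G = G \<and> (\<forall>(u, f)\<in>G. 0 \<le> Re (innerw f u))"

definition weighted_deriv :: "(real \<Rightarrow> complex) \<Rightarrow> real \<Rightarrow> complex" where
  "weighted_deriv u x = complex_of_real (weight x) * vector_derivative u (at x)"

text \<open>
  The realization of \<open>-(\<omega>\<partial>\<^sub>x)\<^sup>2\<close>: the nonnegative self-adjoint operator acting as this
  differential expression on every Chebyshev polynomial.
\<close>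

definition weighted_laplace :: graph where
  "weighted_laplace =
     (THE A. nonneg_selfadjoint A \<and>
             (\<forall>n. (cheb n, \<lambda>x. - weighted_deriv (weighted_deriv (cheb n)) x) \<in> A))"

definition op_sqrt :: "graph \<Rightarrow> graph" where
  "op_sqrt A = (THE B. nonneg_selfadjoint B \<and> B O B = A)"

definition sqrt_laplace :: "real \<Rightarrow> (nat \<Rightarrow> complex) \<Rightarrow> (nat \<Rightarrow> complex)" where
  "sqrt_laplace s =
     continuous_extension (cheb_space s) (cheb_norm s) (cheb_space (s - 1)) (cheb_norm (s - 1))
       {(cheb_coeff u, cheb_coeff f) | u f.
          (u, f) \<in> op_sqrt weighted_laplace \<and> cheb_coeff u \<in> cheb_space s}"

definition mean_value :: "(real \<Rightarrow> complex) \<Rightarrow> real \<Rightarrow> complex" where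
  "mean_value u x =
     complex_of_real (1 / pi) * (LINT y:{-1<..<1}|lborel. u y / complex_of_real (weight y))"

text \<open>
  \<open>\<pi>\<^sub>0\<close> on \<open>T\<^sup>s\<close>. The constant function \<^term>\<open>mean_value u\<close> is the orthogonal projection of \<open>u\<close>
  on \<open>T\<^sub>0\<close>; for \<open>s \<ge> 0\<close> nothing is extended.
\<close>

definition proj0 :: "real \<Rightarrow> (nat \<Rightarrow> complex) \<Rightarrow> (nat \<Rightarrow> complex)" where
  "proj0 s =
     continuous_extension (cheb_space s) (cheb_norm s) (cheb_space s) (cheb_norm s)
       {(cheb_coeff u, cheb_coeff (mean_value u)) | u. u \<in> L2w \<and> cheb_coeff u \<in> cheb_space s}"

section \<open>Single-layer operators\<close>

definition log_potential :: "(real \<Rightarrow> complex) \<Rightarrow> real \<Rightarrow> complex" where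
  "log_potential \<phi> x =
     - complex_of_real (1 / (2 * pi)) *
       (LINT y:{-1<..<1}|lborel. complex_of_real (ln \<bar>x - y\<bar>) * \<phi> y)"

definition single_layer :: "dist \<Rightarrow> dist" where
  "single_layer =
     continuous_extension H_tilde H_tilde_norm H_half H_half_norm
       {(regular_dist UNIV \<phi>, regular_dist {-1<..<1} (log_potential \<phi>)) | \<phi>.
          \<phi> \<in> test_funs {-1<..<1}}"

text \<open>
  \<open>\<alpha> \<mapsto> \<alpha>/\<omega>\<close>, starting from \<open>\<alpha> \<in> C\<^sup>\<infinity>([-1,1])\<close>, i.e. restrictions of smooth functions on the
  line; \<open>\<alpha>/\<omega>\<close> is extended by \<open>0\<close> outside the segment.
\<close>

definition div_weight :: "(nat \<Rightarrow> complex) \<Rightarrow> dist" where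
  "div_weight =
     continuous_extension (cheb_space (-1/2)) (cheb_norm (-1/2)) H_tilde H_tilde_norm
       {(cheb_coeff \<alpha>, regular_dist UNIV (\<lambda>x. indicator {-1<..<1} x * (\<alpha> x / complex_of_real (weight x)))) | \<alpha>.
          smooth \<alpha>}"

definition weighted_single_layer :: "(nat \<Rightarrow> complex) \<Rightarrow> (nat \<Rightarrow> complex)" where
  "weighted_single_layer \<alpha> = cheb_series (single_layer (div_weight \<alpha>))"

end

theory Submission
  imports Defs "HOL-Probability.Sinc_Integral"
begin

text \<open>
  In Chebyshev coefficients every operator of the theorem is diagonal. Let \<open>h\<^sub>n\<close> be the Fourier transform of
  \<open>T\<^sub>n/\<omega>\<close>, extended by \<open>0\<close>. The logarithmic integrals of the \<open>T\<^sub>n\<close> show that \<open>n h\<^sub>n(\<xi>)/|\<xi>|\<close> (for \<open>n = 0\<close>: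
  \<open>(h\<^sub>0(\<xi>) - h\<^sub>0(2\<xi>))/(ln 2 |\<xi>|)\<close>) is the Fourier transform of an extension of \<open>T\<^sub>n\<close> from \<open>(-1,1)\<close> to the line,
  and that the two families are biorthogonal. With the Sobolev weights \<open>(1 + \<xi>\<^sup>2)\<close> to the powers \<open>-1/4\<close> and \<open>1/4\<close> they
  satisfy Bessel inequalities for the \<open>l\<^sup>2\<close> norms of \<open>T\<close> of order \<open>-1/2\<close> and \<open>1/2\<close>, so by duality both coefficient
  maps are isomorphisms onto the Sobolev spaces. By density and duality the single-layer operator then has to
  multiply the coefficients by \<open>ln 2 / 2\<close> and \<open>1 / (2 n)\<close>, while \<open>\<surd>(-(\<omega>\<partial>\<^sub>x)\<^sup>2)\<close> multiplies them by \<open>n\<close>: a nonnegative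
  square root is forced to have the \<open>T\<^sub>n\<close> as eigenfunctions.
\<close>

hide_fact (open) Henstock_Kurzweil_Integration.integral_add Henstock_Kurzweil_Integration.integrable_add
  Henstock_Kurzweil_Integration.integral_diff Henstock_Kurzweil_Integration.integrable_diff
  Henstock_Kurzweil_Integration.integral_nonneg Henstock_Kurzweil_Integration.integral_sum
  Henstock_Kurzweil_Integration.integrable_sum Henstock_Kurzweil_Integration.integrable_bound

text \<open>The single layer has the symbol \<open>1 / (2 |\<xi>|)\<close>, so the eigenvalue
  \<open>1 / (2 n)\<close> on \<open>T_n / \<omega>\<close> says that \<open>n h_n / |\<xi>|\<close>
  is the transform of an extension of \<open>T_n\<close>. For \<open>n = 0\<close> the quotient
  diverges at 0, where \<open>h_0 = pi\<close>. The arcsine density dilated to \<open>[-2,2]\<close>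
  has the same mass, and its potential is constant on the segment with another value; the difference
  of the two has mass zero and a nonzero constant potential there, hence
  \<open>h_0(\<xi>) - h_0(2 \<xi>)\<close> and the factor \<open>ln 2\<close>.

  Both Bessel inequalities rest on one fact: by biorthogonality the functions
  \<open>h_n / sqrt |\<xi>|\<close>, \<open>n > 0\<close>, are orthogonal. This fits the homogeneous
  weights; for the positive order low frequencies need a separate estimate.

  The operators are defined as unique continuous extensions, so uniqueness must be proved. The graph
  of the single layer contains only test functions of the open segment. A bounded functional that
  vanishes on them has a coefficient sequence whose Chebyshev series is the zero distribution, and
  this replaces a direct density proof.\<close>

abbreviation cpx :: "real \<Rightarrow> complex" where
  "cpx \<equiv> complex_of_real"

text \<open>The exponent is the decay \<open>-1/3\<close> of \<open>cheb_ft\<close>, lowered by one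
  through the division by \<open>|\<xi>|\<close> in \<open>cheb_ext\<close>. It lies below
  \<open>-1\<close>, so the function is integrable, and so is its square multiplied by
  \<open>1 + |\<xi>|\<close>. Inverse transforms of test functions fit the same bound.\<close>

abbreviation decay :: "real \<Rightarrow> real" where
  "decay \<xi> \<equiv> (1 + \<bar>\<xi>\<bar>) powr (-4/3)"

abbreviation damp :: "real \<Rightarrow> real \<Rightarrow> real" where
  "damp \<epsilon> x \<equiv> exp (- \<epsilon> * \<bar>x\<bar>)"

abbreviation sob_int :: "real \<Rightarrow> (real \<Rightarrow> complex) \<Rightarrow> real" where
  "sob_int s g \<equiv> LINT \<xi>|lborel. (1 + \<xi>^2) powr s * (cmod (g \<xi>))^2"

lemmas int_cong = Bochner_Integration.integral_cong[OF refl]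

section \<open>Square integrable functions and Bessel systems\<close>

definition sq_int :: "'a measure \<Rightarrow> ('a \<Rightarrow> complex) \<Rightarrow> bool" where
  "sq_int M f \<longleftrightarrow> f \<in> borel_measurable M \<and> integrable M (\<lambda>x. (cmod (f x))^2)"

lemma sq_int_measurable: "sq_int M f \<Longrightarrow> f \<in> borel_measurable M"
  by (simp add: sq_int_def)

lemma sq_int_integrable: "sq_int M f \<Longrightarrow> integrable M (\<lambda>x. (cmod (f x))^2)"
  by (simp add: sq_int_def)

lemma sq_int_bound:
  assumes "f \<in> borel_measurable M" "integrable M g" "AE x in M. (cmod (f x))^2 \<le> g x"
  shows "sq_int M f"
  unfolding sq_int_def
proof
  show "integrable M (\<lambda>x. (cmod (f x))^2)"
    by (rule integrable_bound[OF assms(2)])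
       (use assms in auto)
qed fact

lemma two_mult_le_squares: "2 * (a * b) \<le> a^2 + (b::real)^2"
  using zero_le_power2[of "a - b"] by (simp add: power2_diff)

lemma sq_int_mult:
  assumes "sq_int M f" "sq_int M g"
  shows "integrable M (\<lambda>x. f x * g x)"
proof (rule integrable_bound)
  show "integrable M (\<lambda>x. (cmod (f x))^2 + (cmod (g x))^2)"
    using assms by (intro integrable_add sq_int_integrable)
  show "(\<lambda>x. f x * g x) \<in> borel_measurable M"
    using assms by (intro borel_measurable_times sq_int_measurable)
  have "cmod (f x) * cmod (g x) \<le> (cmod (f x))^2 + (cmod (g x))^2" for x
    using two_mult_le_squares[of "cmod (f x)" "cmod (g x)"]
      mult_nonneg_nonneg[OF norm_ge_zero[of "f x"] norm_ge_zero[of "g x"]] by linarith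
  then show "AE x in M. norm (f x * g x) \<le> norm ((cmod (f x))^2 + (cmod (g x))^2)"
    by (auto simp: norm_mult)
qed

lemma sq_int_add:
  assumes "sq_int M f" "sq_int M g"
  shows "sq_int M (\<lambda>x. f x + g x)"
proof (rule sq_int_bound)
  show "(\<lambda>x. f x + g x) \<in> borel_measurable M"
    using assms by (intro borel_measurable_add sq_int_measurable)
  show "integrable M (\<lambda>x. 2 * (cmod (f x))^2 + 2 * (cmod (g x))^2)"
    using assms by (intro integrable_add integrable_mult_right sq_int_integrable)
  have "(cmod (f x + g x))^2 \<le> 2 * (cmod (f x))^2 + 2 * (cmod (g x))^2" for x
  proof -
    have "(cmod (f x + g x))^2 \<le> (cmod (f x) + cmod (g x))^2"
      by (intro power_mono norm_triangle_ineq) auto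
    also have "\<dots> \<le> 2 * (cmod (f x))^2 + 2 * (cmod (g x))^2"
      using two_mult_le_squares[of "cmod (f x)" "cmod (g x)"] by (simp add: power2_sum)
    finally show ?thesis .
  qed
  then show "AE x in M. (cmod (f x + g x))^2 \<le> 2 * (cmod (f x))^2 + 2 * (cmod (g x))^2" by auto
qed

lemma sq_int_mult_bounded:
  assumes "sq_int M f" "h \<in> borel_measurable M" "AE x in M. cmod (h x) \<le> B"
  shows "sq_int M (\<lambda>x. h x * f x)"
proof (rule sq_int_bound)
  show "(\<lambda>x. h x * f x) \<in> borel_measurable M"
    using assms sq_int_measurable by (intro borel_measurable_times) auto
  show "integrable M (\<lambda>x. B^2 * (cmod (f x))^2)"
    using assms by (intro integrable_mult_right sq_int_integrable)
  show "AE x in M. (cmod (h x * f x))^2 \<le> B^2 * (cmod (f x))^2"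
    using assms(3) by eventually_elim (auto simp: norm_mult power_mult_distrib intro!: mult_right_mono power_mono)
qed

lemma sq_int_cmult: "sq_int M f \<Longrightarrow> sq_int M (\<lambda>x. c * f x)"
  by (rule sq_int_mult_bounded[where B = "cmod c"]) auto

lemma integrable_bounded_mult:
  fixes f h :: "'a \<Rightarrow> complex"
  assumes f: "integrable M f" and h: "h \<in> borel_measurable M" and B: "\<And>x. cmod (h x) \<le> B"
  shows "integrable M (\<lambda>x. h x * f x)"
proof (rule integrable_bound[OF integrable_mult_right[OF integrable_norm[OF f], of B]])
  have "cmod (h x * f x) \<le> B * cmod (f x)" for x unfolding norm_mult by (intro mult_right_mono B) simp
  then show "AE x in M. norm (h x * f x) \<le> norm (B * cmod (f x))"
    by (intro AE_I2) (simp only: real_norm_def, rule order_trans[OF _ abs_ge_self])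
qed (use f h in auto)

lemma sq_int_0 [simp]: "sq_int M (\<lambda>x. 0)"
  by (simp add: sq_int_def)

lemma sq_int_sum:
  assumes "\<And>i. i \<in> I \<Longrightarrow> sq_int M (f i)"
  shows "sq_int M (\<lambda>x. \<Sum>i\<in>I. f i x)"
  using assms by (induction I rule: infinite_finite_induct) (auto intro: sq_int_add)

lemma sq_int_diff:
  assumes "sq_int M f" "sq_int M g"
  shows "sq_int M (\<lambda>x. f x - g x)"
  using sq_int_add[OF assms(1) sq_int_cmult[OF assms(2), of "-1"]] by simp

lemma sq_int_cnj: "sq_int M f \<Longrightarrow> sq_int M (\<lambda>x. cnj (f x))"
  unfolding sq_int_def
  by (auto intro!: borel_measurable_continuous_on[where f = cnj] continuous_intros)

lemma Cauchy_Schwarz_norm_integral: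
  assumes f: "sq_int M f" and g: "sq_int M g"
  shows "(LINT x|M. cmod (f x * g x)) \<le> sqrt (LINT x|M. (cmod (f x))^2) * sqrt (LINT x|M. (cmod (g x))^2)"
proof -
  let ?A = "LINT x|M. (cmod (f x))^2" and ?B = "LINT x|M. (cmod (g x))^2" and ?C = "LINT x|M. cmod (f x * g x)"
  have iC: "integrable M (\<lambda>x. cmod (f x * g x))" using sq_int_mult[OF f g] by simp
  have pos: "?A \<ge> 0" "?B \<ge> 0" "?C \<ge> 0" by (auto intro!: integral_nonneg)
  have quad: "0 \<le> t^2 * ?A - 2 * t * ?C + ?B" for t
  proof -
    have "t^2 * ?A - 2 * t * ?C + ?B = (LINT x|M. t^2 * (cmod (f x))^2 - 2 * t * cmod (f x * g x) + (cmod (g x))^2)"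
      using sq_int_integrable[OF f] sq_int_integrable[OF g] iC by simp
    also have "\<dots> = (LINT x|M. (t * cmod (f x) - cmod (g x))^2)"
      by (intro int_cong) (simp add: power2_diff power_mult_distrib norm_mult)
    also have "\<dots> \<ge> 0" by (auto intro!: integral_nonneg)
    finally show ?thesis by simp
  qed
  have "?C^2 \<le> ?A * ?B"
  proof (cases "?A = 0")
    case True
    have "?C = 0"
    proof (rule ccontr)
      assume "?C \<noteq> 0"
      then have "?C > 0" using pos(3) by linarith
      \<comment> \<open>For \<open>?A = 0\<close> the quadratic is affine in \<open>t\<close> with
        slope \<open>-2 ?C\<close>; this \<open>t\<close> makes its value \<open>-1\<close>.\<close>
      have "2 * ((?B + 1) / (2 * ?C)) * ?C = ?B + 1" using \<open>?C > 0\<close> by simp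
      then show False using quad[of "(?B + 1) / (2 * ?C)"] True by simp
    qed
    then show ?thesis using pos by simp
  next
    case False
    then have "?A > 0" using pos(1) by linarith
    then show ?thesis using quad[of "?C / ?A"] by (simp add: field_simps power2_eq_square)
  qed
  then show ?thesis using pos by (metis real_le_rsqrt real_sqrt_mult)
qed

lemma Cauchy_Schwarz_integral:
  assumes f: "sq_int M f" and g: "sq_int M g"
  shows "cmod (LINT x|M. f x * g x) \<le> sqrt (LINT x|M. (cmod (f x))^2) * sqrt (LINT x|M. (cmod (g x))^2)"
  using Cauchy_Schwarz_norm_integral[OF f g] integral_norm_bound[of M "\<lambda>x. f x * g x"] by linarith

lemma ennreal_term_le_suminf: "f k \<le> (\<Sum>k. f k :: ennreal)"
  using sum_le_suminf[of f "{k}"] by simp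

text \<open>Fatou's lemma for \<open>|S (N j) - S n|^2\<close> with \<open>n\<close> fixed.
  Pointwise convergence is asked along indices \<open>N j\<close>, because
  \<open>L2_complete\<close> obtains it only for a subsequence.\<close>

lemma L2_limit:
  fixes S :: "nat \<Rightarrow> 'a \<Rightarrow> complex"
  assumes S: "\<And>n. sq_int M (S n)" and f: "f \<in> borel_measurable M"
    and N: "\<And>j. j \<le> N j" and lim: "AE x in M. (\<lambda>j. S (N j) x) \<longlonglongrightarrow> f x"
    and r: "\<And>n m. n \<le> m \<Longrightarrow> (LINT x|M. (cmod (S m x - S n x))^2) \<le> r n"
  shows "sq_int M f" and "(LINT x|M. (cmod (f x - S n x))^2) \<le> r n" (is ?A)
proof -
  have r0: "0 \<le> r n" for n using r[of n n] by simp
  have nn: "(\<integral>\<^sup>+x. ennreal ((cmod (f x - S n x))^2) \<partial>M) \<le> ennreal (r n)" for n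
  proof -
    have "(\<integral>\<^sup>+x. ennreal ((cmod (f x - S n x))^2) \<partial>M)
        = (\<integral>\<^sup>+x. liminf (\<lambda>j. ennreal ((cmod (S (N j) x - S n x))^2)) \<partial>M)"
    proof (rule nn_integral_cong_AE, use lim in eventually_elim)
      fix x assume "(\<lambda>j. S (N j) x) \<longlonglongrightarrow> f x"
      then have "(\<lambda>j. ennreal ((cmod (S (N j) x - S n x))^2)) \<longlonglongrightarrow> ennreal ((cmod (f x - S n x))^2)"
        by (intro tendsto_intros)
      from lim_imp_Liminf[OF trivial_limit_sequentially this]
      show "ennreal ((cmod (f x - S n x))^2) = liminf (\<lambda>j. ennreal ((cmod (S (N j) x - S n x))^2))"
        by (rule sym)
    qed
    also have "\<dots> \<le> liminf (\<lambda>j. \<integral>\<^sup>+x. ennreal ((cmod (S (N j) x - S n x))^2) \<partial>M)"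
      using sq_int_integrable[OF sq_int_diff[OF S S]]
      by (intro nn_integral_liminf) (auto dest: borel_measurable_integrable)
    also have "\<dots> \<le> ennreal (r n)"
    proof (rule Liminf_le)
      show "\<forall>\<^sub>F j in sequentially. (\<integral>\<^sup>+x. ennreal ((cmod (S (N j) x - S n x))^2) \<partial>M) \<le> ennreal (r n)"
        using eventually_ge_at_top[of n]
      proof eventually_elim
        fix j assume "n \<le> j"
        then have "n \<le> N j" using N[of j] by simp
        have "(\<integral>\<^sup>+x. ennreal ((cmod (S (N j) x - S n x))^2) \<partial>M) = ennreal (LINT x|M. (cmod (S (N j) x - S n x))^2)"
          by (intro nn_integral_eq_integral sq_int_integrable sq_int_diff S) auto
        then show "(\<integral>\<^sup>+x. ennreal ((cmod (S (N j) x - S n x))^2) \<partial>M) \<le> ennreal (r n)"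
          using r[OF \<open>n \<le> N j\<close>] by (simp add: ennreal_leI)
      qed
    qed simp
    finally show ?thesis .
  qed
  have int: "integrable M (\<lambda>x. (cmod (f x - S n x))^2)" for n
  proof (rule integrableI_bounded)
    show "(\<lambda>x. (cmod (f x - S n x))^2) \<in> borel_measurable M"
      using f sq_int_measurable[OF S] by auto
    show "(\<integral>\<^sup>+ x. ennreal (norm ((cmod (f x - S n x))^2)) \<partial>M) < \<infinity>"
      using le_less_trans[OF nn[of n] ennreal_less_top] by simp
  qed
  have "sq_int M (\<lambda>x. f x - S 0 x)"
    using int f sq_int_measurable[OF S] by (auto simp: sq_int_def)
  from sq_int_add[OF this S[of 0]] show "sq_int M f" by simp
  have "ennreal (LINT x|M. (cmod (f x - S n x))^2) \<le> ennreal (r n)"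
    using nn[of n] int[of n] by (subst nn_integral_eq_integral[symmetric]) auto
  then show ?A
    using r0[of n] by (simp add: ennreal_le_iff)
qed

text \<open>The factors \<open>2 ^ k\<close> make the increments of a rapidly converging subsequence summable at
  almost every point, without Minkowski's inequality.\<close>

lemma L2_complete:
  fixes S :: "nat \<Rightarrow> 'a \<Rightarrow> complex"
  assumes S: "\<And>n. sq_int M (S n)"
    and r: "\<And>n m. n \<le> m \<Longrightarrow> (LINT x|M. (cmod (S m x - S n x))^2) \<le> r n" and r0: "r \<longlonglongrightarrow> 0"
  shows "\<exists>f. sq_int M f \<and> (\<forall>n. (LINT x|M. (cmod (f x - S n x))^2) \<le> r n)"
proof -
  have "\<exists>m. \<forall>n\<ge>m. r n \<le> (1/4)^k" for k :: nat
  proof -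
    have "\<forall>\<^sub>F n in sequentially. r n < (1/4)^k"
      by (rule order_tendstoD(2)[OF r0]) simp
    then show ?thesis by (auto simp: eventually_sequentially intro: less_imp_le)
  qed
  then obtain m where m: "\<And>k n. n \<ge> m k \<Longrightarrow> r n \<le> (1/4)^k" by metis
  \<comment> \<open>The sum makes \<open>N\<close> nondecreasing and at least \<open>m k\<close>;
    the extra \<open>k\<close> gives \<open>k \<le> N k\<close>, as \<open>L2_limit\<close>
    requires.\<close>
  define N where "N k = (\<Sum>j\<le>k. m j) + k" for k :: nat
  have Nm: "m k \<le> N k" for k
    using member_le_sum[of k "{..k}" m] by (simp add: N_def)
  have Nk: "k \<le> N k" for k by (simp add: N_def)
  have Nmono: "N k \<le> N (Suc k)" for k by (simp add: N_def)
  define d where "d k x = S (N (Suc k)) x - S (N k) x" for k x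
  have dsq: "sq_int M (d k)" for k unfolding d_def by (intro sq_int_diff S)
  have dint: "(LINT x|M. (cmod (d k x))^2) \<le> (1/4)^k" for k
    using r[OF Nmono[of k]] m[OF Nm, of k] unfolding d_def by linarith
  have "(\<integral>\<^sup>+x. (\<Sum>k. ennreal (2^k * (cmod (d k x))^2)) \<partial>M) = (\<Sum>k. \<integral>\<^sup>+x. ennreal (2^k * (cmod (d k x))^2) \<partial>M)"
    using sq_int_measurable[OF dsq] by (intro nn_integral_suminf) auto
  also have "\<dots> \<le> (\<Sum>k. ennreal ((1/2)^k))"
  proof (intro suminf_le)
    fix k
    have "(\<integral>\<^sup>+x. ennreal (2^k * (cmod (d k x))^2) \<partial>M) = ennreal (LINT x|M. 2^k * (cmod (d k x))^2)"
      using sq_int_integrable[OF dsq] by (intro nn_integral_eq_integral) auto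
    also have "\<dots> \<le> ennreal (2^k * (1/4)^k)" using dint[of k] by (intro ennreal_leI) simp
    also have "2^k * (1/4)^k = (1/2::real)^k" by (simp add: power_mult_distrib[symmetric])
    finally show "(\<integral>\<^sup>+x. ennreal (2^k * (cmod (d k x))^2) \<partial>M) \<le> ennreal ((1/2)^k)" .
  qed auto
  also have "\<dots> < \<infinity>"
    by (subst suminf_ennreal2) (auto simp: summable_geometric)
  finally have fin: "(\<integral>\<^sup>+x. (\<Sum>k. ennreal (2^k * (cmod (d k x))^2)) \<partial>M) \<noteq> \<infinity>" by simp
  have "AE x in M. (\<Sum>k. ennreal (2^k * (cmod (d k x))^2)) \<noteq> \<infinity>"
    using sq_int_measurable[OF dsq] by (intro nn_integral_noteq_infinite fin) auto
  then have conv: "AE x in M. convergent (\<lambda>k. S (N k) x)"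
  proof eventually_elim
    fix x assume "(\<Sum>k. ennreal (2^k * (cmod (d k x))^2)) \<noteq> \<infinity>"
    then have "(\<Sum>k. ennreal (2^k * (cmod (d k x))^2)) < top"
      unfolding infinity_ennreal_def by (rule top.not_eq_extremum[THEN iffD1])
    then obtain B where B: "B \<ge> 0" "(\<Sum>k. ennreal (2^k * (cmod (d k x))^2)) = ennreal B"
      unfolding less_top_ennreal by blast
    have le: "cmod (d k x) \<le> sqrt B * (sqrt (1/2))^k" for k
    proof -
      have "ennreal (2^k * (cmod (d k x))^2) \<le> ennreal B"
        using ennreal_term_le_suminf[of "\<lambda>k. ennreal (2^k * (cmod (d k x))^2)" k] unfolding B(2) .
      then have "2^k * (cmod (d k x))^2 \<le> B" using B(1) by (simp add: ennreal_le_iff)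
      then have "(cmod (d k x))^2 \<le> B * (1/2)^k" by (simp add: field_simps power_divide)
      then have "cmod (d k x) \<le> sqrt (B * (1/2)^k)" by (rule real_le_rsqrt)
      then show ?thesis by (simp only: real_sqrt_mult real_sqrt_power)
    qed
    have "summable (\<lambda>k. d k x)"
    proof (rule summable_comparison_test')
      show "summable (\<lambda>k. sqrt B * (sqrt (1/2))^k)"
        by (intro summable_mult summable_geometric) (simp add: real_sqrt_lt_1_iff)
    qed (use le in simp)
    then have "convergent (\<lambda>n. \<Sum>k<n. d k x)" by (simp add: summable_iff_convergent)
    moreover have "(\<Sum>k<n. d k x) = S (N n) x - S (N 0) x" for n
      unfolding d_def by (rule sum_lessThan_telescope)
    ultimately have "convergent (\<lambda>n. (S (N n) x - S (N 0) x) + S (N 0) x)"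
      by (intro convergent_add convergent_const) simp
    then show "convergent (\<lambda>k. S (N k) x)" by simp
  qed
  define f where "f x = lim (\<lambda>k. S (N k) x)" for x
  have fm: "f \<in> borel_measurable M"
    unfolding f_def using sq_int_measurable[OF S] by (intro borel_measurable_lim_metric) auto
  have lim: "AE x in M. (\<lambda>j. S (N j) x) \<longlonglongrightarrow> f x"
    using conv by eventually_elim (simp add: f_def convergent_LIMSEQ_iff)
  show ?thesis
    using L2_limit[OF S fm Nk lim r] by blast
qed

text \<open>Boundedness of the synthesis map from a weighted \<open>l^2\<close> space into
  \<open>L^2(M)\<close>, stated on finite sums. It has two consequences: series with coefficients in
  the weighted space converge, and by duality the integrals of an \<open>L^2\<close> function
  against the \<open>e n\<close> lie in the space with the reciprocal weight.\<close>

locale bessel_system =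
  fixes M :: "'a measure" and e :: "nat \<Rightarrow> 'a \<Rightarrow> complex" and w :: "nat \<Rightarrow> real" and C :: real
  assumes sq_int_e: "\<And>n. sq_int M (e n)" and w_pos: "\<And>n. w n > 0" and C_nonneg: "C \<ge> 0"
    and bessel_bound: "\<And>a N. (LINT x|M. (cmod (\<Sum>n<N. a n * e n x))^2) \<le> C * (\<Sum>n<N. w n * (cmod (a n))^2)"
begin

lemma partial_sums:
  assumes a: "summable (\<lambda>n. w n * (cmod (a n))^2)"
  defines "S \<equiv> \<lambda>N x. \<Sum>n<N. a n * e n x"
  shows "\<And>n. sq_int M (S n)"
    and "\<And>n m. n \<le> m \<Longrightarrow> (LINT x|M. (cmod (S m x - S n x))^2) \<le> C * (\<Sum>k. w (k + n) * (cmod (a (k + n)))^2)"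
    and "(\<lambda>n. C * (\<Sum>k. w (k + n) * (cmod (a (k + n)))^2)) \<longlonglongrightarrow> 0"
proof -
  show "sq_int M (S n)" for n unfolding S_def by (intro sq_int_sum sq_int_cmult sq_int_e)
  fix n m :: nat assume "n \<le> m"
  define b where "b k = (if k < n then 0 else a k)" for k
  have "S m x - S n x = (\<Sum>k<m. b k * e k x)" for x
  proof -
    have "(\<Sum>k<m. b k * e k x) = (\<Sum>k\<in>{n..<m}. a k * e k x)"
      by (rule sum.mono_neutral_cong_right) (auto simp: b_def)
    also have "\<dots> = S m x - S n x"
      using sum.atLeastLessThan_concat[of 0 n m "\<lambda>k. a k * e k x"] \<open>n \<le> m\<close>
      by (simp add: S_def atLeast0LessThan algebra_simps)
    finally show ?thesis by simp
  qed
  then have "(LINT x|M. (cmod (S m x - S n x))^2) \<le> C * (\<Sum>k<m. w k * (cmod (b k))^2)"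
    using bessel_bound[of b m] by simp
  also have "(\<Sum>k<m. w k * (cmod (b k))^2) = (\<Sum>k\<in>{n..<m}. w k * (cmod (a k))^2)"
    by (rule sum.mono_neutral_cong_right) (auto simp: b_def)
  also have "\<dots> = (\<Sum>k<m - n. w (k + n) * (cmod (a (k + n)))^2)"
    using \<open>n \<le> m\<close> sum.shift_bounds_nat_ivl[of "\<lambda>k. w k * (cmod (a k))^2" 0 n "m - n"]
    by (simp add: atLeast0LessThan)
  also have "\<dots> \<le> (\<Sum>k. w (k + n) * (cmod (a (k + n)))^2)"
    using w_pos[THEN less_imp_le] a
    by (intro sum_le_suminf) (auto simp: summable_iff_shift[of "\<lambda>k. w k * (cmod (a k))^2"])
  finally show "(LINT x|M. (cmod (S m x - S n x))^2) \<le> C * (\<Sum>k. w (k + n) * (cmod (a (k + n)))^2)"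
    using C_nonneg by (simp add: mult_left_mono)
next
  have "(\<lambda>n. \<Sum>k. w (k + n) * (cmod (a (k + n)))^2) \<longlonglongrightarrow> 0"
    using suminf_exist_split2[OF a] .
  from tendsto_mult_left[OF this, of C]
  show "(\<lambda>n. C * (\<Sum>k. w (k + n) * (cmod (a (k + n)))^2)) \<longlonglongrightarrow> 0" by simp
qed

lemma sums_of_L2_limit:
  assumes a: "summable (\<lambda>n. w n * (cmod (a n))^2)" and g: "sq_int M g" and h: "sq_int M h"
    and lim: "\<And>N. (LINT x|M. (cmod (g x - (\<Sum>n<N. a n * e n x)))^2) \<le> C * (\<Sum>k. w (k + N) * (cmod (a (k + N)))^2)"
  shows "(\<lambda>n. a n * (LINT x|M. e n x * h x)) sums (LINT x|M. g x * h x)"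
proof -
  define S where "S N x = (\<Sum>n<N. a n * e n x)" for N x
  note p = partial_sums[OF a, folded S_def]
  have eq: "(\<Sum>n<N. a n * (LINT x|M. e n x * h x)) = (LINT x|M. S N x * h x)" for N
  proof -
    have "(\<Sum>n<N. a n * (LINT x|M. e n x * h x)) = (LINT x|M. (\<Sum>n<N. a n * (e n x * h x)))"
      by (subst integral_sum) (auto intro!: integrable_mult_right sq_int_mult sq_int_e h)
    then show ?thesis by (simp add: S_def sum_distrib_right mult.assoc)
  qed
  have "(\<lambda>N. LINT x|M. S N x * h x) \<longlonglongrightarrow> (LINT x|M. g x * h x)"
  proof (rule LIM_zero_cancel, rule Lim_null_comparison)
    show "\<forall>\<^sub>F N in sequentially. norm ((LINT x|M. S N x * h x) - (LINT x|M. g x * h x))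
        \<le> sqrt (C * (\<Sum>k. w (k + N) * (cmod (a (k + N)))^2)) * sqrt (LINT x|M. (cmod (h x))^2)"
    proof (rule always_eventually, rule allI)
      fix N
      have "(LINT x|M. S N x * h x) - (LINT x|M. g x * h x) = - (LINT x|M. (g x - S N x) * h x)"
        using sq_int_mult[OF p(1) h] sq_int_mult[OF g h] by (simp add: left_diff_distrib)
      then have "norm ((LINT x|M. S N x * h x) - (LINT x|M. g x * h x)) = cmod (LINT x|M. (g x - S N x) * h x)"
        by simp
      also have "\<dots> \<le> sqrt (LINT x|M. (cmod (g x - S N x))^2) * sqrt (LINT x|M. (cmod (h x))^2)"
        by (intro Cauchy_Schwarz_integral sq_int_diff g p h)
      also have "\<dots> \<le> sqrt (C * (\<Sum>k. w (k + N) * (cmod (a (k + N)))^2)) * sqrt (LINT x|M. (cmod (h x))^2)"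
        using lim[of N, folded S_def] by (intro mult_right_mono) auto
      finally show "norm ((LINT x|M. S N x * h x) - (LINT x|M. g x * h x))
        \<le> sqrt (C * (\<Sum>k. w (k + N) * (cmod (a (k + N)))^2)) * sqrt (LINT x|M. (cmod (h x))^2)" .
    qed
    show "(\<lambda>N. sqrt (C * (\<Sum>k. w (k + N) * (cmod (a (k + N)))^2)) * sqrt (LINT x|M. (cmod (h x))^2)) \<longlonglongrightarrow> 0"
      using tendsto_mult_right[OF tendsto_real_sqrt[OF p(3)], of "sqrt (LINT x|M. (cmod (h x))^2)"] by simp
  qed
  then show ?thesis unfolding sums_def eq .
qed

text \<open>The partial sums are Cauchy because \<open>bessel_bound\<close> controls their
  differences by tails of the weighted series. The limit is described by its norm and by its
  pairings with \<open>L^2\<close> functions, which is how later arguments use it.\<close>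

theorem riesz_fischer:
  assumes a: "summable (\<lambda>n. w n * (cmod (a n))^2)"
  obtains g where "sq_int M g"
    and "(LINT x|M. (cmod (g x))^2) \<le> C * (\<Sum>n. w n * (cmod (a n))^2)"
    and "\<And>h. sq_int M h \<Longrightarrow> (\<lambda>n. a n * (LINT x|M. e n x * h x)) sums (LINT x|M. g x * h x)"
proof -
  note p = partial_sums[OF a]
  obtain g where g: "sq_int M g" "\<And>N. (LINT x|M. (cmod (g x - (\<Sum>n<N. a n * e n x)))^2) \<le> C * (\<Sum>k. w (k + N) * (cmod (a (k + N)))^2)"
    using L2_complete[OF p] by blast
  show ?thesis
  proof (rule that[OF g(1)])
    show "(LINT x|M. (cmod (g x))^2) \<le> C * (\<Sum>n. w n * (cmod (a n))^2)" using g(2)[of 0] by simp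
  qed (rule sums_of_L2_limit[OF a g(1) _ g(2)])
qed

text \<open>For series whose pointwise sum is known: Fatou identifies that sum as the
  \<open>L^2\<close> limit, so the pairing formula holds for the given function and not just for
  some limit supplied by completeness.\<close>

lemma sums_of_pointwise_limit:
  assumes a: "summable (\<lambda>n. w n * (cmod (a n))^2)" and g: "g \<in> borel_measurable M"
    and lim: "AE x in M. (\<lambda>n. a n * e n x) sums g x"
  shows "sq_int M g"
    and "\<And>h. sq_int M h \<Longrightarrow> (\<lambda>n. a n * (LINT x|M. e n x * h x)) sums (LINT x|M. g x * h x)"
proof -
  note p = partial_sums[OF a]
  note l = L2_limit[where N = "\<lambda>j. j", OF p(1) g order_refl lim[unfolded sums_def] p(2)]
  show "sq_int M g" using l(1) by blast
  then show "(\<lambda>n. a n * (LINT x|M. e n x * h x)) sums (LINT x|M. g x * h x)" if "sq_int M h" for h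
    using l(2) that by (intro sums_of_L2_limit a)
qed

end

text \<open>One half of the duality of weighted \<open>l^2\<close> spaces. The extremal sequence
  \<open>cnj (\<gamma> n) / w n\<close> turns both sums into the same \<open>Q\<close>, and
  \<open>Q \<le> K sqrt Q\<close> bounds it independently of \<open>N\<close>.\<close>

lemma sums_bounded_functional:
  fixes \<gamma> :: "nat \<Rightarrow> complex"
  assumes w: "\<And>n. w n > (0::real)"
    and bound: "\<And>a N. cmod (\<Sum>n<N. a n * \<gamma> n) \<le> K * sqrt (\<Sum>n<N. w n * (cmod (a n))^2)"
  shows "summable (\<lambda>n. (cmod (\<gamma> n))^2 / w n)" and "(\<Sum>n. (cmod (\<gamma> n))^2 / w n) \<le> K^2" (is ?A)
proof -
  have part: "(\<Sum>n<N. (cmod (\<gamma> n))^2 / w n) \<le> K^2" for N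
  proof -
    define Q where "Q = (\<Sum>n<N. (cmod (\<gamma> n))^2 / w n)"
    have Q0: "Q \<ge> 0" unfolding Q_def using w by (intro sum_nonneg) (simp add: less_imp_le)
    let ?a = "\<lambda>n. cnj (\<gamma> n) / of_real (w n)"
    have "(\<Sum>n<N. ?a n * \<gamma> n) = of_real Q"
      unfolding Q_def by (simp add: complex_norm_square[symmetric] mult.commute of_real_power[symmetric] del: of_real_power)
    moreover have "(\<Sum>n<N. w n * (cmod (?a n))^2) = Q"
      unfolding Q_def using w
      by (intro sum.cong refl) (simp add: norm_divide power_divide power2_eq_square field_simps less_imp_le abs_of_pos)
    ultimately have "Q \<le> K * sqrt Q" using bound[of ?a N] Q0 by simp
    then have "Q \<le> K^2"
    proof (cases "Q = 0")
      case False
      then have "sqrt Q > 0" using Q0 by simp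
      have "sqrt Q * sqrt Q \<le> K * sqrt Q" using \<open>Q \<le> K * sqrt Q\<close> Q0 by simp
      then have "sqrt Q \<le> K" using \<open>sqrt Q > 0\<close> by (rule mult_right_le_imp_le)
      then have "(sqrt Q)^2 \<le> K^2" using \<open>sqrt Q > 0\<close> by (intro power_mono) auto
      then show ?thesis using Q0 by simp
    qed simp
    then show ?thesis by (simp add: Q_def)
  qed
  show s: "summable (\<lambda>n. (cmod (\<gamma> n))^2 / w n)"
    using part w by (intro summableI_nonneg_bounded[where x = "K^2"]) (auto simp: less_imp_le)
  show ?A
    using s part by (intro suminf_le_const)
qed

context bessel_system
begin

text \<open>The adjoint of the synthesis map. Integrating a finite sum of the \<open>e n\<close>
  against \<open>h\<close> is a functional bounded by Cauchy-Schwarz and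
  \<open>bessel_bound\<close>, so its coefficients obey the dual bound with the same
  constant.\<close>

lemma dual_bound:
  assumes h: "sq_int M h"
  shows "summable (\<lambda>n. (cmod (LINT x|M. e n x * h x))^2 / w n)" (is ?A)
    and "(\<Sum>n. (cmod (LINT x|M. e n x * h x))^2 / w n) \<le> C * (LINT x|M. (cmod (h x))^2)"
proof -
  let ?H = "LINT x|M. (cmod (h x))^2"
  have H: "?H \<ge> 0" by (rule integral_nonneg) auto
  have "cmod (\<Sum>n<N. a n * (LINT x|M. e n x * h x)) \<le> sqrt (C * ?H) * sqrt (\<Sum>n<N. w n * (cmod (a n))^2)" for a N
  proof -
    have "(\<Sum>n<N. a n * (LINT x|M. e n x * h x)) = (LINT x|M. (\<Sum>n<N. a n * (e n x * h x)))"
      by (subst integral_sum) (auto intro!: integrable_mult_right sq_int_mult sq_int_e h)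
    also have "\<dots> = (LINT x|M. (\<Sum>n<N. a n * e n x) * h x)" by (simp add: sum_distrib_right mult.assoc)
    also have "cmod \<dots> \<le> sqrt (LINT x|M. (cmod (\<Sum>n<N. a n * e n x))^2) * sqrt ?H"
      by (intro Cauchy_Schwarz_integral sq_int_sum sq_int_cmult sq_int_e h)
    also have "\<dots> \<le> sqrt (C * (\<Sum>n<N. w n * (cmod (a n))^2)) * sqrt ?H"
      using bessel_bound[of a N] H by (intro mult_right_mono) auto
    finally show ?thesis by (simp add: real_sqrt_mult mult_ac)
  qed
  note s = sums_bounded_functional[of w, OF w_pos this]
  show ?A by (rule s)
  show "(\<Sum>n. (cmod (LINT x|M. e n x * h x))^2 / w n) \<le> C * ?H"
    using s(2) C_nonneg H by simp
qed

end

lemma norm_square_of_real: "cpx ((cmod z)^2) = z * cnj z"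
  by (simp add: complex_norm_square del: of_real_power flip: of_real_power)

lemma norm_integral_le_AE:
  fixes f :: "'a \<Rightarrow> 'b :: {banach, second_countable_topology}"
  assumes "integrable M f" "integrable M g" "AE x in M. norm (f x) \<le> g x"
  shows "norm (LINT x|M. f x) \<le> (LINT x|M. g x)"
  using order_trans[OF integral_norm_bound[of M f] integral_mono_AE[OF integrable_norm assms(2,3)]] assms(1) .

lemma integral_norm_sum_orthogonal:
  fixes e :: "nat \<Rightarrow> 'a \<Rightarrow> complex"
  assumes e: "\<And>n. sq_int M (e n)"
    and orth: "\<And>m n. (LINT x|M. e m x * cnj (e n x)) = (if m = n then cpx (d n) else 0)"
  shows "(LINT x|M. (cmod (\<Sum>n<N. a n * e n x))^2) = (\<Sum>n<N. d n * (cmod (a n))^2)"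
proof -
  have "cpx (LINT x|M. (cmod (\<Sum>n<N. a n * e n x))^2)
      = (LINT x|M. (\<Sum>n<N. \<Sum>m<N. (a n * cnj (a m)) * (e n x * cnj (e m x))))"
    by (simp add: integral_complex_of_real[symmetric] norm_square_of_real sum_product mult_ac
        del: integral_complex_of_real of_real_power)
  also have "\<dots> = (\<Sum>n<N. \<Sum>m<N. (a n * cnj (a m)) * (LINT x|M. e n x * cnj (e m x)))"
    by (subst integral_sum integral_sum,
        (auto intro!: integrable_sum integrable_mult_right sq_int_mult sq_int_cnj e)[1])+
      (simp add: integral_mult_right_zero)
  also have "\<dots> = (\<Sum>n<N. \<Sum>m<N. if m = n then (a n * cnj (a n)) * cpx (d n) else 0)"
    by (intro sum.cong refl) (auto simp: orth)
  also have "\<dots> = (\<Sum>n<N. cpx (d n) * cpx ((cmod (a n))^2))"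
    by (intro sum.cong refl, subst sum.delta) (simp_all add: norm_square_of_real mult_ac del: of_real_power)
  also have "\<dots> = cpx (\<Sum>n<N. d n * (cmod (a n))^2)"
    by simp
  finally show ?thesis by (simp only: of_real_eq_iff)
qed

section \<open>Chebyshev polynomials\<close>

text \<open>The recursion gives a polynomial on the whole line, whereas \<open>cheb\<close> goes
  through \<open>arccos\<close> and is meaningful only on the segment. Smoothness on the line and
  the passage to monomials rely on this form.\<close>

fun tpoly :: "nat \<Rightarrow> real \<Rightarrow> real" where
  "tpoly 0 x = 1"
| "tpoly (Suc 0) x = x"
| "tpoly (Suc (Suc n)) x = 2 * x * tpoly (Suc n) x - tpoly n x"

lemma tpoly_cos: "tpoly n (cos t) = cos (real n * t)"
proof (induction n rule: induct_nat_012)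
  case (ge2 n)
  have "cos (real (Suc (Suc n)) * t) + cos (real n * t) = 2 * cos t * cos (real (Suc n) * t)"
    using cos_times_cos[of "real (Suc n) * t" t] by (simp add: algebra_simps)
  then show ?case using ge2 by simp
qed auto

lemma tpoly_eq: "x \<in> {-1..1} \<Longrightarrow> tpoly n x = cos (real n * arccos x)"
  using tpoly_cos[of n "arccos x"] by (simp add: cos_arccos)

lemma cheb_eq_tpoly: "x \<in> {-1<..<1} \<Longrightarrow> cheb n x = cpx (tpoly n x)"
  by (simp add: cheb_def tpoly_eq)

lemma abs_tpoly_le: "x \<in> {-1..1} \<Longrightarrow> \<bar>tpoly n x\<bar> \<le> 1"
  by (simp add: tpoly_eq)

lemma continuous_on_tpoly [continuous_intros]: "continuous_on S (tpoly n)"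
proof (induction n rule: induct_nat_012)
  case (ge2 n)
  then show ?case by (simp, intro continuous_intros) auto
qed (auto intro!: continuous_intros)

lemma borel_measurable_tpoly [measurable]: "tpoly n \<in> borel_measurable borel"
  by (intro borel_measurable_continuous_onI continuous_intros)

section \<open>The Chebyshev weight as the image of Lebesgue measure under the cosine\<close>

definition arc :: "real measure" where
  "arc = restrict_space lborel {0<..<pi}"

definition cheb_measure :: "real measure" where
  "cheb_measure = density lborel (\<lambda>x. ennreal (indicator {-1<..<1} x / weight x))"

lemma weight_pos: "x \<in> {-1<..<1} \<Longrightarrow> weight x > 0"
  by (simp add: weight_def abs_square_less_1[symmetric] abs_less_iff)
     (simp add: abs_square_less_1 abs_less_iff)

lemma weight_cos: "t \<in> {0..pi} \<Longrightarrow> weight (cos t) = sin t"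
  using sin_squared_eq[of t] sin_ge_zero[of t] by (simp add: weight_def) (metis real_sqrt_unique)

lemma borel_measurable_weight [measurable]: "weight \<in> borel_measurable borel"
  unfolding weight_def by measurable

lemma space_arc [simp]: "space arc = {0<..<pi}"
  by (simp add: arc_def space_restrict_space)

lemma measurable_arc: "f \<in> borel_measurable borel \<Longrightarrow> f \<in> borel_measurable arc"
  unfolding arc_def by (rule measurable_restrict_space1) simp

lemma finite_measure_arc: "finite_measure arc"
  by (rule finite_measureI) (simp add: arc_def emeasure_restrict_space space_restrict_space)

lemma measure_arc: "measure arc {0<..<pi} = pi"
  by (simp add: arc_def measure_restrict_space)

lemma sets_cheb_measure [measurable_cong, simp]: "sets cheb_measure = sets borel"
  by (simp add: cheb_measure_def)

lemma space_cheb_measure [simp]: "space cheb_measure = UNIV"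
  by (simp add: cheb_measure_def)

lemma cos_measurable_arc: "cos \<in> measurable arc borel"
  by (intro measurable_arc) measurable

lemma cos_in_open: "t \<in> {0<..<pi} \<Longrightarrow> cos t \<in> {-1<..<1}"
  using cos_monotone_0_pi[of 0 t] cos_monotone_0_pi[of t pi] by auto

lemma nn_integral_cheb_measure:
  assumes f[measurable]: "f \<in> borel_measurable borel"
  shows "(\<integral>\<^sup>+x. f x \<partial>cheb_measure) = (\<integral>\<^sup>+t. f (cos t) \<partial>arc)"
proof -
  define F where "F x = f (- x) * ennreal (indicator {-1<..<1} x / weight x)" for x
  have [measurable]: "F \<in> borel_measurable borel" unfolding F_def by measurable
  have "(\<integral>\<^sup>+x. f x \<partial>cheb_measure) = (\<integral>\<^sup>+x. f x * ennreal (indicator {-1<..<1} x / weight x) \<partial>lborel)"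
    unfolding cheb_measure_def by (subst nn_integral_density) (auto simp: mult.commute)
  \<comment> \<open>The substitution rule needs an increasing map; after the reflection
    \<open>x \<mapsto> -x\<close> it is applied to \<open>- cos\<close>, whose derivative
    \<open>sin\<close> is nonnegative on \<open>[0, pi]\<close>.\<close>
  also have "\<dots> = (\<integral>\<^sup>+x. f (0 + (-1) * x) * ennreal (indicator {-1<..<1} (0 + (-1) * x) / weight (0 + (-1) * x)) \<partial>lborel)"
    by (subst nn_integral_real_affine[where c = "-1" and t = 0]) auto
  also have "\<dots> = (\<integral>\<^sup>+x. F x \<partial>lborel)"
    by (intro nn_integral_cong) (auto simp: F_def weight_def indicator_def)
  also have "\<dots> = (\<integral>\<^sup>+x. F x * indicator {- cos 0..- cos pi} x \<partial>lborel)"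
    by (intro nn_integral_cong) (auto simp: F_def split: split_indicator)
  also have "\<dots> = (\<integral>\<^sup>+t. F (- cos t) * ennreal (sin t) * indicator {0..pi} t \<partial>lborel)"
    by (rule nn_integral_substitution_aux[where g = "\<lambda>t. - cos t"])
       (auto intro!: derivative_eq_intros continuous_intros sin_ge_zero)
  also have "\<dots> = (\<integral>\<^sup>+t. f (cos t) * indicator {0<..<pi} t \<partial>lborel)"
  proof (intro nn_integral_cong)
    fix t
    show "F (- cos t) * ennreal (sin t) * indicator {0..pi} t = f (cos t) * indicator {0<..<pi} t"
    proof (cases "t \<in> {0<..<pi}")
      case True
      then have "sin t > 0" by (simp add: sin_gt_zero)
      have "weight (- cos t) = sin t" using weight_cos[of t] True by (simp add: weight_def)
      moreover have "- cos t \<in> {-1<..<1}" using cos_in_open[OF True] by auto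
      moreover have "ennreal (1 / sin t) * ennreal (sin t) = 1"
        using \<open>sin t > 0\<close> by (simp add: ennreal_mult[symmetric])
      ultimately show ?thesis using True by (auto simp: F_def mult.assoc)
    next
      case False
      then have "t \<in> {0..pi} \<Longrightarrow> t = 0 \<or> t = pi" by auto
      then show ?thesis using False by (auto simp: F_def split: split_indicator)
    qed
  qed
  also have "\<dots> = (\<integral>\<^sup>+t. f (cos t) \<partial>arc)"
    unfolding arc_def by (subst nn_integral_restrict_space) auto
  finally show ?thesis .
qed

lemma cheb_measure_eq_distr: "cheb_measure = distr arc borel cos"
proof (rule measure_eqI)
  fix A assume "A \<in> sets cheb_measure"
  then have [measurable]: "A \<in> sets borel" by simp
  have "emeasure cheb_measure A = (\<integral>\<^sup>+x. indicator A x \<partial>cheb_measure)" by simp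
  also have "\<dots> = (\<integral>\<^sup>+t. indicator A (cos t) \<partial>arc)" by (rule nn_integral_cheb_measure) simp
  also have "\<dots> = (\<integral>\<^sup>+x. indicator A x \<partial>distr arc borel cos)"
    by (subst nn_integral_distr[OF cos_measurable_arc]) auto
  also have "\<dots> = emeasure (distr arc borel cos) A" by simp
  finally show "emeasure cheb_measure A = emeasure (distr arc borel cos) A" .
qed simp

lemma finite_measure_cheb_measure: "finite_measure cheb_measure"
  unfolding cheb_measure_eq_distr
  by (intro finite_measure.finite_measure_distr finite_measure_arc cos_measurable_arc)

lemma integral_cheb_measure:
  fixes f :: "real \<Rightarrow> 'a :: {banach, second_countable_topology}"
  assumes "f \<in> borel_measurable borel"
  shows "(LINT x|cheb_measure. f x) = (LINT t|arc. f (cos t))"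
    and "integrable cheb_measure f \<longleftrightarrow> integrable arc (\<lambda>t. f (cos t))"
  unfolding cheb_measure_eq_distr using assms
  by (auto intro!: integral_distr integrable_distr_eq cos_measurable_arc)

lemma AE_cheb_measure: "(AE x in cheb_measure. P x) \<longleftrightarrow> (AE x in lborel. x \<in> {-1<..<1} \<longrightarrow> P x)"
  unfolding cheb_measure_def
proof (subst AE_density)
  have "(0 < ennreal (indicator {-1<..<1} x / weight x)) \<longleftrightarrow> x \<in> {-1<..<1}" for x
    using weight_pos[of x] by (auto split: split_indicator)
  then show "(AE x in lborel. 0 < ennreal (indicator {-1<..<1} x / weight x) \<longrightarrow> P x) \<longleftrightarrow>
      (AE x in lborel. x \<in> {-1<..<1} \<longrightarrow> P x)" by simp
qed measurable

lemma AE_cheb_measure_open: "AE x in cheb_measure. x \<in> {-1<..<1}"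
  by (simp add: AE_cheb_measure)

lemma arc_integral_FTC:
  fixes F f :: "real \<Rightarrow> 'a :: euclidean_space"
  assumes F: "\<And>t. (F has_vector_derivative f t) (at t)" and f: "continuous_on {0..pi} f"
  shows "integrable arc f" "(LINT t|arc. f t) = F pi - F 0"
proof -
  have "has_bochner_integral lborel (\<lambda>t. indicator {0..pi} t *\<^sub>R f t) (F pi - F 0)"
    by (rule has_bochner_integral_FTC_Icc) (auto intro: has_vector_derivative_at_within F f)
  moreover have "AE t in lborel. indicator {0..pi} t *\<^sub>R f t = indicator {0<..<pi} t *\<^sub>R f t"
    using AE_lborel_singleton[of 0] AE_lborel_singleton[of pi]
    by eventually_elim (auto split: split_indicator)
  moreover have "(\<lambda>t. indicator {0<..<pi} t *\<^sub>R f t) \<in> borel_measurable lborel"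
    using borel_measurable_continuous_on_indicator[OF _ continuous_on_subset[OF f, of "{0<..<pi}"]]
    by (simp add: greaterThanLessThan_subseteq_atLeastAtMost_iff)
  ultimately have "has_bochner_integral lborel (\<lambda>t. indicator {0<..<pi} t *\<^sub>R f t) (F pi - F 0)"
    by (subst has_bochner_integral_cong_AE[symmetric]) (auto simp: has_bochner_integral_iff)
  then show "integrable arc f" "(LINT t|arc. f t) = F pi - F 0"
    unfolding arc_def by (auto simp: integrable_restrict_space integral_restrict_space has_bochner_integral_iff)
qed

lemma integrable_arc_continuous:
  fixes f :: "real \<Rightarrow> 'a :: euclidean_space"
  assumes "continuous_on {0..pi} f"
  shows "integrable arc f"
proof -
  have "integrable lborel (\<lambda>t. indicator {0..pi} t *\<^sub>R f t)"
    by (rule borel_integrable_compact) (use assms in auto)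
  then have "set_integrable lborel {0..pi} f" by (simp add: set_integrable_def)
  then have "set_integrable lborel {0<..<pi} f"
    by (rule set_integrable_subset) auto
  then show ?thesis
    unfolding arc_def by (simp add: integrable_restrict_space set_integrable_def)
qed

lemma arc_integral_cos:
  "(LINT t|arc. cos (of_int k * t)) = (if k = 0 then pi else 0)"
proof (cases "k = 0")
  case True
  then show ?thesis by (simp add: measure_arc)
next
  case False
  have "(LINT t|arc. cos (of_int k * t)) = sin (of_int k * pi) / of_int k - sin (of_int k * 0) / of_int k"
    using False
    by (intro arc_integral_FTC)
       (auto intro!: derivative_eq_intros continuous_intros simp: has_real_derivative_iff_has_vector_derivative[symmetric])
  then show ?thesis using False by (simp add: sin_times_pi_eq_0 mult.commute)
qed

text \<open>Reciprocal of the squared norm of \<open>T_n\<close> in \<open>cheb_measure\<close>, so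
  the Chebyshev coefficient of \<open>u\<close> is \<open>cheb_const n\<close> times the integral of
  \<open>u T_n\<close>.\<close>

definition cheb_const :: "nat \<Rightarrow> real" where
  "cheb_const n = (if n = 0 then 1 / pi else 2 / pi)"

lemma cheb_const_pos: "cheb_const n > 0" by (simp add: cheb_const_def)

lemma integral_tpoly_mult:
  "(LINT x|cheb_measure. tpoly m x * tpoly n x) = (if m = n then 1 / cheb_const n else 0)"
proof -
  have "(LINT x|cheb_measure. tpoly m x * tpoly n x) = (LINT t|arc. cos (real m * t) * cos (real n * t))"
    by (subst integral_cheb_measure) (auto simp: tpoly_cos)
  also have "\<dots> = (LINT t|arc. (cos (of_int (int m - int n) * t) + cos (of_int (int m + int n) * t)) / 2)"
    by (intro int_cong) (simp add: cos_times_cos algebra_simps)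
  also have "\<dots> = ((LINT t|arc. cos (of_int (int m - int n) * t)) + (LINT t|arc. cos (of_int (int m + int n) * t))) / 2"
    by (subst integral_divide_zero, subst integral_add)
       (auto intro!: integrable_arc_continuous continuous_intros)
  also have "\<dots> = (if m = n then 1 / cheb_const n else 0)"
    unfolding arc_integral_cos by (auto simp: cheb_const_def)
  finally show ?thesis .
qed

abbreviation ctp :: "nat \<Rightarrow> real \<Rightarrow> complex" where
  "ctp n x \<equiv> cpx (tpoly n x)"

lemma sq_int_cheb_bounded:
  assumes "f \<in> borel_measurable borel" "\<And>x. x \<in> {-1<..<1} \<Longrightarrow> cmod (f x) \<le> B"
  shows "sq_int cheb_measure f"
proof (rule sq_int_bound)
  show "integrable cheb_measure (\<lambda>x. B^2)"
    by (intro finite_measure.integrable_const finite_measure_cheb_measure)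
  show "AE x in cheb_measure. (cmod (f x))^2 \<le> B^2"
    using AE_cheb_measure_open by eventually_elim (intro power_mono assms(2), auto)
qed (use assms(1) in simp)

lemma sq_int_tpoly: "sq_int cheb_measure (ctp n)"
  by (rule sq_int_cheb_bounded[where B = 1]) (auto intro!: abs_tpoly_le)

lemma sq_int_cheb_integrable: "sq_int cheb_measure u \<Longrightarrow> integrable cheb_measure u"
  using sq_int_mult[OF _ sq_int_tpoly[of 0], of u] by simp

lemma integral_ctp_mult:
  "(LINT x|cheb_measure. ctp m x * ctp n x) = (if m = n then cpx (1 / cheb_const n) else 0)"
  using arg_cong[OF integral_tpoly_mult[of m n], of cpx]
  by (simp add: integral_complex_of_real[symmetric] del: integral_complex_of_real)

lemma bessel_system_tpoly: "bessel_system cheb_measure ctp (\<lambda>_. 1) pi"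
proof
  fix a N
  have "(LINT x|cheb_measure. (cmod (\<Sum>n<N. a n * ctp n x))^2) = (\<Sum>n<N. 1 / cheb_const n * (cmod (a n))^2)"
    by (rule integral_norm_sum_orthogonal[OF sq_int_tpoly]) (simp add: integral_ctp_mult)
  also have "\<dots> \<le> (\<Sum>n<N. pi * (1 * (cmod (a n))^2))"
    by (intro sum_mono) (auto intro!: mult_right_mono simp: cheb_const_def)
  finally show "(LINT x|cheb_measure. (cmod (\<Sum>n<N. a n * ctp n x))^2) \<le> pi * (\<Sum>n<N. 1 * (cmod (a n))^2)"
    by (simp add: sum_distrib_left)
qed (auto intro: sq_int_tpoly)

interpretation cheb: bessel_system cheb_measure ctp "\<lambda>_. 1" pi
  by (rule bessel_system_tpoly)

section \<open>Completeness of the Chebyshev polynomials and Parseval's identity\<close>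

lemma borel_eq_intervals: "(borel :: real measure) = sigma UNIV (range (\<lambda>(a, b). {a<..<b}))"
  using borel_eq_box[where 'a = real] unfolding box_real .

text \<open>A Dynkin argument: the sets over which \<open>f\<close> integrates to zero are closed
  under complements and disjoint unions, and the open intervals are a generator stable under
  intersection. Complements require the integral over the whole line, which is obtained first by
  exhausting it with bounded intervals.\<close>

lemma AE_zero_if_interval_integrals_zero:
  fixes f :: "real \<Rightarrow> complex"
  assumes sigma: "sigma_finite_measure M" and sets: "sets M = sets borel" and f: "integrable M f"
    and zero: "\<And>a b. (LINT x:{a<..<b}|M. f x) = 0"
  shows "AE x in M. f x = 0"
proof (rule sigma_finite_measure.density_zero[OF sigma f])
  have [simp]: "space M = UNIV" using sets_eq_imp_space_eq[OF sets] by simp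
  have sub: "set_integrable M A f" if "A \<in> sets M" for A
    unfolding set_integrable_def using f that by (intro integrable_mult_indicator)
  have UN: "LINT x|M. f x = 0"
  proof -
    have "(\<lambda>n. LINT x:{- real n<..<real n}|M. f x) \<longlonglongrightarrow> (LINT x:(\<Union>n. {- real n<..<real n})|M. f x)"
    proof (rule set_integral_cont_up)
      have "(\<Union>n. {- real n<..<real n}) \<in> sets M" unfolding sets by measurable
      then show "set_integrable M (\<Union>n. {- real n<..<real n}) f" by (rule sub)
    qed (auto simp: sets incseq_def)
    moreover have "(\<Union>n. {- real n<..<real n}) = UNIV"
    proof -
      have "\<exists>n. - real n < x \<and> x < real n" for x
      proof -
        obtain n where "\<bar>x\<bar> < real n" using reals_Archimedean2 by blast
        then have "- real n < x \<and> x < real n" by linarith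
        then show ?thesis by blast
      qed
      then show ?thesis by auto
    qed
    ultimately have "(LINT x:UNIV|M. f x) = 0"
      unfolding zero by (simp add: LIMSEQ_const_iff)
    then show ?thesis by (simp add: set_lebesgue_integral_def)
  qed
  fix A assume "A \<in> sets M"
  then have A: "A \<in> sigma_sets UNIV (range (\<lambda>(a, b). {a<..<b::real}))"
    unfolding sets borel_eq_intervals by simp
  have "{a<..<b} \<inter> {c<..<d} = {max a c<..<min b (d::real)}" for a b c d by auto
  then have "Int_stable (range (\<lambda>(a, b). {a<..<b::real}))"
    unfolding Int_stable_def by auto
  moreover have "range (\<lambda>(a, b). {a<..<b::real}) \<subseteq> Pow UNIV" by simp
  ultimately show "(LINT x:A|M. f x) = 0"
    using A
  proof (induction rule: sigma_sets_induct_disjoint)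
    case (basic A)
    then show ?case using zero by auto
  next
    case empty
    show ?case by (simp add: set_lebesgue_integral_def)
  next
    case (compl A)
    then have "A \<in> sets M" unfolding sets borel_eq_intervals by simp
    then have "(LINT x:(UNIV - A)|M. f x) = (LINT x|M. f x) - (LINT x:A|M. f x)"
      using f unfolding set_lebesgue_integral_def
      by (subst integral_diff[symmetric])
         (auto intro!: integrable_mult_indicator Bochner_Integration.integral_cong simp: sets split: split_indicator)
    then show ?case using compl UN by simp
  next
    case (union A)
    then have A: "A i \<in> sets M" for i unfolding sets borel_eq_intervals by auto
    have "(LINT x:(\<Union>i. A i)|M. f x) = (\<Sum>i. (LINT x:(A i)|M. f x))"
      using union(1) by (intro lebesgue_integral_countable_add A sub sets.countable_UN) (auto simp: disjoint_family_on_def intro: A)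
    then show ?case using union by simp
  qed
qed

text \<open>Orthogonality to the \<open>T_n\<close> is passed on to monomials, to polynomials, by
  Weierstrass to bounded continuous functions, and by dominated convergence to indicators of
  intervals.\<close>

lemma cheb_complete:
  assumes u: "sq_int cheb_measure u" and zero: "\<And>n. (LINT x|cheb_measure. u x * ctp n x) = 0"
  shows "AE x in cheb_measure. u x = 0"
proof -
  let ?W = cheb_measure
  have um [measurable]: "u \<in> borel_measurable borel" using sq_int_measurable[OF u] by simp
  have u1: "integrable ?W u" by (rule sq_int_cheb_integrable[OF u])
  have bi: "integrable ?W (\<lambda>x. u x * cpx (f x))"
    if "f \<in> borel_measurable borel" "\<And>x. x \<in> {-1<..<1} \<Longrightarrow> \<bar>f x\<bar> \<le> B" for f B
    by (rule sq_int_mult[OF u]) (rule sq_int_cheb_bounded[where B = B], use that in auto)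
  \<comment> \<open>The identity \<open>2 x T_(k+1) = T_(k+2) + T_k\<close> raises the power of
    \<open>x\<close> by one. Carrying an arbitrary factor \<open>T_k\<close> through the induction
    avoids an expansion of \<open>x^i\<close> in Chebyshev polynomials.\<close>
  have mono: "(LINT x|?W. u x * cpx (x ^ i * tpoly k x)) = 0" for i k
  proof (induction i arbitrary: k)
    case 0
    then show ?case using zero by simp
  next
    case (Suc i)
    have b: "\<bar>x ^ j * tpoly n x\<bar> \<le> 1" if "x \<in> {-1<..<1}" for x j n
    proof -
      have "\<bar>x ^ j\<bar> \<le> 1" using that by (auto simp: power_abs intro!: power_le_one)
      moreover have "\<bar>tpoly n x\<bar> \<le> 1" using that by (intro abs_tpoly_le) auto
      ultimately show ?thesis unfolding abs_mult using mult_mono[of "\<bar>x^j\<bar>" 1 "\<bar>tpoly n x\<bar>" 1] by simp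
    qed
    have i: "integrable ?W (\<lambda>x. u x * cpx (x ^ i * tpoly k x))" for k
      by (rule bi[where B = 1]) (use b in auto)
    show ?case
    proof (cases k)
      case 0
      then show ?thesis using Suc.IH[of "Suc 0"] by (simp add: mult_ac)
    next
      case k': (Suc k')
      have "(LINT x|?W. u x * cpx (x ^ Suc i * tpoly k x)) =
          (LINT x|?W. (u x * cpx (x ^ i * tpoly (Suc (Suc k')) x) + u x * cpx (x ^ i * tpoly k' x)) / 2)"
        unfolding k' by (intro int_cong) (simp add: algebra_simps)
      also have "\<dots> = 0"
        unfolding integral_divide_zero integral_add[OF i i] Suc.IH by simp
      finally show ?thesis .
    qed
  qed
  have poly: "(LINT x|?W. u x * cpx (p x)) = 0" if "real_polynomial_function p" for p
  proof -
    obtain a n where p: "p = (\<lambda>x. \<Sum>i\<le>n. a i * x^i)" using \<open>real_polynomial_function p\<close> by (auto simp: real_polynomial_function_iff_sum)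
    have i: "integrable ?W (\<lambda>x. cpx (a i) * (u x * cpx (x ^ i)))" for i
      by (intro integrable_mult_right bi[where B = 1]) (auto simp: power_abs intro!: power_le_one)
    have "(LINT x|?W. u x * cpx (p x)) = (LINT x|?W. (\<Sum>i\<le>n. cpx (a i) * (u x * cpx (x ^ i))))"
      unfolding p by (intro int_cong) (simp add: sum_distrib_left mult_ac)
    also have "\<dots> = (\<Sum>i\<le>n. cpx (a i) * (LINT x|?W. u x * cpx (x ^ i)))"
      by (subst integral_sum[OF i]) (simp only: integral_mult_right_zero)
    also have "\<dots> = 0" using mono[of _ 0] by simp
    finally show ?thesis .
  qed
  have cont: "(LINT x|?W. u x * cpx (f x)) = 0" if f: "continuous_on UNIV f" and fB: "\<And>x. \<bar>f x\<bar> \<le> B" for f B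
  proof -
    have fm: "f \<in> borel_measurable borel" using f by (rule borel_measurable_continuous_onI)
    have "cmod (LINT x|?W. u x * cpx (f x)) \<le> e * (LINT x|?W. cmod (u x))" if "e > 0" for e
    proof -
      obtain g where g: "real_polynomial_function g" "\<And>x. x \<in> {-1..1} \<Longrightarrow> \<bar>f x - g x\<bar> < e"
        using Stone_Weierstrass_real_polynomial_function[of "{-1..1::real}" f e] continuous_on_subset[OF f, of "{-1..1}"] \<open>e > 0\<close>
        by auto
      have gm: "g \<in> borel_measurable borel"
        using g(1) by (intro borel_measurable_continuous_onI continuous_on_polymonial_function) (simp add: real_polynomial_function_eq)
      have gi: "integrable ?W (\<lambda>x. u x * cpx (g x))"
      proof (rule bi[where B = "B + e", OF gm])
        fix x :: real assume "x \<in> {-1<..<1}"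
        then show "\<bar>g x\<bar> \<le> B + e" using g(2)[of x] fB[of x] by auto
      qed
      have fi: "integrable ?W (\<lambda>x. u x * cpx (f x))" by (rule bi[OF fm fB])
      have "cmod (LINT x|?W. u x * cpx (f x)) = cmod (LINT x|?W. u x * cpx (f x) - u x * cpx (g x))"
        using poly[OF g(1)] gi fi by simp
      also have "\<dots> \<le> (LINT x|?W. e * cmod (u x))"
      proof (rule norm_integral_le_AE)
        show "AE x in ?W. norm (u x * cpx (f x) - u x * cpx (g x)) \<le> e * cmod (u x)"
          using AE_cheb_measure_open
        proof eventually_elim
          fix x :: real assume "x \<in> {-1<..<1}"
          then have "\<bar>f x - g x\<bar> \<le> e" using g(2)[of x] by auto
          then have "cmod (u x) * \<bar>f x - g x\<bar> \<le> cmod (u x) * e" by (intro mult_left_mono) auto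
          then show "norm (u x * cpx (f x) - u x * cpx (g x)) \<le> e * cmod (u x)"
            by (simp add: right_diff_distrib[symmetric] norm_mult mult.commute del: of_real_diff add: of_real_diff[symmetric])
        qed
      qed (use gi fi u1 in auto)
      finally show ?thesis by simp
    qed
    then have "((\<lambda>e. e * (LINT x|?W. cmod (u x))) \<longlongrightarrow> 0 * (LINT x|?W. cmod (u x))) (at_right 0) \<Longrightarrow> 
       cmod (LINT x|?W. u x * cpx (f x)) \<le> 0 * (LINT x|?W. cmod (u x))"
      by (intro tendsto_lowerbound[of "\<lambda>e. e * (LINT x|?W. cmod (u x))" _ "at_right 0"])
         (auto simp: eventually_at_right_less intro!: eventually_at_rightI[of 0 1])
    moreover have "((\<lambda>e. e * (LINT x|?W. cmod (u x))) \<longlongrightarrow> 0 * (LINT x|?W. cmod (u x))) (at_right 0)"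
      by (intro tendsto_intros)
    ultimately show ?thesis by simp
  qed
  show ?thesis
  proof (rule AE_zero_if_interval_integrals_zero[OF _ _ u1])
    show "sigma_finite_measure ?W" using finite_measure_cheb_measure by (simp add: finite_measure_def)
    fix a b :: real
    \<comment> \<open>Trapezoids supported in \<open>[a, b]\<close> whose flanks steepen with
      \<open>k\<close>; they converge pointwise to the indicator of the open interval.\<close>
    define f where "f k x = min 1 (max 0 (real k * min (x - a) (b - x)))" for k x
    have fc: "continuous_on UNIV (f k)" for k unfolding f_def by (intro continuous_intros)
    have fB: "\<bar>f k x\<bar> \<le> 1" for k x by (auto simp: f_def)
    have [measurable]: "f k \<in> borel_measurable borel" for k using fc by (rule borel_measurable_continuous_onI)
    have flim: "(\<lambda>k. f k x) \<longlonglongrightarrow> indicator {a<..<b} x" for x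
    proof (cases "x \<in> {a<..<b}")
      case True
      then have m: "min (x - a) (b - x) > 0" by auto
      obtain K where K: "real K * min (x - a) (b - x) > 1"
        using reals_Archimedean3[OF m] by blast
      have "f k x = 1" if "k \<ge> K" for k
      proof -
        have "real K * min (x - a) (b - x) \<le> real k * min (x - a) (b - x)"
          using that m by (intro mult_right_mono) auto
        then show ?thesis using K by (auto simp: f_def)
      qed
      then have "\<forall>\<^sub>F k in sequentially. f k x = indicator {a<..<b} x"
        using True by (auto simp: eventually_sequentially)
      then show ?thesis by (rule tendsto_eventually)
    next
      case False
      then have "min (x - a) (b - x) \<le> 0" by auto
      then have "real k * min (x - a) (b - x) \<le> 0" for k by (simp add: mult_nonneg_nonpos)
      then have "f k x = 0" for k by (simp add: f_def max_absorb1)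
      then show ?thesis using False by simp
    qed
    have "(\<lambda>k. LINT x|?W. u x * cpx (f k x)) \<longlonglongrightarrow> (LINT x|?W. u x * cpx (indicator {a<..<b} x))"
    proof (rule integral_dominated_convergence[where w = "\<lambda>x. cmod (u x)"])
      show "AE x in ?W. (\<lambda>k. u x * cpx (f k x)) \<longlonglongrightarrow> u x * cpx (indicator {a<..<b} x)"
        by (intro AE_I2 tendsto_intros flim)
      show "AE x in ?W. norm (u x * cpx (f k x)) \<le> cmod (u x)" for k
        using fB by (auto simp: norm_mult intro!: mult_left_le)
    qed (use u1 in auto)
    then have "(LINT x|?W. u x * cpx (indicator {a<..<b} x)) = 0"
      using cont[OF fc fB] by (simp add: LIMSEQ_const_iff)
    then show "(LINT x:{a<..<b}|?W. u x) = 0"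
      by (simp add: set_lebesgue_integral_def scaleR_conv_of_real mult.commute)
  qed simp
qed

lemma sum_if_single:
  fixes f :: "nat \<Rightarrow> complex"
  shows "(\<lambda>n. f n * (if n = m then c else 0)) sums (f m * c)"
  using sums_single[of m "\<lambda>n. f n * c"] by (simp add: if_distrib cong: if_cong)

lemma cheb_series_exists:
  assumes a: "summable (\<lambda>n. (cmod (a n))^2)"
  obtains u where "sq_int cheb_measure u"
    and "\<And>n. cpx (cheb_const n) * (LINT x|cheb_measure. u x * ctp n x) = a n"
    and "\<And>v. sq_int cheb_measure v \<Longrightarrow> (\<lambda>n. a n * (LINT x|cheb_measure. ctp n x * v x)) sums (LINT x|cheb_measure. u x * v x)"
proof -
  obtain u where u: "sq_int cheb_measure u"
      "\<And>v. sq_int cheb_measure v \<Longrightarrow> (\<lambda>n. a n * (LINT x|cheb_measure. ctp n x * v x)) sums (LINT x|cheb_measure. u x * v x)"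
    using cheb.riesz_fischer[of a] a by auto
  have "cpx (cheb_const m) * (LINT x|cheb_measure. u x * ctp m x) = a m" for m
  proof -
    have "(\<lambda>n. a n * (if n = m then cpx (1 / cheb_const m) else 0)) sums (LINT x|cheb_measure. u x * ctp m x)"
      using u(2)[OF sq_int_tpoly[of m]] unfolding integral_ctp_mult by simp
    from sums_unique2[OF this sum_if_single] show ?thesis using cheb_const_pos[of m] by simp
  qed
  then show ?thesis using that u by blast
qed

text \<open>Completeness enters here: the function with the coefficients of \<open>u\<close> that
  Riesz-Fischer provides differs from \<open>u\<close> by a function all of whose coefficients
  vanish. The form is bilinear, without conjugation, as in the pairing of distributions with test
  functions.\<close>

theorem cheb_parseval:
  assumes u: "sq_int cheb_measure u" and v: "sq_int cheb_measure v"
  shows "summable (\<lambda>n. (cmod (LINT x|cheb_measure. u x * ctp n x))^2)"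
    and "(\<lambda>n. cpx (cheb_const n) * (LINT x|cheb_measure. u x * ctp n x) * (LINT x|cheb_measure. ctp n x * v x))
      sums (LINT x|cheb_measure. u x * v x)"
proof -
  let ?W = cheb_measure
  let ?a = "\<lambda>n. cpx (cheb_const n) * (LINT x|?W. u x * ctp n x)"
  show s: "summable (\<lambda>n. (cmod (LINT x|?W. u x * ctp n x))^2)"
    using cheb.dual_bound(1)[OF u] by (simp add: mult.commute)
  have a: "summable (\<lambda>n. (cmod (?a n))^2)"
  proof (rule summable_comparison_test')
    show "summable (\<lambda>n. 1 * (cmod (LINT x|?W. u x * ctp n x))^2)" using s by simp
    show "norm ((cmod (?a n))^2) \<le> 1 * (cmod (LINT x|?W. u x * ctp n x))^2" for n
    proof -
      have "\<bar>cheb_const n\<bar> \<le> 1" using pi_gt3 by (simp add: cheb_const_def)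
      then have "(cheb_const n)^2 \<le> 1" by (simp add: abs_square_le_1)
      then show ?thesis by (simp add: norm_mult power_mult_distrib mult_left_le_one_le)
    qed
  qed
  obtain g where g: "sq_int ?W g"
    "\<And>n. cpx (cheb_const n) * (LINT x|?W. g x * ctp n x) = ?a n"
    "\<And>v. sq_int ?W v \<Longrightarrow> (\<lambda>n. ?a n * (LINT x|?W. ctp n x * v x)) sums (LINT x|?W. g x * v x)"
    using cheb_series_exists[OF a] by blast
  have "AE x in ?W. g x - u x = 0"
  proof (rule cheb_complete[OF sq_int_diff[OF g(1) u]])
    fix n
    have "(LINT x|?W. g x * ctp n x) = (LINT x|?W. u x * ctp n x)" using g(2)[of n] cheb_const_pos[of n] by simp
    then show "(LINT x|?W. (g x - u x) * ctp n x) = 0"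
      using sq_int_mult[OF g(1) sq_int_tpoly[of n]] sq_int_mult[OF u sq_int_tpoly[of n]]
      by (simp add: left_diff_distrib)
  qed
  then have "(LINT x|?W. g x * v x) = (LINT x|?W. u x * v x)"
    using sq_int_measurable[OF g(1)] sq_int_measurable[OF u] sq_int_measurable[OF v]
    by (intro integral_cong_AE) auto
  then show "(\<lambda>n. ?a n * (LINT x|?W. ctp n x * v x)) sums (LINT x|?W. u x * v x)" using g(3)[OF v] by simp
qed

section \<open>Test functions\<close>

abbreviation der :: "(real \<Rightarrow> complex) \<Rightarrow> real \<Rightarrow> complex" where
  "der \<equiv> (\<lambda>g y. vector_derivative g (at y))"

text \<open>A class of differentiable functions closed under differentiation contains all iterates
  of \<open>der\<close>, so no formula for higher derivatives is required.\<close>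

lemma smooth_coinduct:
  assumes "P f" and step: "\<And>f. P f \<Longrightarrow> \<exists>f'. P f' \<and> (\<forall>x. (f has_vector_derivative f' x) (at x))"
  shows "smooth f"
proof -
  have *: "P (der g) \<and> (\<forall>x. g differentiable (at x))" if g: "P g" for g
  proof -
    obtain g' where g': "P g'" "\<And>x. (g has_vector_derivative g' x) (at x)" using step[OF g] by blast
    have "der g = g'" using g'(2) by (auto intro!: ext vector_derivative_at)
    then show ?thesis using g' by (auto intro: differentiableI_vector)
  qed
  have "P ((der ^^ k) f)" for k by (induction k) (use assms(1) * in auto)
  then show ?thesis unfolding smooth_def using * by blast
qed

lemma smooth_der: "smooth f \<Longrightarrow> smooth (der f)"
proof -
  assume f: "smooth f"
  have "(der ^^ k) (der f) = (der ^^ Suc k) f" for k by (simp only: funpow_Suc_right o_def)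
  then show ?thesis using f unfolding smooth_def by metis
qed

lemma smooth_has_der: "smooth f \<Longrightarrow> (f has_vector_derivative der f x) (at x)"
proof -
  assume "smooth f"
  then have "((der ^^ 0) f) differentiable (at x)" unfolding smooth_def by blast
  then show ?thesis by (simp add: vector_derivative_works)
qed

lemma smooth_continuous: "smooth f \<Longrightarrow> continuous_on S f"
  using smooth_has_der
  by (intro continuous_at_imp_continuous_on) (auto intro: has_vector_derivative_continuous)

lemma smooth_measurable: "smooth f \<Longrightarrow> f \<in> borel_measurable borel"
  by (intro borel_measurable_continuous_onI smooth_continuous)

text \<open>The standard flat function, with powers of \<open>x\<close> in the denominator so that
  the derivative is a combination of members of the same family. As \<epsilon> tends to 0,
  \<open>flat \<epsilon> 0\<close> approaches the Heaviside step, which makes bumps approximate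
  indicators.\<close>

definition flat :: "real \<Rightarrow> nat \<Rightarrow> real \<Rightarrow> real" where
  "flat \<epsilon> k x = (if x > 0 then exp (- \<epsilon> / x) / x ^ k else 0)"

lemma flat_nonneg: "0 \<le> flat \<epsilon> k x" by (simp add: flat_def)

lemma flat_le_square:
  assumes "\<epsilon> > 0"
  shows "\<exists>C. \<forall>x. flat \<epsilon> k x \<le> C * x^2"
proof (intro exI allI)
  fix x :: real
  \<comment> \<open>In \<open>exp y \<ge> (y / n)^n\<close> the exponent \<open>k + 2\<close>
    cancels the denominator \<open>x^k\<close> and leaves \<open>x^2\<close>, so the difference
    quotient at 0 tends to 0.\<close>
  let ?n = "k + 2"
  show "flat \<epsilon> k x \<le> (real ?n / \<epsilon>) ^ ?n * x^2"
  proof (cases "x > 0")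
    case True
    have "(\<epsilon> / x / real ?n) ^ ?n \<le> (1 + (\<epsilon> / x) / real ?n) ^ ?n"
      using True assms by (intro power_mono) auto
    also have "\<dots> \<le> exp (\<epsilon> / x)"
    proof (rule exp_ge_one_plus_x_over_n_power_n)
      have "0 \<le> \<epsilon> / x" using True assms by simp
      then show "- real ?n \<le> \<epsilon> / x" by linarith
    qed simp
    finally have le: "(\<epsilon> / x / real ?n) ^ ?n \<le> exp (\<epsilon> / x)" .
    have pos: "(\<epsilon> / x / real ?n) ^ ?n > 0" using True assms by (intro zero_less_power) auto
    have "exp (- \<epsilon> / x) = inverse (exp (\<epsilon> / x))" by (simp add: exp_minus)
    also have "\<dots> \<le> inverse ((\<epsilon> / x / real ?n) ^ ?n)" using le pos by (rule le_imp_inverse_le)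
    also have "\<dots> = (real ?n / \<epsilon>) ^ ?n * x ^ ?n"
      by (simp only: power_inverse[symmetric] power_mult_distrib[symmetric]) (simp add: mult_ac divide_inverse)
    finally have "exp (- \<epsilon> / x) / x ^ k \<le> (real ?n / \<epsilon>) ^ ?n * x ^ ?n / x ^ k"
      using True by (intro divide_right_mono) auto
    also have "\<dots> = (real ?n / \<epsilon>) ^ ?n * x^2" using True by (simp add: power_add power2_eq_square)
    finally show ?thesis using True by (simp add: flat_def)
  qed (use assms in \<open>simp add: flat_def\<close>)
qed

lemma flat_has_derivative:
  assumes "\<epsilon> > 0"
  shows "(flat \<epsilon> k has_real_derivative \<epsilon> * flat \<epsilon> (k + 2) x - real k * flat \<epsilon> (k + 1) x) (at x)"
proof -
  consider "x > 0" | "x < 0" | "x = 0" by linarith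
  then show ?thesis
  proof cases
    case 1
    have "((\<lambda>x. exp (- \<epsilon> / x)) has_real_derivative exp (- \<epsilon> / x) * (\<epsilon> / x^2)) (at x)"
      using 1 by (auto intro!: derivative_eq_intros simp: power2_eq_square)
    from DERIV_divide[OF this DERIV_pow[of k x]] 1
    have "((\<lambda>x. exp (- \<epsilon> / x) / x ^ k) has_real_derivative
        (exp (- \<epsilon> / x) * (\<epsilon> / x^2) * x ^ k - exp (- \<epsilon> / x) * (real k * x ^ (k - Suc 0))) / (x ^ k * x ^ k)) (at x)"
      by simp
    also have "(exp (- \<epsilon> / x) * (\<epsilon> / x^2) * x ^ k - exp (- \<epsilon> / x) * (real k * x ^ (k - Suc 0))) / (x ^ k * x ^ k)
        = \<epsilon> * flat \<epsilon> (k + 2) x - real k * flat \<epsilon> (k + 1) x"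
    proof -
      have "real k * x ^ (k - Suc 0) = real k * x ^ k / x" using 1 by (cases k) auto
      show ?thesis using 1 unfolding \<open>real k * x ^ (k - Suc 0) = real k * x ^ k / x\<close>
        by (simp add: flat_def field_simps power2_eq_square)
    qed
    finally have "((\<lambda>x. exp (- \<epsilon> / x) / x ^ k) has_real_derivative \<epsilon> * flat \<epsilon> (k + 2) x - real k * flat \<epsilon> (k + 1) x) (at x)" .
    moreover have "\<forall>\<^sub>F y in nhds x. flat \<epsilon> k y = exp (- \<epsilon> / y) / y ^ k"
      using eventually_nhds_in_open[of "{0<..}" x] 1 by (auto simp: flat_def elim: eventually_mono)
    ultimately show ?thesis by (subst DERIV_cong_ev) auto
  next
    case 2
    have "\<forall>\<^sub>F y in nhds x. flat \<epsilon> k y = 0"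
      using eventually_nhds_in_open[of "{..<0}" x] 2 by (auto simp: flat_def elim: eventually_mono)
    then show ?thesis using 2 by (subst DERIV_cong_ev) (auto simp: flat_def)
  next
    case 3
    obtain C where C: "\<And>x. flat \<epsilon> k x \<le> C * x^2" using flat_le_square[OF assms] by blast
    have "((\<lambda>h. flat \<epsilon> k h / h) \<longlongrightarrow> 0) (at 0)"
    proof (rule Lim_null_comparison)
      show "\<forall>\<^sub>F h in at 0. norm (flat \<epsilon> k h / h) \<le> C * \<bar>h\<bar>"
      proof (rule eventually_at_topological[THEN iffD2], intro exI[of _ UNIV] conjI ballI impI)
        fix h :: real assume "h \<noteq> 0"
        have "flat \<epsilon> k h / \<bar>h\<bar> \<le> C * h^2 / \<bar>h\<bar>" using C[of h] by (intro divide_right_mono) auto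
        also have "\<dots> = C * \<bar>h\<bar>" using \<open>h \<noteq> 0\<close> by (simp add: power2_eq_square abs_if)
        finally show "norm (flat \<epsilon> k h / h) \<le> C * \<bar>h\<bar>" using flat_nonneg[of \<epsilon> k h] by simp
      qed auto
      have "((\<lambda>h::real. C * \<bar>h\<bar>) \<longlongrightarrow> C * \<bar>0\<bar>) (at 0)" by (intro tendsto_intros)
      then show "((\<lambda>h::real. C * \<bar>h\<bar>) \<longlongrightarrow> 0) (at 0)" by simp
    qed
    then show ?thesis using 3 by (simp add: DERIV_def flat_def)
  qed
qed

text \<open>A class of functions closed under differentiation, so that \<open>smooth_coinduct\<close> applies.\<close>

inductive smooth_term :: "(real \<Rightarrow> complex) \<Rightarrow> bool" where
  base: "smooth f \<Longrightarrow> smooth_term f"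
| const: "smooth_term (\<lambda>x. c)"
| ident: "smooth_term (\<lambda>x. cpx x)"
| flat: "\<epsilon> > 0 \<Longrightarrow> smooth_term (\<lambda>x. cpx (flat \<epsilon> k x))"
| add: "smooth_term f \<Longrightarrow> smooth_term g \<Longrightarrow> smooth_term (\<lambda>x. f x + g x)"
| mult: "smooth_term f \<Longrightarrow> smooth_term g \<Longrightarrow> smooth_term (\<lambda>x. f x * g x)"
| affine: "smooth_term f \<Longrightarrow> smooth_term (\<lambda>x. f (c * x + d))"

lemma smooth_term_derivative:
  "smooth_term f \<Longrightarrow> \<exists>f'. smooth_term f' \<and> (\<forall>x. (f has_vector_derivative f' x) (at x))"
proof (induction rule: smooth_term.induct)
  case (base f)
  then show ?case using smooth_der smooth_has_der smooth_term.base by blast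
next
  case (const c)
  show ?case by (intro exI[of _ "\<lambda>x. 0"]) (auto intro: smooth_term.const)
next
  case ident
  show ?case
    by (intro exI[of _ "\<lambda>x. 1"]) (auto intro: smooth_term.const has_vector_derivative_of_real[of "\<lambda>x. x" 1, simplified] )
next
  case (flat \<epsilon> k)
  have "((\<lambda>x. cpx (flat \<epsilon> k x)) has_vector_derivative
      cpx \<epsilon> * cpx (flat \<epsilon> (k + 2) x) + cpx (- real k) * cpx (flat \<epsilon> (k + 1) x)) (at x)" for x
    using has_vector_derivative_of_real[OF flat_has_derivative[OF flat, of k x]]
    by simp
  moreover have "smooth_term (\<lambda>x. cpx \<epsilon> * cpx (flat \<epsilon> (k + 2) x) + cpx (- real k) * cpx (flat \<epsilon> (k + 1) x))"
    by (intro smooth_term.add smooth_term.mult smooth_term.const smooth_term.flat flat)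
  ultimately show ?case by blast
next
  case (add f g)
  then obtain f' g' where "smooth_term f'" "smooth_term g'"
    "\<And>x. (f has_vector_derivative f' x) (at x)" "\<And>x. (g has_vector_derivative g' x) (at x)" by blast
  then show ?case
    by (intro exI[of _ "\<lambda>x. f' x + g' x"]) (auto intro: smooth_term.add has_vector_derivative_add)
next
  case (mult f g)
  then obtain f' g' where "smooth_term f'" "smooth_term g'"
    "\<And>x. (f has_vector_derivative f' x) (at x)" "\<And>x. (g has_vector_derivative g' x) (at x)" by blast
  then show ?case using mult
    by (intro exI[of _ "\<lambda>x. f x * g' x + f' x * g x"])
       (auto intro: smooth_term.add smooth_term.mult has_vector_derivative_mult)
next
  case (affine f c d)
  then obtain f' where f': "smooth_term f'" "\<And>x. (f has_vector_derivative f' x) (at x)" by blast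
  have "((\<lambda>x. f (c * x + d)) has_vector_derivative cpx c * f' (c * x + d)) (at x)" for x
  proof -
    have "((\<lambda>x. c * x + d) has_vector_derivative c) (at x)"
      by (auto intro!: derivative_eq_intros simp: has_real_derivative_iff_has_vector_derivative[symmetric])
    from vector_diff_chain_at[OF this f'(2)] show ?thesis by (simp add: o_def scaleR_conv_of_real)
  qed
  then show ?case using f'(1)
    by (intro exI[of _ "\<lambda>x. cpx c * f' (c * x + d)"]) (auto intro: smooth_term.mult smooth_term.const smooth_term.affine)
qed

lemma smooth_termD: "smooth_term f \<Longrightarrow> smooth f"
  by (rule smooth_coinduct[of smooth_term]) (use smooth_term_derivative in blast)+

lemma smooth_tpoly: "smooth (ctp n)"
proof -
  have "smooth_term (ctp n)"
  proof (induction n rule: induct_nat_012)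
    case (ge2 n)
    have "smooth_term (\<lambda>x. (2 * cpx x) * ctp (Suc n) x + (-1) * ctp n x)"
      by (intro smooth_term.add smooth_term.mult smooth_term.const smooth_term.ident ge2)
    then show ?case by simp
  qed (auto intro: smooth_term.const smooth_term.ident)
  then show ?thesis by (rule smooth_termD)
qed

lemma test_funs_mono: "I \<subseteq> J \<Longrightarrow> test_funs I \<subseteq> test_funs J"
  unfolding test_funs_def by blast

definition bump :: "real \<Rightarrow> real \<Rightarrow> real \<Rightarrow> real \<Rightarrow> complex" where
  "bump \<epsilon> a b x = cpx (flat \<epsilon> 0 (x - a) * flat \<epsilon> 0 (b - x))"

lemma bump_test_fun:
  assumes "\<epsilon> > 0" "{a..b} \<subseteq> I"
  shows "bump \<epsilon> a b \<in> test_funs I"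
proof -
  have "smooth_term (\<lambda>x. cpx (flat \<epsilon> 0 (1 * x + - a)) * cpx (flat \<epsilon> 0 ((-1) * x + b)))"
    by (intro smooth_term.mult smooth_term.affine[of "\<lambda>x. cpx (flat \<epsilon> 0 x)"] smooth_term.flat assms)
  then have "smooth (bump \<epsilon> a b)"
    by (intro smooth_termD) (simp add: bump_def[abs_def])
  moreover have "bump \<epsilon> a b x = 0" if "x \<notin> {a..b}" for x
    using that by (auto simp: bump_def flat_def)
  ultimately show ?thesis using assms(2) unfolding test_funs_def by (auto intro!: exI[of _ "{a..b}"])
qed

lemma flat_0_le: "\<epsilon> > 0 \<Longrightarrow> flat \<epsilon> 0 x \<le> 1"
  by (simp add: flat_def)

lemma norm_bump_le: "\<epsilon> > 0 \<Longrightarrow> cmod (bump \<epsilon> a b x) \<le> 1"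
  using mult_mono[OF flat_0_le flat_0_le, of \<epsilon> \<epsilon> "x - a" "b - x"]
    mult_nonneg_nonneg[OF flat_nonneg flat_nonneg, of \<epsilon> 0 "x - a" \<epsilon> 0 "b - x"]
    flat_nonneg[of \<epsilon> 0 "b - x"] flat_nonneg[of \<epsilon> 0 "x - a"]
  by (simp add: bump_def norm_of_real abs_of_nonneg mult.commute del: of_real_mult)

lemma flat_limit:
  assumes "e \<longlonglongrightarrow> 0" "\<And>k. e k > 0" "c \<longlonglongrightarrow> y" "y > 0"
  shows "(\<lambda>k. flat (e k) 0 (c k)) \<longlonglongrightarrow> 1"
proof -
  have "(\<lambda>k. exp (- e k / c k)) \<longlonglongrightarrow> exp (- 0 / y)"
    using assms by (intro tendsto_intros) auto
  moreover have "\<forall>\<^sub>F k in sequentially. exp (- e k / c k) = flat (e k) 0 (c k)"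
    using order_tendstoD(1)[OF assms(3,4)] by eventually_elim (simp add: flat_def)
  ultimately have "(\<lambda>k. flat (e k) 0 (c k)) \<longlonglongrightarrow> exp (- 0 / y)"
    by (rule Lim_transform_eventually)
  then show ?thesis by simp
qed

text \<open>Bumps whose sharpness parameter and margin both tend to 0 converge to the indicator of
  an interval and are bounded by 1. Dominated convergence thus reduces the claim to integrals over
  intervals.\<close>

theorem AE_zero_if_test_integrals_zero:
  assumes v: "set_integrable lborel {-1<..<1} v"
    and zero: "\<And>\<phi>. \<phi> \<in> test_funs {-1<..<1} \<Longrightarrow> (LINT x:{-1<..<1}|lborel. v x * \<phi> x) = 0"
  shows "AE x in lborel. x \<in> {-1<..<1} \<longrightarrow> v x = (0::complex)"
proof -
  define f where "f x = indicator {-1<..<1} x *\<^sub>R v x" for x :: real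
  have f: "integrable lborel f" using v unfolding f_def set_integrable_def .
  have "AE x in lborel. f x = 0"
  proof (rule AE_zero_if_interval_integrals_zero[OF sigma_finite_lborel _ f])
    fix a b :: real
    \<comment> \<open>The interval is clipped to the segment so that the bumps are test functions
      there; nothing is lost because \<open>f\<close> vanishes outside.\<close>
    define a' b' where "a' = max a (-1)" and "b' = min b 1"
    define e where "e k = 1 / real (Suc k)" for k
    have e0: "e \<longlonglongrightarrow> 0" unfolding e_def using LIMSEQ_inverse_real_of_nat by (simp add: inverse_eq_divide)
    have epos: "e k > 0" for k by (simp add: e_def)
    define \<phi> where "\<phi> k = bump (e k) (a' + e k) (b' - e k)" for k
    have \<phi>: "\<phi> k \<in> test_funs {-1<..<1}" for k
    proof -
      have "{a' + e k..b' - e k} \<subseteq> {-1<..<1}" using epos[of k] by (auto simp: a'_def b'_def)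
      then show ?thesis unfolding \<phi>_def by (intro bump_test_fun epos)
    qed
    have \<phi>m: "\<phi> k \<in> borel_measurable borel" for k
      using \<phi>[of k] smooth_measurable by (auto simp: test_funs_def)
    have lim: "(\<lambda>k. \<phi> k x) \<longlonglongrightarrow> indicator {a'<..<b'} x" for x
    proof (cases "x \<in> {a'<..<b'}")
      case True
      have "(\<lambda>k. x - (a' + e k)) \<longlonglongrightarrow> x - (a' + 0)" "(\<lambda>k. b' - e k - x) \<longlonglongrightarrow> b' - 0 - x"
        by (intro tendsto_intros e0)+
      then have "(\<lambda>k. \<phi> k x) \<longlonglongrightarrow> cpx (1 * 1)"
        unfolding \<phi>_def bump_def using True by (intro tendsto_intros flat_limit[OF e0 epos]) auto
      then show ?thesis using True by simp
    next
      case False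
      then have out: "x - (a' + e k) \<le> 0 \<or> b' - e k - x \<le> 0" for k using epos[of k] by auto
      have "\<phi> k x = 0" for k
        unfolding \<phi>_def bump_def flat_def using out[of k] by auto
      then show ?thesis using False by simp
    qed
    have "(\<lambda>k. LINT x|lborel. f x * \<phi> k x) \<longlonglongrightarrow> (LINT x|lborel. f x * indicator {a'<..<b'} x)"
    proof (rule integral_dominated_convergence[where w = "\<lambda>x. cmod (f x)"])
      show "AE x in lborel. norm (f x * \<phi> k x) \<le> cmod (f x)" for k
        using norm_bump_le[OF epos] by (auto simp: \<phi>_def norm_mult intro!: mult_left_le)
      show "AE x in lborel. (\<lambda>k. f x * \<phi> k x) \<longlonglongrightarrow> f x * indicator {a'<..<b'} x"
        by (intro AE_I2 tendsto_intros lim)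
    qed (use f \<phi>m in auto)
    moreover have "(LINT x|lborel. f x * \<phi> k x) = 0" for k
      using zero[OF \<phi>[of k]] by (simp add: f_def set_lebesgue_integral_def)
    ultimately have "(LINT x|lborel. f x * indicator {a'<..<b'} x) = 0" by (simp add: LIMSEQ_const_iff)
    moreover have "(LINT x:{a<..<b}|lborel. f x) = (LINT x|lborel. f x * indicator {a'<..<b'} x)"
      unfolding set_lebesgue_integral_def
      by (intro int_cong) (auto simp: f_def a'_def b'_def split: split_indicator)
    ultimately show "(LINT x:{a<..<b}|lborel. f x) = 0" by simp
  qed simp
  then show ?thesis by eventually_elim (auto simp: f_def)
qed

section \<open>Fourier integrals of integrable functions and of test functions\<close>

lemma cis_measurable [measurable]: "cis \<in> borel_measurable borel"
  by (intro borel_measurable_continuous_onI continuous_intros)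

lemma tendsto_cis_compose: "(f \<longlongrightarrow> l) F \<Longrightarrow> ((\<lambda>x. cis (f x)) \<longlongrightarrow> cis l) F"
  by (rule continuous_on_tendsto_compose[OF continuous_on_cis[OF continuous_on_id, of UNIV]]) auto

lemma pair_integrable_kernel:
  fixes a :: "'a \<Rightarrow> complex" and b :: "'b \<Rightarrow> complex"
  assumes M: "sigma_finite_measure M" and N: "sigma_finite_measure N"
    and a: "integrable M a" and b: "integrable N b"
    and k: "(\<lambda>(x, y). k x y) \<in> borel_measurable (M \<Otimes>\<^sub>M N)" and kB: "\<And>x y. cmod (k x y) \<le> B"
  shows "integrable (M \<Otimes>\<^sub>M N) (\<lambda>(x, y). a x * b y * k x y)"
proof -
  interpret pair_sigma_finite M N using M N by (simp add: pair_sigma_finite_def)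
  note [measurable] = borel_measurable_integrable[OF a] borel_measurable_integrable[OF b] k
  have "integrable (M \<Otimes>\<^sub>M N) (\<lambda>(x, y). a x * b y)"
  proof (rule Fubini_integrable)
    show "AE x in M. integrable N (\<lambda>y. case (x, y) of (x, y) \<Rightarrow> a x * b y)" using b by simp
    show "integrable M (\<lambda>x. LINT y|N. norm (case (x, y) of (x, y) \<Rightarrow> a x * b y))" using a by (simp add: norm_mult)
  qed measurable
  then have "integrable (M \<Otimes>\<^sub>M N) (\<lambda>z. B * norm (case z of (x, y) \<Rightarrow> a x * b y))" by simp
  then show ?thesis
  proof (rule integrable_bound)
    show "(\<lambda>(x, y). a x * b y * k x y) \<in> borel_measurable (M \<Otimes>\<^sub>M N)" using k by measurable
    have "cmod (a x * b y * k x y) \<le> \<bar>B * cmod (a x * b y)\<bar>" for x y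
    proof -
      have "cmod (a x * b y * k x y) = cmod (k x y) * cmod (a x * b y)" by (simp add: norm_mult)
      also have "\<dots> \<le> B * cmod (a x * b y)" using kB by (intro mult_right_mono) auto
      finally show ?thesis by linarith
    qed
    then show "AE z in M \<Otimes>\<^sub>M N. norm (case z of (x, y) \<Rightarrow> a x * b y * k x y) \<le> norm (B * norm (case z of (x, y) \<Rightarrow> a x * b y))"
      by auto
  qed
qed

text \<open>The common shape of the exchanges of integrals on the Fourier side: two integrable
  factors and a bounded kernel, usually an exponential.\<close>

lemma Fubini_kernel:
  fixes a :: "'a \<Rightarrow> complex" and b :: "'b \<Rightarrow> complex"
  assumes M: "sigma_finite_measure M" and N: "sigma_finite_measure N"
    and a: "integrable M a" and b: "integrable N b"
    and k: "(\<lambda>(x, y). k x y) \<in> borel_measurable (M \<Otimes>\<^sub>M N)" and kB: "\<And>x y. cmod (k x y) \<le> B"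
  shows "(LINT x|M. a x * (LINT y|N. k x y * b y)) = (LINT y|N. b y * (LINT x|M. k x y * a x))" (is ?A)
    and "integrable M (\<lambda>x. a x * (LINT y|N. k x y * b y))" (is ?B)
proof -
  interpret pair_sigma_finite M N using M N by (simp add: pair_sigma_finite_def)
  have i: "integrable (M \<Otimes>\<^sub>M N) (\<lambda>(x, y). a x * b y * k x y)"
    by (rule pair_integrable_kernel[OF M N a b k kB])
  have e: "(LINT y|N. a x * b y * k x y) = a x * (LINT y|N. k x y * b y)" for x
    by (subst integral_mult_right_zero[symmetric]) (intro Bochner_Integration.integral_cong refl, simp add: mult_ac)
  have e': "(LINT x|M. a x * b y * k x y) = b y * (LINT x|M. k x y * a x)" for y
    by (subst integral_mult_right_zero[symmetric]) (intro Bochner_Integration.integral_cong refl, simp add: mult_ac)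
  have "(LINT x|M. a x * (LINT y|N. k x y * b y)) = (LINT x|M. LINT y|N. a x * b y * k x y)"
    by (simp only: e)
  also have "\<dots> = (LINT y|N. LINT x|M. a x * b y * k x y)"
    by (rule Fubini_integral[OF i, symmetric])
  also have "\<dots> = (LINT y|N. b y * (LINT x|M. k x y * a x))"
    by (simp only: e')
  finally show ?A .
  show ?B
    using integrable_fst'[OF i] by (simp only: split_conv e)
qed

lemma continuous_oscillatory_integral:
  fixes f :: "'a \<Rightarrow> complex"
  assumes f: "integrable N f" and Z: "Z \<in> borel_measurable N"
  shows "continuous_on UNIV (\<lambda>\<xi>. LINT t|N. cis (Z t * \<xi>) * f t)"
proof (rule continuous_at_imp_continuous_on, rule ballI)
  fix \<xi> :: real
  note [measurable] = borel_measurable_integrable[OF f] Z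
  show "isCont (\<lambda>\<xi>. LINT t|N. cis (Z t * \<xi>) * f t) \<xi>"
    unfolding continuous_at_sequentially
  proof (intro allI impI)
    fix X :: "nat \<Rightarrow> real" assume X: "X \<longlonglongrightarrow> \<xi>"
    have "(\<lambda>n. LINT t|N. cis (Z t * X n) * f t) \<longlonglongrightarrow> (LINT t|N. cis (Z t * \<xi>) * f t)"
    proof (rule integral_dominated_convergence[where w = "\<lambda>t. cmod (f t)"])
      show "AE t in N. (\<lambda>n. cis (Z t * X n) * f t) \<longlonglongrightarrow> cis (Z t * \<xi>) * f t"
        by (intro AE_I2 tendsto_mult tendsto_cis_compose tendsto_const X)
    qed (use f in \<open>auto simp: norm_mult\<close>)
    then show "((\<lambda>\<xi>. LINT t|N. cis (Z t * \<xi>) * f t) \<circ> X) \<longlonglongrightarrow> (LINT t|N. cis (Z t * \<xi>) * f t)" by (simp add: o_def)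
  qed
qed

lemma norm_oscillatory_integral_le:
  "cmod (LINT t|N. cis (Z t * \<xi>) * f t) \<le> (LINT t|N. cmod (f t))"
  using integral_norm_bound[of N "\<lambda>t. cis (Z t * \<xi>) * f t"] by (simp add: norm_mult)

lemma test_funs_smooth: "\<phi> \<in> test_funs I \<Longrightarrow> smooth \<phi>" by (simp add: test_funs_def)

lemma test_funs_measurable: "\<phi> \<in> test_funs I \<Longrightarrow> \<phi> \<in> borel_measurable borel"
  by (intro smooth_measurable test_funs_smooth)

lemma test_funs_bounded_support:
  assumes "\<phi> \<in> test_funs I"
  obtains R where "R > 0" "\<And>x. \<bar>x\<bar> > R \<Longrightarrow> \<phi> x = 0"
proof -
  obtain K where K: "compact K" "\<And>x. x \<notin> K \<Longrightarrow> \<phi> x = 0" using assms by (auto simp: test_funs_def)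
  then obtain R where R: "R > 0" "\<And>x. x \<in> K \<Longrightarrow> norm x \<le> R"
    using compact_imp_bounded bounded_pos by metis
  have "\<phi> x = 0" if "\<bar>x\<bar> > R" for x using R(2)[of x] K(2)[of x] that by fastforce
  then show ?thesis using that R by blast
qed

lemma test_funs_der:
  assumes "\<phi> \<in> test_funs I"
  shows "der \<phi> \<in> test_funs I"
proof -
  obtain K where K: "compact K" "K \<subseteq> I" "\<And>x. x \<notin> K \<Longrightarrow> \<phi> x = 0" using assms by (auto simp: test_funs_def)
  have "der \<phi> x = 0" if "x \<notin> K" for x
  proof -
    have "open (- K)" using K(1) by (simp add: compact_imp_closed open_Compl)
    then have "(\<phi> has_vector_derivative 0) (at x)"
      using that K(3) by (intro has_vector_derivative_transform_within_open[of "\<lambda>_. 0" 0 x "- K" \<phi>]) auto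
    then show ?thesis by (rule vector_derivative_at)
  qed
  then show ?thesis using K assms smooth_der unfolding test_funs_def by blast
qed

lemma test_funs_bounded_integrable:
  assumes "\<phi> \<in> test_funs I"
  shows "integrable lborel \<phi>" and "\<exists>B. \<forall>x. cmod (\<phi> x) \<le> B" (is ?A)
proof -
  obtain R where R: "R > 0" "\<And>x. \<bar>x\<bar> > R \<Longrightarrow> \<phi> x = 0" using test_funs_bounded_support[OF assms] by blast
  have c: "continuous_on {-R..R} \<phi>" using assms by (intro smooth_continuous test_funs_smooth)
  have "integrable lborel (\<lambda>x. indicator {-R..R} x *\<^sub>R \<phi> x)"
    by (rule borel_integrable_compact) (use c in auto)
  also have "(\<lambda>x. indicator {-R..R} x *\<^sub>R \<phi> x) = \<phi>"
    using R(2) by (auto simp: fun_eq_iff indicator_def)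
  finally show "integrable lborel \<phi>" .
  have "bounded (\<phi> ` {-R..R})" by (intro compact_imp_bounded compact_continuous_image c) auto
  then obtain B where B: "B > 0" "\<And>x. x \<in> {-R..R} \<Longrightarrow> cmod (\<phi> x) \<le> B" by (auto simp: bounded_pos)
  have "cmod (\<phi> x) \<le> B" for x
    using B(2)[of x] R(2)[of x] B(1) by (cases "\<bar>x\<bar> > R") (auto simp: abs_le_iff not_less)
  then show ?A by blast
qed

lemma has_vector_derivative_cis:
  "((\<lambda>x. cis (x * \<xi>)) has_vector_derivative \<i> * cpx \<xi> * cis (x * \<xi>)) (at x)"
proof -
  have "((\<lambda>z. exp (\<i> * z * cpx \<xi>)) has_field_derivative
      \<i> * cpx \<xi> * exp (\<i> * cpx x * cpx \<xi>)) (at (cpx x))"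
    by (auto intro!: derivative_eq_intros)
  from has_vector_derivative_real_field[OF this] show ?thesis
    by (simp add: cis_conv_exp mult_ac)
qed

lemma minus_i_mult_twice: "(- \<i> * c) * ((- \<i> * c) * z) = - (c^2 * z)"
  by (simp add: complex_eq_iff power2_eq_square algebra_simps)

lemma fourier_derivative:
  assumes "\<phi> \<in> test_funs I"
  shows "(LINT x|lborel. cis (x * \<xi>) * der \<phi> x) = - \<i> * cpx \<xi> * (LINT x|lborel. cis (x * \<xi>) * \<phi> x)"
proof -
  obtain R where R: "R > 0" "\<And>x. \<bar>x\<bar> > R \<Longrightarrow> \<phi> x = 0" using test_funs_bounded_support[OF assms] by blast
  obtain R' where R': "R' > 0" "\<And>x. \<bar>x\<bar> > R' \<Longrightarrow> der \<phi> x = 0" using test_funs_bounded_support[OF test_funs_der[OF assms]] by blast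
  define S where "S = max R R' + 1"
  let ?g = "\<lambda>x. cis (x * \<xi>) * der \<phi> x + \<i> * cpx \<xi> * (cis (x * \<xi>) * \<phi> x)"
  have d: "((\<lambda>x. cis (x * \<xi>) * \<phi> x) has_vector_derivative ?g x) (at x)" for x
  proof -
    have "((\<lambda>x. cis (x * \<xi>)) has_vector_derivative \<i> * cpx \<xi> * cis (x * \<xi>)) (at x)"
      by (rule has_vector_derivative_cis)
    from has_vector_derivative_mult[OF this smooth_has_der[OF test_funs_smooth[OF assms]]]
    show ?thesis by (simp add: mult_ac)
  qed
  have i1: "integrable lborel (\<lambda>x. cis (x * \<xi>) * \<psi> x)" if "\<psi> \<in> test_funs I" for \<psi>
    by (rule integrable_bound[OF test_funs_bounded_integrable(1)[OF that]])
       (use test_funs_measurable[OF that] in \<open>auto simp: norm_mult\<close>)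
  have c: "continuous_on {-S..S} ?g"
    using assms by (intro continuous_intros smooth_continuous smooth_der test_funs_smooth)
  have "(LINT x|lborel. ?g x) = (LINT x|lborel. indicator {-S..S} x *\<^sub>R ?g x)"
  proof (intro int_cong)
    fix x
    show "?g x = indicator {-S..S} x *\<^sub>R ?g x"
    proof (cases "x \<in> {-S..S}")
      case False
      then have "\<bar>x\<bar> > R" "\<bar>x\<bar> > R'" unfolding S_def by auto
      then show ?thesis using R(2) R'(2) by simp
    qed simp
  qed
  also have "\<dots> = cis (S * \<xi>) * \<phi> S - cis (- S * \<xi>) * \<phi> (- S)"
    using R(1) by (intro integral_FTC_Icc has_vector_derivative_at_within[OF d] c) (auto simp: S_def)
  also have "\<dots> = 0"
  proof -
    have "\<bar>S\<bar> > R" "\<bar>- S\<bar> > R" using R(1) by (auto simp: S_def)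
    then show ?thesis using R(2) by simp
  qed
  finally have "(LINT x|lborel. ?g x) = 0" .
  then have "(LINT x|lborel. cis (x * \<xi>) * der \<phi> x) + \<i> * cpx \<xi> * (LINT x|lborel. cis (x * \<xi>) * \<phi> x) = 0"
    using i1[OF assms] i1[OF test_funs_der[OF assms]] by simp
  then show ?thesis by (simp add: eq_neg_iff_add_eq_0)
qed

theorem inv_fourier_decay:
  assumes "\<phi> \<in> test_funs I"
  obtains C where "C \<ge> 0" "\<And>\<xi>. cmod (inv_fourier \<phi> \<xi>) \<le> C / (1 + \<xi>^2)"
proof -
  let ?F = "\<lambda>\<psi> \<xi>. LINT x|lborel. cis (x * \<xi>) * \<psi> x"
  define A where "A = (LINT x|lborel. cmod (\<phi> x)) + (LINT x|lborel. cmod (der (der \<phi>) x))"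
  have A0: "A \<ge> 0" unfolding A_def by (intro add_nonneg_nonneg integral_nonneg) auto
  have b: "cmod (?F \<phi> \<xi>) \<le> A / (1 + \<xi>^2)" for \<xi>
  proof -
    have "?F (der (der \<phi>)) \<xi> = - ((cpx \<xi>)^2 * ?F \<phi> \<xi>)"
      unfolding fourier_derivative[OF test_funs_der[OF assms]] fourier_derivative[OF assms]
      by (rule minus_i_mult_twice)
    then have "\<xi>^2 * cmod (?F \<phi> \<xi>) = cmod (?F (der (der \<phi>)) \<xi>)" by (simp add: norm_mult norm_power)
    also have "\<dots> \<le> (LINT x|lborel. cmod (der (der \<phi>) x))" by (rule norm_oscillatory_integral_le)
    finally have "(1 + \<xi>^2) * cmod (?F \<phi> \<xi>) \<le> A"
      using norm_oscillatory_integral_le[of lborel "\<lambda>x. x" \<xi> \<phi>] by (simp add: A_def distrib_right)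
    moreover have "1 + \<xi>^2 > 0" by (intro add_pos_nonneg) auto
    ultimately show ?thesis by (simp add: field_simps)
  qed
  have "cmod (inv_fourier \<phi> \<xi>) \<le> A / (1 + \<xi>^2)" for \<xi>
  proof -
    have "1 / (2 * pi) \<le> 1" using pi_gt3 by simp
    have "cmod (inv_fourier \<phi> \<xi>) = 1 / (2 * pi) * cmod (?F \<phi> \<xi>)" by (simp add: inv_fourier_def norm_mult norm_divide)
    also have "\<dots> \<le> 1 * cmod (?F \<phi> \<xi>)" using \<open>1 / (2 * pi) \<le> 1\<close> by (intro mult_right_mono) auto
    finally show ?thesis using b[of \<xi>] by simp
  qed
  then show ?thesis using that[OF A0] by blast
qed

lemma inv_fourier_continuous: "\<phi> \<in> test_funs I \<Longrightarrow> continuous_on UNIV (inv_fourier \<phi>)"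
  unfolding inv_fourier_def
  by (intro continuous_intros continuous_oscillatory_integral[where Z = "\<lambda>x. x"] test_funs_bounded_integrable) auto

section \<open>A Parseval identity\<close>

lemma has_bochner_integral_exp_half_line:
  assumes c: "Re c > 0"
  shows "has_bochner_integral lborel (\<lambda>x. indicator {0..} x *\<^sub>R exp (- c * cpx x)) (1 / c)"
proof -
  have "(\<integral>\<^sup>+x. ennreal (exp (- Re c * x)) * indicator {0..} x \<partial>lborel) = ennreal (0 - (- exp (- Re c * 0) / Re c))"
  proof (rule nn_integral_FTC_atLeast)
    show "DERIV (\<lambda>x. - exp (- Re c * x) / Re c) x :> exp (- Re c * x)" for x
      using c by (auto intro!: derivative_eq_intros)
    have "LIM x at_top. - Re c * x :> at_bot"
      by (rule filterlim_tendsto_neg_mult_at_bot[OF tendsto_const _ filterlim_ident]) (use c in auto)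
    from filterlim_compose[OF exp_at_bot this]
    have "((\<lambda>x. - exp (- Re c * x) / Re c) \<longlongrightarrow> - 0 / Re c) at_top"
      using c by (intro tendsto_intros) auto
    then show "((\<lambda>x. - exp (- Re c * x) / Re c) \<longlongrightarrow> 0) at_top" by simp
  qed auto
  then have nn: "(\<integral>\<^sup>+x. ennreal (exp (- Re c * x)) * indicator {0..} x \<partial>lborel) < \<infinity>" by simp
  have int: "integrable lborel (\<lambda>x. indicator {0..} x *\<^sub>R exp (- c * cpx x))"
  proof (rule integrableI_bounded)
    have "(\<integral>\<^sup>+x. ennreal (norm (indicator {0..} x *\<^sub>R exp (- c * cpx x))) \<partial>lborel)
        = (\<integral>\<^sup>+x. ennreal (exp (- Re c * x)) * indicator {0..} x \<partial>lborel)"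
      by (intro nn_integral_cong) (auto split: split_indicator)
    then show "(\<integral>\<^sup>+x. ennreal (norm (indicator {0..} x *\<^sub>R exp (- c * cpx x))) \<partial>lborel) < \<infinity>" using nn by simp
  qed measurable
  have c0: "c \<noteq> 0" using c by auto
  have fin: "(LINT x:{0..b}|lborel. exp (- c * cpx x)) = 1 / c - exp (- c * cpx b) / c" if "b \<ge> 0" for b
  proof -
    have d: "((\<lambda>x. - exp (- c * cpx x) / c) has_vector_derivative exp (- c * cpx x)) (at x)" for x
    proof -
      have "((\<lambda>z. - exp (- c * z) / c) has_field_derivative exp (- c * cpx x)) (at (cpx x))"
        using c0 by (auto intro!: derivative_eq_intros)
      then show ?thesis by (rule has_vector_derivative_real_field)
    qed
    have "(LINT x|lborel. indicator {0..b} x *\<^sub>R exp (- c * cpx x)) = - exp (- c * cpx b) / c - (- exp (- c * cpx 0) / c)"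
      using that by (intro integral_FTC_Icc has_vector_derivative_at_within[OF d] continuous_intros)
    then show ?thesis by (simp add: set_lebesgue_integral_def)
  qed
  have "((\<lambda>b. LINT x:{0..b}|lborel. exp (- c * cpx x)) \<longlongrightarrow> (LINT x:{0..}|lborel. exp (- c * cpx x))) at_top"
    by (rule tendsto_set_lebesgue_integral_at_top) (use int in \<open>auto simp: set_integrable_def\<close>)
  moreover have "((\<lambda>b. LINT x:{0..b}|lborel. exp (- c * cpx x)) \<longlongrightarrow> 1 / c - 0 / c) at_top"
  proof (rule Lim_transform_eventually)
    have "LIM x at_top. - Re c * x :> at_bot"
      by (rule filterlim_tendsto_neg_mult_at_bot[OF tendsto_const _ filterlim_ident]) (use c in auto)
    from filterlim_compose[OF exp_at_bot this]
    have "((\<lambda>b. exp (- c * cpx b)) \<longlongrightarrow> 0) at_top"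
      by (intro tendsto_norm_zero_cancel[of "\<lambda>b. exp (- c * cpx b)"]) simp
    then show "((\<lambda>b. 1 / c - exp (- c * cpx b) / c) \<longlongrightarrow> 1 / c - 0 / c) at_top"
      using c0 by (intro tendsto_intros)
    show "\<forall>\<^sub>F b in at_top. 1 / c - exp (- c * cpx b) / c = (LINT x:{0..b}|lborel. exp (- c * cpx x))"
      using eventually_ge_at_top[of 0] by eventually_elim (rule fin[symmetric])
  qed
  ultimately have "(LINT x:{0..}|lborel. exp (- c * cpx x)) = 1 / c - 0 / c"
    by (intro tendsto_unique[OF trivial_limit_at_top_linorder])
  then show ?thesis using int by (simp add: has_bochner_integral_iff set_lebesgue_integral_def)
qed

text \<open>The sum and the difference of the two half-line integrals are the Poisson kernel and the
  conjugate Poisson kernel. The first serves the Parseval identity, the second the Fourier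
  representation of the logarithm.\<close>

lemma has_bochner_integral_two_sided:
  assumes \<epsilon>: "\<epsilon> > 0"
  shows "has_bochner_integral lborel (\<lambda>x. cis (x * a) * cpx (damp \<epsilon> x)) (cpx (2 * \<epsilon> / (\<epsilon>^2 + a^2)))" (is ?A)
    and "has_bochner_integral lborel (\<lambda>x. cpx (sgn x) * cis (x * a) * cpx (damp \<epsilon> x)) (\<i> * cpx (2 * a / (\<epsilon>^2 + a^2)))" (is ?B)
proof -
  let ?P = "\<lambda>x. indicator {0..} x *\<^sub>R exp (- (cpx \<epsilon> - \<i> * a) * cpx x)"
  let ?N = "\<lambda>x. indicator {0..} (0 + (-1) * x) *\<^sub>R exp (- (cpx \<epsilon> + \<i> * a) * cpx (0 + (-1) * x))"
  have P: "has_bochner_integral lborel ?P (1 / (cpx \<epsilon> - \<i> * a))"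
    by (rule has_bochner_integral_exp_half_line) (use \<epsilon> in simp)
  have "has_bochner_integral lborel (\<lambda>x. indicator {0..} x *\<^sub>R exp (- (cpx \<epsilon> + \<i> * a) * cpx x)) (1 / (cpx \<epsilon> + \<i> * a))"
    by (rule has_bochner_integral_exp_half_line) (use \<epsilon> in simp)
  from lborel_has_bochner_integral_real_affine_iff[THEN iffD1, OF _ this, of "-1" 0]
  have N: "has_bochner_integral lborel ?N (1 / (cpx \<epsilon> + \<i> * a))" by simp
  have nz: "cpx \<epsilon> - \<i> * a \<noteq> 0" "cpx \<epsilon> + \<i> * a \<noteq> 0"
    using \<epsilon> by (auto simp: complex_eq_iff)
  have prod: "(cpx \<epsilon> - \<i> * a) * (cpx \<epsilon> + \<i> * a) = cpx (\<epsilon>^2 + a^2)"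
    by (simp add: complex_eq_iff power2_eq_square)
  have sum: "1 / (cpx \<epsilon> - \<i> * a) + 1 / (cpx \<epsilon> + \<i> * a) = cpx (2 * \<epsilon> / (\<epsilon>^2 + a^2))"
  proof -
    have "1 / (cpx \<epsilon> - \<i> * a) + 1 / (cpx \<epsilon> + \<i> * a) = 2 * cpx \<epsilon> / ((cpx \<epsilon> - \<i> * a) * (cpx \<epsilon> + \<i> * a))"
      by (subst add_frac_eq[OF nz]) simp
    then show ?thesis unfolding prod by simp
  qed
  have dif: "1 / (cpx \<epsilon> - \<i> * a) - 1 / (cpx \<epsilon> + \<i> * a) = \<i> * cpx (2 * a / (\<epsilon>^2 + a^2))"
  proof -
    have "1 / (cpx \<epsilon> - \<i> * a) - 1 / (cpx \<epsilon> + \<i> * a) = 2 * (\<i> * a) / ((cpx \<epsilon> - \<i> * a) * (cpx \<epsilon> + \<i> * a))"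
      by (subst diff_frac_eq[OF nz]) simp
    then show ?thesis unfolding prod by simp
  qed
  have eP: "?P x = (if x > 0 then cis (x * a) * cpx (damp \<epsilon> x) else 0)" if "x \<noteq> 0" for x
    using that by (auto simp: cis_conv_exp exp_add[symmetric] exp_of_real[symmetric] algebra_simps simp flip: of_real_mult)
  have eN: "?N x = (if x < 0 then cis (x * a) * cpx (damp \<epsilon> x) else 0)" if "x \<noteq> 0" for x
    using that by (auto simp: cis_conv_exp exp_add[symmetric] exp_of_real[symmetric] algebra_simps simp flip: of_real_mult)
  have m: "(\<lambda>x. cis (x * a) * cpx (damp \<epsilon> x)) \<in> borel_measurable lborel" by measurable
  have "has_bochner_integral lborel (\<lambda>x. ?P x + ?N x) (cpx (2 * \<epsilon> / (\<epsilon>^2 + a^2)))"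
    unfolding sum[symmetric] by (rule has_bochner_integral_add[OF P N])
  moreover have "AE x in lborel. ?P x + ?N x = cis (x * a) * cpx (damp \<epsilon> x)"
    using AE_lborel_singleton[of 0] proof eventually_elim
    case (elim x)
    show ?case unfolding eP[OF elim] eN[OF elim] using elim by auto
  qed
  ultimately show ?A
    by (subst has_bochner_integral_cong_AE[symmetric]) (auto simp: has_bochner_integral_iff)
  have "has_bochner_integral lborel (\<lambda>x. ?P x - ?N x) (\<i> * cpx (2 * a / (\<epsilon>^2 + a^2)))"
    unfolding dif[symmetric] by (rule has_bochner_integral_diff[OF P N])
  moreover have "AE x in lborel. ?P x - ?N x = cpx (sgn x) * cis (x * a) * cpx (damp \<epsilon> x)"
    using AE_lborel_singleton[of 0] proof eventually_elim
    case (elim x)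
    show ?case unfolding eP[OF elim] eN[OF elim] using elim by auto
  qed
  ultimately show ?B
    by (subst has_bochner_integral_cong_AE[symmetric]) (auto simp: has_bochner_integral_iff)
qed

lemma integrable_exp_abs: "\<epsilon> > 0 \<Longrightarrow> integrable lborel (\<lambda>x::real. damp \<epsilon> x)"
  using has_bochner_integral_two_sided(1)[of \<epsilon> 0, THEN integrable.intros] by (simp add: complex_of_real_integrable_eq)

lemma has_bochner_integral_cauchy_density:
  "has_bochner_integral lborel (\<lambda>s::real. 2 / (1 + s^2)) (2 * pi)"
proof -
  have "integrable lborel (\<lambda>s::real. inverse (1 + s^2))" "(LINT s|lborel. inverse (1 + s^2)) = pi"
    using integrable_inverse_1_plus_square LBINT_inverse_1_plus_square
    by (simp_all add: set_integrable_def interval_lebesgue_integral_def set_lebesgue_integral_def einterval_def)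
  then show ?thesis
    by (simp add: has_bochner_integral_iff divide_inverse)
qed

text \<open>With the factor \<open>damp \<epsilon>\<close> inserted, Fubini applies and produces the
  Poisson integral of \<open>G\<close>, which tends to \<open>2 pi G\<close> at continuity points.
  Continuity almost everywhere is the right hypothesis for \<open>cheb_ext\<close>, which can jump
  at 0.\<close>

theorem fourier_parseval:
  fixes m G :: "real \<Rightarrow> complex"
  assumes m: "integrable lborel m" and G: "integrable lborel G"
    and GB: "\<And>\<zeta>. cmod (G \<zeta>) \<le> B" and Gc: "AE \<zeta> in lborel. isCont G \<zeta>"
  defines "U \<equiv> \<lambda>x. LINT \<zeta>|lborel. cis (\<zeta> * x) * m \<zeta>"
    and "V \<equiv> \<lambda>x. LINT \<eta>|lborel. cis (- \<eta> * x) * G \<eta>"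
  assumes UV: "integrable lborel (\<lambda>x. U x * V x)"
  shows "(LINT x|lborel. U x * V x) = 2 * pi * (LINT \<zeta>|lborel. m \<zeta> * G \<zeta>)"
proof -
  have B0: "B \<ge> 0" using GB[of 0] norm_ge_zero[of "G 0"] by linarith
  have [measurable]: "m \<in> borel_measurable borel" "G \<in> borel_measurable borel"
    using m G borel_measurable_integrable by auto
  have Uc: "continuous_on UNIV U" unfolding U_def
    by (rule continuous_oscillatory_integral[OF m, where Z = "\<lambda>x. x"]) simp
  have Vc: "continuous_on UNIV V" unfolding V_def
    using continuous_oscillatory_integral[OF G, where Z = "\<lambda>x. - x"] by simp
  have [measurable]: "U \<in> borel_measurable borel" "V \<in> borel_measurable borel"
    using Uc Vc by (auto intro: borel_measurable_continuous_onI)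
  define V1 where "V1 = (LINT \<eta>|lborel. cmod (G \<eta>))"
  have VB: "cmod (V x) \<le> V1" for x
    unfolding V_def V1_def using norm_oscillatory_integral_le[of lborel "\<lambda>\<eta>. - \<eta>" x G] by simp
  define P where "P \<epsilon> \<zeta> = (LINT \<eta>|lborel. G \<eta> * cpx (2 * \<epsilon> / (\<epsilon>^2 + (\<zeta> - \<eta>)^2)))" for \<epsilon> \<zeta>
  have step: "(LINT x|lborel. cpx (damp \<epsilon> x) * (U x * V x)) = (LINT \<zeta>|lborel. m \<zeta> * P \<epsilon> \<zeta>)"
    and Pint: "integrable lborel (\<lambda>\<zeta>. m \<zeta> * P \<epsilon> \<zeta>)" if \<epsilon>: "\<epsilon> > 0" for \<epsilon>
  proof -
    define a where "a x = cpx (damp \<epsilon> x) * V x" for x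
    have ai: "integrable lborel a"
      using integrable_bounded_mult[OF integrable_of_real[OF integrable_exp_abs[OF \<epsilon>]] _ VB] by (simp add: a_def[abs_def] mult.commute)
    have inner: "(LINT x|lborel. cis (\<zeta> * x) * a x) = P \<epsilon> \<zeta>" for \<zeta>
    proof -
      define b where "b x = cis (\<zeta> * x) * cpx (damp \<epsilon> x)" for x
      have "integrable lborel b"
        using has_bochner_integral_two_sided(1)[OF \<epsilon>, of \<zeta>, THEN integrable.intros] by (simp add: b_def[abs_def] mult.commute)
      have "(LINT x|lborel. cis (\<zeta> * x) * a x) = (LINT x|lborel. b x * (LINT \<eta>|lborel. cis (- \<eta> * x) * G \<eta>))"
        by (simp add: a_def b_def V_def mult.assoc)
      also have "\<dots> = (LINT \<eta>|lborel. G \<eta> * (LINT x|lborel. cis (- \<eta> * x) * b x))"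
        by (rule Fubini_kernel(1)[OF sigma_finite_lborel sigma_finite_lborel \<open>integrable lborel b\<close> G, where B = 1]) auto
      also have "\<dots> = P \<epsilon> \<zeta>"
        unfolding P_def
      proof (intro Bochner_Integration.integral_cong refl arg_cong2[where f = "(*)"])
        fix \<eta>
        have "(LINT x|lborel. cis (- \<eta> * x) * b x) = (LINT x|lborel. cis (x * (\<zeta> - \<eta>)) * cpx (damp \<epsilon> x))"
          by (intro int_cong) (simp add: b_def mult.assoc[symmetric] cis_mult, simp add: algebra_simps)
        also have "\<dots> = cpx (2 * \<epsilon> / (\<epsilon>^2 + (\<zeta> - \<eta>)^2))"
          using has_bochner_integral_two_sided(1)[OF \<epsilon>, of "\<zeta> - \<eta>"] by (rule has_bochner_integral_integral_eq)
        finally show "(LINT x|lborel. cis (- \<eta> * x) * b x) = cpx (2 * \<epsilon> / (\<epsilon>^2 + (\<zeta> - \<eta>)^2))" .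
      qed
      finally show ?thesis .
    qed
    have "(LINT x|lborel. cpx (damp \<epsilon> x) * (U x * V x)) = (LINT x|lborel. a x * (LINT \<zeta>|lborel. cis (\<zeta> * x) * m \<zeta>))"
      by (simp add: a_def U_def mult_ac)
    also have "\<dots> = (LINT \<zeta>|lborel. m \<zeta> * (LINT x|lborel. cis (\<zeta> * x) * a x))"
      by (rule Fubini_kernel(1)[OF sigma_finite_lborel sigma_finite_lborel ai m, where B = 1]) auto
    finally show "(LINT x|lborel. cpx (damp \<epsilon> x) * (U x * V x)) = (LINT \<zeta>|lborel. m \<zeta> * P \<epsilon> \<zeta>)"
      by (simp only: inner)
    have "integrable lborel (\<lambda>\<zeta>. m \<zeta> * (LINT x|lborel. cis (\<zeta> * x) * a x))"
      by (rule Fubini_kernel(2)[OF sigma_finite_lborel sigma_finite_lborel m ai, where B = 1]) auto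
    then show "integrable lborel (\<lambda>\<zeta>. m \<zeta> * P \<epsilon> \<zeta>)" by (simp only: inner)
  qed
  \<comment> \<open>The substitution \<open>\<eta> = \<zeta> + \<epsilon> s\<close> fixes the
    density, so that \<epsilon> remains only in the argument of \<open>G\<close> and dominated
    convergence applies.\<close>
  have P_alt: "P \<epsilon> \<zeta> = (LINT s|lborel. cpx (2 / (1 + s^2)) * G (\<zeta> + \<epsilon> * s))" if "\<epsilon> > 0" for \<epsilon> \<zeta>
  proof -
    have "P \<epsilon> \<zeta> = \<bar>\<epsilon>\<bar> *\<^sub>R (LINT s|lborel. G (\<zeta> + \<epsilon> * s) * cpx (2 * \<epsilon> / (\<epsilon>^2 + (\<zeta> - (\<zeta> + \<epsilon> * s))^2)))"
      unfolding P_def using that by (intro lborel_integral_real_affine) simp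
    also have "\<dots> = (LINT s|lborel. \<bar>\<epsilon>\<bar> *\<^sub>R (G (\<zeta> + \<epsilon> * s) * cpx (2 * \<epsilon> / (\<epsilon>^2 + (\<zeta> - (\<zeta> + \<epsilon> * s))^2))))"
      by (rule integral_scaleR_right[symmetric])
    also have "\<dots> = (LINT s|lborel. cpx (2 / (1 + s^2)) * G (\<zeta> + \<epsilon> * s))"
    proof (intro int_cong)
      fix s :: real
      have "\<epsilon> * (2 * \<epsilon> / (\<epsilon>^2 + (\<zeta> - (\<zeta> + \<epsilon> * s))^2)) = 2 * \<epsilon>^2 / (\<epsilon>^2 * (1 + s^2))"
        by (simp add: power2_eq_square algebra_simps)
      also have "\<dots> = 2 / (1 + s^2)" using that by simp
      finally have e: "\<epsilon> * (2 * \<epsilon> / (\<epsilon>^2 + (\<zeta> - (\<zeta> + \<epsilon> * s))^2)) = 2 / (1 + s^2)" .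
      have "\<bar>\<epsilon>\<bar> *\<^sub>R (G (\<zeta> + \<epsilon> * s) * cpx (2 * \<epsilon> / (\<epsilon>^2 + (\<zeta> - (\<zeta> + \<epsilon> * s))^2))) =
         cpx (\<epsilon> * (2 * \<epsilon> / (\<epsilon>^2 + (\<zeta> - (\<zeta> + \<epsilon> * s))^2))) * G (\<zeta> + \<epsilon> * s)"
        using that by (simp add: scaleR_conv_of_real mult_ac)
      then show "\<bar>\<epsilon>\<bar> *\<^sub>R (G (\<zeta> + \<epsilon> * s) * cpx (2 * \<epsilon> / (\<epsilon>^2 + (\<zeta> - (\<zeta> + \<epsilon> * s))^2))) =
         cpx (2 / (1 + s^2)) * G (\<zeta> + \<epsilon> * s)" unfolding e .
    qed
    finally show ?thesis .
  qed
  note cd = has_bochner_integral_cauchy_density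
  have bound_s: "norm (cpx (2 / (1 + s^2)) * G z) \<le> B * (2 / (1 + s^2))" for s z
  proof -
    have "0 \<le> 2 / (1 + s^2)" by simp
    then have "norm (cpx (2 / (1 + s^2)) * G z) = 2 / (1 + s^2) * cmod (G z)" by (simp only: norm_mult norm_of_real abs_of_nonneg)
    also have "\<dots> \<le> 2 / (1 + s^2) * B" using GB[of z] by (intro mult_left_mono) auto
    finally show ?thesis by (simp add: mult.commute)
  qed
  have PB: "cmod (P \<epsilon> \<zeta>) \<le> B * (2 * pi)" if "\<epsilon> > 0" for \<epsilon> \<zeta>
  proof -
    have "cmod (P \<epsilon> \<zeta>) \<le> (LINT s|lborel. B * (2 / (1 + s^2)))"
      unfolding P_alt[OF that]
    proof (rule norm_integral_le_AE)
      show i: "integrable lborel (\<lambda>s. B * (2 / (1 + s^2)))" using cd by (intro integrable_mult_right) (rule integrable.intros)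
      show "integrable lborel (\<lambda>s. cpx (2 / (1 + s^2)) * G (\<zeta> + \<epsilon> * s))"
        by (rule integrable_bound[OF i]) (use bound_s B0 in \<open>auto intro!: order_trans[OF bound_s]\<close>)
    qed (use bound_s in auto)
    also have "\<dots> = B * (2 * pi)" using has_bochner_integral_integral_eq[OF cd] by (simp only: integral_mult_right_zero)
    finally show ?thesis .
  qed
  define e where "e k = 1 / real (Suc k)" for k
  have e0: "e \<longlonglongrightarrow> 0" unfolding e_def using LIMSEQ_inverse_real_of_nat by (simp add: inverse_eq_divide)
  have epos: "e k > 0" for k by (simp add: e_def)
  have Plim: "(\<lambda>k. P (e k) \<zeta>) \<longlonglongrightarrow> 2 * pi * G \<zeta>" if "isCont G \<zeta>" for \<zeta>
  proof -
    have "(\<lambda>k. LINT s|lborel. cpx (2 / (1 + s^2)) * G (\<zeta> + e k * s)) \<longlonglongrightarrow> (LINT s|lborel. cpx (2 / (1 + s^2)) * G \<zeta>)"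
    proof (rule integral_dominated_convergence[where w = "\<lambda>s. B * (2 / (1 + s^2))"])
      show "integrable lborel (\<lambda>s. B * (2 / (1 + s^2)))" using cd by (intro integrable_mult_right) (rule integrable.intros)
      show "AE s in lborel. (\<lambda>k. cpx (2 / (1 + s^2)) * G (\<zeta> + e k * s)) \<longlonglongrightarrow> cpx (2 / (1 + s^2)) * G \<zeta>"
      proof (rule AE_I2)
        fix s
        have "(\<lambda>k. \<zeta> + e k * s) \<longlonglongrightarrow> \<zeta> + 0 * s" by (intro tendsto_intros e0)
        then have "(\<lambda>k. G (\<zeta> + e k * s)) \<longlonglongrightarrow> G \<zeta>" using isCont_tendsto_compose[OF that] by simp
        then show "(\<lambda>k. cpx (2 / (1 + s^2)) * G (\<zeta> + e k * s)) \<longlonglongrightarrow> cpx (2 / (1 + s^2)) * G \<zeta>"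
          by (rule tendsto_mult_left)
      qed
    qed (use bound_s in auto)
    moreover have "(LINT s|lborel. cpx (2 / (1 + s^2)) * G \<zeta>) = 2 * pi * G \<zeta>"
    proof -
      have "(LINT s|lborel. cpx (2 / (1 + s^2))) = cpx (2 * pi)"
        by (subst integral_complex_of_real) (simp only: has_bochner_integral_integral_eq[OF cd])
      then show ?thesis by (simp only: integral_mult_left_zero)
    qed
    ultimately show ?thesis by (simp only: P_alt[OF epos])
  qed
  have "(\<lambda>k. LINT x|lborel. cpx (damp (e k) x) * (U x * V x)) \<longlonglongrightarrow> (LINT x|lborel. U x * V x)"
  proof (rule integral_dominated_convergence[where w = "\<lambda>x. cmod (U x * V x)"])
    show "AE x in lborel. (\<lambda>k. cpx (damp (e k) x) * (U x * V x)) \<longlonglongrightarrow> U x * V x"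
    proof (rule AE_I2)
      fix x :: real
      have "(\<lambda>k. cpx (damp (e k) x) * (U x * V x)) \<longlonglongrightarrow> cpx (exp (- 0 * \<bar>x\<bar>)) * (U x * V x)"
        by (intro tendsto_intros e0)
      then show "(\<lambda>k. cpx (damp (e k) x) * (U x * V x)) \<longlonglongrightarrow> U x * V x" by simp
    qed
    show "AE x in lborel. norm (cpx (damp (e k) x) * (U x * V x)) \<le> cmod (U x * V x)" for k
      using epos[of k] by (auto simp: norm_mult intro!: mult_left_le_one_le)
  qed (use UV in auto)
  moreover have "(\<lambda>k. LINT \<zeta>|lborel. m \<zeta> * P (e k) \<zeta>) \<longlonglongrightarrow> (LINT \<zeta>|lborel. m \<zeta> * (2 * pi * G \<zeta>))"
  proof (rule integral_dominated_convergence[where w = "\<lambda>\<zeta>. cmod (m \<zeta>) * (B * (2 * pi))"])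
    show "AE \<zeta> in lborel. (\<lambda>k. m \<zeta> * P (e k) \<zeta>) \<longlonglongrightarrow> m \<zeta> * (2 * pi * G \<zeta>)"
      using Gc by eventually_elim (intro tendsto_mult_left Plim)
    show "AE \<zeta> in lborel. norm (m \<zeta> * P (e k) \<zeta>) \<le> cmod (m \<zeta>) * (B * (2 * pi))" for k
      unfolding norm_mult by (intro AE_I2 mult_left_mono PB epos norm_ge_zero)
    show "(\<lambda>\<zeta>. m \<zeta> * P (e k) \<zeta>) \<in> borel_measurable lborel" for k
      by (rule borel_measurable_integrable[OF Pint[OF epos]])
  qed (use m in auto)
  ultimately have "(LINT x|lborel. U x * V x) = (LINT \<zeta>|lborel. m \<zeta> * (2 * pi * G \<zeta>))"
    unfolding step[OF epos] by (rule LIMSEQ_unique)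
  also have "\<dots> = (LINT \<zeta>|lborel. (2 * pi) * (m \<zeta> * G \<zeta>))" by (simp add: mult_ac)
  finally show ?thesis by (simp only: integral_mult_right_zero)
qed

lemma abs_ln_le_powr: "y > 0 \<Longrightarrow> \<bar>ln y\<bar> \<le> 2 * y powr (-1/2) + (y::real)"
proof -
  assume y: "y > 0"
  have "ln (y powr (-1/2)) \<le> y powr (-1/2)" using y by (intro ln_bound) auto
  then have "- ln y \<le> 2 * y powr (-1/2)" using y by (simp add: ln_powr)
  moreover have "ln y \<le> y" using y by (rule ln_bound)
  moreover have "y powr (-1/2) \<ge> 0" by simp
  ultimately show ?thesis using y by linarith
qed

section \<open>The logarithmic kernel\<close>

lemma integrable_ln_abs:
  "integrable lborel (\<lambda>s. indicator {-L..L} s * ln \<bar>s::real\<bar>)"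
proof (cases "L \<ge> 0")
  case True
  let ?f = "\<lambda>s::real. indicator {0..L} s *\<^sub>R s powr (-1/2)"
  have "(\<lambda>s::real. s powr (-1/2)) integrable_on {0..L}"
    using has_integral_powr_from_0[of "-1/2" L] True by (auto simp: integrable_on_def)
  then have "(\<lambda>s::real. s powr (-1/2)) absolutely_integrable_on {0..L}"
    by (rule nonnegative_absolutely_integrable_1) auto
  then have f: "integrable lborel ?f"
    unfolding set_integrable_def by (subst (asm) integrable_completion) auto
  have f': "integrable lborel (\<lambda>s. ?f (0 + (-1) * s))"
    by (rule lborel_integrable_real_affine[OF f]) simp
  have c: "integrable lborel (\<lambda>s::real. indicator {-L..L} s *\<^sub>R L)"
    by (rule borel_integrable_compact) auto
  show ?thesis
  proof (rule integrable_bound)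
    show "integrable lborel (\<lambda>s. 2 * ?f s + 2 * ?f (0 + (-1) * s) + indicator {-L..L} s *\<^sub>R L)"
      by (intro integrable_add integrable_mult_right f f' c)
    show "AE s in lborel. norm (indicator {-L..L} s * ln \<bar>s::real\<bar>) \<le> norm (2 * ?f s + 2 * ?f (0 + (-1) * s) + indicator {-L..L} s *\<^sub>R L)"
    proof (rule AE_I2)
      fix s :: real
      show "norm (indicator {-L..L} s * ln \<bar>s\<bar>) \<le> norm (2 * ?f s + 2 * ?f (0 + (-1) * s) + indicator {-L..L} s *\<^sub>R L)"
      proof (cases "s \<in> {-L..L} \<and> s \<noteq> 0")
        case True
        then have "\<bar>ln \<bar>s\<bar>\<bar> \<le> 2 * \<bar>s\<bar> powr (-1/2) + \<bar>s\<bar>" by (intro abs_ln_le_powr) auto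
        also have "\<dots> \<le> 2 * \<bar>s\<bar> powr (-1/2) + L" using True by (auto simp: abs_le_iff)
        also have "2 * \<bar>s\<bar> powr (-1/2) = 2 * ?f s + 2 * ?f (0 + (-1) * s)"
          using True by (cases "s > 0") (auto simp: indicator_def)
        finally show ?thesis using True by simp
      qed (auto simp: indicator_def)
    qed
  qed measurable
next
  case False
  then show ?thesis by simp
qed

lemma integrable_ln_abs_diff:
  "integrable lborel (\<lambda>s. indicator {-L..L} (c - s) * ln \<bar>c - s::real\<bar>)"
  using lborel_integrable_real_affine[OF integrable_ln_abs[of L], of "-1" c] by simp

lemma ln_abs_integral_bound:
  obtains C where "\<And>y. y \<in> {-1..1} \<Longrightarrow> (\<integral>\<^sup>+x. indicator {-1..1} x * ennreal \<bar>ln \<bar>y - x\<bar>\<bar> \<partial>lborel) \<le> ennreal C"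
proof -
  let ?I = "LINT s|lborel. \<bar>indicator {-2..2} s * ln \<bar>s::real\<bar>\<bar>"
  have nn: "(\<integral>\<^sup>+s. ennreal \<bar>indicator {-2..2} s * ln \<bar>s::real\<bar>\<bar> \<partial>lborel) = ennreal ?I"
    using integrable_ln_abs[of 2] by (intro nn_integral_eq_integral) auto
  have "(\<integral>\<^sup>+x. indicator {-1..1} x * ennreal \<bar>ln \<bar>y - x\<bar>\<bar> \<partial>lborel) \<le> ennreal ?I" if "y \<in> {-1..1}" for y
  proof -
    have "(\<integral>\<^sup>+x. indicator {-1..1} x * ennreal \<bar>ln \<bar>y - x\<bar>\<bar> \<partial>lborel)
        \<le> (\<integral>\<^sup>+x. ennreal \<bar>indicator {-2..2} (y + (-1) * x) * ln \<bar>y + (-1) * x\<bar>\<bar> \<partial>lborel)"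
      using that by (intro nn_integral_mono) (auto split: split_indicator)
    also have "\<dots> = (\<integral>\<^sup>+s. ennreal \<bar>indicator {-2..2} s * ln \<bar>s::real\<bar>\<bar> \<partial>lborel)"
      using nn_integral_real_affine[of "\<lambda>s. ennreal \<bar>indicator {-2..2} s * ln \<bar>s::real\<bar>\<bar>" "-1" y] by simp
    finally show ?thesis unfolding nn .
  qed
  then show ?thesis using that by blast
qed

section \<open>The cosine series of the logarithmic kernel\<close>

lemma sin_ge_quarter: "0 \<le> u \<Longrightarrow> u \<le> pi / 2 \<Longrightarrow> u / 4 \<le> sin u"
proof -
  assume u: "0 \<le> u" "u \<le> pi / 2"
  show "u / 4 \<le> sin u"
  proof (cases "u \<le> pi / 3")
    case True
    show ?thesis
    proof (cases "u = 0")
      case False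
      then have "u > 0" using u by simp
      then obtain z where z: "0 < z" "z < u" "sin u - sin 0 = (u - 0) * cos z"
        using MVT2[of 0 u sin cos] DERIV_sin by blast
      have "cos (pi / 3) \<le> cos z" using z True pi_gt_zero by (intro cos_monotone_0_pi_le) auto
      then have "1 / 4 \<le> cos z" by (simp add: cos_60)
      then have "u * (1 / 4) \<le> u * cos z" using \<open>u > 0\<close> by (intro mult_left_mono) auto
      then show ?thesis using z by simp
    qed simp
  next
    case False
    have "sin (pi / 6) \<le> sin u"
      using u False pi_gt_zero by (intro sin_monotone_2pi_le) auto
    then have "1 / 2 \<le> sin u" by (simp add: sin_30)
    moreover have "u / 4 \<le> 1 / 2" using u pi_less_4 by simp
    ultimately show ?thesis by linarith
  qed
qed

text \<open>This is \<open>|1 - r e^(i s)|^2\<close>, the denominator of the Poisson kernel of the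
  disc.\<close>

definition poisson_den :: "real \<Rightarrow> real \<Rightarrow> real" where
  "poisson_den r s = 1 - 2 * r * cos s + r^2"

lemma poisson_den_eq: "poisson_den r s = (1 - r)^2 + 4 * r * (sin (s / 2))^2"
proof -
  have c: "cos s = 1 - 2 * (sin (s / 2))^2" using cos_double_sin[of "s / 2"] by simp
  show ?thesis unfolding poisson_den_def c by (simp add: power2_eq_square algebra_simps)
qed

lemma poisson_den_bounds:
  assumes "1/2 \<le> r" "r \<le> 1"
  shows "2 * (sin (s / 2))^2 \<le> poisson_den r s" (is ?A) and "poisson_den r s \<le> 4"
proof -
  have "2 * (sin (s / 2))^2 \<le> 4 * r * (sin (s / 2))^2" using assms by (intro mult_right_mono) auto
  then show ?A unfolding poisson_den_eq by (simp add: add_increasing)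
  have "r^2 \<le> 1" using assms by (simp add: power_le_one)
  moreover have "- (2 * r * cos s) \<le> 2"
  proof -
    have "r * (- cos s) \<le> r * 1" using assms cos_ge_minus_one[of s] by (intro mult_left_mono) linarith+
    then show ?thesis using assms by simp
  qed
  ultimately show "poisson_den r s \<le> 4" by (simp add: poisson_den_def)
qed

lemma abs_ln_le: "0 < a \<Longrightarrow> a \<le> q \<Longrightarrow> q \<le> (4::real) \<Longrightarrow> \<bar>ln q\<bar> \<le> ln 4 + \<bar>ln a\<bar>"
proof -
  assume *: "0 < a" "a \<le> q" "q \<le> 4"
  then have "ln a \<le> ln q" "ln q \<le> ln 4" by auto
  moreover have "0 \<le> ln (4::real)" by simp
  ultimately show ?thesis by linarith
qed

text \<open>Real part of the logarithm series at \<open>z = - r e^(i s)\<close>, where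
  \<open>|1 + z|^2 = poisson_den r s\<close>. The term \<open>k = 0\<close> vanishes because
  division by zero gives 0.\<close>

lemma poisson_kernel_series:
  assumes "0 < r" "r < 1"
  shows "(\<lambda>k. - (r ^ k * cos (real k * s)) / real k) sums (ln (poisson_den r s) / 2)"
proof -
  let ?z = "- cpx r * cis s"
  have "cmod ?z < 1" using assms by (simp add: norm_mult)
  from sums_Re[OF Ln_series'[OF this]]
  have "(\<lambda>k. Re (- ((- ?z) ^ k) / of_nat k)) sums Re (ln (1 + ?z))" .
  moreover have "Re (- ((- ?z) ^ k) / of_nat k) = - (r ^ k * cos (real k * s)) / real k" for k
  proof -
    have e: "- ((- ?z) ^ k) / of_nat k = cpx (- (r ^ k) / real k) * cis (real k * s)"
      by (simp add: power_mult_distrib Complex.DeMoivre)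
    show ?thesis unfolding e by simp
  qed
  moreover have "Re (ln (1 + ?z)) = ln (poisson_den r s) / 2"
  proof -
    have nz: "1 + ?z \<noteq> 0"
    proof
      assume "1 + ?z = 0"
      then have "cpx r * cis s = 1" by (simp add: add_eq_0_iff2)
      then have "cmod (cpx r * cis s) = 1" by (simp only: norm_one)
      then show False using assms by (simp add: norm_mult)
    qed
    have "(cmod (1 + ?z))^2 = poisson_den r s"
    proof -
      have "(cmod (1 + ?z))^2 = (1 - r * cos s)^2 + (r * sin s)^2" by (simp add: cmod_power2)
      also have "\<dots> = 1 - 2 * r * cos s + r^2 * ((cos s)^2 + (sin s)^2)"
        by (simp only: power2_diff power_mult_distrib distrib_left) simp
      finally show ?thesis by (simp add: poisson_den_def)
    qed
    then have "cmod (1 + ?z) = sqrt (poisson_den r s)" by (metis norm_ge_zero real_sqrt_unique)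
    moreover have "poisson_den r s > 0" using \<open>(cmod (1 + ?z))\<^sup>2 = poisson_den r s\<close> nz by (metis zero_less_norm_iff zero_less_power)
    ultimately show ?thesis using nz by (simp add: ln_sqrt)
  qed
  ultimately show ?thesis by (simp only:)
qed

lemma arc_integral_cos_cos:
  "(LINT t|arc. cos (real m * t) * cos (real n * t)) = (if m = n then 1 / cheb_const n else 0)"
  using integral_tpoly_mult[of m n] by (subst (asm) integral_cheb_measure) (auto simp: tpoly_cos)

lemma integrable_arc_ln_diff: "\<theta> \<in> {0<..<pi} \<Longrightarrow> integrable arc (\<lambda>t. ln \<bar>\<theta> - t\<bar>)"
proof -
  assume \<theta>: "\<theta> \<in> {0<..<pi}"
  have "integrable lborel (\<lambda>t. indicator {0<..<pi} t *\<^sub>R ln \<bar>\<theta> - t\<bar>)"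
  proof (rule integrable_bound[OF integrable_ln_abs_diff[of pi \<theta>]])
    show "AE t in lborel. norm (indicator {0<..<pi} t *\<^sub>R ln \<bar>\<theta> - t\<bar>) \<le> norm (indicator {- pi..pi} (\<theta> - t) * ln \<bar>\<theta> - t\<bar>)"
      using \<theta> by (intro AE_I2) (auto split: split_indicator)
  qed measurable
  then show ?thesis unfolding arc_def by (simp add: integrable_restrict_space)
qed

lemma AE_arc_neq: "AE t in arc. t \<noteq> \<theta>"
proof -
  have "AE t in lborel. t \<in> {0<..<pi} \<longrightarrow> t \<noteq> \<theta>" using AE_lborel_singleton[of \<theta>] by eventually_elim auto
  then show ?thesis unfolding arc_def by (subst AE_restrict_space_iff) auto
qed

text \<open>The cosine expansion of \<open>ln |cos \<theta> - cos t|\<close> is read off for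
  \<open>r < 1\<close>, where it may be integrated termwise, and then \<open>r\<close> tends to 1
  under an integrable majorant. The logarithm itself is handled through the two half-angle factors
  of the difference of cosines.\<close>

lemma log_kernel:
  assumes \<theta>: "\<theta> \<in> {0<..<pi}"
  shows "integrable arc (\<lambda>t. ln \<bar>cos \<theta> - cos t\<bar>)"
    and "(LINT t|arc. cos (real n * t) * ln \<bar>cos \<theta> - cos t\<bar>) =
      (if n = 0 then - pi * ln 2 else - (pi / real n) * cos (real n * \<theta>))" (is ?A)
proof -
  interpret finite_measure arc by (rule finite_measure_arc)
  define K where "K r t = (ln (poisson_den r (\<theta> + t)) + ln (poisson_den r (\<theta> - t))) / 2" for r t
  have Km: "K r \<in> borel_measurable arc" for r
    by (rule measurable_arc) (simp add: K_def[abs_def] poisson_den_def)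
  \<comment> \<open>Since \<theta> is interior, \<open>sin ((\<theta> + t) / 2)\<close> stays above
    \<kappa> for all \<open>t\<close>; only the factor with \<open>\<theta> - t\<close> is singular.
    The majorant \<open>D\<close> below therefore contains just \<open>ln |\<theta> - t|\<close> and
    constants, uniformly for \<open>r\<close> in \<open>[1/2, 1]\<close>.\<close>
  define \<kappa> where "\<kappa> = min \<theta> (pi - \<theta>) / 8"
  have \<kappa>: "\<kappa> > 0" using \<theta> by (auto simp: \<kappa>_def)
  define D where "D t = ln 4 + ln 32 / 2 + \<bar>ln \<bar>\<theta> - t\<bar>\<bar> + \<bar>ln (2 * \<kappa>^2)\<bar> / 2" for t
  have Di: "integrable arc D"
    unfolding D_def using integrable_arc_ln_diff[OF \<theta>]
    by (intro integrable_add integrable_const integrable_abs)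
  have bound: "\<bar>K r t\<bar> \<le> D t" if r: "1/2 \<le> r" "r \<le> 1" and t: "t \<in> {0<..<pi}" "t \<noteq> \<theta>" for r t
  proof -
    have s1: "\<kappa> \<le> sin ((\<theta> + t) / 2)"
    proof (cases "(\<theta> + t) / 2 \<le> pi / 2")
      case True
      then have "(\<theta> + t) / 2 / 4 \<le> sin ((\<theta> + t) / 2)" using \<theta> t by (intro sin_ge_quarter) auto
      then show ?thesis using t by (auto simp: \<kappa>_def)
    next
      case False
      then have "(pi - (\<theta> + t) / 2) / 4 \<le> sin (pi - (\<theta> + t) / 2)" using \<theta> t by (intro sin_ge_quarter) auto
      moreover have "\<kappa> \<le> (pi - \<theta>) / 8" by (simp add: \<kappa>_def)
      moreover have "(pi - \<theta>) / 8 \<le> (pi - (\<theta> + t) / 2) / 4" using t by (simp add: add_divide_distrib)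
      moreover have "sin (pi - (\<theta> + t) / 2) = sin ((\<theta> + t) / 2)" by (rule sin_pi_minus)
      ultimately show ?thesis by (metis order_trans)
    qed
    have p1: "2 * \<kappa>^2 \<le> poisson_den r (\<theta> + t)"
      using poisson_den_bounds(1)[OF r, of "\<theta> + t"] power_mono[OF s1, of 2] \<kappa> by simp
    have s2: "\<bar>\<theta> - t\<bar> / 8 \<le> \<bar>sin ((\<theta> - t) / 2)\<bar>"
    proof -
      have "\<bar>\<theta> - t\<bar> / 2 / 4 \<le> sin (\<bar>\<theta> - t\<bar> / 2)" using \<theta> t by (intro sin_ge_quarter) auto
      moreover have "sin (\<bar>\<theta> - t\<bar> / 2) \<le> \<bar>sin ((\<theta> - t) / 2)\<bar>"
      proof (cases "\<theta> \<ge> t")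
        case False
        then have "\<bar>\<theta> - t\<bar> / 2 = - ((\<theta> - t) / 2)" by (simp add: abs_if field_simps)
        then show ?thesis by (simp only: sin_minus)
      qed simp
      ultimately show ?thesis by simp
    qed
    have p2: "(\<theta> - t)^2 / 32 \<le> poisson_den r (\<theta> - t)"
      using poisson_den_bounds(1)[OF r, of "\<theta> - t"] power_mono[OF s2, of 2] by (simp add: power_divide)
    have "\<bar>ln (poisson_den r (\<theta> + t))\<bar> \<le> ln 4 + \<bar>ln (2 * \<kappa>^2)\<bar>"
      using \<kappa> by (intro abs_ln_le p1 poisson_den_bounds(2)[OF r]) auto
    moreover have "\<bar>ln (poisson_den r (\<theta> - t))\<bar> \<le> ln 4 + \<bar>ln ((\<theta> - t)^2 / 32)\<bar>"
      using t by (intro abs_ln_le p2 poisson_den_bounds(2)[OF r]) auto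
    moreover have "\<bar>ln ((\<theta> - t)^2 / 32)\<bar> \<le> 2 * \<bar>ln \<bar>\<theta> - t\<bar>\<bar> + ln 32"
    proof -
      have "ln ((\<theta> - t)^2 / 32) = ln (\<bar>\<theta> - t\<bar>\<^sup>2) - ln 32" using t by (simp add: ln_div)
      also have "ln (\<bar>\<theta> - t\<bar>\<^sup>2) = 2 * ln \<bar>\<theta> - t\<bar>" using t by (subst ln_realpow) auto
      finally have "ln ((\<theta> - t)^2 / 32) = 2 * ln \<bar>\<theta> - t\<bar> - ln 32" .
      moreover have "0 \<le> ln (32::real)" by simp
      ultimately show ?thesis by linarith
    qed
    moreover have "\<bar>K r t\<bar> \<le> (\<bar>ln (poisson_den r (\<theta> + t))\<bar> + \<bar>ln (poisson_den r (\<theta> - t))\<bar>) / 2"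
      by (simp add: K_def abs_triangle_ineq)
    moreover have "s \<le> c + g / 2 + f + d / 2"
      if "a \<le> c + d" "b \<le> c + e" "e \<le> 2 * f + g" "s \<le> (a + b) / 2" for a b c d e f g s :: real
      using that by argo
    ultimately show ?thesis unfolding D_def by blast
  qed
  \<comment> \<open>At \<open>r = 1\<close> the product of the two denominators is
    \<open>4 (1 - cos (\<theta> + t)) (1 - cos (\<theta> - t))\<close>, which is the square of
    \<open>2 (cos \<theta> - cos t)\<close>.\<close>
  have K1: "K 1 t = ln 2 + ln \<bar>cos \<theta> - cos t\<bar>" if t: "t \<in> {0<..<pi}" "t \<noteq> \<theta>" for t
  proof -
    have ne: "cos \<theta> \<noteq> cos t" using t \<theta> cos_inj_pi[of \<theta> t] by auto
    have prod: "poisson_den 1 (\<theta> + t) * poisson_den 1 (\<theta> - t) = (2 * \<bar>cos \<theta> - cos t\<bar>)^2"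
    proof -
      have "cos (\<theta> + t) + cos (\<theta> - t) = 2 * cos \<theta> * cos t" by (simp add: cos_add cos_diff)
      moreover have "cos (\<theta> + t) * cos (\<theta> - t) = (cos \<theta>)^2 + (cos t)^2 - 1"
      proof -
        have "cos (\<theta> + t) * cos (\<theta> - t) = (cos \<theta>)^2 * (cos t)^2 - (sin \<theta>)^2 * (sin t)^2"
          by (simp add: cos_add cos_diff power2_eq_square algebra_simps)
        then show ?thesis by (simp add: sin_squared_eq algebra_simps)
      qed
      moreover have "poisson_den 1 (\<theta> + t) * poisson_den 1 (\<theta> - t) = 4 * (1 - (cos (\<theta> + t) + cos (\<theta> - t)) + cos (\<theta> + t) * cos (\<theta> - t))"
        by (simp add: poisson_den_def algebra_simps)
      ultimately show ?thesis by (simp add: power_mult_distrib power2_diff)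
    qed
    have "poisson_den 1 (\<theta> + t) \<noteq> 0" "poisson_den 1 (\<theta> - t) \<noteq> 0" using prod ne by auto
    then have "poisson_den 1 (\<theta> + t) > 0" "poisson_den 1 (\<theta> - t) > 0"
      by (auto simp: poisson_den_eq)
    then have "2 * K 1 t = ln (poisson_den 1 (\<theta> + t) * poisson_den 1 (\<theta> - t))" by (simp add: K_def ln_mult)
    also have "\<dots> = 2 * ln (2 * \<bar>cos \<theta> - cos t\<bar>)" unfolding prod using ne by (subst ln_realpow) auto
    also have "\<dots> = 2 * (ln 2 + ln \<bar>cos \<theta> - cos t\<bar>)" using ne by (simp add: ln_mult)
    finally show ?thesis by simp
  qed
  have Ki: "integrable arc (K 1)"
  proof (rule integrable_bound[OF Di Km])
    show "AE t in arc. norm (K 1 t) \<le> norm (D t)"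
      using AE_arc_neq[of \<theta>] AE_space[of arc]
    proof eventually_elim
      case (elim t)
      then have "\<bar>K 1 t\<bar> \<le> D t" by (intro bound) auto
      then show ?case by simp
    qed
  qed
  have lnm: "(\<lambda>t. ln \<bar>cos \<theta> - cos t\<bar>) \<in> borel_measurable arc" by (rule measurable_arc) measurable
  have AEK: "AE t in arc. K 1 t - ln 2 = ln \<bar>cos \<theta> - cos t\<bar>"
    using AE_arc_neq[of \<theta>] AE_space[of arc] by eventually_elim (simp add: K1)
  show li: "integrable arc (\<lambda>t. ln \<bar>cos \<theta> - cos t\<bar>)"
    by (rule integrable_cong_AE_imp[OF integrable_diff[OF Ki integrable_const[of "ln 2"]] lnm])
       (use AEK in eventually_elim, simp)
  have cosm: "(\<lambda>t. cos (real n * t)) \<in> borel_measurable arc" by (rule measurable_arc) measurable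
  \<comment> \<open>For \<open>n = 0\<close> the right side is 0 by division by zero, correctly so:
    the series of \<open>K r\<close> has no constant term. The mean of the kernel comes entirely
    from the \<open>ln 2\<close> in \<open>K1\<close>.\<close>
  have ser: "(LINT t|arc. cos (real n * t) * K r t) = - (pi / real n) * r ^ n * cos (real n * \<theta>)" if r: "0 < r" "r < 1" for r
  proof -
    define f where "f k t = cos (real n * t) * (- (2 * r ^ k * cos (real k * \<theta>)) / real k * cos (real k * t))" for k t
    have fs: "(\<lambda>k. f k t) sums (cos (real n * t) * K r t)" for t
    proof -
      have s1: "(\<lambda>k. - (r ^ k * cos (real k * (\<theta> + t))) / real k + - (r ^ k * cos (real k * (\<theta> - t))) / real k) sums
          (ln (poisson_den r (\<theta> + t)) / 2 + ln (poisson_den r (\<theta> - t)) / 2)"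
        by (intro sums_add poisson_kernel_series r)
      have eq: "- (r ^ k * cos (real k * (\<theta> + t))) / real k + - (r ^ k * cos (real k * (\<theta> - t))) / real k
          = - (2 * r ^ k * cos (real k * \<theta>)) / real k * cos (real k * t)" for k
      proof -
        have c: "cos (real k * (\<theta> + t)) + cos (real k * (\<theta> - t)) = 2 * cos (real k * \<theta>) * cos (real k * t)"
          by (simp add: distrib_left right_diff_distrib cos_add cos_diff)
        have "- (r ^ k * cos (real k * (\<theta> + t))) / real k + - (r ^ k * cos (real k * (\<theta> - t))) / real k
            = - (r ^ k * (cos (real k * (\<theta> + t)) + cos (real k * (\<theta> - t)))) / real k"
          by (simp only: distrib_left add_divide_distrib minus_add_distrib)
        then show ?thesis unfolding c by (simp add: mult_ac)
      qed
      have "K r t = ln (poisson_den r (\<theta> + t)) / 2 + ln (poisson_den r (\<theta> - t)) / 2"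
        by (simp add: K_def add_divide_distrib)
      with s1 have "(\<lambda>k. - (2 * r ^ k * cos (real k * \<theta>)) / real k * cos (real k * t)) sums K r t"
        unfolding eq by (simp only:)
      then show ?thesis unfolding f_def by (rule sums_mult)
    qed
    have fb: "\<bar>f k t\<bar> \<le> 2 * r ^ k" for k t
    proof -
      have "\<bar>f k t\<bar> = 2 * r ^ k * (\<bar>cos (real n * t)\<bar> * \<bar>cos (real k * \<theta>)\<bar> * \<bar>cos (real k * t)\<bar> * (1 / real k))"
        using r by (simp add: f_def abs_mult)
      also have "\<dots> \<le> 2 * r ^ k * 1"
      proof -
        have "1 / real k \<le> 1" by (cases "k = 0") auto
        then show ?thesis using r by (intro mult_left_mono mult_le_one) auto
      qed
      finally show ?thesis by simp
    qed
    have fi: "integrable arc (f k)" for k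
      unfolding f_def by (intro integrable_arc_continuous continuous_intros)
    have gs: "summable (\<lambda>k. 2 * r ^ k)" using r by (intro summable_mult summable_geometric) simp
    have S1: "(\<lambda>k. LINT t|arc. f k t) sums (LINT t|arc. (\<Sum>k. f k t))"
    proof (rule sums_integral[OF fi])
      show "AE t in arc. summable (\<lambda>k. norm (f k t))"
        by (intro AE_I2 summable_comparison_test'[OF gs]) (use fb in auto)
      show "summable (\<lambda>k. LINT t|arc. norm (f k t))"
      proof (rule summable_comparison_test')
        show "summable (\<lambda>k. pi * (2 * r ^ k))" using gs by (rule summable_mult)
        fix k
        have "(LINT t|arc. norm (f k t)) \<le> (LINT t|arc. 2 * r ^ k)"
          using fi fb by (intro integral_mono integrable_norm) auto
        also have "\<dots> = pi * (2 * r ^ k)" by (simp add: measure_arc)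
        finally show "norm (LINT t|arc. norm (f k t)) \<le> pi * (2 * r ^ k)" by simp
      qed
    qed
    have S2: "(LINT t|arc. f k t) = (if k = n then - (2 * r ^ n * cos (real n * \<theta>)) / real n * (1 / cheb_const n) else 0)" for k
    proof -
      have "(LINT t|arc. f k t) = - (2 * r ^ k * cos (real k * \<theta>)) / real k * (LINT t|arc. cos (real k * t) * cos (real n * t))"
        by (subst integral_mult_right_zero[symmetric]) (intro Bochner_Integration.integral_cong refl, simp add: f_def)
      then show ?thesis unfolding arc_integral_cos_cos by auto
    qed
    have S3: "(LINT t|arc. (\<Sum>k. f k t)) = - (2 * r ^ n * cos (real n * \<theta>)) / real n * (1 / cheb_const n)"
      by (rule sums_unique2[OF S1[unfolded S2] sums_single[of n "\<lambda>_. - (2 * r ^ n * cos (real n * \<theta>)) / real n * (1 / cheb_const n)"]])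
    have S4: "(\<Sum>k. f k t) = cos (real n * t) * K r t" for t using fs by (rule sums_unique[symmetric])
    show ?thesis using S3 unfolding S4 by (simp add: cheb_const_def)
  qed
  define \<rho> where "\<rho> k = 1 - 1 / real (Suc (Suc k))" for k
  have \<rho>: "1/2 \<le> \<rho> k" "\<rho> k < 1" for k by (auto simp: \<rho>_def field_simps)
  have \<rho>1: "\<rho> \<longlonglongrightarrow> 1"
  proof -
    have "(\<lambda>k. 1 - inverse (real (Suc (Suc k)))) \<longlonglongrightarrow> 1 - 0"
      by (intro tendsto_intros LIMSEQ_Suc[OF LIMSEQ_inverse_real_of_nat])
    then show ?thesis by (simp add: \<rho>_def[abs_def] inverse_eq_divide)
  qed
  have lim1: "(\<lambda>k. LINT t|arc. cos (real n * t) * K (\<rho> k) t) \<longlonglongrightarrow> (LINT t|arc. cos (real n * t) * K 1 t)"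
  proof (rule integral_dominated_convergence[where w = D])
    show "AE t in arc. (\<lambda>k. cos (real n * t) * K (\<rho> k) t) \<longlonglongrightarrow> cos (real n * t) * K 1 t"
      using AE_arc_neq[of \<theta>] AE_space[of arc]
    proof eventually_elim
      fix t assume t: "t \<noteq> \<theta>" "t \<in> space arc"
      have "sin ((\<theta> + t) / 2) > 0" using t \<theta> by (intro sin_gt_zero) auto
      then have "poisson_den 1 (\<theta> + t) \<noteq> 0" by (simp add: poisson_den_eq)
      moreover have "sin ((\<theta> - t) / 2) \<noteq> 0"
      proof
        assume "sin ((\<theta> - t) / 2) = 0"
        moreover have "\<bar>(\<theta> - t) / 2\<bar> < pi" using t \<theta> by (auto simp: abs_less_iff)
        ultimately have "(\<theta> - t) / 2 = 0" using sin_eq_0_pi[of "(\<theta> - t) / 2"] by (auto simp: abs_less_iff)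
        then show False using t by simp
      qed
      then have "poisson_den 1 (\<theta> - t) \<noteq> 0" by (simp add: poisson_den_eq)
      moreover have "(\<lambda>k. poisson_den (\<rho> k) s) \<longlonglongrightarrow> poisson_den 1 s" for s
        unfolding poisson_den_def by (intro tendsto_intros \<rho>1)
      ultimately show "(\<lambda>k. cos (real n * t) * K (\<rho> k) t) \<longlonglongrightarrow> cos (real n * t) * K 1 t"
        unfolding K_def by (intro tendsto_intros) auto
    qed
    show "AE t in arc. norm (cos (real n * t) * K (\<rho> k) t) \<le> D t" for k
      using AE_arc_neq[of \<theta>] AE_space[of arc]
    proof eventually_elim
      fix t assume t: "t \<noteq> \<theta>" "t \<in> space arc"
      have "norm (cos (real n * t) * K (\<rho> k) t) \<le> 1 * \<bar>K (\<rho> k) t\<bar>"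
        by (simp add: abs_mult mult_left_le_one_le)
      also have "\<dots> \<le> D t" using bound[of "\<rho> k" t] \<rho>[of k] t by simp
      finally show "norm (cos (real n * t) * K (\<rho> k) t) \<le> D t" .
    qed
  qed (use Di Km cosm in auto)
  have lim2: "(\<lambda>k. LINT t|arc. cos (real n * t) * K (\<rho> k) t) \<longlonglongrightarrow> - (pi / real n) * 1 ^ n * cos (real n * \<theta>)"
  proof -
    have "0 < \<rho> k" for k using \<rho>(1)[of k] by simp
    then show ?thesis by (simp only: ser[OF _ \<rho>(2)]) (intro tendsto_intros \<rho>1)
  qed
  have "(LINT t|arc. cos (real n * t) * K 1 t) = - (pi / real n) * cos (real n * \<theta>)"
    using LIMSEQ_unique[OF lim1 lim2] by simp
  moreover have "(LINT t|arc. cos (real n * t) * K 1 t) = (LINT t|arc. ln 2 * cos (real n * t) + cos (real n * t) * ln \<bar>cos \<theta> - cos t\<bar>)"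
  proof (rule integral_cong_AE)
    show "AE t in arc. cos (real n * t) * K 1 t = ln 2 * cos (real n * t) + cos (real n * t) * ln \<bar>cos \<theta> - cos t\<bar>"
      using AE_arc_neq[of \<theta>] AE_space[of arc] by eventually_elim (simp add: K1 algebra_simps)
  qed (use Km cosm lnm in auto)
  moreover have "\<dots> = ln 2 * (LINT t|arc. cos (real n * t)) + (LINT t|arc. cos (real n * t) * ln \<bar>cos \<theta> - cos t\<bar>)"
  proof (subst integral_add)
    show "integrable arc (\<lambda>t. ln 2 * cos (real n * t))" by (intro integrable_arc_continuous continuous_intros)
    show "integrable arc (\<lambda>t. cos (real n * t) * ln \<bar>cos \<theta> - cos t\<bar>)"
      by (rule integrable_bound[OF li])
         (use cosm lnm in \<open>auto simp: abs_mult intro!: mult_left_le_one_le\<close>)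
  qed simp
  moreover have "(LINT t|arc. cos (real n * t)) = (if n = 0 then pi else 0)"
    using arc_integral_cos[of "int n"] by simp
  ultimately show ?A
    by (auto split: if_splits simp: eq_neg_iff_add_eq_0 algebra_simps)
qed

section \<open>The logarithm as a damped Fourier integral of \<open>1 / |\<xi>|\<close>\<close>

lemma norm_cis_minus_1_le: "cmod (cis u - 1) \<le> \<bar>u\<bar>"
proof -
  have "(cmod (cis u - 1))^2 = (cos u - 1)^2 + (sin u)^2" by (simp add: cmod_power2)
  also have "\<dots> = (cos u)^2 + (sin u)^2 + 1 - 2 * cos u" by (simp add: power2_diff)
  also have "\<dots> = 2 - 2 * cos (2 * (u / 2))" by simp
  also have "\<dots> = (2 * sin (u / 2))^2" unfolding cos_double_sin by (simp add: power_mult_distrib)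
  finally have "cmod (cis u - 1) = \<bar>2 * sin (u / 2)\<bar>"
    by (metis norm_ge_zero real_sqrt_abs real_sqrt_unique)
  then show ?thesis using abs_sin_x_le_abs_x[of "u / 2"] by simp
qed

lemma complex_of_real_indicator: "cpx (indicator A s) = indicator A s"
  by (simp add: indicator_def)

text \<open>Writes the quotient as a superposition of bounded exponentials over
  \<open>[0, a]\<close>, so that Fubini applies and the inner integral becomes the conjugate Poisson
  kernel. At \<open>\<xi> = 0\<close> both sides are 0, by \<open>sgn 0 = 0\<close> and by division
  by zero.\<close>

lemma integral_cis_difference:
  assumes "a \<ge> 0"
  shows "(LINT s|lborel. \<i> * cpx (sgn \<xi>) * cis (s * \<xi>) * indicator {0..a} s) = (cis (\<xi> * a) - 1) / cpx \<bar>\<xi>\<bar>"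
proof (cases "\<xi> = 0")
  case False
  have "((\<lambda>s. cis (s * \<xi>) / cpx \<bar>\<xi>\<bar>) has_vector_derivative \<i> * cpx (sgn \<xi>) * cis (s * \<xi>)) (at s)" for s
  proof -
    have "((\<lambda>s. cis (s * \<xi>) / cpx \<bar>\<xi>\<bar>) has_vector_derivative \<i> * cpx \<xi> * cis (s * \<xi>) / cpx \<bar>\<xi>\<bar>) (at s)"
      by (intro has_vector_derivative_divide has_vector_derivative_cis)
    also have "\<i> * cpx \<xi> * cis (s * \<xi>) / cpx \<bar>\<xi>\<bar> = \<i> * cpx (sgn \<xi>) * cis (s * \<xi>)"
      using False by (auto simp: sgn_if)
    finally show ?thesis .
  qed
  then have "(LINT s|lborel. indicator {0..a} s *\<^sub>R (\<i> * cpx (sgn \<xi>) * cis (s * \<xi>))) = cis (a * \<xi>) / cpx \<bar>\<xi>\<bar> - cis (0 * \<xi>) / cpx \<bar>\<xi>\<bar>"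
    using assms by (intro integral_FTC_Icc has_vector_derivative_at_within[of "\<lambda>s. cis (s * \<xi>) / cpx \<bar>\<xi>\<bar>" _ _ "{0..a}"] continuous_intros) auto
  then show ?thesis by (simp add: diff_divide_distrib mult.commute scaleR_conv_of_real complex_of_real_indicator)
qed simp

lemma integral_log_quotient:
  fixes a \<epsilon> :: real
  assumes "a \<ge> 0" "\<epsilon> > 0"
  shows "(LINT s|lborel. indicator {0..a} s * (- 2 * s / (\<epsilon>^2 + s^2))) = ln (\<epsilon>^2) - ln (\<epsilon>^2 + a^2)"
proof -
  have pos: "\<epsilon>^2 + s^2 > 0" for s :: real using assms by (simp add: add_pos_nonneg)
  have "(LINT s|lborel. indicator {0..a} s *\<^sub>R (- 2 * s / (\<epsilon>^2 + s^2))) = - ln (\<epsilon>^2 + a^2) - - ln (\<epsilon>^2 + 0^2)"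
  proof (rule integral_FTC_Icc[OF assms(1)])
    fix s :: real
    have "((\<lambda>s. - ln (\<epsilon>^2 + s^2)) has_real_derivative - 2 * s / (\<epsilon>^2 + s^2)) (at s)"
      using pos[of s] by (auto intro!: derivative_eq_intros)
    then show "((\<lambda>s. - ln (\<epsilon>^2 + s^2)) has_vector_derivative - 2 * s / (\<epsilon>^2 + s^2)) (at s within {0..a})"
      unfolding has_real_derivative_iff_has_vector_derivative by (rule has_vector_derivative_at_within)
    have "\<epsilon>^2 + s^2 \<noteq> 0" for s :: real using pos[of s] by (rule less_imp_neq[THEN not_sym])
    then show "continuous_on {0..a} (\<lambda>s. - 2 * s / (\<epsilon>^2 + s^2))"
      by (intro continuous_intros) auto
  qed
  then show ?thesis by simp
qed

lemma fourier_log_regularized_nonneg: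
  assumes \<epsilon>: "\<epsilon> > 0" and a: "a \<ge> 0"
  shows "(LINT \<xi>|lborel. cpx (damp \<epsilon> \<xi>) * ((cis (\<xi> * a) - 1) / cpx \<bar>\<xi>\<bar>))
      = cpx (ln (\<epsilon>^2) - ln (\<epsilon>^2 + a^2))"
proof -
  have e: "integrable lborel (\<lambda>\<xi>::real. cpx (damp \<epsilon> \<xi>))"
    using integrable_exp_abs[OF \<epsilon>] by (rule integrable_of_real)
  have "integrable lborel (\<lambda>s::real. indicator {0..a} s *\<^sub>R (1::complex))"
    by (rule borel_integrable_compact) auto
  then have b: "integrable lborel (\<lambda>s::real. indicator {0..a} s :: complex)"
    by (rule back_subst[of "integrable lborel"]) (auto simp: fun_eq_iff indicator_def)
  have "(LINT \<xi>|lborel. cpx (damp \<epsilon> \<xi>) * ((cis (\<xi> * a) - 1) / cpx \<bar>\<xi>\<bar>))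
      = (LINT \<xi>|lborel. cpx (damp \<epsilon> \<xi>) * (LINT s|lborel. \<i> * cpx (sgn \<xi>) * cis (s * \<xi>) * indicator {0..a} s))"
    by (simp only: integral_cis_difference[OF a])
  also have "\<dots> = (LINT s|lborel. indicator {0..a} s * (LINT \<xi>|lborel. \<i> * cpx (sgn \<xi>) * cis (s * \<xi>) * cpx (damp \<epsilon> \<xi>)))"
    by (rule Fubini_kernel(1)[OF sigma_finite_lborel sigma_finite_lborel e b, where B = 1])
       (measurable, simp add: norm_mult sgn_if)
  also have "\<dots> = (LINT s|lborel. cpx (indicator {0..a} s * (- 2 * s / (\<epsilon>^2 + s^2))))"
  proof (intro int_cong)
    fix s :: real
    have "(LINT \<xi>|lborel. \<i> * cpx (sgn \<xi>) * cis (s * \<xi>) * cpx (damp \<epsilon> \<xi>))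
        = \<i> * (LINT \<xi>|lborel. cpx (sgn \<xi>) * cis (\<xi> * s) * cpx (damp \<epsilon> \<xi>))"
      by (subst integral_mult_right_zero[symmetric]) (simp add: mult_ac)
    also have "\<dots> = \<i> * (\<i> * cpx (2 * s / (\<epsilon>^2 + s^2)))"
      by (simp only: has_bochner_integral_integral_eq[OF has_bochner_integral_two_sided(2)[OF \<epsilon>]])
    also have "\<dots> = cpx (- 2 * s / (\<epsilon>^2 + s^2))" by (simp flip: mult.assoc)
    finally show "indicator {0..a} s * (LINT \<xi>|lborel. \<i> * cpx (sgn \<xi>) * cis (s * \<xi>) * cpx (damp \<epsilon> \<xi>))
        = cpx (indicator {0..a} s * (- 2 * s / (\<epsilon>^2 + s^2)))"
      by (simp split: split_indicator)
  qed
  also have "\<dots> = cpx (ln (\<epsilon>^2) - ln (\<epsilon>^2 + a^2))"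
    unfolding integral_complex_of_real integral_log_quotient[OF a \<epsilon>] ..
  finally show ?thesis .
qed

text \<open>A regularised form of the rule that \<open>1 / |\<xi>|\<close> corresponds to
  \<open>-2 ln |a|\<close> up to a constant. Subtracting 1 from the exponential removes the
  divergence at 0, the factor \<open>damp\<close> the one at infinity, and the divergent constant
  appears as \<open>ln (\<epsilon>^2)\<close>.\<close>

lemma fourier_log_regularized:
  assumes \<epsilon>: "\<epsilon> > 0"
  shows "(LINT \<xi>|lborel. cpx (damp \<epsilon> \<xi>) * ((cis (\<xi> * a) - 1) / cpx \<bar>\<xi>\<bar>))
      = cpx (ln (\<epsilon>^2) - ln (\<epsilon>^2 + a^2))"
proof (cases "a \<ge> 0")
  case False
  have "(LINT \<xi>|lborel. cpx (damp \<epsilon> \<xi>) * ((cis (\<xi> * a) - 1) / cpx \<bar>\<xi>\<bar>))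
      = \<bar>-1\<bar> *\<^sub>R (LINT \<xi>|lborel. cpx (damp \<epsilon> (0 + (-1) * \<xi>)) * ((cis ((0 + (-1) * \<xi>) * a) - 1) / cpx \<bar>0 + (-1) * \<xi>\<bar>))"
    by (rule lborel_integral_real_affine) simp
  then show ?thesis using fourier_log_regularized_nonneg[OF \<epsilon>, of "- a"] False by simp
qed (rule fourier_log_regularized_nonneg[OF \<epsilon>])

text \<open>Superposition of the shifts \<open>a = x - Z t\<close> with density \<open>f\<close>.
  The position \<open>Z\<close> is left general because it is used with \<open>cos t\<close> and,
  for the extension of \<open>T_0\<close>, with \<open>2 cos t\<close>.\<close>

theorem fourier_log_potential_regularized:
  fixes f :: "real \<Rightarrow> complex"
  assumes f: "integrable arc f" and Z: "Z \<in> borel_measurable borel" "\<And>t. \<bar>Z t\<bar> \<le> B" and \<epsilon>: "\<epsilon> > 0"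
  shows "(LINT \<xi>|lborel. cpx (damp \<epsilon> \<xi>) *
            ((cis (x * \<xi>) * (LINT t|arc. cis (- Z t * \<xi>) * f t) - (LINT t|arc. f t)) / cpx \<bar>\<xi>\<bar>))
      = (LINT t|arc. f t * cpx (ln (\<epsilon>^2) - ln (\<epsilon>^2 + (x - Z t)^2)))" (is ?A)
    and "integrable lborel (\<lambda>\<xi>. cpx (damp \<epsilon> \<xi>) *
            ((cis (x * \<xi>) * (LINT t|arc. cis (- Z t * \<xi>) * f t) - (LINT t|arc. f t)) / cpx \<bar>\<xi>\<bar>))" (is ?B)
proof -
  interpret arc: finite_measure arc by (rule finite_measure_arc)
  note [measurable] = borel_measurable_integrable[OF f] measurable_arc[OF Z(1)]
  have e: "integrable lborel (\<lambda>\<xi>::real. cpx (damp \<epsilon> \<xi>))"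
    using integrable_exp_abs[OF \<epsilon>] by (rule integrable_of_real)
  define k where "k \<xi> t = (cis (\<xi> * (x - Z t)) - 1) / cpx \<bar>\<xi>\<bar>" for \<xi> t
  have km: "(\<lambda>(\<xi>, t). k \<xi> t) \<in> borel_measurable (lborel \<Otimes>\<^sub>M arc)" unfolding k_def by measurable
  have kB: "cmod (k \<xi> t) \<le> \<bar>x\<bar> + B" for \<xi> t
  proof (cases "\<xi> = 0")
    case True
    then show ?thesis using order_trans[OF abs_ge_zero Z(2)[of t]] by (simp add: k_def)
  next
    case False
    have "cmod (k \<xi> t) = cmod (cis (\<xi> * (x - Z t)) - 1) / \<bar>\<xi>\<bar>" by (simp add: k_def norm_divide)
    also have "\<dots> \<le> \<bar>\<xi> * (x - Z t)\<bar> / \<bar>\<xi>\<bar>" by (intro divide_right_mono norm_cis_minus_1_le) simp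
    also have "\<dots> = \<bar>x - Z t\<bar>" using False by (simp add: abs_mult)
    also have "\<dots> \<le> \<bar>x\<bar> + B" using Z(2)[of t] by linarith
    finally show ?thesis .
  qed
  have inner: "(LINT t|arc. k \<xi> t * f t) = (cis (x * \<xi>) * (LINT t|arc. cis (- Z t * \<xi>) * f t) - (LINT t|arc. f t)) / cpx \<bar>\<xi>\<bar>" for \<xi>
  proof -
    have i: "integrable arc (\<lambda>t. cis (- Z t * \<xi>) * f t)"
      by (rule integrable_bound[OF f]) (auto simp: norm_mult)
    have "(LINT t|arc. k \<xi> t * f t) = (LINT t|arc. (cis (x * \<xi>) * (cis (- Z t * \<xi>) * f t) - f t) / cpx \<bar>\<xi>\<bar>)"
    proof (intro int_cong)
      fix t
      have "cis (\<xi> * (x - Z t)) = cis (x * \<xi>) * cis (- Z t * \<xi>)" by (simp add: cis_mult algebra_simps)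
      then show "k \<xi> t * f t = (cis (x * \<xi>) * (cis (- Z t * \<xi>) * f t) - f t) / cpx \<bar>\<xi>\<bar>"
        by (simp add: k_def left_diff_distrib mult.assoc)
    qed
    also have "\<dots> = ((LINT t|arc. cis (x * \<xi>) * (cis (- Z t * \<xi>) * f t)) - (LINT t|arc. f t)) / cpx \<bar>\<xi>\<bar>"
      by (subst integral_divide_zero, subst integral_diff[OF integrable_mult_right[OF i] f]) simp
    finally show ?thesis by (simp only: integral_mult_right_zero)
  qed
  have outer: "(LINT \<xi>|lborel. k \<xi> t * cpx (damp \<epsilon> \<xi>)) = cpx (ln (\<epsilon>^2) - ln (\<epsilon>^2 + (x - Z t)^2))" for t
    using fourier_log_regularized[OF \<epsilon>, of "x - Z t"] by (simp add: k_def mult.commute)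
  note F = Fubini_kernel[OF sigma_finite_lborel arc.sigma_finite_measure_axioms e f km kB]
  show ?A
    using F(1) unfolding inner outer .
  show ?B
    using F(2) unfolding inner .
qed

definition log_moment :: "nat \<Rightarrow> real \<Rightarrow> real \<Rightarrow> real" where
  "log_moment n \<epsilon> x = (LINT t|arc. cos (real n * t) * ln (\<epsilon>^2 + (x - cos t)^2))"

lemma log_moment_integrable:
  fixes x \<epsilon> :: real
  assumes "\<epsilon> > 0"
  shows "integrable arc (\<lambda>t. cos (real n * t) * ln (\<epsilon>^2 + (x - cos t)^2))"
proof (intro integrable_arc_continuous continuous_intros ballI)
  fix t
  have "\<epsilon>^2 + (x - cos t)^2 > 0" using assms by (simp add: add_pos_nonneg)
  then show "\<epsilon>^2 + (x - cos t)^2 \<noteq> 0" by (rule less_imp_neq[THEN not_sym])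
qed

text \<open>In the limit the smoothed kernel becomes \<open>2 ln |x - cos t|\<close>, so the values
  are twice those of \<open>log_kernel\<close>.\<close>

lemma log_moment_limit:
  assumes x: "x \<in> {-1<..<1}" and e0: "e \<longlonglongrightarrow> 0" and e: "\<And>k. 0 < e k" "\<And>k. e k \<le> 1"
  shows "(\<lambda>k. log_moment n (e k) x) \<longlonglongrightarrow> (if n = 0 then - 2 * pi * ln 2 else - (2 * pi / real n) * tpoly n x)"
proof -
  interpret finite_measure arc by (rule finite_measure_arc)
  define \<theta> where "\<theta> = arccos x"
  have c\<theta>: "cos \<theta> = x" using x by (simp add: \<theta>_def cos_arccos)
  have \<theta>: "\<theta> \<in> {0<..<pi}" using x arccos_lt_bounded[of x] by (simp add: \<theta>_def)
  note lk = log_kernel[OF \<theta>, unfolded c\<theta>]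
  have cosm: "(\<lambda>t. cos (real n * t)) \<in> borel_measurable arc" by (rule measurable_arc) measurable
  have lnm: "(\<lambda>t. ln ((e k)^2 + (x - cos t)^2)) \<in> borel_measurable arc" for k by (rule measurable_arc) measurable
  have "(\<lambda>k. log_moment n (e k) x) \<longlonglongrightarrow> (LINT t|arc. cos (real n * t) * (2 * ln \<bar>x - cos t\<bar>))"
    unfolding log_moment_def
  \<comment> \<open>The constant \<open>ln 5\<close> comes from \<open>\<epsilon>^2 \<le> 1\<close>
    and \<open>|x - cos t| \<le> 2\<close>; from below the smoothed logarithm is bounded by the one
    with \<open>\<epsilon> = 0\<close>.\<close>
  proof (rule integral_dominated_convergence[where w = "\<lambda>t. ln 5 + 2 * \<bar>ln \<bar>x - cos t\<bar>\<bar>"])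
    show "integrable arc (\<lambda>t. ln 5 + 2 * \<bar>ln \<bar>x - cos t\<bar>\<bar>)"
      by (intro integrable_add integrable_const integrable_mult_right integrable_abs lk(1))
    have ne: "x - cos t \<noteq> 0" if "t \<noteq> \<theta>" "t \<in> space arc" for t
      using that \<theta> cos_inj_pi[of \<theta> t] by (auto simp: c\<theta>)
    have sq: "ln ((x - cos t)^2) = 2 * ln \<bar>x - cos t\<bar>" if "x - cos t \<noteq> 0" for t
    proof -
      have "ln (\<bar>x - cos t\<bar>\<^sup>2) = 2 * ln \<bar>x - cos t\<bar>" using that by (subst ln_realpow) auto
      then show ?thesis by simp
    qed
    show "AE t in arc. (\<lambda>k. cos (real n * t) * ln ((e k)^2 + (x - cos t)^2)) \<longlonglongrightarrow> cos (real n * t) * (2 * ln \<bar>x - cos t\<bar>)"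
      using AE_arc_neq[of \<theta>] AE_space[of arc]
    proof eventually_elim
      case (elim t)
      have "(\<lambda>k. cos (real n * t) * ln ((e k)^2 + (x - cos t)^2)) \<longlonglongrightarrow> cos (real n * t) * ln (0^2 + (x - cos t)^2)"
        using ne[OF elim] by (intro tendsto_intros e0) auto
      then show ?case using sq[OF ne[OF elim]] by simp
    qed
    show "AE t in arc. norm (cos (real n * t) * ln ((e k)^2 + (x - cos t)^2)) \<le> ln 5 + 2 * \<bar>ln \<bar>x - cos t\<bar>\<bar>" for k
      using AE_arc_neq[of \<theta>] AE_space[of arc]
    proof eventually_elim
      case (elim t)
      let ?q = "(e k)^2 + (x - cos t)^2"
      have ek: "0 \<le> (e k)^2" "(e k)^2 \<le> 1" using e[of k] by (auto simp: power_le_one less_imp_le)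
      have pos: "(x - cos t)^2 > 0" using ne[OF elim] by simp
      have "-1 < x" "x < 1" using x by auto
      then have "\<bar>x - cos t\<bar> \<le> 2" using cos_le_one[of t] cos_ge_minus_one[of t] by linarith
      then have "\<bar>x - cos t\<bar>\<^sup>2 \<le> 2^2" by (intro power_mono) auto
      then have up: "?q \<le> 5" using ek by simp
      have qpos: "?q > 0" using pos ek by linarith
      have "ln ((x - cos t)^2) \<le> ln ?q" using pos qpos ek by (subst ln_le_cancel_iff) linarith+
      moreover have "ln ?q \<le> ln 5" using up qpos by (subst ln_le_cancel_iff) linarith+
      moreover have "0 \<le> ln (5::real)" by simp
      ultimately have "\<bar>ln ?q\<bar> \<le> ln 5 + 2 * \<bar>ln \<bar>x - cos t\<bar>\<bar>" unfolding sq[OF ne[OF elim]] by linarith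
      moreover have "norm (cos (real n * t) * ln ?q) \<le> \<bar>ln ?q\<bar>" by (simp add: abs_mult mult_left_le_one_le)
      ultimately show ?case by linarith
    qed
    show "(\<lambda>t. cos (real n * t) * (2 * ln \<bar>x - cos t\<bar>)) \<in> borel_measurable arc" by (rule measurable_arc) measurable
    show "(\<lambda>t. cos (real n * t) * ln ((e k)^2 + (x - cos t)^2)) \<in> borel_measurable arc" for k by (rule measurable_arc) measurable
  qed
  moreover have "(LINT t|arc. cos (real n * t) * (2 * ln \<bar>x - cos t\<bar>)) = 2 * (LINT t|arc. cos (real n * t) * ln \<bar>x - cos t\<bar>)"
    by (subst integral_mult_right_zero[symmetric]) (simp add: mult_ac)
  moreover have "tpoly n x = cos (real n * \<theta>)" using tpoly_cos[of n \<theta>] c\<theta> by simp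
  ultimately show ?thesis unfolding lk(2) by (cases "n = 0") (simp_all add: mult.assoc)
qed

lemma integrable_one_plus_abs_powr:
  assumes a: "a > 1"
  shows "integrable lborel (\<lambda>\<xi>::real. (1 + \<bar>\<xi>\<bar>) powr (- a))"
proof -
  let ?h = "\<lambda>x::real. indicator {0..} x * (1 + \<bar>x\<bar>) powr (- a)"
  have "(\<integral>\<^sup>+x. ennreal ((1 + \<bar>x\<bar>) powr (- a)) * indicator {0..} x \<partial>lborel) = ennreal (0 - (- ((1 + 0) powr (1 - a) / (a - 1))))"
  proof (rule nn_integral_FTC_atLeast)
    fix x :: real assume x: "0 \<le> x"
    have "((\<lambda>x. - ((1 + x) powr (1 - a) / (a - 1))) has_real_derivative (1 + x) powr (- a)) (at x)"
    proof -
      have "((\<lambda>x. (1 + x) powr (1 - a)) has_real_derivative (1 - a) * (1 + x) powr (- a)) (at x)"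
        using x by (auto intro!: derivative_eq_intros)
      from DERIV_minus[OF DERIV_cdivide[OF this, of "a - 1"]]
      have "((\<lambda>x. - ((1 + x) powr (1 - a) / (a - 1))) has_real_derivative - ((1 - a) * (1 + x) powr (- a) / (a - 1))) (at x)" .
      moreover have "- ((1 - a) * p / (a - 1)) = p" for p
      proof -
        have e: "(1 - a) * p = - ((a - 1) * p)" by (simp add: algebra_simps)
        have "a - 1 \<noteq> 0" using a by simp
        then show ?thesis unfolding e by simp
      qed
      ultimately show ?thesis by simp
    qed
    then show "((\<lambda>x. - ((1 + x) powr (1 - a) / (a - 1))) has_real_derivative (1 + \<bar>x\<bar>) powr (- a)) (at x)"
      using x by simp
  next
    have "filterlim (\<lambda>x::real. 1 + x) at_top at_top"
      by (rule filterlim_tendsto_add_at_top[OF tendsto_const filterlim_ident])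
    then have "((\<lambda>x. (1 + x) powr (1 - a)) \<longlongrightarrow> 0) at_top"
      using a by (intro tendsto_neg_powr) auto
    then have "((\<lambda>x. - ((1 + x) powr (1 - a) / (a - 1))) \<longlongrightarrow> - (0 / (a - 1))) at_top"
      using a by (intro tendsto_intros) auto
    then show "((\<lambda>x. - ((1 + x) powr (1 - a) / (a - 1))) \<longlongrightarrow> 0) at_top" by simp
  qed auto
  then have fin: "(\<integral>\<^sup>+x. ennreal ((1 + \<bar>x\<bar>) powr (- a)) * indicator {0..} x \<partial>lborel) < \<infinity>" by simp
  have h: "integrable lborel ?h"
  proof (rule integrableI_bounded)
    have "(\<integral>\<^sup>+x. ennreal (norm (?h x)) \<partial>lborel) = (\<integral>\<^sup>+x. ennreal ((1 + \<bar>x\<bar>) powr (- a)) * indicator {0..} x \<partial>lborel)"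
      by (intro nn_integral_cong) (auto split: split_indicator)
    then show "(\<integral>\<^sup>+x. ennreal (norm (?h x)) \<partial>lborel) < \<infinity>" using fin by simp
  qed measurable
  have h': "integrable lborel (\<lambda>x. ?h (0 + (-1) * x))" by (rule lborel_integrable_real_affine[OF h]) simp
  show ?thesis
  proof (rule integrable_bound[OF integrable_add[OF h h']])
    show "AE x in lborel. norm ((1 + \<bar>x\<bar>) powr (- a)) \<le> norm (?h x + ?h (0 + (-1) * x))"
      by (intro AE_I2) (auto split: split_indicator)
  qed measurable
qed

section \<open>Fourier transforms of weighted Chebyshev polynomials\<close>

text \<open>In classical terms \<open>cheb_ft n\<close> is \<open>pi (-i)^n J_n\<close> with the
  Bessel function \<open>J_n\<close>; it is the transform of \<open>T_n / \<omega>\<close> in the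
  variable \<open>x = cos t\<close>.\<close>

definition cheb_ft :: "nat \<Rightarrow> real \<Rightarrow> complex" where
  "cheb_ft n \<xi> = (LINT t|arc. cis (- cos t * \<xi>) * cpx (cos (real n * t)))"

lemma integrable_arc_cos: "integrable arc (\<lambda>t. cpx (cos (real n * t)))"
  by (intro integrable_arc_continuous continuous_intros)

lemma continuous_cheb_ft: "continuous_on UNIV (cheb_ft n)"
  unfolding cheb_ft_def
  by (rule continuous_oscillatory_integral[OF integrable_arc_cos]) (rule measurable_arc, measurable)

lemma cheb_ft_measurable [measurable]: "cheb_ft n \<in> borel_measurable borel"
  by (rule borel_measurable_continuous_onI[OF continuous_cheb_ft])

lemma norm_arc_integral_le:
  assumes "f \<in> borel_measurable arc" "\<And>t. cmod (f t) \<le> B"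
  shows "cmod (LINT t|arc. f t) \<le> pi * B"
proof -
  interpret finite_measure arc by (rule finite_measure_arc)
  have "integrable arc f" using assms by (intro integrable_const_bound[where B = B]) auto
  then have "cmod (LINT t|arc. f t) \<le> (LINT t|arc. B)"
    by (rule norm_integral_le_AE) (use assms in auto)
  then show ?thesis by (simp add: measure_arc)
qed

lemma norm_cheb_ft_le: "cmod (cheb_ft n \<xi>) \<le> pi"
  unfolding cheb_ft_def
  by (rule order_trans[OF norm_arc_integral_le[where B = 1]])
     (rule measurable_arc, measurable, simp_all add: norm_mult)

lemma cnj_cheb_ft: "cnj (cheb_ft n \<xi>) = cheb_ft n (- \<xi>)"
proof -
  have "cnj (cheb_ft n \<xi>) = (LINT t|arc. cnj (cis (- cos t * \<xi>) * cpx (cos (real n * t))))"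
    unfolding cheb_ft_def by (rule Bochner_Integration.integral_cnj[symmetric])
  then show ?thesis by (simp add: cheb_ft_def cis_cnj)
qed

lemma has_vector_derivative_cis_cos:
  "((\<lambda>t. cis (- cos t * \<xi>)) has_vector_derivative \<i> * cpx (\<xi> * sin t) * cis (- cos t * \<xi>)) (at t)"
proof -
  have "((\<lambda>t. - cos t) has_vector_derivative sin t) (at t)"
    unfolding has_real_derivative_iff_has_vector_derivative[symmetric] by (auto intro!: derivative_eq_intros)
  from vector_diff_chain_at[OF this has_vector_derivative_cis[of \<xi>]]
  show ?thesis by (simp add: o_def scaleR_conv_of_real mult_ac)
qed

text \<open>Two integrations by parts at once; the boundary terms vanish because \<open>sin\<close> does.\<close>

lemma norm_cheb_ft_le_square:
  assumes n: "n > 0"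
  shows "cmod (cheb_ft n \<xi>) \<le> pi * (\<bar>\<xi>\<bar> * (1 + \<bar>\<xi>\<bar>)) / (real n)^2"
proof -
  let ?e = "\<lambda>t. cis (- cos t * \<xi>)"
  let ?c = "\<lambda>t. cpx (cos (real n * t))" and ?s = "\<lambda>t. cpx (sin (real n * t))"
  let ?q = "\<lambda>t. \<i> * cpx \<xi> / (cpx (real n))^2 * (?e t * ?c t * (\<i> * cpx (\<xi> * (sin t)^2) + cpx (cos t)))"
  let ?G = "\<lambda>t. cpx (sin (real n * t) / real n) + \<i> * cpx (\<xi> / (real n)^2 * (sin t * cos (real n * t)))"
  have d: "((\<lambda>t. ?e t * ?G t) has_vector_derivative ?e t * ?c t + ?q t) (at t)" for t
  proof -
    have d1: "((\<lambda>t. cpx (sin (real n * t) / real n)) has_vector_derivative ?c t) (at t)"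
      by (rule has_vector_derivative_of_real) (use n in \<open>auto intro!: derivative_eq_intros\<close>)
    have d2: "((\<lambda>t. cpx (\<xi> / (real n)^2 * (sin t * cos (real n * t)))) has_vector_derivative
        cpx (\<xi> / (real n)^2 * (cos t * cos (real n * t) - real n * (sin t * sin (real n * t))))) (at t)"
      by (rule has_vector_derivative_of_real, rule DERIV_cmult) (auto intro!: derivative_eq_intros simp: algebra_simps)
    have "((\<lambda>t. ?e t * ?G t) has_vector_derivative
        ?e t * (?c t + \<i> * cpx (\<xi> / (real n)^2 * (cos t * cos (real n * t) - real n * (sin t * sin (real n * t)))))
        + (\<i> * cpx (\<xi> * sin t) * ?e t) * ?G t) (at t)"
      by (intro has_vector_derivative_mult has_vector_derivative_cis_cos has_vector_derivative_add d1
          has_vector_derivative_mult_right[OF d2])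
    also have "?e t * (?c t + \<i> * cpx (\<xi> / (real n)^2 * (cos t * cos (real n * t) - real n * (sin t * sin (real n * t)))))
        + (\<i> * cpx (\<xi> * sin t) * ?e t) * ?G t = ?e t * ?c t + ?q t"
      using n by (simp add: field_simps power2_eq_square)
    finally show ?thesis .
  qed
  have c: "continuous_on {0..pi} (\<lambda>t. ?e t * ?c t + ?q t)" by (intro continuous_intros)
  have "(LINT t|arc. ?e t * ?c t + ?q t) = ?e pi * ?G pi - ?e 0 * ?G 0"
    by (rule arc_integral_FTC[OF d c])
  also have "\<dots> = 0" using sin_npi[of n] by simp
  finally have sum0: "(LINT t|arc. ?e t * ?c t + ?q t) = 0" .
  have i1: "integrable arc (\<lambda>t. ?e t * ?c t)" and i2: "integrable arc ?q"
    by (intro integrable_arc_continuous continuous_intros)+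
  have "cheb_ft n \<xi> = - (LINT t|arc. ?q t)"
    using sum0 unfolding integral_add[OF i1 i2] by (simp add: cheb_ft_def eq_neg_iff_add_eq_0)
  then have "cmod (cheb_ft n \<xi>) = cmod (LINT t|arc. ?q t)" by simp
  also have "\<dots> \<le> pi * (\<bar>\<xi>\<bar> / (real n)^2 * (1 + \<bar>\<xi>\<bar>))"
  proof (rule norm_arc_integral_le[OF borel_measurable_integrable[OF i2]])
    fix t
    have "cmod (\<i> * cpx (\<xi> * (sin t)^2) + cpx (cos t)) \<le> \<bar>\<xi> * (sin t)\<^sup>2\<bar> + \<bar>cos t\<bar>"
      by (rule order_trans[OF norm_triangle_ineq]) (simp add: norm_mult norm_power abs_mult)
    also have "\<dots> \<le> \<bar>\<xi>\<bar> + 1"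
      by (intro add_mono) (auto simp: abs_mult abs_square_le_1 intro!: mult_left_le)
    finally have b: "cmod (\<i> * cpx (\<xi> * (sin t)^2) + cpx (cos t)) \<le> 1 + \<bar>\<xi>\<bar>" by simp
    have "cmod (?q t) = \<bar>\<xi>\<bar> / (real n)^2 * (\<bar>cos (real n * t)\<bar> * cmod (\<i> * cpx (\<xi> * (sin t)^2) + cpx (cos t)))"
      by (simp add: norm_mult norm_divide norm_power)
    also have "\<dots> \<le> \<bar>\<xi>\<bar> / (real n)^2 * (1 * (1 + \<bar>\<xi>\<bar>))"
      using b by (intro mult_left_mono mult_mono) auto
    finally show "cmod (?q t) \<le> \<bar>\<xi>\<bar> / (real n)^2 * (1 + \<bar>\<xi>\<bar>)" by simp
  qed
  finally show ?thesis by simp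
qed

text \<open>The profile bounds \<open>\<delta>^2 / (sin^2 t + \<delta>^2)\<close> near an endpoint
  \<open>c\<close>, by \<open>sin u \<ge> u / 4\<close>. Its integral is of order \<delta>, the
  width of the region in which the phase is nearly stationary.\<close>

lemma arc_integral_cauchy:
  assumes \<delta>: "\<delta> > 0"
  shows "integrable arc (\<lambda>t. \<delta>^2 / (\<delta>^2 + ((t - c) / 4)^2))" and "(LINT t|arc. \<delta>^2 / (\<delta>^2 + ((t - c) / 4)^2)) \<le> 4 * pi * \<delta>"
proof -
  let ?q = "\<lambda>t. \<delta>^2 / (\<delta>^2 + ((t - c) / 4)^2)" and ?k = "1 / (4 * \<delta>)"
  note cd = has_bochner_integral_cauchy_density
  have q: "?q t = 1/2 * (2 / (1 + (- c * ?k + ?k * t)^2))" for t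
  proof -
    have "\<delta>^2 + ((t - c) / 4)^2 = \<delta>^2 * (1 + (- c * ?k + ?k * t)^2)"
      using \<delta> by (simp add: power2_eq_square field_simps)
    then show ?thesis using \<delta> by simp
  qed
  have i: "integrable lborel (\<lambda>t. 2 / (1 + (- c * ?k + ?k * t)^2))"
    using lborel_integrable_real_affine[OF integrable.intros[OF cd], of ?k "- c * ?k"] \<delta> by simp
  have "2 * pi = \<bar>?k\<bar> *\<^sub>R (LINT t|lborel. 2 / (1 + (- c * ?k + ?k * t)^2))"
    using lborel_integral_real_affine[of ?k "\<lambda>s. 2 / (1 + s^2)" "- c * ?k"] has_bochner_integral_integral_eq[OF cd] \<delta> by simp
  then have v: "(LINT t|lborel. 2 / (1 + (- c * ?k + ?k * t)^2)) = 8 * pi * \<delta>" using \<delta> by (simp add: field_simps)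
  have qi: "integrable lborel ?q" unfolding q by (rule integrable_mult_right[OF i])
  have qi': "integrable lborel (\<lambda>t. indicator {0<..<pi} t *\<^sub>R ?q t)" using qi by (intro integrable_mult_indicator) auto
  then show "integrable arc ?q" by (simp add: arc_def integrable_restrict_space)
  have "(LINT t|arc. ?q t) = (LINT t|lborel. indicator {0<..<pi} t *\<^sub>R ?q t)" unfolding arc_def by (subst integral_restrict_space) auto
  also have "\<dots> \<le> (LINT t|lborel. ?q t)" by (rule integral_mono[OF qi' qi]) (auto split: split_indicator)
  also have "\<dots> = 1/2 * (8 * pi * \<delta>)" unfolding q integral_mult_right_zero v ..
  finally show "(LINT t|arc. ?q t) \<le> 4 * pi * \<delta>" by simp
qed

text \<open>Integration by parts with the factor \<open>sin^2 t / (sin^2 t + \<delta>^2)\<close>, which removes the stationary points of the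
  phase \<open>\<xi> cos t\<close>; \<open>\<delta> = (1 + |\<xi>|) powr (-1/3)\<close> balances the two error terms.\<close>

lemma norm_cheb_ft_split:
  assumes \<xi>: "\<xi> \<noteq> 0" and \<delta>: "0 < \<delta>" "\<delta> \<le> 1"
  shows "cmod (cheb_ft n \<xi>) \<le> 8 * pi * \<delta> + pi * ((real n + 3) / \<delta>^2 / \<bar>\<xi>\<bar>)"
proof -
  interpret finite_measure arc by (rule finite_measure_arc)
  define D where "D t = (sin t)^2 + \<delta>^2" for t
  have D: "D t > 0" "(sin t)^2 \<le> D t" "\<delta>^2 \<le> D t" for t using \<delta> by (auto simp: D_def add_nonneg_pos)
  have D0: "D t \<noteq> 0" for t using D(1)[of t] by simp
  define g where "g t = (cos (real n * t) * cos t - real n * sin (real n * t) * sin t) / D t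
    - 2 * (cos (real n * t) * cos t) * ((sin t)^2 / D t) / D t" for t
  let ?e = "\<lambda>t. cis (- cos t * \<xi>)" and ?c = "\<lambda>t. cpx (cos (real n * t))"
  let ?G = "\<lambda>t. cpx (cos (real n * t) * sin t / D t) / (\<i> * cpx \<xi>)"
  let ?r = "\<lambda>t. ?e t * (cpx (g t) / (\<i> * cpx \<xi>))" and ?p = "\<lambda>t. ?e t * ?c t * cpx (\<delta>^2 / D t)"
  have Dd: "(D has_real_derivative 2 * sin t * cos t) (at t)" for t
    unfolding D_def by (auto intro!: derivative_eq_intros)
  have d: "((\<lambda>t. ?e t * ?G t) has_vector_derivative ?e t * ?c t + (?r t - ?p t)) (at t)" for t
  proof -
    have "((\<lambda>t. cos (real n * t) * sin t / D t) has_real_derivative g t) (at t)"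
      using D0[of t] by (auto intro!: derivative_eq_intros Dd simp: g_def field_simps power2_eq_square)
    then have "(?G has_vector_derivative cpx (g t) / (\<i> * cpx \<xi>)) (at t)"
      by (intro has_vector_derivative_divide has_vector_derivative_of_real)
    then have h: "((\<lambda>t. ?e t * ?G t) has_vector_derivative ?r t + (\<i> * cpx (\<xi> * sin t) * ?e t) * ?G t) (at t)"
      by (intro has_vector_derivative_mult has_vector_derivative_cis_cos)
    have "?r t + (\<i> * cpx (\<xi> * sin t) * ?e t) * ?G t = ?e t * ?c t + (?r t - ?p t)"
    proof -
      have "(\<i> * cpx (\<xi> * sin t) * ?e t) * ?G t = ?e t * ?c t * cpx ((sin t)^2 / D t)"
        using \<xi> by (simp add: power2_eq_square)
      also have "(sin t)^2 / D t = 1 - \<delta>^2 / D t" using D0[of t] by (simp add: D_def field_simps)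
      also have "?e t * ?c t * cpx (1 - \<delta>^2 / D t) = ?e t * ?c t - ?p t" by (simp add: right_diff_distrib)
      finally show ?thesis by simp
    qed
    with h show ?thesis by (simp only:)
  qed
  have cD: "continuous_on {0..pi} D" unfolding D_def by (intro continuous_intros)
  have cg: "continuous_on {0..pi} g" unfolding g_def using D0 by (intro continuous_intros cD) auto
  have cr: "continuous_on {0..pi} ?r" using \<xi> by (intro continuous_intros cg) auto
  have cp: "continuous_on {0..pi} ?p" using D0 by (intro continuous_intros cD) auto
  have c1: "continuous_on {0..pi} (\<lambda>t. ?e t * ?c t)" by (intro continuous_intros)
  note i = integrable_arc_continuous[OF c1] integrable_arc_continuous[OF cr] integrable_arc_continuous[OF cp]
  have "(LINT t|arc. ?e t * ?c t + (?r t - ?p t)) = ?e pi * ?G pi - ?e 0 * ?G 0"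
    by (rule arc_integral_FTC[OF d continuous_on_add[OF c1 continuous_on_diff[OF cr cp]]])
  then have "cheb_ft n \<xi> + ((LINT t|arc. ?r t) - (LINT t|arc. ?p t)) = 0"
    using integral_add[OF i(1) integrable_diff[OF i(2,3)]] integral_diff[OF i(2,3)]
    by (simp add: cheb_ft_def)
  then have eq: "cheb_ft n \<xi> = (LINT t|arc. ?p t) - (LINT t|arc. ?r t)" by (simp add: algebra_simps add_eq_0_iff)
  have "cmod (LINT t|arc. ?p t) \<le> (LINT t|arc. \<delta>^2 / (\<delta>^2 + ((t - 0) / 4)^2) + \<delta>^2 / (\<delta>^2 + ((t - pi) / 4)^2))"
  proof (rule norm_integral_le_AE[OF i(3)])
    show "integrable arc (\<lambda>t. \<delta>^2 / (\<delta>^2 + ((t - 0) / 4)^2) + \<delta>^2 / (\<delta>^2 + ((t - pi) / 4)^2))"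
      by (intro integrable_add arc_integral_cauchy \<delta>)
    show "AE t in arc. norm (?p t) \<le> \<delta>^2 / (\<delta>^2 + ((t - 0) / 4)^2) + \<delta>^2 / (\<delta>^2 + ((t - pi) / 4)^2)"
      using AE_space[of arc]
    proof eventually_elim
      case (elim t)
      have b: "\<delta>^2 / D t \<le> \<delta>^2 / (\<delta>^2 + s^2)" if "0 \<le> s" "s \<le> sin t" for s
      proof -
        have "s^2 \<le> (sin t)^2" using that by (intro power_mono)
        then show ?thesis using \<delta> by (intro divide_left_mono mult_pos_pos) (auto simp: D_def add_pos_nonneg add_nonneg_pos)
      qed
      have pos: "0 \<le> \<delta>^2 / (\<delta>^2 + x^2)" for x by simp
      have "\<delta>^2 / D t \<le> \<delta>^2 / (\<delta>^2 + ((t - 0) / 4)^2) + \<delta>^2 / (\<delta>^2 + ((t - pi) / 4)^2)"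
      proof (cases "t \<le> pi / 2")
        case True
        then have "\<delta>^2 / D t \<le> \<delta>^2 / (\<delta>^2 + ((t - 0) / 4)^2)" using b[of "(t - 0) / 4"] sin_ge_quarter[of t] elim by simp
        then show ?thesis using pos[of "(t - pi) / 4"] by linarith
      next
        case False
        then have "\<delta>^2 / D t \<le> \<delta>^2 / (\<delta>^2 + ((pi - t) / 4)^2)" using b[of "(pi - t) / 4"] sin_ge_quarter[of "pi - t"] elim by simp
        also have "((pi - t) / 4)^2 = ((t - pi) / 4)^2" by (simp add: power_divide power2_commute)
        finally show ?thesis using pos[of "(t - 0) / 4"] by linarith
      qed
      moreover have "norm (?p t) \<le> 1 * (\<delta>^2 / D t)"
        unfolding norm_mult norm_cis norm_of_real using D(1)[of t] by (intro mult_mono) auto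
      ultimately show ?case by simp
    qed
  qed
  also have "\<dots> \<le> 4 * pi * \<delta> + 4 * pi * \<delta>"
    unfolding integral_add[OF arc_integral_cauchy(1)[OF \<delta>(1)] arc_integral_cauchy(1)[OF \<delta>(1)]]
    by (intro add_mono arc_integral_cauchy \<delta>)
  finally have P: "cmod (LINT t|arc. ?p t) \<le> 8 * pi * \<delta>" by simp
  have R: "cmod (LINT t|arc. ?r t) \<le> pi * ((real n + 3) / \<delta>^2 / \<bar>\<xi>\<bar>)"
  proof (rule norm_arc_integral_le[OF borel_measurable_integrable[OF i(2)]])
    fix t
    have cc: "\<bar>cos (real n * t) * cos t\<bar> \<le> 1" "\<bar>sin (real n * t) * sin t\<bar> \<le> 1" unfolding abs_mult by (intro mult_le_one; simp)+
    have "\<bar>cos (real n * t) * cos t - real n * sin (real n * t) * sin t\<bar> \<le> \<bar>cos (real n * t) * cos t\<bar> + real n * \<bar>sin (real n * t) * sin t\<bar>"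
      by (rule order_trans[OF abs_triangle_ineq4]) (simp add: abs_mult)
    also have "\<dots> \<le> 1 + real n * 1" by (intro add_mono mult_left_mono cc) simp
    finally have 1: "\<bar>(cos (real n * t) * cos t - real n * sin (real n * t) * sin t) / D t\<bar> \<le> (real n + 1) / \<delta>^2"
      unfolding abs_divide using D[of t] \<delta> by (intro frac_le) auto
    have s: "0 \<le> (sin t)^2 / D t" "(sin t)^2 / D t \<le> 1" using D[of t] by (auto simp: divide_le_eq)
    have "\<bar>2 * (cos (real n * t) * cos t) * ((sin t)^2 / D t)\<bar> \<le> 2 * 1 * 1"
      unfolding abs_mult[of _ "(sin t)^2 / D t"] abs_mult[of 2] using cc s by (intro mult_mono) auto
    then have 2: "\<bar>2 * (cos (real n * t) * cos t) * ((sin t)^2 / D t) / D t\<bar> \<le> 2 / \<delta>^2"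
      unfolding abs_divide[of _ "D t"] using D[of t] \<delta> by (intro frac_le) auto
    have "\<bar>g t\<bar> \<le> (real n + 1) / \<delta>^2 + 2 / \<delta>^2" unfolding g_def by (rule order_trans[OF abs_triangle_ineq4 add_mono[OF 1 2]])
    also have "\<dots> = (real n + 3) / \<delta>^2" by (simp flip: add_divide_distrib)
    finally have "\<bar>g t\<bar> / \<bar>\<xi>\<bar> \<le> (real n + 3) / \<delta>^2 / \<bar>\<xi>\<bar>" by (rule divide_right_mono) simp
    then show "cmod (?r t) \<le> (real n + 3) / \<delta>^2 / \<bar>\<xi>\<bar>" by (simp add: norm_mult norm_divide)
  qed
  show ?thesis unfolding eq by (rule order_trans[OF norm_triangle_ineq4 add_mono[OF P R]])
qed

text \<open>Sum of the two terms of \<open>norm_cheb_ft_split\<close> for the balancing \<delta>,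
  namely \<open>8 pi + 2 pi (n + 3)\<close>; the last factor 2 compares \<open>1 / |\<xi>|\<close>
  with \<open>1 / (1 + |\<xi>|)\<close> for \<open>|\<xi>| > 1\<close>.\<close>

definition decay_const :: "nat \<Rightarrow> real" where
  "decay_const n = 2 * pi * (real n + 7)"

lemma decay_const_ge: "decay_const n \<ge> 2 * pi"
  by (simp add: decay_const_def)

text \<open>Bessel functions decay like \<open>|\<xi>|^(-1/2)\<close>; the weaker exponent
  \<open>-1/3\<close> follows from one integration by parts and still makes \<open>cheb_ft n\<close>
  square integrable against \<open>(1 + |\<xi>|)^(-1)\<close>. Small frequencies are covered by the
  trivial bound \<open>pi\<close>.\<close>

theorem norm_cheb_ft_decay: "cmod (cheb_ft n \<xi>) \<le> decay_const n * (1 + \<bar>\<xi>\<bar>) powr (-1/3)"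
proof (cases "\<bar>\<xi>\<bar> \<le> 1")
  case True
  have "(1 + \<bar>\<xi>\<bar>) powr (-1/3) \<ge> 2 powr (-1/3)" using True by (intro powr_mono2') auto
  moreover have "2 powr (-1/3) \<ge> (2::real) powr (-1)" by (intro powr_mono) auto
  moreover have "(2::real) powr (-1) = 1 / 2" by (simp add: powr_minus_divide)
  ultimately have "(1 + \<bar>\<xi>\<bar>) powr (-1/3) \<ge> 1 / 2" by linarith
  then have "2 * pi * (1 / 2) \<le> decay_const n * (1 + \<bar>\<xi>\<bar>) powr (-1/3)"
    using decay_const_ge[of n] pi_gt_zero by (intro mult_mono) linarith+
  then show ?thesis using norm_cheb_ft_le[of n \<xi>] by linarith
next
  case False
  define X where "X = 1 + \<bar>\<xi>\<bar>"
  have X: "X > 2" "X \<le> 2 * \<bar>\<xi>\<bar>" using False by (auto simp: X_def)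
  define \<delta> where "\<delta> = X powr (-1/3)"
  have "X powr (-1/3) \<le> X powr 0" using X by (intro powr_mono) auto
  then have \<delta>: "0 < \<delta>" "\<delta> \<le> 1" using X by (auto simp: \<delta>_def)
  have "\<delta>^2 * \<delta> = X powr (-1/3) * X powr (-1/3) * X powr (-1/3)" by (simp add: \<delta>_def power2_eq_square)
  also have "\<dots> = 1 / X" using X by (simp add: powr_minus_divide flip: powr_add)
  finally have cube: "\<delta>^2 * \<delta> = 1 / X" .
  have "1 / \<bar>\<xi>\<bar> \<le> 2 / X" using X by (simp add: field_simps)
  then have inv: "1 / \<bar>\<xi>\<bar> \<le> 2 * (\<delta>^2 * \<delta>)" unfolding cube by simp
  have "cmod (cheb_ft n \<xi>) \<le> 8 * pi * \<delta> + pi * ((real n + 3) / \<delta>^2 * (1 / \<bar>\<xi>\<bar>))"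
    using norm_cheb_ft_split[of \<xi> \<delta> n] False \<delta> by simp
  also have "\<dots> \<le> 8 * pi * \<delta> + pi * ((real n + 3) / \<delta>^2 * (2 * (\<delta>^2 * \<delta>)))"
    using \<delta> by (intro add_left_mono mult_left_mono inv) auto
  also have "(real n + 3) / \<delta>^2 * (2 * (\<delta>^2 * \<delta>)) = 2 * (real n + 3) * \<delta>" using \<delta> by simp
  also have "8 * pi * \<delta> + pi * (2 * (real n + 3) * \<delta>) = decay_const n * \<delta>" by (simp add: decay_const_def algebra_simps)
  finally show ?thesis by (simp add: \<delta>_def X_def)
qed

text \<open>Numerator of the transform of an extension of \<open>T_n\<close>. It vanishes to first
  order at 0: for \<open>n > 0\<close> because \<open>cos (n t)\<close> has mean zero, for
  \<open>n = 0\<close> because the dilate takes the same value \<open>pi\<close> there. The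
  logarithmic potentials of the arcsine laws on \<open>[-1,1]\<close> and \<open>[-2,2]\<close> are
  constants on the smaller segment that differ by \<open>ln 2\<close>, which explains the
  divisor.\<close>

definition ext_num :: "nat \<Rightarrow> real \<Rightarrow> complex" where
  "ext_num n \<xi> = (if n = 0 then (cheb_ft 0 \<xi> - cheb_ft 0 (2 * \<xi>)) / cpx (ln 2) else of_nat n * cheb_ft n \<xi>)"

definition cheb_ext :: "nat \<Rightarrow> real \<Rightarrow> complex" where
  "cheb_ext n \<xi> = ext_num n \<xi> / cpx \<bar>\<xi>\<bar>"

lemma continuous_ext_num: "continuous_on UNIV (ext_num n)"
proof -
  have "continuous_on UNIV (\<lambda>\<xi>. cheb_ft 0 (2 * \<xi>))"
    by (rule continuous_on_compose2[OF continuous_cheb_ft]) (auto intro!: continuous_intros)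
  then show ?thesis unfolding ext_num_def by (cases "n = 0") (auto intro!: continuous_intros continuous_cheb_ft)
qed

lemma isCont_cheb_ext: "\<xi> \<noteq> 0 \<Longrightarrow> isCont (cheb_ext n) \<xi>"
proof -
  assume "\<xi> \<noteq> 0"
  have "isCont (ext_num n) \<xi>" using continuous_ext_num[of n] by (simp add: continuous_on_eq_continuous_at)
  then show ?thesis unfolding cheb_ext_def using \<open>\<xi> \<noteq> 0\<close> by (intro continuous_intros) auto
qed

lemma cheb_ext_measurable [measurable]: "cheb_ext n \<in> borel_measurable borel"
  using borel_measurable_continuous_onI[OF continuous_ext_num[of n]]
  unfolding cheb_ext_def[abs_def] by measurable

text \<open>Near 0 the linear vanishing of the numerator absorbs the division; away from 0 the
  division lowers the exponent by one.\<close>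

lemma quotient_decay:
  fixes \<xi> N A B :: real
  assumes A: "\<bar>\<xi>\<bar> \<le> 1 \<Longrightarrow> N \<le> A * \<bar>\<xi>\<bar>" "A \<ge> 0" and B: "N \<le> B * (1 + \<bar>\<xi>\<bar>) powr (-1/3)" "B \<ge> 0" and N: "0 \<le> N"
  shows "N / \<bar>\<xi>\<bar> \<le> (4 * A + 2 * B) * decay \<xi>"
proof (cases "\<bar>\<xi>\<bar> \<le> 1")
  case True
  have "(2::real) powr (-2) \<le> 2 powr (-4/3)" by (intro powr_mono) auto
  also have "\<dots> \<le> decay \<xi>" using True by (intro powr_mono2') auto
  finally have p: "1 \<le> 4 * decay \<xi>" by (simp add: powr_minus_divide)
  have "N / \<bar>\<xi>\<bar> \<le> A"
    using A(1)[OF True] A(2) by (cases "\<xi> = 0") (auto simp: divide_le_eq)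
  also have "\<dots> \<le> A * (4 * decay \<xi>)" using p A(2) mult_left_mono[OF p A(2)] by simp
  also have "\<dots> \<le> (4 * A + 2 * B) * decay \<xi>"
    using B(2) by (simp add: distrib_right)
  finally show ?thesis .
next
  case False
  have "N / \<bar>\<xi>\<bar> \<le> (B * (1 + \<bar>\<xi>\<bar>) powr (-1/3)) / ((1 + \<bar>\<xi>\<bar>) / 2)"
    using B N False by (intro frac_le) auto
  also have "\<dots> = 2 * B * ((1 + \<bar>\<xi>\<bar>) powr (-1/3) / (1 + \<bar>\<xi>\<bar>) powr 1)" by simp
  also have "(1 + \<bar>\<xi>\<bar>) powr (-1/3) / (1 + \<bar>\<xi>\<bar>) powr 1 = decay \<xi>"
    by (subst powr_diff[symmetric]) simp
  also have "2 * B * decay \<xi> \<le> (4 * A + 2 * B) * decay \<xi>"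
    using A(2) by (intro mult_right_mono) auto
  finally show ?thesis .
qed

lemma norm_cheb_ft_0_diff: "cmod (cheb_ft 0 \<xi> - cheb_ft 0 (2 * \<xi>)) \<le> pi * \<bar>\<xi>\<bar>"
proof -
  have i: "integrable arc (\<lambda>t. cis (- cos t * \<eta>) * cpx (cos (real 0 * t)))" for \<eta>
    by (intro integrable_arc_continuous continuous_intros)
  have "cheb_ft 0 \<xi> - cheb_ft 0 (2 * \<xi>) = (LINT t|arc. cis (- cos t * \<xi>) - cis (- cos t * (2 * \<xi>)))"
    using integral_diff[OF i i, of \<xi> "2 * \<xi>"] by (simp add: cheb_ft_def)
  also have "cmod \<dots> \<le> pi * \<bar>\<xi>\<bar>"
  proof (rule norm_arc_integral_le)
    show "(\<lambda>t. cis (- cos t * \<xi>) - cis (- cos t * (2 * \<xi>))) \<in> borel_measurable arc" by (rule measurable_arc) measurable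
    fix t
    have "cis (- cos t * \<xi>) - cis (- cos t * (2 * \<xi>)) = - cis (- cos t * \<xi>) * (cis (- cos t * \<xi>) - 1)"
      by (simp add: right_diff_distrib cis_mult algebra_simps)
    then have "cmod (cis (- cos t * \<xi>) - cis (- cos t * (2 * \<xi>))) = cmod (cis (- cos t * \<xi>) - 1)" by (simp add: norm_mult)
    also have "\<dots> \<le> \<bar>cos t\<bar> * \<bar>\<xi>\<bar>" using norm_cis_minus_1_le[of "- cos t * \<xi>"] by (simp add: abs_mult)
    also have "\<dots> \<le> \<bar>\<xi>\<bar>" by (simp add: mult_left_le_one_le)
    finally show "cmod (cis (- cos t * \<xi>) - cis (- cos t * (2 * \<xi>))) \<le> \<bar>\<xi>\<bar>" .
  qed
  finally show ?thesis .
qed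

lemma cheb_ext_decay:
  obtains C where "C \<ge> 0" "\<And>\<xi>. cmod (cheb_ext n \<xi>) \<le> C * decay \<xi>"
proof -
  have dpos: "decay_const n \<ge> 0" for n using decay_const_ge[of n] pi_gt_zero by linarith
  have ln2: "ln (2::real) > 0" by simp
  obtain A B where AB: "A \<ge> 0" "B \<ge> 0" "\<And>\<xi>. \<bar>\<xi>\<bar> \<le> 1 \<Longrightarrow> cmod (ext_num n \<xi>) \<le> A * \<bar>\<xi>\<bar>"
      "\<And>\<xi>. cmod (ext_num n \<xi>) \<le> B * (1 + \<bar>\<xi>\<bar>) powr (-1/3)"
  proof (cases "n = 0")
    case True
    have c: "cmod (ext_num n \<xi>) = cmod (cheb_ft 0 \<xi> - cheb_ft 0 (2 * \<xi>)) / ln 2" for \<xi>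
      using True ln2 by (simp add: ext_num_def norm_divide)
    show ?thesis
    proof (rule that[of "pi / ln 2" "2 * decay_const 0 / ln 2"])
      fix \<xi> :: real
      show "cmod (ext_num n \<xi>) \<le> pi / ln 2 * \<bar>\<xi>\<bar>"
        unfolding c using divide_right_mono[OF norm_cheb_ft_0_diff[of \<xi>], of "ln 2"] ln2 by simp
      have "(1 + \<bar>2 * \<xi>\<bar>) powr (-1/3) \<le> (1 + \<bar>\<xi>\<bar>) powr (-1/3)" by (intro powr_mono2') auto
      then have "decay_const 0 * (1 + \<bar>2 * \<xi>\<bar>) powr (-1/3) \<le> decay_const 0 * (1 + \<bar>\<xi>\<bar>) powr (-1/3)"
        by (intro mult_left_mono dpos)
      then have "cmod (cheb_ft 0 \<xi> - cheb_ft 0 (2 * \<xi>)) \<le> 2 * decay_const 0 * (1 + \<bar>\<xi>\<bar>) powr (-1/3)"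
        using norm_triangle_ineq4[of "cheb_ft 0 \<xi>" "cheb_ft 0 (2 * \<xi>)"] norm_cheb_ft_decay[of 0 \<xi>] norm_cheb_ft_decay[of 0 "2 * \<xi>"]
        by linarith
      from divide_right_mono[OF this, of "ln 2"] ln2
      show "cmod (ext_num n \<xi>) \<le> 2 * decay_const 0 / ln 2 * (1 + \<bar>\<xi>\<bar>) powr (-1/3)" unfolding c by simp
    qed (use ln2 dpos in auto)
  next
    case False
    have c: "cmod (ext_num n \<xi>) = real n * cmod (cheb_ft n \<xi>)" for \<xi>
      using False by (simp add: ext_num_def norm_mult)
    show ?thesis
    proof (rule that[of "real n * (2 * pi)" "real n * decay_const n"])
      fix \<xi> :: real
      show "cmod (ext_num n \<xi>) \<le> real n * (2 * pi) * \<bar>\<xi>\<bar>" if \<xi>: "\<bar>\<xi>\<bar> \<le> 1"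
      proof -
        have "cmod (cheb_ft n \<xi>) \<le> pi * (\<bar>\<xi>\<bar> * (1 + \<bar>\<xi>\<bar>)) / (real n)^2" using False by (intro norm_cheb_ft_le_square) simp
        also have "\<dots> \<le> pi * (\<bar>\<xi>\<bar> * 2) / 1"
        proof (intro frac_le mult_left_mono)
          have "1 \<le> real n" using False by simp
          then show "1 \<le> (real n)^2" by (simp add: one_le_power)
        qed (use \<xi> in auto)
        finally have "real n * cmod (cheb_ft n \<xi>) \<le> real n * (pi * (\<bar>\<xi>\<bar> * 2))" by (intro mult_left_mono) auto
        then show ?thesis unfolding c by (simp add: mult_ac)
      qed
      have "real n * cmod (cheb_ft n \<xi>) \<le> real n * (decay_const n * (1 + \<bar>\<xi>\<bar>) powr (-1/3))"
        by (intro mult_left_mono norm_cheb_ft_decay) auto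
      then show "cmod (ext_num n \<xi>) \<le> real n * decay_const n * (1 + \<bar>\<xi>\<bar>) powr (-1/3)" unfolding c by (simp add: mult_ac)
    qed (use dpos in auto)
  qed
  show ?thesis
  proof (rule that[of "4 * A + 2 * B"])
    fix \<xi>
    show "cmod (cheb_ext n \<xi>) \<le> (4 * A + 2 * B) * decay \<xi>"
      using quotient_decay[OF AB(3) AB(1) AB(4) AB(2) norm_ge_zero, of \<xi>] by (simp add: cheb_ext_def norm_divide)
  qed (use AB in auto)
qed

lemma integrable_cheb_ext: "integrable lborel (cheb_ext n)"
proof -
  obtain C where C: "C \<ge> 0" "\<And>\<xi>. cmod (cheb_ext n \<xi>) \<le> C * decay \<xi>" using cheb_ext_decay by blast
  have i: "integrable lborel (\<lambda>\<xi>::real. decay \<xi>)" using integrable_one_plus_abs_powr[of "4/3"] by simp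
  show ?thesis
    by (rule integrable_bound[OF integrable_mult_right[OF i, of C]]) (use C in auto)
qed

lemma regularization_limit:
  assumes f: "integrable lborel f" and e0: "e \<longlonglongrightarrow> 0" and e: "\<And>k. 0 < e k"
  shows "(\<lambda>k. LINT \<xi>|lborel. cpx (damp (e k) \<xi>) * f \<xi>) \<longlonglongrightarrow> (LINT \<xi>|lborel. f \<xi>)"
proof (rule integral_dominated_convergence[where w = "\<lambda>\<xi>. cmod (f \<xi>)"])
  show "AE \<xi> in lborel. (\<lambda>k. cpx (damp (e k) \<xi>) * f \<xi>) \<longlonglongrightarrow> f \<xi>"
  proof (rule AE_I2)
    fix \<xi> :: real
    have "(\<lambda>k. cpx (damp (e k) \<xi>) * f \<xi>) \<longlonglongrightarrow> cpx (exp (- 0 * \<bar>\<xi>\<bar>)) * f \<xi>"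
      by (intro tendsto_intros e0)
    then show "(\<lambda>k. cpx (damp (e k) \<xi>) * f \<xi>) \<longlonglongrightarrow> f \<xi>" by simp
  qed
  show "AE \<xi> in lborel. norm (cpx (damp (e k) \<xi>) * f \<xi>) \<le> cmod (f \<xi>)" for k
  proof (rule AE_I2)
    fix \<xi> :: real
    have "0 \<le> e k * \<bar>\<xi>\<bar>" using e[of k] by simp
    then have "damp (e k) \<xi> \<le> 1" by simp
    then show "norm (cpx (damp (e k) \<xi>) * f \<xi>) \<le> cmod (f \<xi>)"
      unfolding norm_mult norm_of_real by (intro mult_left_le_one_le) auto
  qed
  show "(\<lambda>\<xi>. cpx (damp (e k) \<xi>) * f \<xi>) \<in> borel_measurable lborel" for k
    using borel_measurable_integrable[OF f] by measurable
qed (use f in auto)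

text \<open>The damped integral is a combination of logarithmic moments, whose limits are known. For
  \<open>n > 0\<close> the mean of \<open>cos (n t)\<close> is zero, so the divergent
  \<open>ln (\<epsilon>^2)\<close> is absent; for \<open>n = 0\<close> it cancels between the two
  dilates.\<close>

theorem fourier_cheb_ext:
  assumes x: "x \<in> {-1<..<1}"
  shows "(LINT \<xi>|lborel. cis (x * \<xi>) * cheb_ext n \<xi>) = cpx (2 * pi * tpoly n x)"
proof -
  interpret finite_measure arc by (rule finite_measure_arc)
  define e where "e k = 1 / real (Suc k)" for k
  have e0: "e \<longlonglongrightarrow> 0" unfolding e_def using LIMSEQ_inverse_real_of_nat by (simp add: inverse_eq_divide)
  have e: "0 < e k" "e k \<le> 1" for k by (auto simp: e_def)
  have xi: "integrable lborel (\<lambda>\<xi>. cis (x * \<xi>) * cheb_ext n \<xi>)"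
    by (rule integrable_bound[OF integrable_cheb_ext[of n]]) (auto simp: norm_mult)
  note lim = regularization_limit[OF xi e0 e(1)]
  let ?c = "\<lambda>n t. cpx (cos (real n * t))"
  have lmi: "integrable arc (\<lambda>t. ?c n t * cpx (ln ((e k)^2 + (y - cos t)^2)))" for n k y
    using integrable_of_real[OF log_moment_integrable[OF e(1), of n k y], where 'a = complex] by simp
  have rhs: "(LINT t|arc. ?c n t * cpx (ln (\<epsilon>^2) - ln (\<epsilon>^2 + (x - cos t)^2)))
      = cpx ((if n = 0 then pi * ln (\<epsilon>^2) else 0) - log_moment n \<epsilon> x)" if "\<epsilon> > 0" for \<epsilon> n
  proof -
    have i1: "integrable arc (\<lambda>t. ln (\<epsilon>^2) * cos (real n * t))" by (intro integrable_arc_continuous continuous_intros)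
    have "(LINT t|arc. ?c n t * cpx (ln (\<epsilon>^2) - ln (\<epsilon>^2 + (x - cos t)^2)))
        = (LINT t|arc. cpx (ln (\<epsilon>^2) * cos (real n * t) - cos (real n * t) * ln (\<epsilon>^2 + (x - cos t)^2)))"
      by (intro int_cong) (simp add: algebra_simps)
    also have "\<dots> = cpx ((LINT t|arc. ln (\<epsilon>^2) * cos (real n * t)) - log_moment n \<epsilon> x)"
      unfolding integral_complex_of_real log_moment_def
      by (subst integral_diff[OF i1 log_moment_integrable[OF that]]) simp
    also have "(LINT t|arc. ln (\<epsilon>^2) * cos (real n * t)) = (if n = 0 then pi * ln (\<epsilon>^2) else 0)"
      using arc_integral_cos[of "int n"] by (simp add: measure_arc)
    finally show ?thesis .
  qed
  have ftc: "(LINT t|arc. ?c n t) = (if n = 0 then cpx pi else 0)" for n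
    using arg_cong[OF arc_integral_cos[of "int n"], of cpx] unfolding integral_complex_of_real by (simp split: if_splits)
  have R1: "(LINT \<xi>|lborel. cpx (damp \<epsilon> \<xi>) * ((cis (x * \<xi>) * cheb_ft n \<xi> - (if n = 0 then cpx pi else 0)) / cpx \<bar>\<xi>\<bar>))
      = cpx ((if n = 0 then pi * ln (\<epsilon>^2) else 0) - log_moment n \<epsilon> x)"
    and I1: "integrable lborel (\<lambda>\<xi>. cpx (damp \<epsilon> \<xi>) * ((cis (x * \<xi>) * cheb_ft n \<xi> - (if n = 0 then cpx pi else 0)) / cpx \<bar>\<xi>\<bar>))"
    if "\<epsilon> > 0" for \<epsilon> n
    using fourier_log_potential_regularized[OF integrable_arc_cos[of n] _ _ that, of cos 1 x] unfolding rhs[OF that] ftc cheb_ft_def by auto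
  show ?thesis
  proof (cases "n = 0")
    case False
    have eqk: "(LINT \<xi>|lborel. cpx (damp (e k) \<xi>) * (cis (x * \<xi>) * cheb_ext n \<xi>)) = of_nat n * cpx (- log_moment n (e k) x)" for k
    proof -
      have "(LINT \<xi>|lborel. cpx (damp (e k) \<xi>) * (cis (x * \<xi>) * cheb_ext n \<xi>))
          = (LINT \<xi>|lborel. of_nat n * (cpx (damp (e k) \<xi>) * ((cis (x * \<xi>) * cheb_ft n \<xi> - (if n = 0 then cpx pi else 0)) / cpx \<bar>\<xi>\<bar>)))"
        using False by (intro int_cong) (simp add: cheb_ext_def ext_num_def mult_ac)
      then show ?thesis unfolding integral_mult_right_zero R1[OF e(1)] using False by simp
    qed
    have limr: "(\<lambda>k. of_nat n * cpx (- log_moment n (e k) x)) \<longlonglongrightarrow> of_nat n * cpx (- (- (2 * pi / real n) * tpoly n x))"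
      using log_moment_limit[OF x e0 e, of n] False by (intro tendsto_intros) auto
    from LIMSEQ_unique[OF lim[unfolded eqk] limr] show ?thesis using False by simp
  next
    case True
    have x2: "x / 2 \<in> {-1<..<1}" using x by auto
    \<comment> \<open>Writing \<open>x - 2 cos t = 2 (x / 2 - cos t)\<close> splits off
      \<open>ln 4\<close> and leaves the moment at \<open>x / 2\<close> with
      \<open>\<epsilon> / 2\<close>. Both moments have the limit \<open>-2 pi ln 2\<close>, so only
      \<open>pi ln 4 / ln 2 = 2 pi\<close> survives.\<close>
    have R2: "(LINT \<xi>|lborel. cpx (damp \<epsilon> \<xi>) * ((cis (x * \<xi>) * cheb_ft 0 (2 * \<xi>) - cpx pi) / cpx \<bar>\<xi>\<bar>))
      = cpx (pi * ln (\<epsilon>^2) - (pi * ln 4 + log_moment 0 (\<epsilon> / 2) (x / 2)))" (is ?A)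
     and I2: "integrable lborel (\<lambda>\<xi>. cpx (damp \<epsilon> \<xi>) * ((cis (x * \<xi>) * cheb_ft 0 (2 * \<xi>) - cpx pi) / cpx \<bar>\<xi>\<bar>))" (is ?B)
     if \<epsilon>: "\<epsilon> > 0" for \<epsilon>
    proof -
      have i: "integrable arc (\<lambda>t. cpx 1)" by (rule integrable_const)
      note F = fourier_log_potential_regularized[OF i, of "\<lambda>t. 2 * cos t" 2 \<epsilon> x]
      have ft2: "(LINT t|arc. cis (- (2 * cos t) * \<xi>) * cpx 1) = cheb_ft 0 (2 * \<xi>)" for \<xi>
        unfolding cheb_ft_def by (intro int_cong) (simp add: mult_ac)
      have c1: "(LINT t|arc. cpx 1) = cpx pi" by (simp add: measure_arc scaleR_conv_of_real)
      have i0: "integrable arc (\<lambda>t. cos (real 0 * t) * ln ((\<epsilon> / 2)^2 + (x / 2 - cos t)^2))" using \<epsilon> by (intro log_moment_integrable) simp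
      have "(LINT t|arc. cpx 1 * cpx (ln (\<epsilon>^2) - ln (\<epsilon>^2 + (x - 2 * cos t)^2)))
          = cpx (LINT t|arc. (ln (\<epsilon>^2) - ln 4) - cos (real 0 * t) * ln ((\<epsilon> / 2)^2 + (x / 2 - cos t)^2))"
        unfolding integral_complex_of_real[symmetric]
      proof (intro int_cong)
        fix t
        have "(\<epsilon> / 2)^2 + (x / 2 - cos t)^2 > 0" using \<epsilon> by (simp add: add_pos_nonneg)
        then have "ln (4 * ((\<epsilon> / 2)^2 + (x / 2 - cos t)^2)) = ln 4 + ln ((\<epsilon> / 2)^2 + (x / 2 - cos t)^2)" by (subst ln_mult) auto
        moreover have "4 * ((\<epsilon> / 2)^2 + (x / 2 - cos t)^2) = \<epsilon>^2 + (x - 2 * cos t)^2" by (simp add: power2_eq_square field_simps)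
        ultimately show "cpx 1 * cpx (ln (\<epsilon>^2) - ln (\<epsilon>^2 + (x - 2 * cos t)^2))
            = cpx ((ln (\<epsilon>^2) - ln 4) - cos (real 0 * t) * ln ((\<epsilon> / 2)^2 + (x / 2 - cos t)^2))" by simp
      qed
      also have "\<dots> = cpx (pi * (ln (\<epsilon>^2) - ln 4) - log_moment 0 (\<epsilon> / 2) (x / 2))"
        unfolding log_moment_def by (subst integral_diff[OF integrable_const i0]) (simp add: measure_arc)
      also have "\<dots> = cpx (pi * ln (\<epsilon>^2) - (pi * ln 4 + log_moment 0 (\<epsilon> / 2) (x / 2)))" by (simp add: algebra_simps)
      finally have r2: "(LINT t|arc. cpx 1 * cpx (ln (\<epsilon>^2) - ln (\<epsilon>^2 + (x - 2 * cos t)^2))) = cpx (pi * ln (\<epsilon>^2) - (pi * ln 4 + log_moment 0 (\<epsilon> / 2) (x / 2)))" .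
      have Z: "(\<lambda>t::real. 2 * cos t) \<in> borel_measurable borel" "\<And>t::real. \<bar>2 * cos t\<bar> \<le> 2" by (simp_all add: abs_mult)
      show ?A ?B using F[OF Z \<epsilon>] unfolding ft2 c1 r2 .
    qed
    have eqk: "(LINT \<xi>|lborel. cpx (damp (e k) \<xi>) * (cis (x * \<xi>) * cheb_ext n \<xi>))
        = cpx ((pi * ln 4 + log_moment 0 (e k / 2) (x / 2) - log_moment 0 (e k) x) / ln 2)" for k
    proof -
      let ?a = "\<lambda>\<xi>. cpx (damp (e k) \<xi>) * ((cis (x * \<xi>) * cheb_ft 0 \<xi> - (if (0::nat) = 0 then cpx pi else 0)) / cpx \<bar>\<xi>\<bar>)"
      let ?b = "\<lambda>\<xi>. cpx (damp (e k) \<xi>) * ((cis (x * \<xi>) * cheb_ft 0 (2 * \<xi>) - cpx pi) / cpx \<bar>\<xi>\<bar>)"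
      have "(LINT \<xi>|lborel. cpx (damp (e k) \<xi>) * (cis (x * \<xi>) * cheb_ext n \<xi>)) = (LINT \<xi>|lborel. (?a \<xi> - ?b \<xi>) / cpx (ln 2))"
      proof (intro int_cong)
        fix \<xi> :: real
        have "((E * ((c * h - p) / q)) - (E * ((c * h' - p) / q))) / l = E * (c * ((h - h') / l / q))" for E c h h' p q l :: complex
          by (simp add: algebra_simps diff_divide_distrib)
        then show "cpx (damp (e k) \<xi>) * (cis (x * \<xi>) * cheb_ext n \<xi>) = (?a \<xi> - ?b \<xi>) / cpx (ln 2)"
          using True by (simp only: cheb_ext_def ext_num_def if_True simp_thms)
      qed
      also have "\<dots> = ((LINT \<xi>|lborel. ?a \<xi>) - (LINT \<xi>|lborel. ?b \<xi>)) / cpx (ln 2)"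
        by (subst integral_divide_zero, subst integral_diff[OF I1[OF e(1), of k 0] I2[OF e(1), of k]]) simp
      also have "\<dots> = cpx ((pi * ln 4 + log_moment 0 (e k / 2) (x / 2) - log_moment 0 (e k) x) / ln 2)"
        unfolding R1[OF e(1), of k 0] R2[OF e(1)] by simp
      finally show ?thesis .
    qed
    have limr: "(\<lambda>k. cpx ((pi * ln 4 + log_moment 0 (e k / 2) (x / 2) - log_moment 0 (e k) x) / ln 2))
        \<longlonglongrightarrow> cpx ((pi * ln 4 + (- 2 * pi * ln 2) - (- 2 * pi * ln 2)) / ln 2)"
    proof (intro tendsto_intros)
      show "(\<lambda>k. log_moment 0 (e k) x) \<longlonglongrightarrow> - 2 * pi * ln 2" using log_moment_limit[OF x e0 e, of 0] by simp
      have "(\<lambda>k. e k / 2) \<longlonglongrightarrow> 0 / 2" by (intro tendsto_intros e0) auto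
      then have e2: "(\<lambda>k. e k / 2) \<longlonglongrightarrow> 0" by simp
      have e3: "0 < e k / 2" "e k / 2 \<le> 1" for k using e[of k] by auto
      show "(\<lambda>k. log_moment 0 (e k / 2) (x / 2)) \<longlonglongrightarrow> - 2 * pi * ln 2"
        using log_moment_limit[OF x2 e2 e3, of 0] by simp
    qed auto
    have "(LINT \<xi>|lborel. cis (x * \<xi>) * cheb_ext n \<xi>) = cpx ((pi * ln 4 + (- 2 * pi * ln 2) - (- 2 * pi * ln 2)) / ln 2)"
      by (rule LIMSEQ_unique[OF lim[unfolded eqk] limr])
    also have "ln (4::real) = 2 * ln 2" using ln_realpow[of 2 2] by simp
    finally show ?thesis using True by simp
  qed
qed

text \<open>\<open>T_m / \<omega>\<close> lives on the segment, so its pairing with the extension of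
  \<open>T_n\<close> sees only the values \<open>T_n\<close> there and reduces to the orthogonality
  of Chebyshev polynomials.\<close>

theorem biorthogonal:
  "(LINT \<xi>|lborel. cheb_ext n \<xi> * cheb_ft m (- \<xi>)) = (if n = m then cpx (2 * pi / cheb_const n) else 0)"
proof -
  have "(LINT \<xi>|lborel. cheb_ext n \<xi> * cheb_ft m (- \<xi>)) = (LINT \<xi>|lborel. cheb_ext n \<xi> * (LINT t|arc. cis (cos t * \<xi>) * cpx (cos (real m * t))))"
    by (simp add: cheb_ft_def)
  also have "\<dots> = (LINT t|arc. cpx (cos (real m * t)) * (LINT \<xi>|lborel. cis (cos t * \<xi>) * cheb_ext n \<xi>))"
  proof (rule Fubini_kernel(1)[OF sigma_finite_lborel _ integrable_cheb_ext integrable_arc_cos, where B = 1])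
    show "sigma_finite_measure arc" using finite_measure_arc by (simp add: finite_measure_def)
    have [measurable]: "cos \<in> borel_measurable arc" by (rule measurable_arc) measurable
    show "(\<lambda>(\<xi>, t). cis (cos t * \<xi>)) \<in> borel_measurable (lborel \<Otimes>\<^sub>M arc)" by measurable
  qed simp
  also have "\<dots> = (LINT t|arc. cpx (2 * pi * (cos (real n * t) * cos (real m * t))))"
  proof (intro int_cong)
    fix t assume "t \<in> space arc"
    then have "cos t \<in> {-1<..<1}" by (intro cos_in_open) simp
    then show "cpx (cos (real m * t)) * (LINT \<xi>|lborel. cis (cos t * \<xi>) * cheb_ext n \<xi>) = cpx (2 * pi * (cos (real n * t) * cos (real m * t)))"
      by (simp add: fourier_cheb_ext tpoly_cos)
  qed
  also have "\<dots> = cpx (2 * pi * (if n = m then 1 / cheb_const m else 0))"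
    unfolding integral_complex_of_real integral_mult_right_zero arc_integral_cos_cos ..
  finally show ?thesis by simp
qed

text \<open>Square root of the Sobolev weight of order \<open>1/2\<close>: membership in the space
  of order \<open>1/2\<close> or \<open>-1/2\<close> is square integrability of the transform
  multiplied or divided by \<open>jw\<close>.\<close>

definition jw :: "real \<Rightarrow> real" where
  "jw \<xi> = (1 + \<xi>^2) powr (1/4)"

lemma jw_pos: "jw \<xi> > 0"
proof -
  have "1 + \<xi>^2 > 0" by (simp add: add_pos_nonneg)
  then show ?thesis by (simp add: jw_def)
qed

lemma jw_measurable [measurable]: "jw \<in> borel_measurable borel"
  unfolding jw_def[abs_def] by measurable

lemma jw_square: "(jw \<xi>)^2 = (1 + \<xi>^2) powr (1/2)"
  by (simp add: jw_def power2_eq_square flip: powr_add)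

lemma jw_square_sqrt: "(jw \<xi>)^2 = sqrt (1 + \<xi>^2)"
  unfolding jw_square by (rule powr_half_sqrt) simp

lemma jw_square_bounds: "\<bar>\<xi>\<bar> \<le> (jw \<xi>)^2" "(jw \<xi>)^2 \<le> 1 + \<bar>\<xi>\<bar>" (is ?A) "(1 + \<bar>\<xi>\<bar>) / 2 \<le> (jw \<xi>)^2" (is ?B) "1 \<le> (jw \<xi>)^2"
proof -
  show a: "\<bar>\<xi>\<bar> \<le> (jw \<xi>)^2" unfolding jw_square_sqrt by (rule real_le_rsqrt) simp
  show b: "1 \<le> (jw \<xi>)^2" unfolding jw_square_sqrt by simp
  show ?A unfolding jw_square_sqrt by (rule real_le_lsqrt) (auto simp: power2_sum)
  show ?B using a b by argo
qed

lemma inverse_jw_square: "(1 + \<xi>^2) powr (-1/2) = 1 / (jw \<xi>)^2"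
  by (simp add: jw_square powr_minus_divide)

definition wminus :: "nat \<Rightarrow> real" where "wminus n = (1 + (real n)^2) powr (-1/2)"
definition wplus :: "nat \<Rightarrow> real" where "wplus n = (1 + (real n)^2) powr (1/2)"

lemma wplus_eq: "wplus n = (jw (real n))^2" by (simp add: wplus_def jw_square)
lemma wminus_eq: "wminus n = 1 / wplus n" by (simp add: wminus_def wplus_def powr_minus_divide)
lemma wplus_ge: "1 \<le> wplus n" "real n \<le> wplus n" "wplus n \<le> 1 + real n"
  using jw_square_bounds[of "real n"] by (auto simp: wplus_eq)
lemma wplus_pos: "wplus n > 0" using wplus_ge(1)[of n] by linarith
lemma wminus_pos: "wminus n > 0" using wplus_pos[of n] by (simp add: wminus_eq)
lemma wminus_le_1: "wminus n \<le> 1" using wplus_ge(1)[of n] by (simp add: wminus_eq)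

lemma sq_int_cheb_ft: "sq_int lborel (\<lambda>\<xi>. cheb_ft n \<xi> / cpx (jw \<xi>))"
proof (rule sq_int_bound)
  show "integrable lborel (\<lambda>\<xi>::real. 2 * (decay_const n)^2 * (1 + \<bar>\<xi>\<bar>) powr (- (5/3)))"
    by (intro integrable_mult_right integrable_one_plus_abs_powr) simp
  show "AE \<xi> in lborel. (cmod (cheb_ft n \<xi> / cpx (jw \<xi>)))^2 \<le> 2 * (decay_const n)^2 * (1 + \<bar>\<xi>\<bar>) powr (- (5/3))"
  proof (rule AE_I2)
    fix \<xi> :: real
    have "(cmod (cheb_ft n \<xi> / cpx (jw \<xi>)))^2 = (cmod (cheb_ft n \<xi>))^2 / (jw \<xi>)^2"
      by (simp add: norm_divide power_divide)
    also have "\<dots> \<le> (decay_const n * (1 + \<bar>\<xi>\<bar>) powr (-1/3))^2 / ((1 + \<bar>\<xi>\<bar>) / 2)"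
      using jw_square_bounds(3)[of \<xi>] by (intro frac_le power_mono norm_cheb_ft_decay) auto
    also have "\<dots> = 2 * (decay_const n)^2 * (((1 + \<bar>\<xi>\<bar>) powr (-1/3))^2 / (1 + \<bar>\<xi>\<bar>) powr 1)" by (simp add: power_mult_distrib)
    also have "((1 + \<bar>\<xi>\<bar>) powr (-1/3))^2 / (1 + \<bar>\<xi>\<bar>) powr 1 = (1 + \<bar>\<xi>\<bar>) powr (- (5/3))"
      unfolding power2_eq_square by (simp only: flip: powr_add powr_diff) simp
    finally show "(cmod (cheb_ft n \<xi> / cpx (jw \<xi>)))^2 \<le> 2 * (decay_const n)^2 * (1 + \<bar>\<xi>\<bar>) powr (- (5/3))" .
  qed
qed measurable

lemma sq_int_cheb_ext: "sq_int lborel (\<lambda>\<xi>. cpx (jw \<xi>) * cheb_ext n \<xi>)"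
proof -
  obtain C where C: "C \<ge> 0" "\<And>\<xi>. cmod (cheb_ext n \<xi>) \<le> C * decay \<xi>" using cheb_ext_decay by blast
  show ?thesis
  proof (rule sq_int_bound)
    show "integrable lborel (\<lambda>\<xi>::real. C^2 * (1 + \<bar>\<xi>\<bar>) powr (- (5/3)))"
      by (intro integrable_mult_right integrable_one_plus_abs_powr) simp
    show "AE \<xi> in lborel. (cmod (cpx (jw \<xi>) * cheb_ext n \<xi>))^2 \<le> C^2 * (1 + \<bar>\<xi>\<bar>) powr (- (5/3))"
    proof (rule AE_I2)
      fix \<xi> :: real
      have "(cmod (cpx (jw \<xi>) * cheb_ext n \<xi>))^2 = (jw \<xi>)^2 * (cmod (cheb_ext n \<xi>))^2"
        by (simp add: norm_mult power_mult_distrib)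
      also have "\<dots> \<le> (1 + \<bar>\<xi>\<bar>) * (C * decay \<xi>)^2"
        using C jw_square_bounds(2)[of \<xi>] by (intro mult_mono power_mono) auto
      also have "\<dots> = C^2 * ((1 + \<bar>\<xi>\<bar>) powr 1 * (decay \<xi>)^2)" by (simp add: power_mult_distrib)
      also have "(1 + \<bar>\<xi>\<bar>) powr 1 * (decay \<xi>)^2 = (1 + \<bar>\<xi>\<bar>) powr (- (5/3))"
        unfolding power2_eq_square by (simp only: flip: powr_add) simp
      finally show "(cmod (cpx (jw \<xi>) * cheb_ext n \<xi>))^2 \<le> C^2 * (1 + \<bar>\<xi>\<bar>) powr (- (5/3))" .
    qed
  qed measurable
qed

text \<open>Up to the factor \<open>n\<close>, the product of one member with the conjugate of
  another is a product of \<open>cheb_ext\<close> and \<open>cheb_ft\<close>, so biorthogonality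
  makes the family orthogonal. The index starts at 1 because \<open>|h_0|^2 / |\<xi>|\<close> is not
  integrable at 0.\<close>

definition half_ft :: "nat \<Rightarrow> real \<Rightarrow> complex" where
  "half_ft n \<xi> = cheb_ft (Suc n) \<xi> / cpx (sqrt \<bar>\<xi>\<bar>)"

lemma half_ft_measurable [measurable]: "half_ft n \<in> borel_measurable borel"
  unfolding half_ft_def[abs_def] by measurable

lemma half_ft_mult: "half_ft m \<xi> * cnj (half_ft n \<xi>) = cpx (1 / real (Suc m)) * (cheb_ext (Suc m) \<xi> * cheb_ft (Suc n) (- \<xi>))"
proof -
  have "cpx (sqrt \<bar>\<xi>\<bar>) * cpx (sqrt \<bar>\<xi>\<bar>) = cpx \<bar>\<xi>\<bar>"
    by (simp flip: of_real_mult)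
  moreover have "cpx (real (Suc m)) \<noteq> 0" by (simp only: of_real_eq_0_iff)
  ultimately show ?thesis
    by (simp add: half_ft_def cheb_ext_def ext_num_def cnj_cheb_ft times_divide_times_eq del: of_nat_Suc)
qed

lemma integrable_cheb_ext_ft: "integrable lborel (\<lambda>\<xi>. cheb_ext n \<xi> * cheb_ft m (- \<xi>))"
  using integrable_bounded_mult[OF integrable_cheb_ext[of n], of "\<lambda>\<xi>. cheb_ft m (- \<xi>)" pi] norm_cheb_ft_le[of m]
  by (simp add: mult.commute)

lemma sq_int_half_ft: "sq_int lborel (half_ft n)"
  unfolding sq_int_def
proof
  have "integrable lborel (\<lambda>\<xi>. half_ft n \<xi> * cnj (half_ft n \<xi>))"
    unfolding half_ft_mult by (intro integrable_mult_right integrable_cheb_ext_ft)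
  then have "integrable lborel (\<lambda>\<xi>. cpx ((cmod (half_ft n \<xi>))^2))" by (simp only: norm_square_of_real)
  then show "integrable lborel (\<lambda>\<xi>. (cmod (half_ft n \<xi>))^2)" by (simp only: complex_of_real_integrable_eq)
qed simp

lemma integral_half_ft_mult:
  "(LINT \<xi>|lborel. half_ft m \<xi> * cnj (half_ft n \<xi>)) = (if m = n then cpx (pi^2 / real (Suc n)) else 0)"
  unfolding half_ft_mult integral_mult_right_zero biorthogonal
  by (simp add: cheb_const_def power2_eq_square)

lemma integral_sum_half_ft:
  "(LINT \<xi>|lborel. (cmod (\<Sum>n<N. a n * half_ft n \<xi>))^2) = (\<Sum>n<N. pi^2 / real (Suc n) * (cmod (a n))^2)"
  by (rule integral_norm_sum_orthogonal[OF sq_int_half_ft integral_half_ft_mult])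

lemma norm_add_square_le: "(cmod (x + y))^2 \<le> 2 * (cmod x)^2 + 2 * (cmod y)^2"
proof -
  have "(cmod (x + y))^2 \<le> (cmod x + cmod y)^2" by (intro power_mono norm_triangle_ineq) auto
  also have "\<dots> \<le> 2 * (cmod x)^2 + 2 * (cmod y)^2"
    using two_mult_le_squares[of "cmod x" "cmod y"] by (simp add: power2_sum)
  finally show ?thesis .
qed

lemma sqrt_abs_mult: "cpx (sqrt \<bar>\<xi>\<bar>) * half_ft n \<xi> = (if \<xi> = 0 then 0 else cheb_ft (Suc n) \<xi>)"
  by (simp add: half_ft_def)

text \<open>For \<open>n > 0\<close> the functions are \<open>half_ft\<close> times the common
  factor \<open>sqrt |\<xi>| / jw\<close>, which is at most 1; orthogonality then gives the bound.
  The term \<open>n = 0\<close> is treated separately.\<close>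

theorem bessel_system_minus:
  obtains C where "bessel_system lborel (\<lambda>n \<xi>. cheb_ft n \<xi> / cpx (jw \<xi>)) wminus C"
proof -
  let ?e = "\<lambda>n \<xi>. cheb_ft n \<xi> / cpx (jw \<xi>)"
  define I0 where "I0 = (LINT \<xi>|lborel. (cmod (?e 0 \<xi>))^2)"
  have I0: "I0 \<ge> 0" unfolding I0_def by (rule integral_nonneg) auto
  \<comment> \<open>A factor 2 comes from separating the term \<open>n = 0\<close>; the squared
    norms of \<open>half_ft\<close> are \<open>pi^2 / n\<close>, and
    \<open>1 / n \<le> 2 wminus n\<close> supplies the remaining factor 2 in
    \<open>4 pi^2\<close>.\<close>
  have "bessel_system lborel ?e wminus (2 * I0 + 4 * pi^2)"
  proof
    fix a :: "nat \<Rightarrow> complex" and N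
    show "(LINT \<xi>|lborel. (cmod (\<Sum>n<N. a n * ?e n \<xi>))^2) \<le> (2 * I0 + 4 * pi^2) * (\<Sum>n<N. wminus n * (cmod (a n))^2)"
    proof (cases N)
      case (Suc M)
      define V where "V \<xi> = (\<Sum>n<M. a (Suc n) * half_ft n \<xi>)" for \<xi>
      have V: "sq_int lborel V" unfolding V_def by (intro sq_int_sum sq_int_cmult sq_int_half_ft)
      have "(LINT \<xi>|lborel. (cmod (\<Sum>n<N. a n * ?e n \<xi>))^2) \<le> (LINT \<xi>|lborel. 2 * (cmod (a 0))^2 * (cmod (?e 0 \<xi>))^2 + 2 * (cmod (V \<xi>))^2)"
      proof (rule integral_mono_AE)
        show "integrable lborel (\<lambda>\<xi>. (cmod (\<Sum>n<N. a n * ?e n \<xi>))^2)"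
          by (intro sq_int_integrable sq_int_sum sq_int_cmult sq_int_cheb_ft)
        show "integrable lborel (\<lambda>\<xi>. 2 * (cmod (a 0))^2 * (cmod (?e 0 \<xi>))^2 + 2 * (cmod (V \<xi>))^2)"
          by (intro integrable_add integrable_mult_right sq_int_integrable sq_int_cheb_ft V)
        show "AE \<xi> in lborel. (cmod (\<Sum>n<N. a n * ?e n \<xi>))^2 \<le> 2 * (cmod (a 0))^2 * (cmod (?e 0 \<xi>))^2 + 2 * (cmod (V \<xi>))^2"
          using AE_lborel_singleton[of 0]
        proof eventually_elim
          case (elim \<xi>)
          have j: "jw \<xi> \<noteq> 0" using jw_pos[of \<xi>] by simp
          have "(\<Sum>n<N. a n * ?e n \<xi>) = a 0 * ?e 0 \<xi> + (\<Sum>n<M. a (Suc n) * ?e (Suc n) \<xi>)"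
            unfolding Suc by (rule sum.lessThan_Suc_shift)
          also have "(\<Sum>n<M. a (Suc n) * ?e (Suc n) \<xi>) = cpx (sqrt \<bar>\<xi>\<bar> / jw \<xi>) * V \<xi>"
            unfolding V_def sum_distrib_left
          proof (intro sum.cong refl)
            fix n
            have "cheb_ft (Suc n) \<xi> = cpx (sqrt \<bar>\<xi>\<bar>) * half_ft n \<xi>" using elim by (simp add: sqrt_abs_mult)
            then show "a (Suc n) * ?e (Suc n) \<xi> = cpx (sqrt \<bar>\<xi>\<bar> / jw \<xi>) * (a (Suc n) * half_ft n \<xi>)" by simp
          qed
          finally have "(cmod (\<Sum>n<N. a n * ?e n \<xi>))^2 \<le> 2 * (cmod (a 0 * ?e 0 \<xi>))^2 + 2 * (cmod (cpx (sqrt \<bar>\<xi>\<bar> / jw \<xi>) * V \<xi>))^2"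
            by (simp only: norm_add_square_le)
          moreover have "(cmod (cpx (sqrt \<bar>\<xi>\<bar> / jw \<xi>) * V \<xi>))^2 \<le> (cmod (V \<xi>))^2"
          proof -
            have "(cmod (cpx (sqrt \<bar>\<xi>\<bar> / jw \<xi>) * V \<xi>))^2 = \<bar>\<xi>\<bar> / (jw \<xi>)^2 * (cmod (V \<xi>))^2"
              by (simp add: norm_mult norm_divide power_mult_distrib power_divide)
            also have "\<dots> \<le> 1 * (cmod (V \<xi>))^2"
              using jw_square_bounds(1)[of \<xi>] jw_pos[of \<xi>] by (intro mult_right_mono) auto
            finally show ?thesis by simp
          qed
          moreover have "(cmod (a 0 * ?e 0 \<xi>))^2 = (cmod (a 0))^2 * (cmod (?e 0 \<xi>))^2" by (simp only: norm_mult power_mult_distrib)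
          ultimately show ?case by linarith
        qed
      qed
      also have "\<dots> = 2 * (cmod (a 0))^2 * I0 + 2 * (\<Sum>n<M. pi^2 / real (Suc n) * (cmod (a (Suc n)))^2)"
      proof -
        have "(LINT \<xi>|lborel. 2 * (cmod (a 0))^2 * (cmod (?e 0 \<xi>))^2 + 2 * (cmod (V \<xi>))^2)
            = 2 * (cmod (a 0))^2 * I0 + 2 * (LINT \<xi>|lborel. (cmod (V \<xi>))^2)"
          unfolding I0_def
          by (subst integral_add[OF integrable_mult_right[OF sq_int_integrable[OF sq_int_cheb_ft]] integrable_mult_right[OF sq_int_integrable[OF V]]])
             (simp only: integral_mult_right_zero)
        then show ?thesis unfolding V_def integral_sum_half_ft .
      qed
      also have "\<dots> \<le> (2 * I0 + 4 * pi^2) * (wminus 0 * (cmod (a 0))^2) + (\<Sum>n<M. (2 * I0 + 4 * pi^2) * (wminus (Suc n) * (cmod (a (Suc n)))^2))"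
      proof (rule add_mono)
        have "wminus 0 = 1" by (simp add: wminus_def)
        moreover have "2 * I0 * (cmod (a 0))^2 \<le> (2 * I0 + 4 * pi^2) * (cmod (a 0))^2" by (intro mult_right_mono) auto
        ultimately show "2 * (cmod (a 0))^2 * I0 \<le> (2 * I0 + 4 * pi^2) * (wminus 0 * (cmod (a 0))^2)" by (simp add: mult_ac)
        show "2 * (\<Sum>n<M. pi^2 / real (Suc n) * (cmod (a (Suc n)))^2) \<le> (\<Sum>n<M. (2 * I0 + 4 * pi^2) * (wminus (Suc n) * (cmod (a (Suc n)))^2))"
          unfolding sum_distrib_left
        proof (rule sum_mono)
          fix n
          have "1 / real (Suc n) \<le> 2 * wminus (Suc n)"
          proof -
            have "wplus (Suc n) \<le> 2 * real (Suc n)" using wplus_ge(3)[of "Suc n"] by simp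
            then have "1 / real (Suc n) \<le> 2 / wplus (Suc n)" using wplus_pos[of "Suc n"] by (simp add: field_simps)
            then show ?thesis by (simp add: wminus_eq)
          qed
          then have "2 * pi^2 * (1 / real (Suc n)) \<le> 2 * pi^2 * (2 * wminus (Suc n))" by (intro mult_left_mono) auto
          also have "\<dots> \<le> (2 * I0 + 4 * pi^2) * wminus (Suc n)" using I0 wminus_pos[of "Suc n"] by (simp add: distrib_right)
          finally have "2 * pi^2 * (1 / real (Suc n)) * (cmod (a (Suc n)))^2 \<le> (2 * I0 + 4 * pi^2) * wminus (Suc n) * (cmod (a (Suc n)))^2"
            by (intro mult_right_mono) auto
          then show "2 * (pi^2 / real (Suc n) * (cmod (a (Suc n)))^2) \<le> (2 * I0 + 4 * pi^2) * (wminus (Suc n) * (cmod (a (Suc n)))^2)"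
            by (simp only: mult.assoc times_divide_eq_right mult_1_right times_divide_eq_left)
        qed
      qed
      also have "\<dots> = (2 * I0 + 4 * pi^2) * (\<Sum>n<N. wminus n * (cmod (a n))^2)"
        unfolding Suc sum.lessThan_Suc_shift by (simp only: distrib_left sum_distrib_left)
      finally show ?thesis .
    qed simp
  qed (use I0 in \<open>auto intro: sq_int_cheb_ft wminus_pos\<close>)
  then show ?thesis using that by blast
qed

text \<open>Near 0 the weight \<open>jw\<close> is not dominated by \<open>sqrt |\<xi>|\<close>, so
  orthogonality gives nothing there. Instead each term is of size \<open>2 pi / n\<close> by
  \<open>norm_cheb_ft_le_square\<close>, and Cauchy-Schwarz with the convergent sum of
  \<open>1 / n^2\<close> replaces it.\<close>

lemma cheb_ext_low_frequency:
  assumes "\<bar>\<xi>\<bar> < 1"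
  shows "(cmod (\<Sum>n<M. b n * cheb_ext (Suc n) \<xi>))^2 \<le> 4 * pi^2 * (\<Sum>n. 1 / (real (Suc n))^2) * (\<Sum>n<M. (cmod (b n))^2)"
proof -
  have sm: "summable (\<lambda>n. 1 / (real (Suc n))^2)"
    using inverse_power_summable[of 2, where 'a = real] by (subst summable_Suc_iff) (simp add: inverse_eq_divide)
  have t: "cmod (cheb_ext (Suc n) \<xi>) \<le> 2 * pi * (1 / real (Suc n))" for n
  proof -
    have "cmod (cheb_ext (Suc n) \<xi>) = real (Suc n) * (cmod (cheb_ft (Suc n) \<xi>) / \<bar>\<xi>\<bar>)"
      by (simp add: cheb_ext_def ext_num_def norm_mult norm_divide del: of_nat_Suc)
    also have "\<dots> \<le> real (Suc n) * (2 * pi / (real (Suc n))^2)"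
    proof (rule mult_left_mono)
      have "cmod (cheb_ft (Suc n) \<xi>) \<le> pi * (\<bar>\<xi>\<bar> * (1 + \<bar>\<xi>\<bar>)) / (real (Suc n))^2" by (rule norm_cheb_ft_le_square) simp
      also have "\<dots> \<le> pi * (\<bar>\<xi>\<bar> * 2) / (real (Suc n))^2" using assms by (intro divide_right_mono mult_left_mono) auto
      finally have "cmod (cheb_ft (Suc n) \<xi>) / \<bar>\<xi>\<bar> \<le> (pi * (\<bar>\<xi>\<bar> * 2) / (real (Suc n))^2) / \<bar>\<xi>\<bar>" by (intro divide_right_mono) auto
      also have "\<dots> \<le> 2 * pi / (real (Suc n))^2" by (cases "\<xi> = 0") (auto simp: mult.commute)
      finally show "cmod (cheb_ft (Suc n) \<xi>) / \<bar>\<xi>\<bar> \<le> 2 * pi / (real (Suc n))^2" .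
    qed simp
    also have "\<dots> = 2 * pi * (1 / real (Suc n))" by (simp add: power2_eq_square del: of_nat_Suc)
    finally show ?thesis .
  qed
  have "cmod (\<Sum>n<M. b n * cheb_ext (Suc n) \<xi>) \<le> (\<Sum>n<M. cmod (b n) * (2 * pi * (1 / real (Suc n))))"
    by (rule order_trans[OF norm_sum], unfold norm_mult, intro sum_mono mult_left_mono t norm_ge_zero)
  also have "\<dots> = 2 * pi * (\<Sum>n<M. cmod (b n) * (1 / real (Suc n)))"
    unfolding sum_distrib_left by (intro sum.cong refl) simp
  finally have "(cmod (\<Sum>n<M. b n * cheb_ext (Suc n) \<xi>))^2 \<le> (2 * pi * (\<Sum>n<M. cmod (b n) * (1 / real (Suc n))))^2"
    by (intro power_mono) auto
  also have "\<dots> = 4 * pi^2 * (\<Sum>n<M. cmod (b n) * (1 / real (Suc n)))^2" by (simp add: power_mult_distrib)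
  also have "\<dots> \<le> 4 * pi^2 * ((\<Sum>n<M. (cmod (b n))^2) * (\<Sum>n<M. (1 / real (Suc n))^2))"
    by (intro mult_left_mono Cauchy_Schwarz_ineq_sum) auto
  also have "\<dots> \<le> 4 * pi^2 * ((\<Sum>n<M. (cmod (b n))^2) * (\<Sum>n. 1 / (real (Suc n))^2))"
  proof (intro mult_left_mono)
    show "(\<Sum>n<M. (1 / real (Suc n))^2) \<le> (\<Sum>n. 1 / (real (Suc n))^2)"
      using sum_le_suminf[OF sm, of "{..<M}"] by (simp add: power_divide del: of_nat_Suc)
  qed (auto intro: sum_nonneg)
  finally show ?thesis by (simp add: mult_ac)
qed

text \<open>For \<open>|\<xi>| \<ge> 1\<close> the weight is comparable to \<open>|\<xi>|\<close>
  and the sum over \<open>n > 0\<close> becomes an orthogonal sum of \<open>half_ft\<close>; for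
  \<open>|\<xi>| < 1\<close> the pointwise bound is integrated over a set of finite length.\<close>

theorem bessel_system_plus:
  obtains C where "bessel_system lborel (\<lambda>n \<xi>. cpx (jw \<xi>) * cheb_ext n \<xi>) wplus C"
proof -
  let ?e = "\<lambda>n \<xi>. cpx (jw \<xi>) * cheb_ext n \<xi>"
  define I0 where "I0 = (LINT \<xi>|lborel. (cmod (?e 0 \<xi>))^2)"
  have I0: "I0 \<ge> 0" unfolding I0_def by (rule integral_nonneg) auto
  define S where "S = (\<Sum>n. 1 / (real (Suc n))^2)"
  have S: "S \<ge> 0" unfolding S_def
    using inverse_power_summable[of 2, where 'a = real]
    by (intro suminf_nonneg, subst summable_Suc_iff) (auto simp: inverse_eq_divide)
  \<comment> \<open>High frequencies give \<open>4 pi^2\<close>: a factor 2 from separating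
    \<open>n = 0\<close>, another from \<open>jw^2 \<le> 2 |\<xi>|\<close>. Low frequencies give
    \<open>32 pi^2 S\<close>: the same 2, \<open>jw^2 \<le> 2\<close>, the bound
    \<open>4 pi^2 S\<close>, and the interval length 2.\<close>
  define C where "C = 2 * I0 + 4 * pi^2 + 32 * pi^2 * S"
  have "bessel_system lborel ?e wplus C"
  proof
    fix a :: "nat \<Rightarrow> complex" and N
    show "(LINT \<xi>|lborel. (cmod (\<Sum>n<N. a n * ?e n \<xi>))^2) \<le> C * (\<Sum>n<N. wplus n * (cmod (a n))^2)"
    proof (cases N)
      case (Suc M)
      define V where "V \<xi> = (\<Sum>n<M. (cpx (real (Suc n)) * a (Suc n)) * half_ft n \<xi>)" for \<xi>
      have V: "sq_int lborel V" unfolding V_def by (intro sq_int_sum sq_int_cmult sq_int_half_ft)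
      define A where "A = (\<Sum>n<M. (cmod (a (Suc n)))^2)"
      have A: "A \<ge> 0" unfolding A_def by (intro sum_nonneg) auto
      let ?m = "\<lambda>\<xi>. 2 * (cmod (a 0))^2 * (cmod (?e 0 \<xi>))^2 + (4 * (cmod (V \<xi>))^2 + (16 * pi^2 * S * A) * indicator {-1<..<1} \<xi>)"
      have ind: "integrable lborel (indicator {-1<..<1} :: real \<Rightarrow> real)" by simp
      have i0: "integrable lborel (\<lambda>\<xi>. 2 * (cmod (a 0))^2 * (cmod (?e 0 \<xi>))^2)"
        by (intro integrable_mult_right sq_int_integrable sq_int_cheb_ext)
      have i1: "integrable lborel (\<lambda>\<xi>. 4 * (cmod (V \<xi>))^2)" by (intro integrable_mult_right sq_int_integrable V)
      have i2: "integrable lborel (\<lambda>\<xi>. (16 * pi^2 * S * A) * indicator {-1<..<1} (\<xi>::real))" using ind by (rule integrable_mult_right)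
      have "(LINT \<xi>|lborel. (cmod (\<Sum>n<N. a n * ?e n \<xi>))^2) \<le> (LINT \<xi>|lborel. ?m \<xi>)"
      proof (rule integral_mono_AE)
        show "integrable lborel (\<lambda>\<xi>. (cmod (\<Sum>n<N. a n * ?e n \<xi>))^2)"
          by (intro sq_int_integrable sq_int_sum sq_int_cmult sq_int_cheb_ext)
        show "integrable lborel ?m" by (intro integrable_add i0 i1 i2)
        show "AE \<xi> in lborel. (cmod (\<Sum>n<N. a n * ?e n \<xi>))^2 \<le> ?m \<xi>"
          using AE_lborel_singleton[of 0]
        proof eventually_elim
          case (elim \<xi>)
          define T where "T = (\<Sum>n<M. a (Suc n) * cheb_ext (Suc n) \<xi>)"
          have "(\<Sum>n<N. a n * ?e n \<xi>) = a 0 * ?e 0 \<xi> + (\<Sum>n<M. a (Suc n) * ?e (Suc n) \<xi>)"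
            unfolding Suc by (rule sum.lessThan_Suc_shift)
          also have "(\<Sum>n<M. a (Suc n) * ?e (Suc n) \<xi>) = cpx (jw \<xi>) * T"
            unfolding T_def sum_distrib_left by (intro sum.cong refl) (simp only: mult_ac)
          finally have "(cmod (\<Sum>n<N. a n * ?e n \<xi>))^2 \<le> 2 * (cmod (a 0 * ?e 0 \<xi>))^2 + 2 * (cmod (cpx (jw \<xi>) * T))^2"
            by (simp only: norm_add_square_le)
          moreover have "(cmod (cpx (jw \<xi>) * T))^2 \<le> 2 * (cmod (V \<xi>))^2 + (8 * pi^2 * S * A) * indicator {-1<..<1} \<xi>"
          proof -
            have n: "(cmod (cpx (jw \<xi>) * T))^2 = (jw \<xi>)^2 * (cmod T)^2" by (simp add: norm_mult power_mult_distrib)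
            show ?thesis
            proof (cases "\<bar>\<xi>\<bar> < 1")
              case True
              have "(cmod T)^2 \<le> 4 * pi^2 * S * A" unfolding T_def S_def A_def by (rule cheb_ext_low_frequency[OF True])
              then have "(jw \<xi>)^2 * (cmod T)^2 \<le> 2 * (4 * pi^2 * S * A)"
                using jw_square_bounds(2)[of \<xi>] True by (intro mult_mono) auto
              moreover have "indicator {-1<..<1} \<xi> = (1::real)" using True by (auto simp: abs_less_iff)
              ultimately show ?thesis unfolding n by (simp add: add_increasing)
            next
              case False
              have "cpx (sqrt \<bar>\<xi>\<bar>) * T = V \<xi>"
                unfolding V_def T_def sum_distrib_left
              proof (intro sum.cong refl)
                fix n
                define q r h where "q = cpx (sqrt \<bar>\<xi>\<bar>)" and "r = cpx \<bar>\<xi>\<bar>" and "h = half_ft n \<xi>"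
                have qq: "q * q = r" by (simp add: q_def r_def flip: of_real_mult)
                have r0: "r \<noteq> 0" using elim by (simp add: r_def)
                have "cheb_ext (Suc n) \<xi> = cpx (real (Suc n)) * (q * h) / r"
                  using elim by (simp add: cheb_ext_def ext_num_def sqrt_abs_mult q_def r_def h_def del: of_nat_Suc)
                then have "q * (a (Suc n) * cheb_ext (Suc n) \<xi>) = cpx (real (Suc n)) * a (Suc n) * h * (q * q) / r"
                  by (simp add: mult_ac del: of_nat_Suc)
                also have "\<dots> = cpx (real (Suc n)) * a (Suc n) * h"
                  using r0 unfolding qq by simp
                finally show "cpx (sqrt \<bar>\<xi>\<bar>) * (a (Suc n) * cheb_ext (Suc n) \<xi>) = cpx (real (Suc n)) * a (Suc n) * half_ft n \<xi>"
                  unfolding q_def h_def .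
              qed
              then have "(cmod (V \<xi>))^2 = \<bar>\<xi>\<bar> * (cmod T)^2" by (simp add: norm_mult power_mult_distrib flip: \<open>cpx (sqrt \<bar>\<xi>\<bar>) * T = V \<xi>\<close>)
              moreover have "(jw \<xi>)^2 * (cmod T)^2 \<le> (2 * \<bar>\<xi>\<bar>) * (cmod T)^2"
                using jw_square_bounds(2)[of \<xi>] False by (intro mult_right_mono) auto
              moreover have "0 \<le> (8 * pi^2 * S * A) * indicator {-1<..<1} \<xi>" using S A by simp
              ultimately show ?thesis unfolding n by linarith
            qed
          qed
          moreover have "(cmod (a 0 * ?e 0 \<xi>))^2 = (cmod (a 0))^2 * (cmod (?e 0 \<xi>))^2" by (simp only: norm_mult power_mult_distrib)
          ultimately show ?case by linarith
        qed
      qed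
      also have "\<dots> = 2 * (cmod (a 0))^2 * I0 + (4 * (LINT \<xi>|lborel. (cmod (V \<xi>))^2) + (16 * pi^2 * S * A) * 2)"
        unfolding integral_add[OF i0 integrable_add[OF i1 i2]] integral_add[OF i1 i2]
        by (simp only: integral_mult_right_zero I0_def) simp
      also have "\<dots> = 2 * I0 * (cmod (a 0))^2 + (\<Sum>n<M. (4 * pi^2 * real (Suc n) + 32 * pi^2 * S) * (cmod (a (Suc n)))^2)"
      proof -
        have "(LINT \<xi>|lborel. (cmod (V \<xi>))^2) = (\<Sum>n<M. pi^2 / real (Suc n) * (cmod (cpx (real (Suc n)) * a (Suc n)))^2)"
          unfolding V_def by (rule integral_sum_half_ft)
        also have "\<dots> = (\<Sum>n<M. pi^2 * real (Suc n) * (cmod (a (Suc n)))^2)"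
          by (intro sum.cong refl) (simp add: norm_mult power_mult_distrib power2_eq_square del: of_nat_Suc)
        finally show ?thesis unfolding A_def by (simp add: sum_distrib_left distrib_right distrib_left sum.distrib mult_ac del: of_nat_Suc)
      qed
      also have "\<dots> \<le> C * (wplus 0 * (cmod (a 0))^2) + (\<Sum>n<M. C * (wplus (Suc n) * (cmod (a (Suc n)))^2))"
      proof (intro add_mono sum_mono)
        have "2 * I0 \<le> C * wplus 0" using S by (simp add: C_def wplus_def)
        then have "2 * I0 * (cmod (a 0))^2 \<le> C * wplus 0 * (cmod (a 0))^2" by (intro mult_right_mono) auto
        then show "2 * I0 * (cmod (a 0))^2 \<le> C * (wplus 0 * (cmod (a 0))^2)" by (simp only: mult.assoc)
        fix n
        have "4 * pi^2 * real (Suc n) + 32 * pi^2 * S * 1 \<le> 4 * pi^2 * wplus (Suc n) + 32 * pi^2 * S * wplus (Suc n)"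
          using S wplus_ge[of "Suc n"] by (intro add_mono mult_left_mono) auto
        also have "\<dots> \<le> C * wplus (Suc n)" using I0 wplus_pos[of "Suc n"] by (simp add: C_def distrib_right)
        finally have "(4 * pi^2 * real (Suc n) + 32 * pi^2 * S) * (cmod (a (Suc n)))^2 \<le> C * wplus (Suc n) * (cmod (a (Suc n)))^2"
          by (intro mult_right_mono) auto
        then show "(4 * pi^2 * real (Suc n) + 32 * pi^2 * S) * (cmod (a (Suc n)))^2 \<le> C * (wplus (Suc n) * (cmod (a (Suc n)))^2)"
          by (simp only: mult.assoc)
      qed
      also have "\<dots> = C * (\<Sum>n<N. wplus n * (cmod (a n))^2)"
        unfolding Suc sum.lessThan_Suc_shift by (simp only: distrib_left sum_distrib_left)
      finally show ?thesis .
    qed simp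
  qed (use I0 S in \<open>auto intro: sq_int_cheb_ext wplus_pos simp: C_def\<close>)
  then show ?thesis using that by blast
qed

section \<open>Distributions supported in the closed segment\<close>

text \<open>Elements of \<open>L2w\<close> are measurable and meaningful only inside the segment.
  Their truncation is a function on the line to which the results on \<open>cheb_measure\<close>
  apply, and equality of truncations is equality for all purposes of the weighted space.\<close>

definition tr :: "(real \<Rightarrow> complex) \<Rightarrow> real \<Rightarrow> complex" where
  "tr u x = indicator {-1<..<1} x *\<^sub>R u x"

lemma tr_open: "x \<in> {-1<..<1} \<Longrightarrow> tr u x = u x"
  by (simp add: tr_def)

lemma density_cheb_measure:
  fixes f :: "real \<Rightarrow> 'a :: {banach, second_countable_topology}"
  assumes "f \<in> borel_measurable borel"
  shows "integrable cheb_measure f \<longleftrightarrow> integrable lborel (\<lambda>x. (indicator {-1<..<1} x / weight x) *\<^sub>R f x)" (is ?A)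
    and "(LINT x|cheb_measure. f x) = (LINT x|lborel. (indicator {-1<..<1} x / weight x) *\<^sub>R f x)" (is ?B)
proof -
  have nn: "AE x in lborel. 0 \<le> indicator {-1<..<1} x / weight x"
    using weight_pos by (intro AE_I2) (auto simp: less_imp_le split: split_indicator)
  show ?A
    unfolding cheb_measure_def by (rule integrable_density) (use nn assms in auto)
  show ?B
    unfolding cheb_measure_def by (rule integral_density) (use nn assms in auto)
qed

lemma L2w_iff: "u \<in> L2w \<longleftrightarrow> sq_int cheb_measure (tr u)"
proof (cases "tr u \<in> borel_measurable borel")
  case True
  then have m: "(\<lambda>x. (cmod (tr u x))^2) \<in> borel_measurable borel" by measurable
  have "integrable cheb_measure (\<lambda>x. (cmod (tr u x))^2) \<longleftrightarrow> set_integrable lborel {-1<..<1} (\<lambda>x. (cmod (u x))^2 / weight x)"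
    unfolding set_integrable_def
    unfolding density_cheb_measure(1)[OF m]
    by (rule Bochner_Integration.integrable_cong) (auto simp: tr_def split: split_indicator)
  then show ?thesis using True by (simp add: L2w_def sq_int_def set_borel_measurable_def tr_def[abs_def])
next
  case False
  moreover have "borel_measurable cheb_measure = (borel_measurable borel :: (real \<Rightarrow> complex) set)" by (rule measurable_cong_sets) simp_all
  ultimately show ?thesis by (simp add: L2w_def sq_int_def set_borel_measurable_def tr_def[abs_def])
qed

lemma sq_int_tr: "sq_int cheb_measure f \<Longrightarrow> sq_int cheb_measure (tr f)"
  unfolding tr_def[abs_def] scaleR_conv_of_real
  by (rule sq_int_mult_bounded[where B = 1]) (auto split: split_indicator)

lemma sq_int_L2w: "sq_int cheb_measure f \<Longrightarrow> f \<in> L2w"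
  by (simp add: L2w_iff sq_int_tr)

lemma AE_tr: "AE x in cheb_measure. tr f x = f x"
  using AE_cheb_measure_open by eventually_elim (rule tr_open)

lemma integral_tr_mult:
  assumes "f \<in> borel_measurable borel" "g \<in> borel_measurable borel"
  shows "(LINT x|cheb_measure. tr f x * g x) = (LINT x|cheb_measure. f x * g x)"
proof (rule integral_cong_AE)
  show "AE x in cheb_measure. tr f x * g x = f x * g x" using AE_tr[of f] by eventually_elim simp
qed (use assms in \<open>auto simp: tr_def[abs_def]\<close>)

lemma innerw_eq:
  assumes "u \<in> L2w" "v \<in> L2w"
  shows "innerw u v = cpx (1 / pi) * (LINT x|cheb_measure. tr u x * cnj (tr v x))"
proof -
  have "(\<lambda>x. tr u x * cnj (tr v x)) \<in> borel_measurable borel"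
    using sq_int_measurable[of cheb_measure "tr u"] sq_int_measurable[OF sq_int_cnj, of cheb_measure "tr v"] assms by (auto simp: L2w_iff)
  then show ?thesis
    unfolding innerw_def set_lebesgue_integral_def
    by (subst density_cheb_measure) (auto simp: tr_def scaleR_conv_of_real intro!: Bochner_Integration.integral_cong split: split_indicator)
qed

lemma tr_cheb: "tr (cheb n) = tr (ctp n)"
  by (auto simp: fun_eq_iff tr_def cheb_eq_tpoly split: split_indicator)

lemma tr_cong: "(\<And>x. x \<in> {-1<..<1} \<Longrightarrow> f x = g x) \<Longrightarrow> tr f = tr g"
  by (auto simp: fun_eq_iff tr_def split: split_indicator)


lemma tpoly_L2w: "ctp n \<in> L2w" by (rule sq_int_L2w[OF sq_int_tpoly])

lemma cheb_L2w: "cheb n \<in> L2w" using tpoly_L2w[of n] by (simp add: L2w_iff tr_cheb)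

lemma innerw_cong: "tr u = tr u' \<Longrightarrow> tr v = tr v' \<Longrightarrow> innerw u v = innerw u' v'"
proof -
  assume "tr u = tr u'" "tr v = tr v'"
  then have "u x = u' x" "v x = v' x" if "x \<in> {-1<..<1}" for x
    using that by (metis tr_open)+
  then show ?thesis unfolding innerw_def set_lebesgue_integral_def
    by (intro arg_cong2[where f = "(*)"] refl Bochner_Integration.integral_cong) (auto split: split_indicator)
qed

lemma innerw_cheb:
  assumes "u \<in> L2w"
  shows "innerw u (cheb n) = cpx (1 / pi) * (LINT x|cheb_measure. tr u x * ctp n x)"
proof -
  have "innerw u (cheb n) = innerw u (ctp n)" by (rule innerw_cong) (simp_all add: tr_cheb)
  also have "\<dots> = cpx (1 / pi) * (LINT x|cheb_measure. tr (ctp n) x * tr u x)"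
  proof -
    have "tr u x * cnj (tr (ctp n) x) = tr (ctp n) x * tr u x" for x by (simp add: tr_def)
    then show ?thesis unfolding innerw_eq[OF assms tpoly_L2w] by (simp only:)
  qed
  also have "(LINT x|cheb_measure. tr (ctp n) x * tr u x) = (LINT x|cheb_measure. ctp n x * tr u x)"
    by (rule integral_tr_mult) (use sq_int_measurable[of cheb_measure "tr u"] assms in \<open>auto simp: L2w_iff\<close>)
  finally show ?thesis by (simp add: mult.commute)
qed

lemma innerw_cheb_cheb: "innerw (cheb m) (cheb n) = (if m = n then cpx (1 / (pi * cheb_const n)) else 0)"
proof -
  have "(LINT x|cheb_measure. tr (cheb m) x * ctp n x) = (LINT x|cheb_measure. ctp m x * ctp n x)"
    unfolding tr_cheb by (rule integral_tr_mult) auto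
  then show ?thesis unfolding innerw_cheb[OF cheb_L2w] integral_ctp_mult by simp
qed

lemma cheb_coeff_eq:
  assumes "u \<in> L2w"
  shows "cheb_coeff u n = cpx (cheb_const n) * (LINT x|cheb_measure. tr u x * ctp n x)"
  unfolding cheb_coeff_def innerw_cheb[OF assms] innerw_cheb_cheb using cheb_const_pos[of n] by simp

lemma cheb_coeff_sq_int:
  assumes "sq_int cheb_measure u"
  shows "cheb_coeff u n = cpx (cheb_const n) * (LINT x|cheb_measure. u x * ctp n x)"
  unfolding cheb_coeff_eq[OF sq_int_L2w[OF assms]]
  using sq_int_measurable[OF assms] by (subst integral_tr_mult) auto

lemma cheb_coeff_ctp: "cheb_coeff (ctp m) n = (if n = m then 1 else 0)"
  unfolding cheb_coeff_sq_int[OF sq_int_tpoly] integral_ctp_mult using cheb_const_pos[of n] by auto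

lemma cheb_coeff_cong: "tr u = tr v \<Longrightarrow> cheb_coeff u = cheb_coeff v"
  by (rule ext) (simp only: cheb_coeff_def innerw_cong[OF _ refl, of u v])

lemma cheb_const_le_1: "cheb_const n \<le> 1"
  using pi_gt3 by (simp add: cheb_const_def)

lemma cheb_coeff_summable:
  assumes "u \<in> L2w"
  shows "summable (\<lambda>n. (cmod (cheb_coeff u n))^2)"
proof (rule summable_comparison_test')
  show "summable (\<lambda>n. (cmod (LINT x|cheb_measure. tr u x * ctp n x))^2)"
    using assms cheb_parseval(1)[of "tr u"] by (simp add: L2w_iff)
  show "norm ((cmod (cheb_coeff u n))^2) \<le> (cmod (LINT x|cheb_measure. tr u x * ctp n x))^2" for n
  proof -
    have "cmod (cheb_coeff u n) = cheb_const n * cmod (LINT x|cheb_measure. tr u x * ctp n x)"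
      using cheb_const_pos[of n] by (simp add: cheb_coeff_eq[OF assms] norm_mult)
    also have "\<dots> \<le> cmod (LINT x|cheb_measure. tr u x * ctp n x)"
      using cheb_const_pos[of n] cheb_const_le_1[of n] by (intro mult_left_le_one_le) auto
    finally show ?thesis by (simp add: power_mono)
  qed
qed

lemma summable_imp_minus: "summable (\<lambda>n. (cmod (a n))^2) \<Longrightarrow> summable (\<lambda>n. wminus n * (cmod (a n))^2)"
  by (rule summable_comparison_test') (use wminus_le_1 wminus_pos in \<open>auto simp: less_imp_le intro!: mult_left_le_one_le\<close>)

lemma summable_plus_imp: "summable (\<lambda>n. wplus n * (cmod (a n))^2) \<Longrightarrow> summable (\<lambda>n. (cmod (a n))^2)"
proof (rule summable_comparison_test')
  fix n
  have "1 * (cmod (a n))^2 \<le> wplus n * (cmod (a n))^2" using wplus_ge(1) by (intro mult_right_mono) auto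
  then show "norm ((cmod (a n))^2) \<le> wplus n * (cmod (a n))^2" by simp
qed

lemma cheb_series_coeff_exists:
  assumes a: "summable (\<lambda>n. (cmod (a n))^2)"
  shows "\<exists>u. sq_int cheb_measure u \<and> cheb_coeff u = a \<and>
    (\<forall>v. sq_int cheb_measure v \<longrightarrow> (\<lambda>n. a n * (LINT x|cheb_measure. ctp n x * v x)) sums (LINT x|cheb_measure. u x * v x))"
proof (rule cheb_series_exists[OF a])
  fix u assume u: "sq_int cheb_measure u"
    "\<And>n. cpx (cheb_const n) * (LINT x|cheb_measure. u x * ctp n x) = a n"
    "\<And>v. sq_int cheb_measure v \<Longrightarrow> (\<lambda>n. a n * (LINT x|cheb_measure. ctp n x * v x)) sums (LINT x|cheb_measure. u x * v x)"
  have "cheb_coeff u = a" by (rule ext) (simp only: cheb_coeff_sq_int[OF u(1)] u(2))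
  then show ?thesis using u(1,3) by (intro exI[of _ u] conjI allI impI)
qed

lemma cheb_space_minus: "cheb_space (- 1 / 2) = {a. summable (\<lambda>n. wminus n * (cmod (a n))^2)}"
  by (simp add: cheb_space_def wminus_def)

text \<open>By Riesz-Fischer every such sequence consists of the coefficients of a function of
  \<open>L2w\<close>; both spaces of the theorem are thereby plain weighted \<open>l^2\<close>
  spaces.\<close>

lemma cheb_space_plus: "cheb_space (1 / 2) = {a. summable (\<lambda>n. wplus n * (cmod (a n))^2)}"
proof -
  have "a \<in> cheb_coeff ` L2w" if s: "summable (\<lambda>n. wplus n * (cmod (a n))^2)" for a
  proof -
    obtain u where "sq_int cheb_measure u" "cheb_coeff u = a"
      using cheb_series_coeff_exists[OF summable_plus_imp[OF s]] by (elim exE conjE)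
    then show ?thesis using sq_int_L2w by (intro image_eqI[of _ _ u]) auto
  qed
  then show ?thesis by (auto simp: cheb_space_def wplus_def)
qed

lemma cheb_norm_minus: "cheb_norm (- 1 / 2) a = sqrt (\<Sum>n. wminus n * (cmod (a n))^2)"
  by (simp add: cheb_norm_def wminus_def)

lemma cheb_norm_plus: "cheb_norm (1 / 2) a = sqrt (\<Sum>n. wplus n * (cmod (a n))^2)"
  by (simp add: cheb_norm_def wplus_def)

section \<open>Pairings on the Fourier side and Sobolev norms\<close>

lemma lborel_reflect:
  fixes f :: "real \<Rightarrow> 'a :: {banach, second_countable_topology}"
  shows "(LINT \<xi>|lborel. f (- \<xi>)) = (LINT \<xi>|lborel. f \<xi>)" and "integrable lborel f \<Longrightarrow> integrable lborel (\<lambda>\<xi>. f (- \<xi>))"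
  using lborel_integral_real_affine[of "-1" f 0] lborel_integrable_real_affine[of f "-1" 0] by simp_all

lemma sq_int_reflect: "sq_int lborel f \<Longrightarrow> sq_int lborel (\<lambda>\<xi>::real. f (- \<xi>))"
  unfolding sq_int_def using lborel_reflect(2)[of "\<lambda>\<xi>::real. (cmod (f \<xi>))^2"] by auto

lemma inv_fourier_measurable: "\<phi> \<in> test_funs I \<Longrightarrow> inv_fourier \<phi> \<in> borel_measurable borel"
  by (intro borel_measurable_continuous_onI inv_fourier_continuous)

lemma one_plus_square_ge: "(1 + \<bar>\<xi>\<bar>)^2 \<le> 2 * (1 + \<xi>^2)" for \<xi> :: real
  using two_mult_le_squares[of 1 "\<bar>\<xi>\<bar>"] by (simp add: power2_sum)

lemma sq_int_jw_decay:
  assumes q: "q \<in> borel_measurable borel" and C: "\<And>\<xi>. cmod (q \<xi>) \<le> C * decay \<xi>"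
  shows "sq_int lborel (\<lambda>\<xi>. cpx (jw \<xi>) * q \<xi>)"
proof (rule sq_int_bound)
  show "integrable lborel (\<lambda>\<xi>::real. C^2 * (1 + \<bar>\<xi>\<bar>) powr (- (5/3)))"
    by (intro integrable_mult_right integrable_one_plus_abs_powr) simp
  show "AE \<xi> in lborel. (cmod (cpx (jw \<xi>) * q \<xi>))^2 \<le> C^2 * (1 + \<bar>\<xi>\<bar>) powr (- (5/3))"
  proof (rule AE_I2)
    fix \<xi> :: real
    have "(cmod (cpx (jw \<xi>) * q \<xi>))^2 = (jw \<xi>)^2 * (cmod (q \<xi>))^2"
      by (simp add: norm_mult power_mult_distrib)
    also have "\<dots> \<le> (1 + \<bar>\<xi>\<bar>) * (C * decay \<xi>)^2"
      using C[of \<xi>] jw_square_bounds(2)[of \<xi>] by (intro mult_mono power_mono) auto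
    also have "\<dots> = C^2 * ((1 + \<bar>\<xi>\<bar>) powr 1 * (decay \<xi>)^2)" by (simp add: power_mult_distrib)
    also have "(1 + \<bar>\<xi>\<bar>) powr 1 * (decay \<xi>)^2 = (1 + \<bar>\<xi>\<bar>) powr (- (5/3))"
      unfolding power2_eq_square by (simp only: flip: powr_add) simp
    finally show "(cmod (cpx (jw \<xi>) * q \<xi>))^2 \<le> C^2 * (1 + \<bar>\<xi>\<bar>) powr (- (5/3))" .
  qed
qed (use q in measurable)

lemma inverse_square_decay: "1 / (1 + \<xi>^2) \<le> 2 * decay \<xi>" for \<xi> :: real
proof -
  have p: "0 < 1 + \<xi>^2" by (simp add: add_pos_nonneg)
  have "1 / (1 + \<xi>^2) \<le> 2 / (1 + \<bar>\<xi>\<bar>)^2" using one_plus_square_ge[of \<xi>] p by (simp add: field_simps)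
  also have "\<dots> = 2 * (1 + \<bar>\<xi>\<bar>) powr (-2)" by (simp add: powr_minus_divide)
  also have "\<dots> \<le> 2 * decay \<xi>" by (intro mult_left_mono powr_mono) auto
  finally show ?thesis .
qed

lemma inv_fourier_decay':
  assumes "\<phi> \<in> test_funs I"
  obtains C where "C \<ge> 0" "\<And>\<xi>. cmod (inv_fourier \<phi> \<xi>) \<le> C * decay \<xi>"
proof -
  obtain C where C: "C \<ge> 0" "\<And>\<xi>. cmod (inv_fourier \<phi> \<xi>) \<le> C / (1 + \<xi>^2)" using inv_fourier_decay[OF assms] by blast
  have "cmod (inv_fourier \<phi> \<xi>) \<le> (2 * C) * decay \<xi>" for \<xi>
    using C(2)[of \<xi>] mult_left_mono[OF inverse_square_decay[of \<xi>] C(1)] by simp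
  then show ?thesis using that[of "2 * C"] C(1) by simp
qed

lemma sq_int_jw_inv_fourier: "\<phi> \<in> test_funs I \<Longrightarrow> sq_int lborel (\<lambda>\<xi>. cpx (jw \<xi>) * inv_fourier \<phi> \<xi>)"
  using inv_fourier_decay'[of \<phi> I] inv_fourier_measurable[of \<phi> I] sq_int_jw_decay[of "inv_fourier \<phi>"] by metis

lemma integrable_decay:
  assumes q: "q \<in> borel_measurable borel" and C: "\<And>\<xi>. cmod (q \<xi>) \<le> C * decay \<xi>"
  shows "integrable lborel q"
proof (rule integrable_bound)
  show "integrable lborel (\<lambda>\<xi>::real. C * decay \<xi>)"
    using integrable_mult_right[OF integrable_one_plus_abs_powr[of "4/3"], of C] by simp
qed (use q C in \<open>auto intro!: AE_I2 order_trans[OF C]\<close>)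

lemma integrable_inv_fourier: "\<phi> \<in> test_funs I \<Longrightarrow> integrable lborel (inv_fourier \<phi>)"
  using inv_fourier_decay'[of \<phi> I] inv_fourier_measurable[of \<phi> I] integrable_decay[of "inv_fourier \<phi>"] by metis

text \<open>Shows that an integrable density has its classical transform as transform in the sense
  of \<open>sobolev_fourier\<close>. It is \<open>fourier_parseval\<close> with \<open>G\<close> a
  test function.\<close>

theorem fourier_pairing:
  assumes m: "integrable lborel m" and \<phi>: "\<phi> \<in> test_funs I"
  shows "(LINT \<xi>|lborel. (LINT x|lborel. cis (- x * \<xi>) * m x) * inv_fourier \<phi> \<xi>) = (LINT x|lborel. m x * \<phi> x)"
proof -
  obtain B where B: "\<And>x. cmod (\<phi> x) \<le> B" using test_funs_bounded_integrable(2)[OF \<phi>] by blast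
  define U V where "U x = (LINT \<zeta>|lborel. cis (\<zeta> * x) * m \<zeta>)" and "V x = (LINT \<eta>|lborel. cis (- \<eta> * x) * \<phi> \<eta>)" for x
  have V: "V \<xi> = 2 * pi * inv_fourier \<phi> (- \<xi>)" for \<xi> by (simp add: V_def inv_fourier_def)
  have Uc: "continuous_on UNIV U" unfolding U_def
    by (rule continuous_oscillatory_integral[OF m, where Z = "\<lambda>x. x"]) simp
  have UV: "integrable lborel (\<lambda>x. U x * V x)"
  proof (rule integrable_bounded_mult)
    show "integrable lborel V" unfolding V[abs_def] by (intro integrable_mult_right lborel_reflect(2)[OF integrable_inv_fourier[OF \<phi>]])
    show "U \<in> borel_measurable lborel" using borel_measurable_continuous_onI[OF Uc] by simp
    show "cmod (U \<xi>) \<le> (LINT x|lborel. cmod (m x))" for \<xi> unfolding U_def by (rule norm_oscillatory_integral_le)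
  qed
  have "AE \<zeta> in lborel. isCont \<phi> \<zeta>"
    using smooth_continuous[OF test_funs_smooth[OF \<phi>], of UNIV] by (auto simp: continuous_on_eq_continuous_at)
  from fourier_parseval[OF m test_funs_bounded_integrable(1)[OF \<phi>] B this UV[unfolded U_def V_def]]
  have P: "(LINT x|lborel. U x * V x) = 2 * pi * (LINT x|lborel. m x * \<phi> x)" unfolding U_def V_def .
  have "(LINT \<xi>|lborel. (LINT x|lborel. cis (- x * \<xi>) * m x) * inv_fourier \<phi> \<xi>) = (LINT \<xi>|lborel. U (- \<xi>) * inv_fourier \<phi> \<xi>)"
    by (simp add: U_def)
  also have "\<dots> = (LINT \<xi>|lborel. U \<xi> * inv_fourier \<phi> (- \<xi>))"
    using lborel_reflect(1)[of "\<lambda>\<xi>. U \<xi> * inv_fourier \<phi> (- \<xi>)"] by simp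
  also have "\<dots> = (LINT \<xi>|lborel. (U \<xi> * V \<xi>) / (2 * pi))" unfolding V by simp
  also have "\<dots> = (LINT x|lborel. m x * \<phi> x)" unfolding integral_divide_zero P by simp
  finally show ?thesis .
qed

definition test_coeff :: "(real \<Rightarrow> complex) \<Rightarrow> nat \<Rightarrow> complex" where
  "test_coeff \<phi> n = (LINT x|cheb_measure. ctp n x * \<phi> x)"

lemma integral_weighted:
  fixes f h :: "real \<Rightarrow> complex"
  assumes "f \<in> borel_measurable borel" "h \<in> borel_measurable borel"
  shows "(LINT x|lborel. (indicator {-1<..<1} x * (f x / cpx (weight x))) * h x) = (LINT x|cheb_measure. f x * h x)"
    and "integrable lborel (\<lambda>x. (indicator {-1<..<1} x * (f x / cpx (weight x))) * h x) \<longleftrightarrow> integrable cheb_measure (\<lambda>x. f x * h x)"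
  using assms by (subst density_cheb_measure; auto simp: scaleR_conv_of_real mult_ac complex_of_real_indicator)+

lemma fourier_weighted:
  assumes f: "sq_int cheb_measure f"
  shows "integrable lborel (\<lambda>x. indicator {-1<..<1} x * (f x / cpx (weight x)))" (is ?A)
    and "(LINT x|lborel. cis (- x * \<xi>) * (indicator {-1<..<1} x * (f x / cpx (weight x)))) = (LINT x|cheb_measure. f x * cis (- x * \<xi>))" (is ?B)
proof -
  have fm: "f \<in> borel_measurable borel" using sq_int_measurable[OF f] by simp
  show ?A
    using integral_weighted(2)[OF fm, of "\<lambda>_. 1"] sq_int_cheb_integrable[OF f] by simp
  have "(\<lambda>x. cis (- x * \<xi>)) \<in> borel_measurable borel" by measurable
  from integral_weighted(1)[OF fm this]
  show ?B
    by (simp add: mult.commute)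
qed

lemma cheb_ft_eq: "cheb_ft n \<xi> = (LINT x|cheb_measure. ctp n x * cis (- x * \<xi>))"
proof -
  have "(\<lambda>x. ctp n x * cis (- x * \<xi>)) \<in> borel_measurable borel" by measurable
  from integral_cheb_measure(1)[OF this] show ?thesis
    by (simp add: cheb_ft_def tpoly_cos mult.commute)
qed

lemma cheb_ft_pairing:
  assumes \<phi>: "\<phi> \<in> test_funs I"
  shows "(LINT \<xi>|lborel. cheb_ft n \<xi> * inv_fourier \<phi> \<xi>) = test_coeff \<phi> n"
proof -
  note F = fourier_weighted[OF sq_int_tpoly[of n]]
  have "(LINT \<xi>|lborel. cheb_ft n \<xi> * inv_fourier \<phi> \<xi>) = (LINT x|lborel. (indicator {-1<..<1} x * (ctp n x / cpx (weight x))) * \<phi> x)"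
    using fourier_pairing[OF F(1) \<phi>] unfolding F(2) cheb_ft_eq .
  also have "\<dots> = test_coeff \<phi> n"
    unfolding test_coeff_def using test_funs_measurable[OF \<phi>] by (intro integral_weighted) auto
  finally show ?thesis .
qed

text \<open>Fubini and \<open>fourier_cheb_ext\<close>: test functions of the open segment see only
  the part of the extension where it equals \<open>T_n\<close>.\<close>

lemma cheb_ext_pairing:
  assumes \<phi>: "\<phi> \<in> test_funs {-1<..<1}"
  shows "(LINT \<xi>|lborel. cheb_ext n \<xi> * inv_fourier \<phi> \<xi>) = (LINT x|lborel. ctp n x * \<phi> x)"
proof -
  have \<phi>0: "\<phi> x = 0" if "x \<notin> {-1<..<1}" for x using \<phi> that by (auto simp: test_funs_def)
  have "(LINT \<xi>|lborel. cheb_ext n \<xi> * inv_fourier \<phi> \<xi>) = (LINT \<xi>|lborel. cpx (1 / (2 * pi)) * (cheb_ext n \<xi> * (LINT x|lborel. cis (x * \<xi>) * \<phi> x)))"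
    by (simp add: inv_fourier_def mult_ac)
  also have "\<dots> = cpx (1 / (2 * pi)) * (LINT x|lborel. \<phi> x * (LINT \<xi>|lborel. cis (x * \<xi>) * cheb_ext n \<xi>))"
    unfolding integral_mult_right_zero
    by (subst Fubini_kernel(1)[OF sigma_finite_lborel sigma_finite_lborel integrable_cheb_ext test_funs_bounded_integrable(1)[OF \<phi>], where B = 1]) auto
  also have "(LINT x|lborel. \<phi> x * (LINT \<xi>|lborel. cis (x * \<xi>) * cheb_ext n \<xi>)) = (LINT x|lborel. cpx (2 * pi) * (ctp n x * \<phi> x))"
  proof (intro int_cong)
    fix x
    show "\<phi> x * (LINT \<xi>|lborel. cis (x * \<xi>) * cheb_ext n \<xi>) = cpx (2 * pi) * (ctp n x * \<phi> x)"
      using fourier_cheb_ext[of x n] \<phi>0[of x] by (cases "x \<in> {-1<..<1}") auto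
  qed
  finally show ?thesis unfolding integral_mult_right_zero by simp
qed

text \<open>Explicit form of \<open>\<alpha> \<mapsto> \<alpha> / \<omega>\<close> in coefficients,
  later identified with \<open>div_weight\<close>.\<close>

definition div_map :: "(nat \<Rightarrow> complex) \<Rightarrow> dist" where
  "div_map a = (\<lambda>\<phi>. if \<phi> \<in> test_funs UNIV then (\<Sum>n. a n * test_coeff \<phi> n) else 0)"

lemma test_coeff_outside:
  assumes "\<phi> \<in> test_funs (- {-1..1})"
  shows "test_coeff \<phi> n = 0"
proof -
  have "\<phi> x = 0" if "x \<in> {-1<..<1}" for x
  proof -
    have "x \<notin> - {-1..1}" using that by auto
    then show ?thesis using assms unfolding test_funs_def by blast
  qed
  then have "AE x in cheb_measure. ctp n x * \<phi> x = 0"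
    using AE_cheb_measure_open by (auto elim: eventually_mono)
  then show ?thesis unfolding test_coeff_def
    by (rule integral_eq_zero_AE)
qed

lemma sobolev_norm_le:
  assumes "sobolev_fourier s u g"
  shows "sobolev_norm s u \<le> sqrt (sob_int s g)"
  unfolding sobolev_norm_def
  by (rule cInf_lower) (use assms in \<open>auto intro!: bdd_belowI[of _ 0] integral_nonneg\<close>)

lemma sobolev_norm_ge:
  assumes "u \<in> sobolev s" "\<And>g. sobolev_fourier s u g \<Longrightarrow> c \<le> sqrt (sob_int s g)"
  shows "c \<le> sobolev_norm s u"
  unfolding sobolev_norm_def
  by (rule cInf_greatest) (use assms in \<open>auto simp: sobolev_def\<close>)

lemma sobolev_fourier_minus:
  "sobolev_fourier (- 1 / 2) u g \<longleftrightarrow> sq_int lborel (\<lambda>\<xi>. g \<xi> / cpx (jw \<xi>)) \<and> g \<in> borel_measurable lborel \<and>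
     u = (\<lambda>\<phi>. if \<phi> \<in> test_funs UNIV then (LINT \<xi>|lborel. g \<xi> * inv_fourier \<phi> \<xi>) else 0)" (is ?A)
  and sobolev_weight_minus: "(1 + \<xi>^2) powr (- 1 / 2) * (cmod (g \<xi>))^2 = (cmod (g \<xi> / cpx (jw \<xi>)))^2" (is ?B)
proof -
  have e: "(1 + \<xi>^2) powr (- 1 / 2) * (cmod (g \<xi>))^2 = (cmod (g \<xi> / cpx (jw \<xi>)))^2" for \<xi>
    using inverse_jw_square[of \<xi>] by (simp add: norm_divide power_divide)
  then show ?B .
  show ?A
    unfolding sobolev_fourier_def sq_int_def e by auto
qed

lemma sobolev_fourier_plus:
  "sobolev_fourier (1 / 2) u g \<longleftrightarrow> sq_int lborel (\<lambda>\<xi>. cpx (jw \<xi>) * g \<xi>) \<and> g \<in> borel_measurable lborel \<and>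
     u = (\<lambda>\<phi>. if \<phi> \<in> test_funs UNIV then (LINT \<xi>|lborel. g \<xi> * inv_fourier \<phi> \<xi>) else 0)" (is ?A)
  and sobolev_weight_plus: "(1 + \<xi>^2) powr (1 / 2) * (cmod (g \<xi>))^2 = (cmod (cpx (jw \<xi>) * g \<xi>))^2" (is ?B)
proof -
  have e: "(1 + \<xi>^2) powr (1 / 2) * (cmod (g \<xi>))^2 = (cmod (cpx (jw \<xi>) * g \<xi>))^2" for \<xi>
    by (simp add: norm_mult power_mult_distrib jw_square)
  then show ?B .
  show ?A
    unfolding sobolev_fourier_def sq_int_def e by auto
qed

lemma jw_cancel: "a / cpx (jw \<xi>) * (cpx (jw \<xi>) * b) = a * b"
  using jw_pos[of \<xi>] by simp

text \<open>The transform is the series of the \<open>cheb_ft n\<close>, which converges by the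
  Bessel inequality. Biorthogonality recovers \<open>a\<close> from it, and this is what later
  proves injectivity of \<open>div_map\<close>.\<close>

theorem div_map_fourier:
  obtains K where "K \<ge> 0"
    and "\<And>a. a \<in> cheb_space (- 1 / 2) \<Longrightarrow> \<exists>g. sobolev_fourier (- 1 / 2) (div_map a) g \<and>
          sqrt (sob_int (- 1 / 2) g) \<le> K * cheb_norm (- 1 / 2) a \<and>
          (\<forall>n. (LINT \<xi>|lborel. g \<xi> * cheb_ext n (- \<xi>)) = a n * cpx (2 * pi / cheb_const n)) \<and>
          (\<forall>\<phi>\<in>test_funs UNIV. summable (\<lambda>n. a n * test_coeff \<phi> n))"
proof -
  obtain C where "bessel_system lborel (\<lambda>n \<xi>. cheb_ft n \<xi> / cpx (jw \<xi>)) wminus C" by (rule bessel_system_minus)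
  then interpret bessel_system lborel "\<lambda>n \<xi>. cheb_ft n \<xi> / cpx (jw \<xi>)" wminus C .
  show ?thesis
  proof (rule that[of "sqrt C"])
    show "0 \<le> sqrt C" using C_nonneg by simp
    fix a assume "a \<in> cheb_space (- 1 / 2)"
    then have a: "summable (\<lambda>n. wminus n * (cmod (a n))^2)" unfolding cheb_space_minus by (rule CollectD)
    obtain g0 where g0: "sq_int lborel g0" "(LINT x|lborel. (cmod (g0 x))^2) \<le> C * (\<Sum>n. wminus n * (cmod (a n))^2)"
      "\<And>h. sq_int lborel h \<Longrightarrow> (\<lambda>n. a n * (LINT \<xi>|lborel. cheb_ft n \<xi> / cpx (jw \<xi>) * h \<xi>)) sums (LINT x|lborel. g0 x * h x)"
      using riesz_fischer[OF a] by blast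
    \<comment> \<open>Riesz-Fischer works with \<open>cheb_ft n / jw\<close>; multiplying by
      \<open>jw\<close> undoes the Sobolev weight.\<close>
    define g where "g \<xi> = cpx (jw \<xi>) * g0 \<xi>" for \<xi>
    have gj: "g \<xi> / cpx (jw \<xi>) = g0 \<xi>" for \<xi> using jw_pos[of \<xi>] by (simp add: g_def)
    have gm: "g \<in> borel_measurable lborel" unfolding g_def[abs_def] using sq_int_measurable[OF g0(1)] by measurable
    have sums: "(\<lambda>n. a n * (LINT \<xi>|lborel. cheb_ft n \<xi> * q \<xi>)) sums (LINT \<xi>|lborel. g \<xi> * q \<xi>)"
      if "sq_int lborel (\<lambda>\<xi>. cpx (jw \<xi>) * q \<xi>)" for q
      using g0(3)[OF that] unfolding jw_cancel g_def by (simp add: mult_ac)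
    have t: "(\<lambda>n. a n * test_coeff \<phi> n) sums (LINT \<xi>|lborel. g \<xi> * inv_fourier \<phi> \<xi>)" if "\<phi> \<in> test_funs UNIV" for \<phi>
      using sums[OF sq_int_jw_inv_fourier[OF that]] unfolding cheb_ft_pairing[OF that] .
    have "sobolev_fourier (- 1 / 2) (div_map a) g"
      unfolding sobolev_fourier_minus gj using g0(1) gm t by (auto simp: div_map_def fun_eq_iff sums_unique[symmetric])
    moreover have "sqrt (sob_int (- 1 / 2) g) \<le> sqrt C * cheb_norm (- 1 / 2) a"
      unfolding sobolev_weight_minus gj cheb_norm_minus using g0(2) by (simp flip: real_sqrt_mult)
    moreover have "(LINT \<xi>|lborel. g \<xi> * cheb_ext n (- \<xi>)) = a n * cpx (2 * pi / cheb_const n)" for n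
    proof -
      have "sq_int lborel (\<lambda>\<xi>. cpx (jw \<xi>) * cheb_ext n (- \<xi>))"
        using sq_int_reflect[OF sq_int_cheb_ext[of n]] by (simp add: jw_def)
      from sums[OF this] have s: "(\<lambda>m. a m * (LINT \<xi>|lborel. cheb_ft m \<xi> * cheb_ext n (- \<xi>))) sums (LINT \<xi>|lborel. g \<xi> * cheb_ext n (- \<xi>))" .
      have "(LINT \<xi>|lborel. cheb_ft m \<xi> * cheb_ext n (- \<xi>)) = (if m = n then cpx (2 * pi / cheb_const n) else 0)" for m
        using lborel_reflect(1)[of "\<lambda>\<xi>. cheb_ext n \<xi> * cheb_ft m (- \<xi>)"] unfolding biorthogonal by (auto simp: mult.commute)
      from sums_unique2[OF s[unfolded this] sum_if_single] show ?thesis .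
    qed
    ultimately show "\<exists>g. sobolev_fourier (- 1 / 2) (div_map a) g \<and>
          sqrt (sob_int (- 1 / 2) g) \<le> sqrt C * cheb_norm (- 1 / 2) a \<and>
          (\<forall>n. (LINT \<xi>|lborel. g \<xi> * cheb_ext n (- \<xi>)) = a n * cpx (2 * pi / cheb_const n)) \<and>
          (\<forall>\<phi>\<in>test_funs UNIV. summable (\<lambda>n. a n * test_coeff \<phi> n))"
      using t by (blast intro: sums_summable)
  qed
qed

lemma div_map_H_tilde: "a \<in> cheb_space (- 1 / 2) \<Longrightarrow> div_map a \<in> H_tilde"
proof -
  assume a: "a \<in> cheb_space (- 1 / 2)"
  have "div_map a \<in> sobolev (- 1 / 2)"
  proof (rule div_map_fourier)
    fix K assume *: "\<And>a. a \<in> cheb_space (- 1 / 2) \<Longrightarrow> \<exists>g. sobolev_fourier (- 1 / 2) (div_map a) g \<and>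
          sqrt (sob_int (- 1 / 2) g) \<le> K * cheb_norm (- 1 / 2) a \<and>
          (\<forall>n. (LINT \<xi>|lborel. g \<xi> * cheb_ext n (- \<xi>)) = a n * cpx (2 * pi / cheb_const n)) \<and>
          (\<forall>\<phi>\<in>test_funs UNIV. summable (\<lambda>n. a n * test_coeff \<phi> n))"
    show ?thesis using *[OF a] unfolding sobolev_def by (elim exE conjE) (rule CollectI, rule exI)
  qed
  moreover have "div_map a \<phi> = 0" if "\<phi> \<in> test_funs (- {-1..1})" for \<phi>
    by (simp add: div_map_def test_coeff_outside[OF that])
  ultimately show ?thesis by (simp add: H_tilde_def)
qed

section \<open>Dilation and mollification into the open segment\<close>

abbreviation rho :: "real \<Rightarrow> complex" where "rho \<equiv> bump 1 (-1) 1"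

lemma rho_test: "rho \<in> test_funs UNIV" by (rule bump_test_fun) auto

lemma rho_outside: "\<bar>s\<bar> > 1 \<Longrightarrow> rho s = 0"
  by (auto simp: bump_def flat_def abs_if split: if_splits)

lemma integral_rho_nonzero: "(LINT s|lborel. rho s) \<noteq> 0"
proof -
  let ?f = "\<lambda>s::real. flat 1 0 (s - (-1)) * flat 1 0 (1 - s)"
  have r: "rho = (\<lambda>s. cpx (?f s))" by (simp add: bump_def[abs_def])
  have f: "integrable lborel ?f"
    using test_funs_bounded_integrable(1)[OF rho_test] unfolding r complex_of_real_integrable_eq .
  have e: "flat 1 0 y \<ge> exp (-2)" if "y \<ge> 1/2" for y
  proof -
    have "1 / y \<le> 2" using that by (simp add: field_simps)
    then show ?thesis using that by (simp add: flat_def)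
  qed
  have "(LINT s|lborel. indicator {-1/2..1/2::real} s *\<^sub>R (exp (-2) * exp (-2::real))) \<le> (LINT s|lborel. ?f s)"
  proof (rule integral_mono[OF _ f])
    show "integrable lborel (\<lambda>s. indicator {-1/2..1/2::real} s *\<^sub>R (exp (-2) * exp (-2::real)))"
      by (rule borel_integrable_compact) auto
    fix s :: real
    show "indicator {-1/2..1/2::real} s *\<^sub>R (exp (-2) * exp (-2::real)) \<le> ?f s"
    proof (cases "s \<in> {-1/2..1/2}")
      case True
      have "exp (-2) * exp (-2::real) \<le> ?f s" using True by (intro mult_mono e flat_nonneg) auto
      then show ?thesis using True by simp
    qed (simp add: flat_nonneg)
  qed
  then have "(LINT s|lborel. ?f s) > 0" by (simp add: less_le_trans[of 0 "exp (-2) * exp (-2)"])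
  then show ?thesis unfolding r integral_complex_of_real by simp
qed

text \<open>Fourier transform of \<open>rho\<close> divided by its mass: the multiplier of the
  mollification, with value 1 at 0.\<close>

definition Psi :: "real \<Rightarrow> complex" where
  "Psi \<eta> = inv_fourier rho (- \<eta>) / inv_fourier rho 0"

lemma inv_fourier_rho_0: "inv_fourier rho 0 = cpx (1 / (2 * pi)) * (LINT s|lborel. rho s)"
  by (simp add: inv_fourier_def)

lemma inv_fourier_rho_0_nonzero: "inv_fourier rho 0 \<noteq> 0"
  unfolding inv_fourier_rho_0 using integral_rho_nonzero by simp

lemma powr_decay_le_1: "decay (x::real) \<le> 1"
proof -
  have "decay x \<le> (1 + \<bar>x\<bar>) powr 0" by (intro powr_mono) auto
  also have "\<dots> = 1" using abs_ge_zero[of x] by (auto simp: powr_def)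
  finally show ?thesis .
qed

lemma isCont_reflect: "isCont f (- x) \<Longrightarrow> isCont (\<lambda>x. f (- x)) (x::real)"
  by (rule isCont_o2[of _ uminus]) (simp_all add: isCont_minus)

lemma Psi_0: "Psi 0 = 1" using inv_fourier_rho_0_nonzero by (simp add: Psi_def)

lemma continuous_Psi: "continuous_on UNIV Psi"
proof -
  have "continuous_on UNIV (\<lambda>\<eta>. inv_fourier rho (- \<eta>))"
    by (rule continuous_on_compose2[OF inv_fourier_continuous[OF rho_test]]) (auto intro!: continuous_intros)
  then show ?thesis unfolding Psi_def[abs_def] using inv_fourier_rho_0_nonzero by (intro continuous_intros) auto
qed

lemma Psi_measurable [measurable]: "Psi \<in> borel_measurable borel"
  by (rule borel_measurable_continuous_onI[OF continuous_Psi])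

lemma Psi_decay:
  obtains C where "C \<ge> 0" "\<And>\<eta>. cmod (Psi \<eta>) \<le> C * decay \<eta>"
proof -
  obtain C where C: "C \<ge> 0" "\<And>\<xi>. cmod (inv_fourier rho \<xi>) \<le> C * decay \<xi>"
    using inv_fourier_decay'[OF rho_test] by blast
  show ?thesis
  proof (rule that[of "C / cmod (inv_fourier rho 0)"])
    fix \<eta>
    have "cmod (Psi \<eta>) = cmod (inv_fourier rho (- \<eta>)) / cmod (inv_fourier rho 0)" by (simp add: Psi_def norm_divide)
    also have "\<dots> \<le> (C * decay \<eta>) / cmod (inv_fourier rho 0)"
      using C(2)[of "- \<eta>"] by (intro divide_right_mono) auto
    finally show "cmod (Psi \<eta>) \<le> C / cmod (inv_fourier rho 0) * decay \<eta>" by simp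
  qed (use C in simp)
qed

lemma Psi_bounded: obtains C where "C \<ge> 0" "\<And>\<eta>. cmod (Psi \<eta>) \<le> C"
proof -
  obtain C where C: "C \<ge> 0" "\<And>\<eta>. cmod (Psi \<eta>) \<le> C * decay \<eta>" using Psi_decay by blast
  have "cmod (Psi \<eta>) \<le> C" for \<eta>
    using C(2)[of \<eta>] mult_left_mono[OF powr_decay_le_1[of \<eta>] C(1)] by linarith
  then show ?thesis using that C(1) by blast
qed

text \<open>Dilating by \<open>dil k < 1\<close> and mollifying at scale \<open>1 / (k + 3)\<close> moves the support of a distribution
  supported in \<open>[-1,1]\<close> into a compact subset of the open interval.\<close>

definition dil :: "nat \<Rightarrow> real" where "dil k = (real k + 1) / (real k + 3)"
definition tau :: "nat \<Rightarrow> real" where "tau k = 1 / (real k + 1)"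

lemma dil_bounds: "0 < dil k" "dil k \<le> 1" "1 / dil k \<le> 3"
  by (auto simp: dil_def field_simps)

lemma tau_bounds: "0 < tau k" "tau k \<le> 1" by (auto simp: tau_def)

lemma dil_limit: "(\<lambda>k. 1 / dil k) \<longlonglongrightarrow> 1"
proof -
  have "1 / dil k = 1 + 2 * inverse (real (Suc k))" for k by (simp add: dil_def field_simps)
  moreover have "(\<lambda>k. 1 + 2 * inverse (real (Suc k))) \<longlonglongrightarrow> 1 + 2 * 0"
    by (intro tendsto_intros LIMSEQ_inverse_real_of_nat)
  ultimately show ?thesis by simp
qed

lemma tau_limit: "tau \<longlonglongrightarrow> 0"
proof -
  have "tau = (\<lambda>k. inverse (real (Suc k)))" by (simp add: fun_eq_iff tau_def field_simps)
  then show ?thesis using LIMSEQ_inverse_real_of_nat by simp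
qed

text \<open>The argument of \<open>rho\<close> is \<open>(k + 3) (x - dil k y)\<close>. Applying a
  distribution in \<open>y\<close> therefore gives the density at \<open>x\<close> of its dilate by
  \<open>dil k\<close>, mollified with unit mass at scale \<open>1 / (k + 3)\<close>.\<close>

definition mol :: "nat \<Rightarrow> real \<Rightarrow> real \<Rightarrow> complex" where
  "mol k x y = cpx (real k + 3) / (LINT s|lborel. rho s) * rho (- (real k + 1) * y + (real k + 3) * x)"

lemma smooth_mol: "smooth (mol k x)"
proof -
  have "smooth_term (\<lambda>y. cpx (real k + 3) / (LINT s|lborel. rho s) * rho (- (real k + 1) * y + (real k + 3) * x))"
    by (intro smooth_term.mult smooth_term.const smooth_term.affine[of rho] smooth_term.base test_funs_smooth[OF rho_test])
  then show ?thesis unfolding mol_def[abs_def] by (rule smooth_termD)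
qed

lemma mol_test:
  assumes "{((real k + 3) * x - 1) / (real k + 1)..((real k + 3) * x + 1) / (real k + 1)} \<subseteq> I"
  shows "mol k x \<in> test_funs I"
proof -
  let ?K = "{((real k + 3) * x - 1) / (real k + 1)..((real k + 3) * x + 1) / (real k + 1)}"
  have "mol k x y = 0" if "y \<notin> ?K" for y
  proof -
    have "\<bar>- (real k + 1) * y + (real k + 3) * x\<bar> > 1"
      using that by (auto simp: field_simps abs_if not_le)
    then show ?thesis by (simp add: mol_def rho_outside)
  qed
  then show ?thesis unfolding test_funs_def using assms smooth_mol by (auto intro!: exI[of _ ?K])
qed

text \<open>For such \<open>x\<close>, the support condition
  \<open>|x - dil k y| \<le> 1 / (k + 3)\<close> forces \<open>|y| > 1\<close>, so a distribution
  supported in the segment vanishes on the kernel.\<close>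

lemma mol_outside:
  assumes "\<bar>x\<bar> > (real k + 2) / (real k + 3)"
  shows "mol k x \<in> test_funs (- {-1..1})"
proof (rule mol_test)
  have p: "real k + 1 > 0" "real k + 3 > 0" by auto
  have "(real k + 3) * \<bar>x\<bar> > real k + 2" using assms p(2) by (simp add: divide_less_eq mult.commute)
  then consider "(real k + 3) * x > real k + 2" | "(real k + 3) * x < - (real k + 2)"
    by (cases "x \<ge> 0") auto
  then show "{((real k + 3) * x - 1) / (real k + 1)..((real k + 3) * x + 1) / (real k + 1)} \<subseteq> - {-1..1}"
  proof cases
    case 1
    then have "1 < ((real k + 3) * x - 1) / (real k + 1)" using p by (simp add: less_divide_eq)
    then show ?thesis by (intro subsetI) (simp only: atLeastAtMost_iff Compl_iff, linarith)
  next
    case 2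
    then have "((real k + 3) * x + 1) / (real k + 1) < - 1" using p by (simp add: divide_less_eq)
    then show ?thesis by (intro subsetI) (simp only: atLeastAtMost_iff Compl_iff, linarith)
  qed
qed

text \<open>Mollification turns into multiplication by \<open>Psi\<close> and dilation into a
  rescaled frequency, by the substitution \<open>y = x / dil k - tau k s\<close>.\<close>

lemma inv_fourier_mol:
  "inv_fourier (mol k x) \<xi> = cpx (1 / (2 * pi * dil k)) * (cis (x * \<xi> / dil k) * Psi (tau k * \<xi>))"
proof -
  let ?c = "LINT s|lborel. rho s"
  have c0: "?c \<noteq> 0" by (rule integral_rho_nonzero)
  have "(LINT y|lborel. cis (y * \<xi>) * mol k x y) = \<bar>- tau k\<bar> *\<^sub>R (LINT s|lborel. cis ((x / dil k + (- tau k) * s) * \<xi>) * mol k x (x / dil k + (- tau k) * s))"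
    using tau_bounds(1)[of k] by (intro lborel_integral_real_affine) simp
  also have "(LINT s|lborel. cis ((x / dil k + (- tau k) * s) * \<xi>) * mol k x (x / dil k + (- tau k) * s))
      = (LINT s|lborel. (cpx (real k + 3) / ?c * cis (x * \<xi> / dil k)) * (cis (s * (- (tau k * \<xi>))) * rho s))"
  proof (intro int_cong)
    fix s
    have d: "(real k + 1) / dil k = real k + 3" "(real k + 1) * tau k = 1" by (simp_all add: dil_def tau_def)
    have "- (real k + 1) * (x / dil k + (- tau k) * s) + (real k + 3) * x = (real k + 1) * tau k * s - (real k + 1) / dil k * x + (real k + 3) * x"
      by (simp add: distrib_left add_divide_distrib) (simp add: algebra_simps add_divide_distrib)
    also have "\<dots> = s" unfolding d by simp
    finally have "- (real k + 1) * (x / dil k + (- tau k) * s) + (real k + 3) * x = s" .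
    then have m: "mol k x (x / dil k + (- tau k) * s) = cpx (real k + 3) / ?c * rho s" by (simp add: mol_def)
    have "cis ((x / dil k + (- tau k) * s) * \<xi>) = cis (x * \<xi> / dil k) * cis (s * (- (tau k * \<xi>)))"
      by (simp add: cis_mult algebra_simps)
    then show "cis ((x / dil k + (- tau k) * s) * \<xi>) * mol k x (x / dil k + (- tau k) * s)
      = (cpx (real k + 3) / ?c * cis (x * \<xi> / dil k)) * (cis (s * (- (tau k * \<xi>))) * rho s)"
      unfolding m by (simp add: mult_ac)
  qed
  also have "\<dots> = (cpx (real k + 3) / ?c * cis (x * \<xi> / dil k)) * (LINT s|lborel. cis (s * (- (tau k * \<xi>))) * rho s)"
    by (rule integral_mult_right_zero)
  also have "(LINT s|lborel. cis (s * (- (tau k * \<xi>))) * rho s) = ?c * Psi (tau k * \<xi>)"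
    using c0 by (simp add: Psi_def inv_fourier_def)
  finally have "(LINT y|lborel. cis (y * \<xi>) * mol k x y) = \<bar>- tau k\<bar> *\<^sub>R (cpx (real k + 3) / ?c * cis (x * \<xi> / dil k) * (?c * Psi (tau k * \<xi>)))" .
  also have "\<dots> = cpx (tau k * (real k + 3)) * (cis (x * \<xi> / dil k) * Psi (tau k * \<xi>))"
    using c0 tau_bounds(1)[of k] by (simp add: scaleR_conv_of_real)
  also have "tau k * (real k + 3) = 1 / dil k" by (simp add: tau_def dil_def)
  finally show ?thesis unfolding inv_fourier_def by simp
qed

section \<open>Pairing and weak limits in weighted sequence spaces\<close>

lemma weighted_pairing:
  fixes u w :: "nat \<Rightarrow> real" and a t :: "nat \<Rightarrow> complex"
  assumes pos: "\<And>n. u n > 0" "\<And>n. w n > 0" and uw: "\<And>n. u n * w n = 1"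
    and a: "summable (\<lambda>n. u n * (cmod (a n))^2)" and t: "summable (\<lambda>n. w n * (cmod (t n))^2)"
  shows "summable (\<lambda>n. a n * t n)"
    and "cmod (\<Sum>n. a n * t n) \<le> sqrt (\<Sum>n. u n * (cmod (a n))^2) * sqrt (\<Sum>n. w n * (cmod (t n))^2)" (is ?A)
proof -
  let ?x = "\<lambda>n. sqrt (u n) * cmod (a n)" and ?y = "\<lambda>n. sqrt (w n) * cmod (t n)"
  have xy: "?x n * ?y n = cmod (a n * t n)" for n
    using uw[of n] by (simp add: norm_mult mult.left_commute[of "cmod (a n)"] real_sqrt_mult[symmetric] flip: mult.assoc)
  have x2: "(?x n)^2 = u n * (cmod (a n))^2" "(?y n)^2 = w n * (cmod (t n))^2" for n
    using pos[of n] by (simp_all add: power_mult_distrib less_imp_le)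
  have part: "(\<Sum>n<N. cmod (a n * t n)) \<le> sqrt (\<Sum>n. u n * (cmod (a n))^2) * sqrt (\<Sum>n. w n * (cmod (t n))^2)" for N
  proof -
    have "(\<Sum>n<N. ?x n * ?y n)^2 \<le> (\<Sum>n<N. (?x n)^2) * (\<Sum>n<N. (?y n)^2)" by (rule Cauchy_Schwarz_ineq_sum)
    also have "\<dots> \<le> (\<Sum>n. u n * (cmod (a n))^2) * (\<Sum>n. w n * (cmod (t n))^2)"
      unfolding x2 using pos
      by (intro mult_mono sum_le_suminf a t suminf_nonneg sum_nonneg) (auto simp: less_imp_le)
    finally show ?thesis unfolding xy real_sqrt_mult[symmetric] by (rule real_le_rsqrt)
  qed
  have ns: "summable (\<lambda>n. cmod (a n * t n))" by (rule summableI_nonneg_bounded[OF _ part]) simp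
  then show "summable (\<lambda>n. a n * t n)" by (rule summable_norm_cancel)
  show ?A
    by (rule order_trans[OF summable_norm[OF ns] suminf_le_const[OF ns part]])
qed

lemma wminus_wplus: "wminus n * wplus n = 1" "wplus n * wminus n = 1"
  using wplus_pos[of n] by (simp_all add: wminus_eq)

text \<open>Bounded sequences that converge coordinatewise converge weakly: by Cauchy-Schwarz the
  tails of the pairings are at most \<open>sqrt L\<close> times a tail of \<open>t\<close>,
  uniformly in \<open>k\<close>, and finitely many coordinates remain.\<close>

lemma weak_sequence_limit:
  fixes a :: "nat \<Rightarrow> nat \<Rightarrow> complex"
  assumes t: "summable (\<lambda>n. wplus n * (cmod (t n))^2)"
    and ak: "\<And>k. summable (\<lambda>n. wminus n * (cmod (a k n))^2)" "\<And>k. (\<Sum>n. wminus n * (cmod (a k n))^2) \<le> K"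
    and b: "summable (\<lambda>n. wminus n * (cmod (b n))^2)"
    and lim: "\<And>n. (\<lambda>k. a k n) \<longlonglongrightarrow> b n"
    and sk: "\<And>k. (\<lambda>n. a k n * t n) sums s k"
  shows "s \<longlonglongrightarrow> (\<Sum>n. b n * t n)"
proof -
  define B where "B = (\<Sum>n. wminus n * (cmod (b n))^2)"
  define L where "L = max K B"
  have L: "(\<Sum>n. wminus n * (cmod (a k n))^2) \<le> L" "(\<Sum>n. wminus n * (cmod (b n))^2) \<le> L" for k
    using ak(2)[of k] by (auto simp: L_def B_def)
  define T where "T N = (\<Sum>n. wplus (n + N) * (cmod (t (n + N)))^2)" for N
  have T0: "T \<longlonglongrightarrow> 0" unfolding T_def by (rule suminf_exist_split2[OF t])
  have tail: "summable (\<lambda>n. c n * t n) \<and> cmod ((\<Sum>n. c n * t n) - (\<Sum>n<N. c n * t n)) \<le> sqrt L * sqrt (T N)"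
    if c: "summable (\<lambda>n. wminus n * (cmod (c n))^2)" "(\<Sum>n. wminus n * (cmod (c n))^2) \<le> L" for c :: "nat \<Rightarrow> complex" and N
  proof -
    have s: "summable (\<lambda>n. c n * t n)" by (rule weighted_pairing(1)[OF wminus_pos wplus_pos wminus_wplus(1) c(1) t])
    have "cmod (\<Sum>n. c (n + N) * t (n + N)) \<le> sqrt (\<Sum>n. wminus (n + N) * (cmod (c (n + N)))^2) * sqrt (T N)"
      unfolding T_def
      by (rule weighted_pairing(2)[OF wminus_pos wplus_pos wminus_wplus(1) summable_ignore_initial_segment[OF c(1)] summable_ignore_initial_segment[OF t]])
    also have "\<dots> \<le> sqrt L * sqrt (T N)"
    proof (intro mult_right_mono real_sqrt_le_mono)
      have "0 \<le> (\<Sum>n<N. wminus n * (cmod (c n))^2)" using wminus_pos by (intro sum_nonneg) (simp add: less_imp_le)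
      then show "(\<Sum>n. wminus (n + N) * (cmod (c (n + N)))^2) \<le> L"
        using suminf_split_initial_segment[OF c(1), of N] c(2) by linarith
      show "0 \<le> sqrt (T N)" unfolding T_def using wplus_pos
        by (intro real_sqrt_ge_zero suminf_nonneg summable_ignore_initial_segment[OF t]) (simp add: less_imp_le)
    qed
    finally show ?thesis using s suminf_split_initial_segment[OF s, of N] by simp
  qed
  have sk': "s k = (\<Sum>n. a k n * t n)" for k using sk by (rule sums_unique)
  show ?thesis
  proof (rule LIMSEQ_I)
    fix e :: real assume e: "e > 0"
    have "(\<lambda>N. sqrt L * sqrt (T N)) \<longlonglongrightarrow> sqrt L * sqrt 0" by (intro tendsto_intros T0)
    then have "\<forall>\<^sub>F N in sequentially. sqrt L * sqrt (T N) < e / 3" using e by (intro order_tendstoD(2)) auto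
    then obtain N where N: "sqrt L * sqrt (T N) < e / 3" by (auto simp: eventually_sequentially)
    have "(\<lambda>k. \<Sum>n<N. a k n * t n) \<longlonglongrightarrow> (\<Sum>n<N. b n * t n)" by (intro tendsto_intros lim)
    from LIMSEQ_D[OF this, of "e / 3"] e obtain k0 where k0: "\<And>k. k \<ge> k0 \<Longrightarrow> cmod ((\<Sum>n<N. a k n * t n) - (\<Sum>n<N. b n * t n)) < e / 3" by auto
    have "cmod (s k - (\<Sum>n. b n * t n)) < e" if "k \<ge> k0" for k
    proof -
      have 1: "cmod (s k - (\<Sum>n<N. a k n * t n)) < e / 3"
        using tail[OF ak(1) L(1), of k N] N unfolding sk' by linarith
      have 2: "cmod ((\<Sum>n. b n * t n) - (\<Sum>n<N. b n * t n)) < e / 3"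
        using tail[OF b L(2), of N] N by linarith
      let ?A = "\<Sum>n<N. a k n * t n" and ?B = "\<Sum>n<N. b n * t n"
      have "cmod (s k - (\<Sum>n. b n * t n)) = cmod ((s k - ?A) + (?A - ?B) - ((\<Sum>n. b n * t n) - ?B))" by simp
      then have "cmod (s k - (\<Sum>n. b n * t n)) \<le> cmod (s k - ?A) + cmod (?A - ?B) + cmod ((\<Sum>n. b n * t n) - ?B)"
        using norm_triangle_ineq4[of "(s k - ?A) + (?A - ?B)" "(\<Sum>n. b n * t n) - ?B"] norm_triangle_ineq[of "s k - ?A" "?A - ?B"] by linarith
      then show ?thesis using 1 2 k0[OF that] by linarith
    qed
    then show "\<exists>no. \<forall>k\<ge>no. norm (s k - (\<Sum>n. b n * t n)) < e" by (intro exI[of _ k0]) auto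
  qed
qed

text \<open>Membership in \<open>sobolev\<close> asserts that some transform exists; one is fixed
  here. The coefficients computed from it turn out to depend on \<open>v\<close> alone.\<close>

locale tilde_rep =
  fixes v :: dist and g :: "real \<Rightarrow> complex"
  assumes v: "v \<in> H_tilde" and g: "sobolev_fourier (- 1 / 2) v g"
begin

lemma gj: "sq_int lborel (\<lambda>\<xi>. g \<xi> / cpx (jw \<xi>))"
  and g_measurable: "g \<in> borel_measurable borel"
  and v_eq: "\<phi> \<in> test_funs UNIV \<Longrightarrow> v \<phi> = (LINT \<xi>|lborel. g \<xi> * inv_fourier \<phi> \<xi>)"
  using g unfolding sobolev_fourier_minus by auto

declare g_measurable [measurable]

text \<open>\<open>nn k\<close> is the transform after mollification and \<open>mm k\<close> after
  dilation as well; \<open>FF k\<close> is the corresponding density. It is a continuous function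
  vanishing outside the open segment, so ordinary Chebyshev expansion applies to it.\<close>

definition nn :: "nat \<Rightarrow> real \<Rightarrow> complex" where "nn k \<xi> = g \<xi> * Psi (tau k * \<xi>)"
definition mm :: "nat \<Rightarrow> real \<Rightarrow> complex" where "mm k \<eta> = nn k (0 + dil k * \<eta>)"
definition FF :: "nat \<Rightarrow> real \<Rightarrow> complex" where "FF k x = v (mol k x)"

lemma integrable_nn: "integrable lborel (nn k)"
proof -
  obtain C where C: "C \<ge> 0" "\<And>\<eta>. cmod (Psi \<eta>) \<le> C * decay \<eta>" using Psi_decay by blast
  have "sq_int lborel (\<lambda>\<xi>. cpx (jw \<xi>) * Psi (tau k * \<xi>))"
  proof (rule sq_int_jw_decay)
    show "cmod (Psi (tau k * \<xi>)) \<le> (C * tau k powr (-4/3)) * decay \<xi>" for \<xi>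
    proof -
      have "tau k * (1 + \<bar>\<xi>\<bar>) \<le> 1 + \<bar>tau k * \<xi>\<bar>" using tau_bounds[of k] by (simp add: distrib_left abs_mult)
      moreover have "0 < tau k * (1 + \<bar>\<xi>\<bar>)" using tau_bounds(1)[of k] by (intro mult_pos_pos) auto
      ultimately have "decay (tau k * \<xi>) \<le> (tau k * (1 + \<bar>\<xi>\<bar>)) powr (-4/3)"
        by (intro powr_mono2') auto
      also have "\<dots> = tau k powr (-4/3) * decay \<xi>" by (rule powr_mult)
      finally have "C * decay (tau k * \<xi>) \<le> C * (tau k powr (-4/3) * decay \<xi>)"
        using C(1) by (intro mult_left_mono)
      then show ?thesis using C(2)[of "tau k * \<xi>"] by (simp add: mult.assoc)
    qed
  qed measurable
  from sq_int_mult[OF gj this] show ?thesis unfolding jw_cancel nn_def[abs_def] .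
qed

lemma integrable_mm: "integrable lborel (mm k)"
  unfolding mm_def[abs_def] using dil_bounds(1)[of k] by (intro lborel_integrable_real_affine integrable_nn) auto

lemma mm_measurable [measurable]: "mm k \<in> borel_measurable borel"
  using borel_measurable_integrable[OF integrable_mm] by simp

lemma FF_eq: "FF k x = cpx (1 / (2 * pi)) * (LINT \<eta>|lborel. cis (\<eta> * x) * mm k \<eta>)"
proof -
  have "mol k x \<in> test_funs UNIV" by (rule mol_test) auto
  then have "FF k x = (LINT \<xi>|lborel. g \<xi> * (cpx (1 / (2 * pi * dil k)) * (cis (x * \<xi> / dil k) * Psi (tau k * \<xi>))))"
    unfolding FF_def by (simp only: v_eq inv_fourier_mol)
  also have "\<dots> = (LINT \<xi>|lborel. cpx (1 / (2 * pi * dil k)) * (cis (x * \<xi> / dil k) * nn k \<xi>))"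
    by (intro int_cong) (simp only: nn_def mult_ac)
  also have "\<dots> = cpx (1 / (2 * pi * dil k)) * (LINT \<xi>|lborel. cis (x * \<xi> / dil k) * nn k \<xi>)"
    by (rule integral_mult_right_zero)
  also have "(LINT \<xi>|lborel. cis (x * \<xi> / dil k) * nn k \<xi>) = \<bar>dil k\<bar> *\<^sub>R (LINT \<eta>|lborel. cis (x * (0 + dil k * \<eta>) / dil k) * nn k (0 + dil k * \<eta>))"
    using dil_bounds(1)[of k] by (intro lborel_integral_real_affine) simp
  also have "(LINT \<eta>|lborel. cis (x * (0 + dil k * \<eta>) / dil k) * nn k (0 + dil k * \<eta>)) = (LINT \<eta>|lborel. cis (\<eta> * x) * mm k \<eta>)"
    using dil_bounds(1)[of k] by (simp add: mm_def mult.commute)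
  finally show ?thesis using dil_bounds(1)[of k] by (simp add: scaleR_conv_of_real)
qed

lemma continuous_FF: "continuous_on UNIV (FF k)"
  unfolding FF_eq[abs_def]
  by (intro continuous_intros continuous_oscillatory_integral[OF integrable_mm, where Z = "\<lambda>x. x"]) simp

lemma FF_measurable [measurable]: "FF k \<in> borel_measurable borel"
  by (rule borel_measurable_continuous_onI[OF continuous_FF])

lemma FF_outside: "x \<notin> {-1<..<1} \<Longrightarrow> FF k x = 0"
proof -
  assume "x \<notin> {-1<..<1}"
  then have "\<bar>x\<bar> \<ge> 1" by (auto simp: abs_if)
  moreover have "(real k + 2) / (real k + 3) < 1" by simp
  ultimately have "mol k x \<in> test_funs (- {-1..1})" by (intro mol_outside) linarith
  then show ?thesis using v unfolding FF_def H_tilde_def by blast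
qed

lemma FF_bounded: obtains B where "\<And>x. cmod (FF k x) \<le> B"
proof (rule that)
  fix x
  have "cmod (FF k x) = 1 / (2 * pi) * cmod (LINT \<eta>|lborel. cis (\<eta> * x) * mm k \<eta>)" by (simp add: FF_eq norm_mult norm_divide)
  also have "\<dots> \<le> 1 / (2 * pi) * (LINT \<eta>|lborel. cmod (mm k \<eta>))"
    by (intro mult_left_mono norm_oscillatory_integral_le) simp
  finally show "cmod (FF k x) \<le> 1 / (2 * pi) * (LINT \<eta>|lborel. cmod (mm k \<eta>))" .
qed

lemma integrable_FF: "integrable lborel (FF k)"
proof -
  have "integrable lborel (\<lambda>x. indicator {-1..1} x *\<^sub>R FF k x)"
    by (rule borel_integrable_compact) (use continuous_on_subset[OF continuous_FF] in auto)
  moreover have "indicator {-1..1} x *\<^sub>R FF k x = FF k x" for x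
    using FF_outside[of x k] by (cases "x \<in> {-1..1}") auto
  ultimately show ?thesis by simp
qed

lemma FF_test_pairing:
  assumes \<phi>: "\<phi> \<in> test_funs I"
  shows "(LINT x|lborel. FF k x * \<phi> x) = (LINT \<eta>|lborel. mm k \<eta> * inv_fourier \<phi> \<eta>)"
proof -
  have "(LINT \<eta>|lborel. mm k \<eta> * inv_fourier \<phi> \<eta>) = (LINT \<eta>|lborel. cpx (1 / (2 * pi)) * (mm k \<eta> * (LINT x|lborel. cis (\<eta> * x) * \<phi> x)))"
    by (simp add: inv_fourier_def mult_ac)
  also have "\<dots> = cpx (1 / (2 * pi)) * (LINT x|lborel. \<phi> x * (LINT \<eta>|lborel. cis (\<eta> * x) * mm k \<eta>))"
    unfolding integral_mult_right_zero
    by (subst Fubini_kernel(1)[OF sigma_finite_lborel sigma_finite_lborel integrable_mm test_funs_bounded_integrable(1)[OF \<phi>], where B = 1]) auto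
  also have "\<dots> = (LINT x|lborel. cpx (1 / (2 * pi)) * (\<phi> x * (LINT \<eta>|lborel. cis (\<eta> * x) * mm k \<eta>)))"
    by (rule integral_mult_right_zero[symmetric])
  also have "\<dots> = (LINT x|lborel. FF k x * \<phi> x)"
    by (intro int_cong) (simp only: FF_eq mult_ac)
  finally show ?thesis by simp
qed

text \<open>Parseval between \<open>FF k\<close> and the extension of \<open>T_n\<close>: it moves
  the Chebyshev integral of the density to the Fourier side, where the limit in \<open>k\<close> can
  be taken.\<close>

lemma FF_cheb_pairing:
  "(LINT x|lborel. FF k x * ctp n x) = cpx (1 / (2 * pi)) * (LINT \<eta>|lborel. mm k \<eta> * cheb_ext n (- \<eta>))"
proof -
  obtain C where C: "C \<ge> 0" "\<And>\<xi>. cmod (cheb_ext n \<xi>) \<le> C * decay \<xi>" using cheb_ext_decay by blast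
  have CB: "cmod (cheb_ext n (- \<zeta>)) \<le> C" for \<zeta>
    using C(2)[of "- \<zeta>"] mult_left_mono[OF powr_decay_le_1[of "- \<zeta>"] C(1)] by linarith
  have Gi: "integrable lborel (\<lambda>\<zeta>. cheb_ext n (- \<zeta>))" by (rule lborel_reflect(2)[OF integrable_cheb_ext])
  have Gc: "AE \<zeta> in lborel. isCont (\<lambda>\<zeta>. cheb_ext n (- \<zeta>)) \<zeta>"
    using AE_lborel_singleton[of 0]
  proof eventually_elim
    case (elim \<zeta>)
    have "isCont (cheb_ext n) (- \<zeta>)" using elim by (intro isCont_cheb_ext) simp
    then show ?case by (rule isCont_reflect)
  qed
  define V where "V x = (LINT \<eta>|lborel. cis (- \<eta> * x) * cheb_ext n (- \<eta>))" for x
  have V: "V x = cpx (2 * pi) * ctp n x" if "x \<in> {-1<..<1}" for x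
  proof -
    have "V x = (LINT \<eta>|lborel. cis (x * \<eta>) * cheb_ext n \<eta>)"
      using lborel_reflect(1)[of "\<lambda>\<eta>. cis (x * \<eta>) * cheb_ext n \<eta>"] by (simp add: V_def mult.commute)
    then show ?thesis using fourier_cheb_ext[OF that, of n] by simp
  qed
  have Ui: "(LINT \<zeta>|lborel. cis (\<zeta> * x) * mm k \<zeta>) = cpx (2 * pi) * FF k x" for x by (simp add: FF_eq)
  \<comment> \<open>The values of \<open>V\<close> outside the segment are not known; there
    \<open>FF k\<close> vanishes.\<close>
  have eq: "cpx (2 * pi) * FF k x * V x = cpx (4 * pi^2) * (FF k x * ctp n x)" for x
    using V[of x] FF_outside[of x k] by (cases "x \<in> {-1<..<1}") (auto simp: power2_eq_square)
  have i: "integrable lborel (\<lambda>x. FF k x * ctp n x)"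
  proof (rule integrable_bound[OF integrable_FF[of k]])
    show "AE x in lborel. norm (FF k x * ctp n x) \<le> norm (FF k x)"
    proof (rule AE_I2)
      fix x
      show "norm (FF k x * ctp n x) \<le> norm (FF k x)"
      proof (cases "x \<in> {-1<..<1}")
        case True
        then have "\<bar>tpoly n x\<bar> \<le> 1" by (intro abs_tpoly_le) auto
        then show ?thesis by (simp add: norm_mult mult_left_le)
      qed (simp add: FF_outside)
    qed
  qed measurable
  have UV: "integrable lborel (\<lambda>x. (LINT \<zeta>|lborel. cis (\<zeta> * x) * mm k \<zeta>) * (LINT \<eta>|lborel. cis (- \<eta> * x) * cheb_ext n (- \<eta>)))"
    unfolding Ui V_def[symmetric] eq by (intro integrable_mult_right i)
  from fourier_parseval[OF integrable_mm Gi CB Gc UV]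
  have "(LINT x|lborel. cpx (4 * pi^2) * (FF k x * ctp n x)) = 2 * pi * (LINT \<zeta>|lborel. mm k \<zeta> * cheb_ext n (- \<zeta>))"
    unfolding Ui V_def[symmetric] eq .
  then have "cpx (4 * pi^2) * (LINT x|lborel. FF k x * ctp n x) = cpx (2 * pi) * (LINT \<zeta>|lborel. mm k \<zeta> * cheb_ext n (- \<zeta>))"
    unfolding integral_mult_right_zero by simp
  then show ?thesis by (simp add: power2_eq_square field_simps)
qed

text \<open>The substitution moves the dilation from \<open>g\<close>, which is merely measurable,
  to \<open>q\<close>, which is continuous away from 0. Dominated convergence then applies, since
  \<open>Psi\<close> is bounded and contracting the argument of \<open>q\<close> back only decreases
  the bound \<open>decay\<close>.\<close>

lemma mm_limit:
  assumes q: "q \<in> borel_measurable borel" and C: "\<And>\<xi>. cmod (q \<xi>) \<le> C * decay \<xi>"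
    and c: "\<And>\<xi>. \<xi> \<noteq> 0 \<Longrightarrow> isCont q \<xi>"
  shows "(\<lambda>k. LINT \<eta>|lborel. mm k \<eta> * q \<eta>) \<longlonglongrightarrow> (LINT \<xi>|lborel. g \<xi> * q \<xi>)"
proof -
  obtain P where P: "P \<ge> 0" "\<And>\<eta>. cmod (Psi \<eta>) \<le> P" using Psi_bounded by blast
  have C0: "C \<ge> 0" using order_trans[OF norm_ge_zero C[of 0]] by simp
  have eq: "(LINT \<eta>|lborel. mm k \<eta> * q \<eta>) = cpx (1 / dil k) * (LINT \<xi>|lborel. nn k \<xi> * q (\<xi> / dil k))" for k
  proof -
    have "(LINT \<xi>|lborel. nn k \<xi> * q (\<xi> / dil k)) = \<bar>dil k\<bar> *\<^sub>R (LINT \<eta>|lborel. nn k (0 + dil k * \<eta>) * q ((0 + dil k * \<eta>) / dil k))"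
      using dil_bounds(1)[of k] by (intro lborel_integral_real_affine) simp
    then show ?thesis using dil_bounds(1)[of k] by (simp add: mm_def scaleR_conv_of_real)
  qed
  have "(\<lambda>k. LINT \<xi>|lborel. nn k \<xi> * q (\<xi> / dil k)) \<longlonglongrightarrow> (LINT \<xi>|lborel. g \<xi> * q \<xi>)"
  proof (rule integral_dominated_convergence[where w = "\<lambda>\<xi>. P * cmod (g \<xi> * cpx (C * decay \<xi>))"])
    have "sq_int lborel (\<lambda>\<xi>. cpx (jw \<xi>) * cpx (C * decay \<xi>))"
      by (rule sq_int_jw_decay[of _ C]) (use C0 in \<open>simp_all only: norm_of_real abs_mult abs_of_nonneg powr_ge_zero order_refl, measurable\<close>)
    from sq_int_mult[OF gj this] show "integrable lborel (\<lambda>\<xi>. P * cmod (g \<xi> * cpx (C * decay \<xi>)))"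
      unfolding jw_cancel by (intro integrable_mult_right integrable_norm)
    show "AE \<xi> in lborel. (\<lambda>k. nn k \<xi> * q (\<xi> / dil k)) \<longlonglongrightarrow> g \<xi> * q \<xi>"
      using AE_lborel_singleton[of 0]
    proof eventually_elim
      case (elim \<xi>)
      have "(\<lambda>k. tau k * \<xi>) \<longlonglongrightarrow> 0 * \<xi>" by (intro tendsto_intros tau_limit)
      then have t: "(\<lambda>k. tau k * \<xi>) \<longlonglongrightarrow> 0" by simp
      have "isCont Psi 0" using continuous_Psi by (simp add: continuous_on_eq_continuous_at)
      from isCont_tendsto_compose[OF this t] have 1: "(\<lambda>k. Psi (tau k * \<xi>)) \<longlonglongrightarrow> 1" by (simp add: Psi_0)
      have "(\<lambda>k. \<xi> * (1 / dil k)) \<longlonglongrightarrow> \<xi> * 1" by (intro tendsto_intros dil_limit)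
      then have 2: "(\<lambda>k. q (\<xi> / dil k)) \<longlonglongrightarrow> q \<xi>" using isCont_tendsto_compose[OF c[OF elim]] by simp
      have "(\<lambda>k. g \<xi> * Psi (tau k * \<xi>) * q (\<xi> / dil k)) \<longlonglongrightarrow> g \<xi> * 1 * q \<xi>" by (intro tendsto_intros 1 2)
      then show ?case by (simp add: nn_def)
    qed
    show "AE \<xi> in lborel. norm (nn k \<xi> * q (\<xi> / dil k)) \<le> P * cmod (g \<xi> * cpx (C * decay \<xi>))" for k
    proof (rule AE_I2)
      fix \<xi> :: real
      have "\<bar>\<xi>\<bar> * 1 \<le> \<bar>\<xi>\<bar> * (1 / dil k)" using dil_bounds[of k] by (intro mult_left_mono) auto
      then have "\<bar>\<xi>\<bar> \<le> \<bar>\<xi> / dil k\<bar>" using dil_bounds(1)[of k] by (simp add: abs_divide)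
      then have "decay (\<xi> / dil k) \<le> decay \<xi>" by (intro powr_mono2') auto
      then have "C * decay (\<xi> / dil k) \<le> C * decay \<xi>" using C0 by (intro mult_left_mono)
      then have qb: "cmod (q (\<xi> / dil k)) \<le> C * decay \<xi>" using C[of "\<xi> / dil k"] by linarith
      have "norm (nn k \<xi> * q (\<xi> / dil k)) = cmod (g \<xi>) * (cmod (Psi (tau k * \<xi>)) * cmod (q (\<xi> / dil k)))" by (simp add: nn_def norm_mult mult.assoc)
      also have "\<dots> \<le> cmod (g \<xi>) * (P * (C * decay \<xi>))" by (intro mult_left_mono mult_mono P qb) auto
      also have "\<dots> = P * cmod (g \<xi> * cpx (C * decay \<xi>))" using C0 by (simp add: norm_mult mult_ac)
      finally show "norm (nn k \<xi> * q (\<xi> / dil k)) \<le> P * cmod (g \<xi> * cpx (C * decay \<xi>))" .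
    qed
  qed (use q in \<open>auto simp: nn_def[abs_def]\<close>)
  from tendsto_mult[OF tendsto_of_real[OF dil_limit] this]
  show ?thesis unfolding eq by simp
qed

lemma mm_bound:
  obtains P where "\<And>k. sq_int lborel (\<lambda>\<eta>. mm k \<eta> / cpx (jw \<eta>))"
    "\<And>k. (LINT \<eta>|lborel. (cmod (mm k \<eta> / cpx (jw \<eta>)))^2) \<le> P"
proof -
  obtain P where P: "P \<ge> 0" "\<And>\<eta>. cmod (Psi \<eta>) \<le> P" using Psi_bounded by blast
  let ?h = "\<lambda>\<xi>. (cmod (g \<xi> / cpx (jw \<xi>)))^2"
  have hi: "integrable lborel ?h" by (rule sq_int_integrable[OF gj])
  have hk: "integrable lborel (\<lambda>\<eta>. ?h (0 + dil k * \<eta>))" for k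
    using dil_bounds(1)[of k] by (intro lborel_integrable_real_affine[OF hi]) simp
  \<comment> \<open>The Jacobian of the dilation is \<open>1 / dil k\<close>, which is largest for
    \<open>k = 0\<close>, where it is 3.\<close>
  have hv: "(LINT \<eta>|lborel. ?h (0 + dil k * \<eta>)) \<le> 3 * (LINT \<xi>|lborel. ?h \<xi>)" for k
  proof -
    have e: "(LINT \<xi>|lborel. ?h \<xi>) = \<bar>dil k\<bar> *\<^sub>R (LINT \<eta>|lborel. ?h (0 + dil k * \<eta>))"
      using dil_bounds(1)[of k] by (intro lborel_integral_real_affine) simp
    then have "(LINT \<eta>|lborel. ?h (0 + dil k * \<eta>)) = 1 / dil k * (LINT \<xi>|lborel. ?h \<xi>)" using dil_bounds(1)[of k] by simp
    also have "\<dots> \<le> 3 * (LINT \<xi>|lborel. ?h \<xi>)"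
      using dil_bounds(3)[of k] by (intro mult_right_mono integral_nonneg) auto
    finally show ?thesis .
  qed
  have pt: "(cmod (mm k \<eta> / cpx (jw \<eta>)))^2 \<le> P^2 * ?h (0 + dil k * \<eta>)" for k \<eta>
  proof -
    let ?y = "0 + dil k * \<eta>"
    have "\<bar>?y\<bar> \<le> \<bar>\<eta>\<bar>" using dil_bounds[of k] by (simp add: abs_mult mult_left_le_one_le)
    then have "?y^2 \<le> \<eta>^2" by (simp only: abs_le_square_iff)
    then have "(1 + ?y^2) powr (1/4) \<le> (1 + \<eta>^2) powr (1/4)" by (intro powr_mono2) auto
    then have j: "jw ?y \<le> jw \<eta>" unfolding jw_def .
    have "cmod (mm k \<eta> / cpx (jw \<eta>)) = cmod (g ?y) * cmod (Psi (tau k * ?y)) / jw \<eta>"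
      using jw_pos[of \<eta>] by (simp add: mm_def nn_def norm_divide norm_mult)
    also have "\<dots> \<le> cmod (g ?y) * P / jw ?y"
      using j jw_pos[of ?y] P by (intro frac_le mult_left_mono mult_nonneg_nonneg) auto
    also have "\<dots> = P * cmod (g ?y / cpx (jw ?y))" using jw_pos[of ?y] by (simp add: norm_divide)
    finally have "(cmod (mm k \<eta> / cpx (jw \<eta>)))^2 \<le> (P * cmod (g ?y / cpx (jw ?y)))^2" by (intro power_mono) auto
    then show ?thesis by (simp only: power_mult_distrib)
  qed
  have sq: "sq_int lborel (\<lambda>\<eta>. mm k \<eta> / cpx (jw \<eta>))" for k
    by (rule sq_int_bound[OF _ integrable_mult_right[OF hk, of "P^2"]]) (use pt in auto)
  have "(LINT \<eta>|lborel. (cmod (mm k \<eta> / cpx (jw \<eta>)))^2) \<le> P^2 * (3 * (LINT \<xi>|lborel. ?h \<xi>))" for k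
  proof -
    have "(LINT \<eta>|lborel. (cmod (mm k \<eta> / cpx (jw \<eta>)))^2) \<le> (LINT \<eta>|lborel. P^2 * ?h (0 + dil k * \<eta>))"
      by (rule integral_mono[OF sq_int_integrable[OF sq] integrable_mult_right[OF hk] pt])
    also have "\<dots> = P^2 * (LINT \<eta>|lborel. ?h (0 + dil k * \<eta>))" by (rule integral_mult_right_zero)
    also have "\<dots> \<le> P^2 * (3 * (LINT \<xi>|lborel. ?h \<xi>))" by (intro mult_left_mono hv) auto
    finally show ?thesis .
  qed
  then show ?thesis using that sq by blast
qed

text \<open>Inverts the constant \<open>2 pi / cheb_const n\<close> of the biorthogonality
  relation.\<close>

definition coeff :: "nat \<Rightarrow> complex" where
  "coeff n = cpx (cheb_const n / (2 * pi)) * (LINT \<xi>|lborel. g \<xi> * cheb_ext n (- \<xi>))"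

text \<open>Expressed through the distribution \<open>v\<close> alone and not through the transform
  \<open>g\<close>; hence its limit \<open>coeff\<close> is the same for every transform of
  \<open>v\<close>.\<close>

definition coeffk :: "nat \<Rightarrow> nat \<Rightarrow> complex" where
  "coeffk k n = cpx (cheb_const n) * (LINT x|lborel. v (mol k x) * ctp n x)"

lemma coeffk_eq: "coeffk k n = cpx (cheb_const n / (2 * pi)) * (LINT \<eta>|lborel. mm k \<eta> * cheb_ext n (- \<eta>))"
  using FF_cheb_pairing[of k n] by (simp add: coeffk_def FF_def)

lemma coeffk_limit: "(\<lambda>k. coeffk k n) \<longlonglongrightarrow> coeff n"
proof -
  obtain C where C: "C \<ge> 0" "\<And>\<xi>. cmod (cheb_ext n \<xi>) \<le> C * decay \<xi>" using cheb_ext_decay by blast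
  have "(\<lambda>k. LINT \<eta>|lborel. mm k \<eta> * cheb_ext n (- \<eta>)) \<longlonglongrightarrow> (LINT \<xi>|lborel. g \<xi> * cheb_ext n (- \<xi>))"
  proof (rule mm_limit)
    show "cmod (cheb_ext n (- \<xi>)) \<le> C * decay \<xi>" for \<xi> using C(2)[of "- \<xi>"] by simp
    fix \<xi> :: real assume "\<xi> \<noteq> 0"
    then have "isCont (cheb_ext n) (- \<xi>)" by (intro isCont_cheb_ext) simp
    then show "isCont (\<lambda>\<eta>. cheb_ext n (- \<eta>)) \<xi>" by (rule isCont_reflect)
  qed measurable
  then show ?thesis unfolding coeffk_eq coeff_def by (rule tendsto_mult_left)
qed

end

lemma (in bessel_system) dual_bound_scaled:
  assumes "sq_int M h" "\<And>n. \<bar>c n\<bar> \<le> (1::real)"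
  shows "summable (\<lambda>n. (cmod (cpx (c n) * (LINT x|M. e n x * h x)))^2 / w n)"
    and "(\<Sum>n. (cmod (cpx (c n) * (LINT x|M. e n x * h x)))^2 / w n) \<le> C * (LINT x|M. (cmod (h x))^2)" (is ?A)
proof -
  have le: "(cmod (cpx (c n) * (LINT x|M. e n x * h x)))^2 / w n \<le> (cmod (LINT x|M. e n x * h x))^2 / w n" for n
  proof (rule divide_right_mono)
    have "cmod (cpx (c n) * (LINT x|M. e n x * h x)) \<le> cmod (LINT x|M. e n x * h x)"
      using assms(2)[of n] by (simp add: norm_mult mult_left_le_one_le)
    then show "(cmod (cpx (c n) * (LINT x|M. e n x * h x)))^2 \<le> (cmod (LINT x|M. e n x * h x))^2" by (intro power_mono) auto
  qed (use w_pos in \<open>simp add: less_imp_le\<close>)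
  show s: "summable (\<lambda>n. (cmod (cpx (c n) * (LINT x|M. e n x * h x)))^2 / w n)"
    by (rule summable_comparison_test'[OF dual_bound(1)[OF assms(1)]]) (use le w_pos in \<open>auto simp: less_imp_le\<close>)
  show ?A
    using suminf_le[OF le s dual_bound(1)[OF assms(1)]] dual_bound(2)[OF assms(1)] by linarith
qed

lemma cheb_const_2pi: "\<bar>cheb_const n / (2 * pi)\<bar> \<le> 1"
proof -
  have "cheb_const n \<le> 2 * pi" using cheb_const_le_1[of n] pi_gt3 by linarith
  then show ?thesis using cheb_const_pos[of n] by (simp add: abs_of_pos)
qed

text \<open>The Bessel inequality for \<open>cheb_ext\<close> at order \<open>1/2\<close>, dualised,
  bounds the Chebyshev coefficients of a transform of order \<open>-1/2\<close>. The reflection is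
  due to the pairing with \<open>cheb_ext n (- \<eta>)\<close>.\<close>

lemma ext_dual_minus:
  assumes C: "bessel_system lborel (\<lambda>n \<xi>. cpx (jw \<xi>) * cheb_ext n \<xi>) wplus C"
    and m: "sq_int lborel (\<lambda>\<eta>. m \<eta> / cpx (jw \<eta>))"
  shows "summable (\<lambda>n. wminus n * (cmod (cpx (cheb_const n / (2 * pi)) * (LINT \<eta>|lborel. m \<eta> * cheb_ext n (- \<eta>))))^2)" (is ?A)
    and "(\<Sum>n. wminus n * (cmod (cpx (cheb_const n / (2 * pi)) * (LINT \<eta>|lborel. m \<eta> * cheb_ext n (- \<eta>))))^2)
      \<le> C * (LINT \<eta>|lborel. (cmod (m \<eta> / cpx (jw \<eta>)))^2)" (is ?B)
proof -
  interpret bessel_system lborel "\<lambda>n \<xi>. cpx (jw \<xi>) * cheb_ext n \<xi>" wplus C by (fact C)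
  have j: "jw (- \<eta>) = jw \<eta>" for \<eta> by (simp add: jw_def)
  have h: "sq_int lborel (\<lambda>\<eta>. m (- \<eta>) / cpx (jw \<eta>))" using sq_int_reflect[OF m] unfolding j .
  have hn: "(LINT \<eta>|lborel. (cmod (m (- \<eta>) / cpx (jw \<eta>)))^2) = (LINT \<eta>|lborel. (cmod (m \<eta> / cpx (jw \<eta>)))^2)"
    using lborel_reflect(1)[of "\<lambda>\<eta>. (cmod (m \<eta> / cpx (jw \<eta>)))^2"] unfolding j .
  have e: "(LINT \<eta>|lborel. cpx (jw \<eta>) * cheb_ext n \<eta> * (m (- \<eta>) / cpx (jw \<eta>))) = (LINT \<eta>|lborel. m \<eta> * cheb_ext n (- \<eta>))" for n
  proof -
    have "(LINT \<eta>|lborel. cpx (jw \<eta>) * cheb_ext n \<eta> * (m (- \<eta>) / cpx (jw \<eta>))) = (LINT \<eta>|lborel. m (- \<eta>) * cheb_ext n (- (- \<eta>)))"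
    proof (intro int_cong)
      fix \<eta> show "cpx (jw \<eta>) * cheb_ext n \<eta> * (m (- \<eta>) / cpx (jw \<eta>)) = m (- \<eta>) * cheb_ext n (- (- \<eta>))"
        using jw_pos[of \<eta>] by simp
    qed
    also have "\<dots> = (LINT \<eta>|lborel. m \<eta> * cheb_ext n (- \<eta>))" by (rule lborel_reflect(1))
    finally show ?thesis .
  qed
  have w: "x / wplus n = wminus n * x" for x n by (simp add: wminus_eq)
  note D = dual_bound_scaled[OF h cheb_const_2pi, unfolded e w hn]
  show ?A
    by (rule D(1))
  show ?B by (rule D(2))
qed

lemma test_coeff_summable:
  assumes \<phi>: "\<phi> \<in> test_funs I"
  shows "summable (\<lambda>n. wplus n * (cmod (test_coeff \<phi> n))^2)"
proof -
  obtain C where "bessel_system lborel (\<lambda>n \<xi>. cheb_ft n \<xi> / cpx (jw \<xi>)) wminus C" by (rule bessel_system_minus)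
  then interpret bessel_system lborel "\<lambda>n \<xi>. cheb_ft n \<xi> / cpx (jw \<xi>)" wminus C .
  have w: "x / wminus n = wplus n * x" for x n by (simp add: wminus_eq)
  show ?thesis using dual_bound(1)[OF sq_int_jw_inv_fourier[OF \<phi>]] unfolding jw_cancel cheb_ft_pairing[OF \<phi>] w .
qed

context tilde_rep
begin

text \<open>\<open>FF k\<close> is bounded and supported in the segment, so
  \<open>\<omega> FF k\<close> lies in the weighted space; its Chebyshev coefficients are
  \<open>coeffk k\<close>, and the statement is Parseval for it.\<close>

lemma FF_expansion:
  assumes \<phi>: "\<phi> \<in> test_funs I"
  shows "(\<lambda>n. coeffk k n * test_coeff \<phi> n) sums (LINT x|lborel. FF k x * \<phi> x)"
proof -
  obtain B where B: "\<And>x. cmod (FF k x) \<le> B" using FF_bounded by blast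
  obtain B' where B': "\<And>x. cmod (\<phi> x) \<le> B'" using test_funs_bounded_integrable(2)[OF \<phi>] by blast
  have pm: "\<phi> \<in> borel_measurable borel" by (rule test_funs_measurable[OF \<phi>])
  let ?\<alpha> = "\<lambda>x. cpx (weight x) * FF k x"
  have am: "?\<alpha> \<in> borel_measurable borel" by measurable
  have \<alpha>: "sq_int cheb_measure ?\<alpha>"
  proof (rule sq_int_cheb_bounded[OF am])
    fix x :: real assume x: "x \<in> {-1<..<1}"
    have "\<bar>weight x\<bar> \<le> 1" using weight_pos[OF x] by (simp add: weight_def)
    then have "\<bar>weight x\<bar> * cmod (FF k x) \<le> 1 * B" using B by (intro mult_mono) auto
    then show "cmod (?\<alpha> x) \<le> B" by (simp add: norm_mult)
  qed
  have conv: "(LINT x|cheb_measure. ?\<alpha> x * h x) = (LINT x|lborel. FF k x * h x)" if h: "h \<in> borel_measurable borel" for h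
  proof -
    have "(LINT x|cheb_measure. ?\<alpha> x * h x) = (LINT x|lborel. (indicator {-1<..<1} x * (?\<alpha> x / cpx (weight x))) * h x)"
      using integral_weighted(1)[OF am h] by simp
    also have "\<dots> = (LINT x|lborel. FF k x * h x)"
    proof (intro int_cong)
      fix x show "(indicator {-1<..<1} x * (?\<alpha> x / cpx (weight x))) * h x = FF k x * h x"
        using weight_pos[of x] FF_outside[of x k] by (cases "x \<in> {-1<..<1}") auto
    qed
    finally show ?thesis .
  qed
  have "sq_int cheb_measure \<phi>" by (rule sq_int_cheb_bounded[OF pm B'])
  from cheb_parseval(2)[OF \<alpha> this] show ?thesis
    unfolding conv[OF pm] test_coeff_def coeffk_def FF_def[symmetric] by (subst (asm) conv) auto
qed

lemma tilde_expansion: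
  assumes C: "bessel_system lborel (\<lambda>n \<xi>. cpx (jw \<xi>) * cheb_ext n \<xi>) wplus C"
  shows "coeff \<in> cheb_space (- 1 / 2)"
    and "cheb_norm (- 1 / 2) coeff \<le> sqrt C * sqrt (sob_int (- 1 / 2) g)" (is ?A)
    and "v = div_map coeff"
proof -
  interpret bessel_system lborel "\<lambda>n \<xi>. cpx (jw \<xi>) * cheb_ext n \<xi>" wplus C by (fact C)
  note E = ext_dual_minus[OF C gj, folded coeff_def]
  show "coeff \<in> cheb_space (- 1 / 2)" unfolding cheb_space_minus by (rule CollectI) (rule E(1))
  show ?A
    unfolding cheb_norm_minus sobolev_weight_minus real_sqrt_mult[symmetric] using E(2) by (rule real_sqrt_le_mono)
  obtain P where P: "\<And>k. sq_int lborel (\<lambda>\<eta>. mm k \<eta> / cpx (jw \<eta>))"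
    "\<And>k. (LINT \<eta>|lborel. (cmod (mm k \<eta> / cpx (jw \<eta>)))^2) \<le> P" using mm_bound by blast
  have ak: "summable (\<lambda>n. wminus n * (cmod (coeffk k n))^2)" "(\<Sum>n. wminus n * (cmod (coeffk k n))^2) \<le> C * P" for k
    using ext_dual_minus[OF C P(1), of k] mult_left_mono[OF P(2) C_nonneg, of k] unfolding coeffk_eq by auto
  \<comment> \<open>The integrals of \<open>FF k\<close> against \<phi> have two limits:
    \<open>v \<phi>\<close> on the Fourier side, by \<open>mm_limit\<close>, and the series on the
    coefficient side, by weak convergence of \<open>coeffk k\<close> to
    \<open>coeff\<close>.\<close>
  have "v \<phi> = (\<Sum>n. coeff n * test_coeff \<phi> n)" if \<phi>: "\<phi> \<in> test_funs UNIV" for \<phi>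
  proof (rule LIMSEQ_unique)
    show "(\<lambda>k. LINT x|lborel. FF k x * \<phi> x) \<longlonglongrightarrow> (\<Sum>n. coeff n * test_coeff \<phi> n)"
      by (rule weak_sequence_limit[OF test_coeff_summable[OF \<phi>] ak E(1) coeffk_limit FF_expansion[OF \<phi>]])
    obtain D where D: "D \<ge> 0" "\<And>\<xi>. cmod (inv_fourier \<phi> \<xi>) \<le> D * decay \<xi>" using inv_fourier_decay'[OF \<phi>] by blast
    show "(\<lambda>k. LINT x|lborel. FF k x * \<phi> x) \<longlonglongrightarrow> v \<phi>"
      unfolding FF_test_pairing[OF \<phi>] v_eq[OF \<phi>]
      by (rule mm_limit[OF inv_fourier_measurable[OF \<phi>] D(2)])
         (use inv_fourier_continuous[OF \<phi>] in \<open>simp add: continuous_on_eq_continuous_at\<close>)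
  qed
  moreover have "v \<phi> = 0" if "\<phi> \<notin> test_funs UNIV" for \<phi>
    using g that unfolding sobolev_fourier_minus by simp
  ultimately show "v = div_map coeff" by (auto simp: fun_eq_iff div_map_def)
qed

end

text \<open>Boundedness comes from the Bessel inequality for \<open>cheb_ft\<close>, the inverse
  bound from the one for \<open>cheb_ext\<close>, and surjectivity from
  \<open>tilde_expansion\<close>.\<close>

theorem div_map_bijective:
  obtains K where "K \<ge> 0" "bij_betw div_map (cheb_space (- 1 / 2)) H_tilde"
    "\<And>a. a \<in> cheb_space (- 1 / 2) \<Longrightarrow> H_tilde_norm (div_map a) \<le> K * cheb_norm (- 1 / 2) a"
    "\<And>a. a \<in> cheb_space (- 1 / 2) \<Longrightarrow> cheb_norm (- 1 / 2) a \<le> K * H_tilde_norm (div_map a)"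
proof -
  obtain C where C: "bessel_system lborel (\<lambda>n \<xi>. cpx (jw \<xi>) * cheb_ext n \<xi>) wplus C" by (rule bessel_system_plus)
  then interpret bessel_system lborel "\<lambda>n \<xi>. cpx (jw \<xi>) * cheb_ext n \<xi>" wplus C .
  obtain K where K: "K \<ge> 0"
    "\<And>a. a \<in> cheb_space (- 1 / 2) \<Longrightarrow> \<exists>g. sobolev_fourier (- 1 / 2) (div_map a) g \<and>
          sqrt (sob_int (- 1 / 2) g) \<le> K * cheb_norm (- 1 / 2) a \<and>
          (\<forall>n. (LINT \<xi>|lborel. g \<xi> * cheb_ext n (- \<xi>)) = a n * cpx (2 * pi / cheb_const n)) \<and>
          (\<forall>\<phi>\<in>test_funs UNIV. summable (\<lambda>n. a n * test_coeff \<phi> n))"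
    using div_map_fourier by blast
  \<comment> \<open>\<open>coeffk\<close> is determined by the distribution, so all its transforms
    yield the same limit; for the transform supplied by \<open>div_map_fourier\<close>
    biorthogonality shows that this limit is \<open>a\<close>.\<close>
  have same: "tilde_rep.coeff g = a" if a: "a \<in> cheb_space (- 1 / 2)" and g: "sobolev_fourier (- 1 / 2) (div_map a) g" for a g
  proof
    fix n
    obtain g' where g': "sobolev_fourier (- 1 / 2) (div_map a) g'" "(LINT \<xi>|lborel. g' \<xi> * cheb_ext n (- \<xi>)) = a n * cpx (2 * pi / cheb_const n)"
      using K(2)[OF a] by blast
    interpret G: tilde_rep "div_map a" g by unfold_locales (rule div_map_H_tilde[OF a], rule g)
    interpret G': tilde_rep "div_map a" g' by unfold_locales (rule div_map_H_tilde[OF a], rule g'(1))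
    have "G.coeff n = G'.coeff n" by (rule LIMSEQ_unique[OF G.coeffk_limit G'.coeffk_limit])
    also have "\<dots> = a n" unfolding G'.coeff_def g'(2) using cheb_const_pos[of n] by simp
    finally show "G.coeff n = a n" .
  qed
  have inj: "inj_on div_map (cheb_space (- 1 / 2))"
  proof (rule inj_onI)
    fix a b assume a: "a \<in> cheb_space (- 1 / 2)" and b: "b \<in> cheb_space (- 1 / 2)" and eq: "div_map a = div_map b"
    obtain g where g: "sobolev_fourier (- 1 / 2) (div_map a) g" using K(2)[OF a] by blast
    show "a = b" using same[OF a g] same[OF b g[unfolded eq]] by simp
  qed
  have surj: "v \<in> div_map ` cheb_space (- 1 / 2)" if v: "v \<in> H_tilde" for v
  proof -
    obtain g where g: "sobolev_fourier (- 1 / 2) v g" using v by (auto simp: H_tilde_def sobolev_def)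
    interpret G: tilde_rep v g by unfold_locales (rule v, rule g)
    show ?thesis using G.tilde_expansion[OF C] by (intro image_eqI[of _ _ G.coeff])
  qed
  show ?thesis
  proof (rule that[of "max K (sqrt C)"])
    show "0 \<le> max K (sqrt C)" using K(1) by simp
    show "bij_betw div_map (cheb_space (- 1 / 2)) H_tilde"
      unfolding bij_betw_def using inj surj div_map_H_tilde by blast
    fix a assume a: "a \<in> cheb_space (- 1 / 2)"
    have n0: "0 \<le> cheb_norm (- 1 / 2) a"
      using a wminus_pos unfolding cheb_norm_minus cheb_space_minus by (intro real_sqrt_ge_zero suminf_nonneg) (auto simp: less_imp_le)
    obtain g where g: "sobolev_fourier (- 1 / 2) (div_map a) g" "sqrt (sob_int (- 1 / 2) g) \<le> K * cheb_norm (- 1 / 2) a"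
      using K(2)[OF a] by blast
    have "H_tilde_norm (div_map a) \<le> K * cheb_norm (- 1 / 2) a"
      unfolding H_tilde_norm_def using sobolev_norm_le[OF g(1)] g(2) by linarith
    also have "\<dots> \<le> max K (sqrt C) * cheb_norm (- 1 / 2) a" using n0 by (intro mult_right_mono) auto
    finally show "H_tilde_norm (div_map a) \<le> max K (sqrt C) * cheb_norm (- 1 / 2) a" .
    have le: "cheb_norm (- 1 / 2) a \<le> max K (sqrt C) * sqrt (sob_int (- 1 / 2) g)"
      if g: "sobolev_fourier (- 1 / 2) (div_map a) g" for g
    proof -
      interpret G: tilde_rep "div_map a" g by unfold_locales (rule div_map_H_tilde[OF a], rule g)
      have "cheb_norm (- 1 / 2) a \<le> sqrt C * sqrt (sob_int (- 1 / 2) g)"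
        using G.tilde_expansion(2)[OF C] unfolding same[OF a g] .
      also have "\<dots> \<le> max K (sqrt C) * sqrt (sob_int (- 1 / 2) g)"
        by (intro mult_right_mono real_sqrt_ge_zero integral_nonneg) auto
      finally show ?thesis .
    qed
    show "cheb_norm (- 1 / 2) a \<le> max K (sqrt C) * H_tilde_norm (div_map a)"
    proof (cases "max K (sqrt C) = 0")
      case True
      then show ?thesis using le[OF g(1)] by simp
    next
      case False
      then have p: "max K (sqrt C) > 0" using K(1) by linarith
      have "cheb_norm (- 1 / 2) a / max K (sqrt C) \<le> H_tilde_norm (div_map a)"
        unfolding H_tilde_norm_def
      proof (rule sobolev_norm_ge)
        show "div_map a \<in> sobolev (- 1 / 2)" using g(1) by (auto simp: sobolev_def)
        show "cheb_norm (- 1 / 2) a / max K (sqrt C) \<le> sqrt (sob_int (- 1 / 2) g)"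
          if "sobolev_fourier (- 1 / 2) (div_map a) g" for g
          using le[OF that] p by (simp add: divide_le_eq mult.commute)
      qed
      then show ?thesis using p by (simp add: divide_le_eq mult.commute)
    qed
  qed
qed

section \<open>Distributions on the open segment\<close>

text \<open>Absorbs the weight: the Lebesgue integral against \<phi> is the
  \<open>cheb_measure\<close> integral against \<open>\<omega> \<phi>\<close>, which makes
  \<open>plain_coeff\<close> accessible to Parseval.\<close>

definition wfun :: "(real \<Rightarrow> complex) \<Rightarrow> real \<Rightarrow> complex" where
  "wfun \<phi> x = cpx (weight x) * \<phi> x"

definition plain_coeff :: "(real \<Rightarrow> complex) \<Rightarrow> nat \<Rightarrow> complex" where
  "plain_coeff \<phi> n = (LINT x|lborel. ctp n x * \<phi> x)"

lemma test_funs_outside: "\<phi> \<in> test_funs I \<Longrightarrow> x \<notin> I \<Longrightarrow> \<phi> x = 0"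
  by (auto simp: test_funs_def)

lemma sq_int_bounded: "\<phi> \<in> test_funs I \<Longrightarrow> sq_int cheb_measure \<phi>"
  using test_funs_bounded_integrable(2) test_funs_measurable by (metis sq_int_cheb_bounded)

lemma sq_int_wfun:
  assumes \<phi>: "\<phi> \<in> test_funs I"
  shows "sq_int cheb_measure (wfun \<phi>)"
  unfolding wfun_def[abs_def]
proof (rule sq_int_mult_bounded[OF sq_int_bounded[OF \<phi>], where B = 1])
  show "AE x in cheb_measure. cmod (cpx (weight x)) \<le> 1"
    using AE_cheb_measure_open
  proof eventually_elim
    case (elim x)
    then show ?case using weight_pos[OF elim] by (simp add: weight_def)
  qed
qed measurable

lemma integral_wfun:
  assumes \<phi>: "\<phi> \<in> test_funs {-1<..<1}" and h: "h \<in> borel_measurable borel"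
  shows "(LINT x|cheb_measure. wfun \<phi> x * h x) = (LINT x|lborel. \<phi> x * h x)"
proof -
  have m: "wfun \<phi> \<in> borel_measurable borel"
    unfolding wfun_def[abs_def] using test_funs_measurable[OF \<phi>] by measurable
  have "(LINT x|cheb_measure. wfun \<phi> x * h x) = (LINT x|lborel. (indicator {-1<..<1} x * (wfun \<phi> x / cpx (weight x))) * h x)"
    by (rule integral_weighted(1)[OF m h, symmetric])
  also have "\<dots> = (LINT x|lborel. \<phi> x * h x)"
  proof (intro int_cong)
    fix x show "(indicator {-1<..<1} x * (wfun \<phi> x / cpx (weight x))) * h x = \<phi> x * h x"
      using weight_pos[of x] test_funs_outside[OF \<phi>, of x] by (cases "x \<in> {-1<..<1}") (auto simp: wfun_def)
  qed
  finally show ?thesis .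
qed

lemma wfun_ctp:
  assumes \<phi>: "\<phi> \<in> test_funs {-1<..<1}"
  shows "(LINT x|cheb_measure. wfun \<phi> x * ctp n x) = plain_coeff \<phi> n"
    and "(LINT x|cheb_measure. ctp n x * wfun \<phi> x) = plain_coeff \<phi> n"
  unfolding plain_coeff_def using integral_wfun[OF \<phi>, of "ctp n"] by (simp_all add: mult.commute)

lemma plain_coeff_summable:
  assumes \<phi>: "\<phi> \<in> test_funs {-1<..<1}"
  shows "summable (\<lambda>n. (cmod (plain_coeff \<phi> n))^2)"
  using cheb_parseval(1)[OF sq_int_wfun[OF \<phi>] sq_int_wfun[OF \<phi>]] unfolding wfun_ctp[OF \<phi>] .

lemma summable_scaled_square:
  assumes "summable (\<lambda>n. (cmod (a n))^2)" "\<And>n. \<bar>c n\<bar> \<le> (1::real)"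
  shows "summable (\<lambda>n. (cmod (cpx (c n) * a n))^2)"
proof (rule summable_comparison_test'[OF assms(1)])
  fix n
  have "\<bar>c n\<bar> * cmod (a n) \<le> 1 * cmod (a n)" by (intro mult_right_mono assms(2)) auto
  then show "norm ((cmod (cpx (c n) * a n))^2) \<le> (cmod (a n))^2"
    by (simp only: norm_mult norm_of_real real_norm_def abs_power2) (intro power_mono, auto)
qed

lemma L2w_set_integrable:
  assumes "u \<in> L2w"
  shows "set_integrable lborel {-1<..<1} u"
proof -
  have u: "sq_int cheb_measure (tr u)" using assms by (simp add: L2w_iff)
  have "sq_int cheb_measure (\<lambda>x. cpx (indicator {-1<..<1} x * weight x))"
  proof (rule sq_int_cheb_bounded)
    fix x :: real assume "x \<in> {-1<..<1}"
    then show "cmod (cpx (indicator {-1<..<1} x * weight x)) \<le> 1" using weight_pos[of x] by (simp add: weight_def)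
  qed measurable
  from sq_int_mult[OF u this] have "integrable lborel (\<lambda>x. (indicator {-1<..<1} x * (tr u x / cpx (weight x))) * cpx (indicator {-1<..<1} x * weight x))"
    using sq_int_measurable[OF u] by (subst integral_weighted(2)) auto
  moreover have "(indicator {-1<..<1} x * (tr u x / cpx (weight x))) * cpx (indicator {-1<..<1} x * weight x) = indicator {-1<..<1} x *\<^sub>R u x" for x
    using weight_pos[of x] by (cases "x \<in> {-1<..<1}") (auto simp: tr_def)
  ultimately show ?thesis unfolding set_integrable_def by simp
qed

text \<open>The Chebyshev series as a distribution on the open segment, the counterpart of
  \<open>div_map\<close> for the space of order \<open>1/2\<close>.\<close>

definition ext_map :: "(nat \<Rightarrow> complex) \<Rightarrow> dist" where
  "ext_map b = (\<lambda>\<phi>. if \<phi> \<in> test_funs {-1<..<1} then (\<Sum>n. b n * plain_coeff \<phi> n) else 0)"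

lemma regular_dist_sums:
  assumes u: "u \<in> L2w" and \<phi>: "\<phi> \<in> test_funs {-1<..<1}"
  shows "(\<lambda>n. cheb_coeff u n * plain_coeff \<phi> n) sums regular_dist {-1<..<1} u \<phi>"
proof -
  have t: "sq_int cheb_measure (tr u)" using u by (simp add: L2w_iff)
  have tm: "tr u \<in> borel_measurable borel" using sq_int_measurable[OF t] by simp
  have "(\<lambda>n. cpx (cheb_const n) * (LINT x|cheb_measure. tr u x * ctp n x) * (LINT x|cheb_measure. ctp n x * wfun \<phi> x))
    sums (LINT x|cheb_measure. tr u x * wfun \<phi> x)"
    by (rule cheb_parseval(2)[OF t sq_int_wfun[OF \<phi>]])
  moreover have "(LINT x|cheb_measure. tr u x * wfun \<phi> x) = (LINT x|lborel. \<phi> x * tr u x)"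
    using integral_wfun[OF \<phi> tm] by (simp add: mult.commute)
  moreover have "(LINT x|lborel. \<phi> x * tr u x) = regular_dist {-1<..<1} u \<phi>"
    using \<phi> by (simp add: regular_dist_def set_lebesgue_integral_def tr_def mult.commute)
  ultimately show ?thesis unfolding wfun_ctp[OF \<phi>] cheb_coeff_eq[OF u] by simp
qed

lemma ext_map_cheb_coeff: "u \<in> L2w \<Longrightarrow> ext_map (cheb_coeff u) = regular_dist {-1<..<1} u"
  using regular_dist_sums by (auto simp: fun_eq_iff ext_map_def sums_iff) (simp add: regular_dist_def)

text \<open>Justifies the definite description in \<open>cheb_series\<close>: two functions of the
  weighted space with the same distribution agree almost everywhere, hence have the same
  coefficients.\<close>

lemma cheb_series_regular_dist:
  assumes u: "u \<in> L2w"
  shows "cheb_series (regular_dist {-1<..<1} u) = cheb_coeff u"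
  unfolding cheb_series_def
proof (rule the_equality)
  show "\<exists>v\<in>L2w. regular_dist {-1<..<1} v = regular_dist {-1<..<1} u \<and> cheb_coeff u = cheb_coeff v" using u by auto
  fix a assume "\<exists>v\<in>L2w. regular_dist {-1<..<1} v = regular_dist {-1<..<1} u \<and> a = cheb_coeff v"
  then obtain v where v: "v \<in> L2w" "regular_dist {-1<..<1} v = regular_dist {-1<..<1} u" "a = cheb_coeff v" by blast
  have i: "set_integrable lborel {-1<..<1} u" "set_integrable lborel {-1<..<1} v" by (intro L2w_set_integrable u v)+
  have "AE x in lborel. x \<in> {-1<..<1} \<longrightarrow> v x - u x = 0"
  proof (rule AE_zero_if_test_integrals_zero)
    show "set_integrable lborel {-1<..<1} (\<lambda>x. v x - u x)" by (rule set_integral_diff(1)[OF i(2,1)])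
    fix \<phi> assume \<phi>: "\<phi> \<in> test_funs {-1<..<1}"
    obtain B where B: "\<And>x. cmod (\<phi> x) \<le> B" using test_funs_bounded_integrable(2)[OF \<phi>] by blast
    have s: "set_integrable lborel {-1<..<1} (\<lambda>x. f x * \<phi> x)" if "set_integrable lborel {-1<..<1} f" for f
    proof -
      have f: "integrable lborel (\<lambda>x. indicator {-1<..<1} x *\<^sub>R f x)" using that by (simp add: set_integrable_def)
      have "integrable lborel (\<lambda>x. \<phi> x * (indicator {-1<..<1} x *\<^sub>R f x))"
        by (rule integrable_bounded_mult[OF f _ B]) (use test_funs_measurable[OF \<phi>] in simp)
      then show ?thesis by (simp add: set_integrable_def mult.commute)
    qed
    have "(LINT x:{-1<..<1}|lborel. (v x - u x) * \<phi> x) = (LINT x:{-1<..<1}|lborel. v x * \<phi> x - u x * \<phi> x)" by (simp add: left_diff_distrib)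
    also have "\<dots> = (LINT x:{-1<..<1}|lborel. v x * \<phi> x) - (LINT x:{-1<..<1}|lborel. u x * \<phi> x)"
      by (rule set_integral_diff(2)[OF s[OF i(2)] s[OF i(1)]])
    also have "\<dots> = 0" using fun_cong[OF v(2), of \<phi>] \<phi> by (simp add: regular_dist_def)
    finally show "(LINT x:{-1<..<1}|lborel. (v x - u x) * \<phi> x) = 0" .
  qed
  then have ae: "AE x in cheb_measure. tr v x = tr u x" unfolding AE_cheb_measure by eventually_elim (simp add: tr_def)
  have um: "tr u \<in> borel_measurable cheb_measure" "tr v \<in> borel_measurable cheb_measure" using u v(1) unfolding L2w_iff by (auto dest: sq_int_measurable)
  show "a = cheb_coeff u"
  proof
    fix n
    have "(LINT x|cheb_measure. tr v x * ctp n x) = (LINT x|cheb_measure. tr u x * ctp n x)"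
      by (rule integral_cong_AE) (use ae um in auto)
    then show "a n = cheb_coeff u n" by (simp add: v(3) cheb_coeff_eq[OF u] cheb_coeff_eq[OF v(1)])
  qed
qed

lemma cheb_series_ext_map:
  assumes "summable (\<lambda>n. (cmod (b n))^2)"
  shows "cheb_series (ext_map b) = b"
proof -
  obtain u where u: "sq_int cheb_measure u" "cheb_coeff u = b" using cheb_series_coeff_exists[OF assms] by blast
  then have L: "u \<in> L2w" by (intro sq_int_L2w)
  show ?thesis using cheb_series_regular_dist[OF L] ext_map_cheb_coeff[OF L] unfolding u(2) by simp
qed

text \<open>The Bessel inequality for \<open>cheb_ft\<close> at order \<open>-1/2\<close>, dualised:
  the coefficients of a function of order \<open>1/2\<close> are its pairings with
  \<open>T_n / \<omega>\<close>.\<close>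

lemma ft_dual_plus:
  assumes C: "bessel_system lborel (\<lambda>n \<xi>. cheb_ft n \<xi> / cpx (jw \<xi>)) wminus C"
    and g: "sq_int lborel (\<lambda>\<eta>. cpx (jw \<eta>) * g \<eta>)"
  shows "summable (\<lambda>n. wplus n * (cmod (cpx (cheb_const n / (2 * pi)) * (LINT \<eta>|lborel. cheb_ft n \<eta> * g (- \<eta>))))^2)" (is ?A)
    and "(\<Sum>n. wplus n * (cmod (cpx (cheb_const n / (2 * pi)) * (LINT \<eta>|lborel. cheb_ft n \<eta> * g (- \<eta>))))^2)
      \<le> C * (LINT \<eta>|lborel. (cmod (cpx (jw \<eta>) * g \<eta>))^2)" (is ?B)
proof -
  interpret bessel_system lborel "\<lambda>n \<xi>. cheb_ft n \<xi> / cpx (jw \<xi>)" wminus C by (fact C)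
  have j: "jw (- \<eta>) = jw \<eta>" for \<eta> by (simp add: jw_def)
  have h: "sq_int lborel (\<lambda>\<eta>. cpx (jw \<eta>) * g (- \<eta>))" using sq_int_reflect[OF g] unfolding j .
  have hn: "(LINT \<eta>|lborel. (cmod (cpx (jw \<eta>) * g (- \<eta>)))^2) = (LINT \<eta>|lborel. (cmod (cpx (jw \<eta>) * g \<eta>))^2)"
    using lborel_reflect(1)[of "\<lambda>\<eta>. (cmod (cpx (jw \<eta>) * g \<eta>))^2"] unfolding j .
  have w: "x / wminus n = wplus n * x" for x n by (simp add: wminus_eq)
  note D = dual_bound_scaled[OF h cheb_const_2pi, unfolded jw_cancel w hn]
  show ?A
    by (rule D(1))
  show ?B by (rule D(2))
qed

text \<open>Parseval for \<open>\<omega> \<phi>\<close> against the exponential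
  \<open>e^(-i x \<xi>)\<close>, whose Chebyshev integrals are the
  \<open>cheb_ft n \<xi>\<close>.\<close>

lemma cheb_expansion_inv_fourier:
  assumes \<phi>: "\<phi> \<in> test_funs {-1<..<1}"
  shows "(\<lambda>n. cpx (cheb_const n / (2 * pi)) * plain_coeff \<phi> n * cheb_ft n \<xi>) sums inv_fourier \<phi> (- \<xi>)"
proof -
  have "sq_int cheb_measure (\<lambda>x. cis (- x * \<xi>))" by (rule sq_int_cheb_bounded[of _ 1]) auto
  from cheb_parseval(2)[OF sq_int_wfun[OF \<phi>] this]
  have "(\<lambda>n. cpx (cheb_const n) * plain_coeff \<phi> n * cheb_ft n \<xi>) sums (LINT x|cheb_measure. wfun \<phi> x * cis (- x * \<xi>))"
    unfolding wfun_ctp[OF \<phi>] cheb_ft_eq .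
  from sums_mult[OF this, of "cpx (1 / (2 * pi))"]
  have "(\<lambda>n. cpx (1 / (2 * pi)) * (cpx (cheb_const n) * plain_coeff \<phi> n * cheb_ft n \<xi>)) sums inv_fourier \<phi> (- \<xi>)"
    using integral_wfun[OF \<phi>, of "\<lambda>x. cis (- x * \<xi>)"] by (simp add: inv_fourier_def mult.commute)
  moreover have "cpx (1 / (2 * pi)) * (cpx (cheb_const n) * plain_coeff \<phi> n * cheb_ft n \<xi>)
      = cpx (cheb_const n / (2 * pi)) * plain_coeff \<phi> n * cheb_ft n \<xi>" for n by simp
  ultimately show ?thesis by simp
qed

text \<open>In the formula for \<open>U \<phi>\<close> the inverse transform of \<phi> is replaced
  by its expansion in the \<open>cheb_ft n\<close>. The expansion holds pointwise, and the Bessel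
  inequality upgrades it to \<open>L^2\<close> convergence after division by \<open>jw\<close>,
  which permits integration term by term against \<open>g\<close>.\<close>

lemma restrict_eq_ext_map:
  assumes C: "bessel_system lborel (\<lambda>n \<xi>. cheb_ft n \<xi> / cpx (jw \<xi>)) wminus C"
    and g: "sobolev_fourier (1 / 2) U g"
  shows "restrict_dist {-1<..<1} U = ext_map (\<lambda>n. cpx (cheb_const n / (2 * pi)) * (LINT \<eta>|lborel. cheb_ft n \<eta> * g (- \<eta>)))"
proof
  fix \<phi>
  interpret bessel_system lborel "\<lambda>n \<xi>. cheb_ft n \<xi> / cpx (jw \<xi>)" wminus C by (fact C)
  have j: "jw (- \<eta>) = jw \<eta>" for \<eta> by (simp add: jw_def)
  have gj: "sq_int lborel (\<lambda>\<eta>. cpx (jw \<eta>) * g (- \<eta>))"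
    using sq_int_reflect[of "\<lambda>\<eta>. cpx (jw \<eta>) * g \<eta>"] g unfolding sobolev_fourier_plus j by blast
  show "restrict_dist {-1<..<1} U \<phi> = ext_map (\<lambda>n. cpx (cheb_const n / (2 * pi)) * (LINT \<eta>|lborel. cheb_ft n \<eta> * g (- \<eta>))) \<phi>"
  proof (cases "\<phi> \<in> test_funs {-1<..<1}")
    case True
    note \<phi> = True
    then have \<phi>U: "\<phi> \<in> test_funs UNIV" using test_funs_mono[of "{-1<..<1}" UNIV] by auto
    let ?a = "\<lambda>n. cpx (cheb_const n / (2 * pi)) * plain_coeff \<phi> n"
    have a: "summable (\<lambda>n. wminus n * (cmod (?a n))^2)"
      by (intro summable_imp_minus summable_scaled_square plain_coeff_summable[OF \<phi>] cheb_const_2pi)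
    have m: "inv_fourier \<phi> \<in> borel_measurable borel" by (rule inv_fourier_measurable[OF \<phi>])
    have "(\<lambda>n. ?a n * (cheb_ft n \<xi> / cpx (jw \<xi>))) sums (inv_fourier \<phi> (- \<xi>) / cpx (jw \<xi>))" for \<xi>
      using sums_divide[OF cheb_expansion_inv_fourier[OF \<phi>, of \<xi>], of "cpx (jw \<xi>)"] by simp
    then have "AE \<xi> in lborel. (\<lambda>n. ?a n * (cheb_ft n \<xi> / cpx (jw \<xi>))) sums (inv_fourier \<phi> (- \<xi>) / cpx (jw \<xi>))" by simp
    from sums_of_pointwise_limit(2)[OF a _ this gj]
    have "(\<lambda>n. ?a n * (LINT \<xi>|lborel. cheb_ft n \<xi> * g (- \<xi>))) sums (LINT \<xi>|lborel. inv_fourier \<phi> (- \<xi>) * g (- \<xi>))"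
      unfolding jw_cancel using m by simp
    moreover have "(LINT \<xi>|lborel. inv_fourier \<phi> (- \<xi>) * g (- \<xi>)) = (LINT \<xi>|lborel. g \<xi> * inv_fourier \<phi> \<xi>)"
      using lborel_reflect(1)[of "\<lambda>\<xi>. inv_fourier \<phi> \<xi> * g \<xi>"] by (simp add: mult.commute)
    moreover have "(LINT \<xi>|lborel. g \<xi> * inv_fourier \<phi> \<xi>) = U \<phi>" using g \<phi>U unfolding sobolev_fourier_plus by simp
    ultimately have "(\<lambda>n. cpx (cheb_const n / (2 * pi)) * (LINT \<eta>|lborel. cheb_ft n \<eta> * g (- \<eta>)) * plain_coeff \<phi> n) sums U \<phi>"
      by (simp add: mult_ac)
    then show ?thesis using \<phi> by (simp add: restrict_dist_def ext_map_def sums_iff)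
  qed (simp add: restrict_dist_def ext_map_def)
qed

text \<open>A bounded extension operator: the series of the \<open>cheb_ext n\<close> with
  coefficients \<open>b n\<close> converges in the Sobolev space of the line and restricts to the
  Chebyshev series.\<close>

lemma ext_map_extension:
  assumes C: "bessel_system lborel (\<lambda>n \<xi>. cpx (jw \<xi>) * cheb_ext n \<xi>) wplus C"
    and b: "b \<in> cheb_space (1 / 2)"
  shows "\<exists>U g. sobolev_fourier (1 / 2) U g \<and> restrict_dist {-1<..<1} U = ext_map b \<and>
    sqrt (sob_int (1 / 2) g) \<le> sqrt C * cheb_norm (1 / 2) b"
proof -
  interpret bessel_system lborel "\<lambda>n \<xi>. cpx (jw \<xi>) * cheb_ext n \<xi>" wplus C by (fact C)
  have b': "summable (\<lambda>n. wplus n * (cmod (b n))^2)" using b unfolding cheb_space_plus by simp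
  obtain g0 where g0: "sq_int lborel g0" "(LINT x|lborel. (cmod (g0 x))^2) \<le> C * (\<Sum>n. wplus n * (cmod (b n))^2)"
    "\<And>h. sq_int lborel h \<Longrightarrow> (\<lambda>n. b n * (LINT x|lborel. cpx (jw x) * cheb_ext n x * h x)) sums (LINT x|lborel. g0 x * h x)"
    using riesz_fischer[OF b'] by blast
  let ?g = "\<lambda>\<xi>. g0 \<xi> / cpx (jw \<xi>)"
  let ?U = "\<lambda>\<phi>. if \<phi> \<in> test_funs UNIV then (LINT \<xi>|lborel. ?g \<xi> * inv_fourier \<phi> \<xi>) else 0"
  have jg: "cpx (jw \<xi>) * ?g \<xi> = g0 \<xi>" for \<xi> using jw_pos[of \<xi>] by simp
  have gm: "g0 \<in> borel_measurable borel" using sq_int_measurable[OF g0(1)] by simp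
  have U: "sobolev_fourier (1 / 2) ?U ?g" unfolding sobolev_fourier_plus jg using g0(1) gm by simp
  have R: "restrict_dist {-1<..<1} ?U = ext_map b"
  proof
    fix \<phi>
    show "restrict_dist {-1<..<1} ?U \<phi> = ext_map b \<phi>"
    proof (cases "\<phi> \<in> test_funs {-1<..<1}")
      case True
      note \<phi> = True
      then have \<phi>U: "\<phi> \<in> test_funs UNIV" using test_funs_mono[of "{-1<..<1}" UNIV] by auto
      have im: "inv_fourier \<phi> \<in> borel_measurable borel" by (rule inv_fourier_measurable[OF \<phi>])
      \<comment> \<open>Division by \<open>jw\<close> instead of multiplication is harmless, as
        \<open>1 / jw^2 \<le> 1\<close>.\<close>
      have "sq_int lborel (\<lambda>\<xi>. cpx (1 / (jw \<xi>)^2) * (cpx (jw \<xi>) * inv_fourier \<phi> \<xi>))"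
        using jw_square_bounds(4) by (intro sq_int_mult_bounded[OF sq_int_jw_inv_fourier[OF \<phi>], where B = 1]) (auto simp: norm_divide norm_power intro!: AE_I2 divide_le_eq_1[THEN iffD2])
      moreover have "cpx (1 / (jw \<xi>)^2) * (cpx (jw \<xi>) * inv_fourier \<phi> \<xi>) = inv_fourier \<phi> \<xi> / cpx (jw \<xi>)" for \<xi>
        using jw_pos[of \<xi>] by (simp add: power2_eq_square)
      ultimately have h: "sq_int lborel (\<lambda>\<xi>. inv_fourier \<phi> \<xi> / cpx (jw \<xi>))" by simp
      have e: "cpx (jw \<xi>) * cheb_ext n \<xi> * (inv_fourier \<phi> \<xi> / cpx (jw \<xi>)) = cheb_ext n \<xi> * inv_fourier \<phi> \<xi>" for n \<xi>
        using jw_pos[of \<xi>] by simp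
      have "(\<lambda>n. b n * plain_coeff \<phi> n) sums (LINT \<xi>|lborel. g0 \<xi> * (inv_fourier \<phi> \<xi> / cpx (jw \<xi>)))"
        using g0(3)[OF h] unfolding e cheb_ext_pairing[OF \<phi>] plain_coeff_def .
      then show ?thesis using \<phi> \<phi>U by (simp add: restrict_dist_def ext_map_def sums_iff)
    qed (simp add: restrict_dist_def ext_map_def)
  qed
  have "sqrt (sob_int (1 / 2) ?g) \<le> sqrt C * cheb_norm (1 / 2) b"
    unfolding cheb_norm_plus sobolev_weight_plus[where g = ?g] jg real_sqrt_mult[symmetric] by (rule real_sqrt_le_mono[OF g0(2)])
  then show ?thesis using U R by blast
qed

lemma sobolev_norm_nonneg: "u \<in> sobolev s \<Longrightarrow> 0 \<le> sobolev_norm s u"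
  by (rule sobolev_norm_ge) (auto intro!: integral_nonneg)

lemma H_half_norm_le:
  assumes "U \<in> sobolev (1 / 2)"
  shows "H_half_norm (restrict_dist {-1<..<1} U) \<le> sobolev_norm (1 / 2) U"
  unfolding H_half_norm_def
proof (rule cInf_lower)
  show "sobolev_norm (1 / 2) U \<in> {sobolev_norm (1 / 2) V |V. V \<in> sobolev (1 / 2) \<and> restrict_dist {-1<..<1} V = restrict_dist {-1<..<1} U}"
    using assms by blast
  show "bdd_below {sobolev_norm (1 / 2) V |V. V \<in> sobolev (1 / 2) \<and> restrict_dist {-1<..<1} V = restrict_dist {-1<..<1} U}"
    using sobolev_norm_nonneg by (intro bdd_belowI[of _ 0]) auto
qed

lemma H_half_norm_ge:
  assumes v: "v \<in> H_half"
    and c: "\<And>U g. sobolev_fourier (1 / 2) U g \<Longrightarrow> restrict_dist {-1<..<1} U = v \<Longrightarrow> c \<le> sqrt (sob_int (1 / 2) g)"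
  shows "c \<le> H_half_norm v"
  unfolding H_half_norm_def
proof (rule cInf_greatest)
  show "{sobolev_norm (1 / 2) U |U. U \<in> sobolev (1 / 2) \<and> restrict_dist {-1<..<1} U = v} \<noteq> {}"
    using v by (auto simp: H_half_def)
  fix x assume "x \<in> {sobolev_norm (1 / 2) U |U. U \<in> sobolev (1 / 2) \<and> restrict_dist {-1<..<1} U = v}"
  then obtain U where U: "U \<in> sobolev (1 / 2)" "restrict_dist {-1<..<1} U = v" "x = sobolev_norm (1 / 2) U" by blast
  show "c \<le> x" unfolding U(3) by (rule sobolev_norm_ge[OF U(1)]) (rule c[OF _ U(2)])
qed

lemma cheb_norm_nonneg: "a \<in> cheb_space s \<Longrightarrow> 0 \<le> cheb_norm s a"
  unfolding cheb_norm_def cheb_space_def by (intro real_sqrt_ge_zero suminf_nonneg) auto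

text \<open>The norm of \<open>H_half\<close> is an infimum over extensions. The upper bound uses
  the extension by \<open>cheb_ext\<close>; the lower bound uses the dual Bessel estimate, which
  holds for every extension.\<close>

theorem ext_map_bijective:
  "\<exists>K \<ge> 0. bij_betw ext_map (cheb_space (1 / 2)) H_half \<and>
    (\<forall>b\<in>cheb_space (1 / 2). H_half_norm (ext_map b) \<le> K * cheb_norm (1 / 2) b \<and> cheb_norm (1 / 2) b \<le> K * H_half_norm (ext_map b))"
proof -
  obtain C where C: "bessel_system lborel (\<lambda>n \<xi>. cheb_ft n \<xi> / cpx (jw \<xi>)) wminus C" using bessel_system_minus by blast
  obtain D where D: "bessel_system lborel (\<lambda>n \<xi>. cpx (jw \<xi>) * cheb_ext n \<xi>) wplus D" using bessel_system_plus by blast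
  have C0: "C \<ge> 0" "D \<ge> 0" using C D by (auto simp: bessel_system_def)
  \<comment> \<open>The summand 1 makes \<open>K\<close> positive, so that one may divide by
    it.\<close>
  define K where "K = sqrt C + sqrt D + 1"
  have K: "K > 0" "sqrt C \<le> K" "sqrt D \<le> K" using C0 by (auto simp: K_def add_pos_nonneg intro!: add_nonneg_pos)
  let ?b = "\<lambda>g n. cpx (cheb_const n / (2 * pi)) * (LINT \<eta>|lborel. cheb_ft n \<eta> * g (- \<eta>))"
  have l2: "summable (\<lambda>n. (cmod (b n))^2)" if "b \<in> cheb_space (1 / 2)" for b
    using that unfolding cheb_space_plus by (intro summable_plus_imp) simp
  have rep: "?b g \<in> cheb_space (1 / 2)" "cheb_norm (1 / 2) (?b g) \<le> sqrt C * sqrt (sob_int (1 / 2) g)"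
    if g: "sobolev_fourier (1 / 2) U g" for U g
  proof -
    have gj: "sq_int lborel (\<lambda>\<xi>. cpx (jw \<xi>) * g \<xi>)" using g unfolding sobolev_fourier_plus by blast
    show "?b g \<in> cheb_space (1 / 2)" unfolding cheb_space_plus by (rule CollectI) (rule ft_dual_plus(1)[OF C gj])
    show "cheb_norm (1 / 2) (?b g) \<le> sqrt C * sqrt (sob_int (1 / 2) g)"
      unfolding cheb_norm_plus sobolev_weight_plus real_sqrt_mult[symmetric] by (rule real_sqrt_le_mono[OF ft_dual_plus(2)[OF C gj]])
  qed
  have mem: "ext_map b \<in> H_half" "H_half_norm (ext_map b) \<le> K * cheb_norm (1 / 2) b" if b: "b \<in> cheb_space (1 / 2)" for b
  proof -
    obtain U g where U: "sobolev_fourier (1 / 2) U g" "restrict_dist {-1<..<1} U = ext_map b"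
      "sqrt (sob_int (1 / 2) g) \<le> sqrt D * cheb_norm (1 / 2) b"
      using ext_map_extension[OF D b] by blast
    have S: "U \<in> sobolev (1 / 2)" using U(1) by (auto simp: sobolev_def)
    show "ext_map b \<in> H_half" using S U(2) by (auto simp: H_half_def intro!: image_eqI[of _ _ U])
    have "H_half_norm (ext_map b) \<le> sobolev_norm (1 / 2) U" using H_half_norm_le[OF S] unfolding U(2) .
    also have "\<dots> \<le> sqrt D * cheb_norm (1 / 2) b" using sobolev_norm_le[OF U(1)] U(3) by linarith
    also have "\<dots> \<le> K * cheb_norm (1 / 2) b" by (intro mult_right_mono K cheb_norm_nonneg b)
    finally show "H_half_norm (ext_map b) \<le> K * cheb_norm (1 / 2) b" .
  qed
  have low: "cheb_norm (1 / 2) b \<le> K * H_half_norm (ext_map b)" if b: "b \<in> cheb_space (1 / 2)" for b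
  proof -
    have "cheb_norm (1 / 2) b / K \<le> H_half_norm (ext_map b)"
    proof (rule H_half_norm_ge[OF mem(1)[OF b]])
      fix U g assume g: "sobolev_fourier (1 / 2) U g" and U: "restrict_dist {-1<..<1} U = ext_map b"
      have "ext_map (?b g) = ext_map b" using restrict_eq_ext_map[OF C g] U by simp
      \<comment> \<open>The coefficients obtained from any extension are \<open>b\<close>, since
        \<open>cheb_series\<close> recovers them from the restriction.\<close>
      then have "?b g = b" using cheb_series_ext_map[OF l2[OF b]] cheb_series_ext_map[OF l2[OF rep(1)[OF g]]] by simp
      then have "cheb_norm (1 / 2) b \<le> sqrt C * sqrt (sob_int (1 / 2) g)" using rep(2)[OF g] by simp
      also have "\<dots> \<le> K * sqrt (sob_int (1 / 2) g)"
        by (intro mult_right_mono K real_sqrt_ge_zero integral_nonneg) auto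
      finally show "cheb_norm (1 / 2) b / K \<le> sqrt (sob_int (1 / 2) g)"
        using K(1) by (simp only: pos_divide_le_eq mult.commute)
    qed
    then show ?thesis using K(1) by (simp only: pos_divide_le_eq mult.commute)
  qed
  have "bij_betw ext_map (cheb_space (1 / 2)) H_half"
  proof (rule bij_betw_byWitness[where f' = cheb_series])
    show "\<forall>b\<in>cheb_space (1 / 2). cheb_series (ext_map b) = b" using cheb_series_ext_map[OF l2] by blast
    have 1: "\<exists>b\<in>cheb_space (1 / 2). v = ext_map b" if "v \<in> H_half" for v
    proof -
      obtain U g where "sobolev_fourier (1 / 2) U g" "v = restrict_dist {-1<..<1} U" using \<open>v \<in> H_half\<close> by (auto simp: H_half_def sobolev_def)
      then show ?thesis using rep(1) restrict_eq_ext_map[OF C] by (intro bexI[of _ "?b g"]) auto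
    qed
    show "\<forall>v\<in>H_half. ext_map (cheb_series v) = v" 
    proof
      fix v assume "v \<in> H_half"
      then obtain b where "b \<in> cheb_space (1 / 2)" "v = ext_map b" using 1 by blast
      then show "ext_map (cheb_series v) = v" using cheb_series_ext_map[OF l2] by simp
    qed
    show "cheb_series ` H_half \<subseteq> cheb_space (1 / 2)"
    proof (rule image_subsetI)
      fix v assume "v \<in> H_half"
      then obtain b where "b \<in> cheb_space (1 / 2)" "v = ext_map b" using 1 by blast
      then show "cheb_series v \<in> cheb_space (1 / 2)" using cheb_series_ext_map[OF l2] by simp
    qed
    show "ext_map ` cheb_space (1 / 2) \<subseteq> H_half" using mem(1) by blast
  qed
  then show ?thesis using K(1) mem(2) low by (intro exI[of _ K]) auto
qed

section \<open>Operators on weighted sequence spaces\<close>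

definition linear_set :: "('a \<Rightarrow> complex) set \<Rightarrow> bool" where
  "linear_set X \<longleftrightarrow> (\<forall>x\<in>X. \<forall>y\<in>X. (\<lambda>i. x i + y i) \<in> X) \<and> (\<forall>c. \<forall>x\<in>X. (\<lambda>i. c * x i) \<in> X)"

lemma bounded_opI:
  assumes "\<And>x. x \<in> X \<Longrightarrow> F x \<in> Y" "\<And>x y. x \<in> X \<Longrightarrow> y \<in> X \<Longrightarrow> F (\<lambda>i. x i + y i) = (\<lambda>j. F x j + F y j)"
    and "\<And>c x. x \<in> X \<Longrightarrow> F (\<lambda>i. c * x i) = (\<lambda>j. c * F x j)" "\<And>x. x \<in> X \<Longrightarrow> nY (F x) \<le> C * nX x"
  shows "bounded_op X nX Y nY F"
  using assms unfolding bounded_op_def by blast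

lemma bounded_opD:
  assumes "bounded_op X nX Y nY F"
  shows "x \<in> X \<Longrightarrow> F x \<in> Y" "x \<in> X \<Longrightarrow> y \<in> X \<Longrightarrow> F (\<lambda>i. x i + y i) = (\<lambda>j. F x j + F y j)"
    "x \<in> X \<Longrightarrow> F (\<lambda>i. c * x i) = (\<lambda>j. c * F x j)"
  using assms unfolding bounded_op_def by blast+

lemma bounded_op_bound:
  assumes "bounded_op X nX Y nY F" "\<And>x. x \<in> X \<Longrightarrow> 0 \<le> nX x"
  obtains C where "C \<ge> 0" "\<And>x. x \<in> X \<Longrightarrow> nY (F x) \<le> C * nX x"
proof -
  obtain C where C: "\<And>x. x \<in> X \<Longrightarrow> nY (F x) \<le> C * nX x" using assms(1) unfolding bounded_op_def by blast
  show ?thesis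
  proof (rule that[of "max C 0"])
    fix x assume "x \<in> X"
    then have "C * nX x \<le> max C 0 * nX x" using assms(2) by (intro mult_right_mono) auto
    then show "nY (F x) \<le> max C 0 * nX x" using C[OF \<open>x \<in> X\<close>] by linarith
  qed simp
qed

lemma bounded_op_cong:
  assumes X: "linear_set X" and eq: "\<And>x. x \<in> X \<Longrightarrow> F x = G x" and G: "bounded_op X nX Y nY G"
  shows "bounded_op X nX Y nY F"
proof -
  obtain C where C: "\<And>x. x \<in> X \<Longrightarrow> nY (G x) \<le> C * nX x" using G unfolding bounded_op_def by blast
  have cl: "x \<in> X \<Longrightarrow> y \<in> X \<Longrightarrow> (\<lambda>i. x i + y i) \<in> X" "x \<in> X \<Longrightarrow> (\<lambda>i. c * x i) \<in> X" for x y c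
    using X unfolding linear_set_def by blast+
  show ?thesis by (rule bounded_opI[where C = C]) (simp_all only: eq cl bounded_opD[OF G] C)
qed

lemma bounded_op_comp:
  assumes F: "bounded_op X nX Y nY F" and G: "bounded_op Y nY Z nZ G" and n: "\<And>y. y \<in> Y \<Longrightarrow> 0 \<le> nY y"
  shows "bounded_op X nX Z nZ (\<lambda>x. G (F x))"
proof -
  obtain C where C: "\<And>x. x \<in> X \<Longrightarrow> nY (F x) \<le> C * nX x" using F unfolding bounded_op_def by blast
  obtain D where D: "D \<ge> 0" "\<And>y. y \<in> Y \<Longrightarrow> nZ (G y) \<le> D * nY y" using bounded_op_bound[OF G n] by blast
  show ?thesis
  proof (rule bounded_opI[where C = "D * C"])
    fix x assume x: "x \<in> X"
    have "nZ (G (F x)) \<le> D * nY (F x)" by (intro D bounded_opD(1)[OF F x])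
    also have "\<dots> \<le> D * (C * nX x)" by (intro mult_left_mono C x D)
    finally show "nZ (G (F x)) \<le> D * C * nX x" by (simp add: mult.assoc)
  qed (simp_all add: bounded_opD[OF F] bounded_opD[OF G])
qed

lemma bounded_isoI:
  assumes X: "linear_set X" and F: "bounded_op X nX Y nY F" and bij: "bij_betw F X Y"
    and low: "\<And>x. x \<in> X \<Longrightarrow> nX x \<le> C * nY (F x)"
  shows "bounded_iso X nX Y nY F"
proof -
  have cl: "x \<in> X \<Longrightarrow> y \<in> X \<Longrightarrow> (\<lambda>i. x i + y i) \<in> X" "x \<in> X \<Longrightarrow> (\<lambda>i. c * x i) \<in> X" for x y c
    using X unfolding linear_set_def by blast+
  have inv: "inv_into X F y \<in> X" "F (inv_into X F y) = y" if "y \<in> Y" for y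
    using that bij by (auto simp: bij_betw_def inv_into_into f_inv_into_f)
  have inv': "inv_into X F (F x) = x" if "x \<in> X" for x using that bij by (simp add: bij_betw_def inv_into_f_f)
  have "bounded_op Y nY X nX (inv_into X F)"
  proof (rule bounded_opI[where C = C])
    fix y z :: "'b \<Rightarrow> complex" and c assume y: "y \<in> Y"
    have "inv_into X F (\<lambda>i. c * y i) = inv_into X F (F (\<lambda>i. c * inv_into X F y i))"
      by (simp add: bounded_opD(3)[OF F inv(1)[OF y]] inv(2)[OF y])
    then show "inv_into X F (\<lambda>i. c * y i) = (\<lambda>j. c * inv_into X F y j)" by (simp add: inv' cl inv y)
    show "inv_into X F y \<in> X" by (rule inv(1)[OF y])
    show "nX (inv_into X F y) \<le> C * nY y" using low[OF inv(1)[OF y]] by (simp add: inv(2)[OF y])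
    assume z: "z \<in> Y"
    have "inv_into X F (\<lambda>i. y i + z i) = inv_into X F (F (\<lambda>i. inv_into X F y i + inv_into X F z i))"
      by (simp add: bounded_opD(2)[OF F inv(1)[OF y] inv(1)[OF z]] inv(2)[OF y] inv(2)[OF z])
    then show "inv_into X F (\<lambda>i. y i + z i) = (\<lambda>j. inv_into X F y j + inv_into X F z j)" by (simp add: inv' cl inv y z)
  qed
  then show ?thesis using F bij unfolding bounded_iso_def by blast
qed

lemma bounded_iso_inverse: "bounded_iso X nX Y nY F \<Longrightarrow> bounded_op Y nY X nX (inv_into X F)"
  by (simp add: bounded_iso_def)

text \<open>Resolves the definite description: besides the witness \<open>F\<close>, every bounded
  operator with the same graph must agree with \<open>F\<close> at \<open>x\<close>. This uniqueness
  is where density enters in each application.\<close>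

lemma continuous_extension_eq:
  assumes "bounded_op X nX Y nY F" "\<And>d e. (d, e) \<in> R \<Longrightarrow> F d = e"
    and "\<And>G. bounded_op X nX Y nY G \<Longrightarrow> (\<And>d e. (d, e) \<in> R \<Longrightarrow> G d = e) \<Longrightarrow> G x = F x"
  shows "continuous_extension X nX Y nY R x = F x"
  unfolding continuous_extension_def
proof (rule the_equality)
  show "\<exists>F'. bounded_op X nX Y nY F' \<and> (\<forall>(d, e)\<in>R. F' d = e) \<and> F x = F' x" using assms(1,2) by blast
  fix y assume "\<exists>F'. bounded_op X nX Y nY F' \<and> (\<forall>(d, e)\<in>R. F' d = e) \<and> y = F' x"
  then obtain G where "bounded_op X nX Y nY G" "\<forall>(d, e)\<in>R. G d = e" "y = G x" by blast
  moreover from this have "(d, e) \<in> R \<Longrightarrow> G d = e" for d e by auto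
  ultimately show "y = F x" using assms(3)[of G] by simp
qed

lemma summable_weighted_add:
  assumes "\<And>n. w n > (0::real)" "summable (\<lambda>n. w n * (cmod (a n))^2)" "summable (\<lambda>n. w n * (cmod (b n))^2)"
  shows "summable (\<lambda>n. w n * (cmod (a n + b n))^2)"
proof (rule summable_comparison_test')
  show "summable (\<lambda>n. 2 * (w n * (cmod (a n))^2) + 2 * (w n * (cmod (b n))^2))"
    by (intro summable_add summable_mult assms)
  fix n
  have "w n * (cmod (a n + b n))^2 \<le> w n * (2 * (cmod (a n))^2 + 2 * (cmod (b n))^2)"
    using assms(1)[of n] by (intro mult_left_mono norm_add_square_le) auto
  then show "norm (w n * (cmod (a n + b n))^2) \<le> 2 * (w n * (cmod (a n))^2) + 2 * (w n * (cmod (b n))^2)"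
    using assms(1)[of n] by (simp add: algebra_simps)
qed

lemma linear_weighted:
  assumes w: "\<And>n. w n > (0::real)"
  shows "linear_set {a. summable (\<lambda>n. w n * (cmod (a n))^2)}"
proof -
  have "summable (\<lambda>n. w n * (cmod (c * a n))^2)" if "summable (\<lambda>n. w n * (cmod (a n))^2)" for a and c :: complex
  proof -
    have "(\<lambda>n. w n * (cmod (c * a n))^2) = (\<lambda>n. (cmod c)^2 * (w n * (cmod (a n))^2))" by (simp add: norm_mult power_mult_distrib fun_eq_iff)
    then show ?thesis using summable_mult[OF that, of "(cmod c)^2"] by (simp only:)
  qed
  then show ?thesis using summable_weighted_add[OF w] by (auto simp: linear_set_def)
qed

abbreviation unit_seq :: "nat \<Rightarrow> nat \<Rightarrow> complex" where "unit_seq m \<equiv> (\<lambda>n. if n = m then 1 else 0)"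

text \<open>Truncations of \<open>a\<close> converge in the weighted norm, so the functional is the
  series of its values on unit sequences; boundedness on finite sequences puts these values into the
  dual weighted space.\<close>

lemma bounded_functional:
  fixes H :: "(nat \<Rightarrow> complex) \<Rightarrow> complex" and w :: "nat \<Rightarrow> real"
  defines "X \<equiv> {a. summable (\<lambda>n. w n * (cmod (a n))^2)}"
  assumes w: "\<And>n. w n > 0"
    and add: "\<And>a b. a \<in> X \<Longrightarrow> b \<in> X \<Longrightarrow> H (\<lambda>n. a n + b n) = H a + H b"
    and cmult: "\<And>c a. a \<in> X \<Longrightarrow> H (\<lambda>n. c * a n) = c * H a"
    and bound: "\<And>a. a \<in> X \<Longrightarrow> cmod (H a) \<le> K * sqrt (\<Sum>n. w n * (cmod (a n))^2)"
  shows "a \<in> X \<Longrightarrow> (\<lambda>n. a n * H (unit_seq n)) sums H a"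
    and "summable (\<lambda>n. (cmod (H (unit_seq n)))^2 / w n)"
proof -
  have fin: "finite {n. b n \<noteq> 0} \<Longrightarrow> b \<in> X" for b
    unfolding X_def by (rule CollectI, rule summable_finite[of "{n. b n \<noteq> 0}"]) auto
  have unit: "unit_seq n \<in> X" for n by (rule fin) simp
  have zero: "H (\<lambda>n. 0) = 0" using cmult[OF unit[of 0], of 0] by simp
  have trunc: "H (\<lambda>n. if n < N then a n else 0) = (\<Sum>n<N. a n * H (unit_seq n))" for a N
  proof (induction N)
    case (Suc N)
    have s: "(\<lambda>n. if n < Suc N then a n else 0) = (\<lambda>n. (if n < N then a n else 0) + a N * unit_seq N n)" by (auto simp: fun_eq_iff less_Suc_eq)
    have 1: "(\<lambda>n. if n < N then a n else 0) \<in> X" by (rule fin) (auto intro: finite_subset[of _ "{..<N}"])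
    have 2: "(\<lambda>n. a N * unit_seq N n) \<in> X" by (rule fin) auto
    show ?case unfolding s add[OF 1 2] cmult[OF unit] Suc.IH by simp
  qed (simp add: zero)
  have tb: "cmod (\<Sum>n<N. a n * H (unit_seq n)) \<le> K * sqrt (\<Sum>n<N. w n * (cmod (a n))^2)" for a N
  proof -
    have f: "(\<lambda>n. if n < N then a n else 0) \<in> X" by (rule fin) (auto intro: finite_subset[of _ "{..<N}"])
    have "(\<Sum>n. w n * (cmod (if n < N then a n else 0))^2) = (\<Sum>n<N. w n * (cmod (if n < N then a n else 0))^2)" by (rule suminf_finite) auto
    then show ?thesis using bound[OF f] unfolding trunc by simp
  qed
  show "summable (\<lambda>n. (cmod (H (unit_seq n)))^2 / w n)" by (rule sums_bounded_functional(1)[OF w tb])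
  assume a: "a \<in> X"
  then have as: "summable (\<lambda>n. w n * (cmod (a n))^2)" by (simp add: X_def)
  have tail: "cmod (H a - (\<Sum>n<N. a n * H (unit_seq n))) \<le> K * sqrt (\<Sum>n. w (n + N) * (cmod (a (n + N)))^2)" for N
  proof -
    let ?b = "\<lambda>n. if n < N then a n else 0" and ?c = "\<lambda>n. if n < N then 0 else a n"
    have b: "?b \<in> X" by (rule fin) (auto intro: finite_subset[of _ "{..<N}"])
    have sh: "(\<lambda>n. w (n + N) * (cmod (?c (n + N)))^2) = (\<lambda>n. w (n + N) * (cmod (a (n + N)))^2)" by simp
    have cs: "summable (\<lambda>n. w n * (cmod (?c n))^2)"
      using summable_iff_shift[of "\<lambda>n. w n * (cmod (?c n))^2" N] summable_iff_shift[of "\<lambda>n. w n * (cmod (a n))^2" N] as unfolding sh by simp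
    then have c: "?c \<in> X" by (simp add: X_def)
    have "(\<lambda>n. ?b n + ?c n) = a" by auto
    then have "H a = H ?b + H ?c" using add[OF b c] by simp
    then have "cmod (H a - (\<Sum>n<N. a n * H (unit_seq n))) = cmod (H ?c)" unfolding trunc by simp
    moreover have "(\<Sum>n. w n * (cmod (?c n))^2) = (\<Sum>n. w (n + N) * (cmod (a (n + N)))^2)"
      using suminf_split_initial_segment[OF cs, of N] unfolding sh by simp
    ultimately show ?thesis using bound[OF c] by simp
  qed
  have "(\<lambda>N. K * sqrt (\<Sum>n. w (n + N) * (cmod (a (n + N)))^2)) \<longlonglongrightarrow> K * sqrt 0"
    by (intro tendsto_intros suminf_exist_split2[OF as])
  then have t0: "(\<lambda>N. K * sqrt (\<Sum>n. w (n + N) * (cmod (a (n + N)))^2)) \<longlonglongrightarrow> 0" by simp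
  have "(\<lambda>N. H a - (\<Sum>n<N. a n * H (unit_seq n))) \<longlonglongrightarrow> 0"
    by (rule Lim_null_comparison[OF _ t0]) (use tail in auto)
  then have "(\<lambda>N. H a - (H a - (\<Sum>n<N. a n * H (unit_seq n)))) \<longlonglongrightarrow> H a - 0" by (intro tendsto_intros)
  then show "(\<lambda>n. a n * H (unit_seq n)) sums H a" unfolding sums_def by simp
qed

text \<open>Composition with the evaluation at \<open>j\<close>, bounded on \<open>Y\<close> by
  \<open>ev\<close>, reduces operators to functionals, and those are determined by the unit
  sequences.\<close>

lemma bounded_ops_agree:
  assumes w: "\<And>n. w n > (0::real)" and X: "X = {a. summable (\<lambda>n. w n * (cmod (a n))^2)}"
    and nX: "\<And>a. nX a = sqrt (\<Sum>n. w n * (cmod (a n))^2)"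
    and F: "bounded_op X nX Y nY F" and G: "bounded_op X nX Y nY G"
    and ev: "\<And>j. \<exists>K\<ge>0. \<forall>y\<in>Y. cmod (y j) \<le> K * nY y"
    and unit: "\<And>m. F (unit_seq m) = G (unit_seq m)" and a: "a \<in> X"
  shows "F a = G a"
proof
  fix j
  obtain K where K: "K \<ge> 0" "\<And>y. y \<in> Y \<Longrightarrow> cmod (y j) \<le> K * nY y" using ev by blast
  have n0: "0 \<le> nX x" if "x \<in> X" for x
    unfolding nX using that w by (intro real_sqrt_ge_zero suminf_nonneg) (auto simp: X less_imp_le)
  have rep: "(\<lambda>n. a n * T (unit_seq n) j) sums T a j" if T: "bounded_op X nX Y nY T" for T
  proof -
    obtain C where C: "C \<ge> 0" "\<And>x. x \<in> X \<Longrightarrow> nY (T x) \<le> C * nX x" using bounded_op_bound[OF T n0] by blast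
    show ?thesis
    proof (rule bounded_functional(1)[where w = w and H = "\<lambda>a. T a j" and K = "K * C", OF w, folded X])
      fix x assume x: "x \<in> X"
      have "cmod (T x j) \<le> K * nY (T x)" by (intro K bounded_opD(1)[OF T x])
      also have "\<dots> \<le> K * (C * nX x)" by (intro mult_left_mono C x K)
      finally show "cmod (T x j) \<le> K * C * sqrt (\<Sum>n. w n * (cmod (x n))^2)" by (simp add: nX mult.assoc)
    qed (simp_all add: bounded_opD[OF T] a)
  qed
  have "(\<lambda>n. a n * G (unit_seq n) j) sums F a j" using rep[OF F] unfolding unit .
  then show "F a j = G a j" using rep[OF G] by (rule sums_unique2)
qed

text \<open>The common form of \<open>div_map\<close> and \<open>ext_map\<close>, so that linearity
  and boundedness are proved once.\<close>

definition pairing_dist :: "(real \<Rightarrow> complex) set \<Rightarrow> ((real \<Rightarrow> complex) \<Rightarrow> nat \<Rightarrow> complex) \<Rightarrow> (nat \<Rightarrow> complex) \<Rightarrow> dist" where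
  "pairing_dist S c a = (\<lambda>\<phi>. if \<phi> \<in> S then (\<Sum>n. a n * c \<phi> n) else 0)"

text \<open>Each \<open>c \<phi>\<close> lies in the dual weighted space, so the series converge and
  evaluation at a test function is bounded. The last conclusion supplies the bounded evaluations
  that the uniqueness of continuous extensions rests on.\<close>

lemma pairing_dist_iso:
  fixes u w :: "nat \<Rightarrow> real"
  assumes pos: "\<And>n. u n > 0" "\<And>n. w n > 0" and uw: "\<And>n. u n * w n = 1"
    and X: "X = {a. summable (\<lambda>n. u n * (cmod (a n))^2)}" and nX: "\<And>a. nX a = sqrt (\<Sum>n. u n * (cmod (a n))^2)"
    and c: "\<And>\<phi>. \<phi> \<in> S \<Longrightarrow> summable (\<lambda>n. w n * (cmod (c \<phi> n))^2)"
    and bij: "bij_betw (pairing_dist S c) X Y" and K: "K \<ge> 0"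
    "\<And>a. a \<in> X \<Longrightarrow> nY (pairing_dist S c a) \<le> K * nX a" "\<And>a. a \<in> X \<Longrightarrow> nX a \<le> K * nY (pairing_dist S c a)"
  shows "a \<in> X \<Longrightarrow> b \<in> X \<Longrightarrow> pairing_dist S c (\<lambda>n. p * a n + q * b n) = (\<lambda>\<phi>. p * pairing_dist S c a \<phi> + q * pairing_dist S c b \<phi>)"
    and "bounded_iso X nX Y nY (pairing_dist S c)"
    and "\<exists>E\<ge>0. \<forall>v\<in>Y. cmod (v \<phi>) \<le> E * nY v" (is ?A)
proof -
  let ?P = "pairing_dist S c"
  have lin: "?P (\<lambda>n. p * a n + q * b n) = (\<lambda>\<phi>. p * ?P a \<phi> + q * ?P b \<phi>)" if "a \<in> X" "b \<in> X" for a b p q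
  proof
    fix \<phi>
    have s: "summable (\<lambda>n. d n * c \<phi> n)" if "\<phi> \<in> S" "d \<in> X" for d
      using that weighted_pairing(1)[OF pos uw _ c] by (simp add: X)
    have "(\<lambda>n. (p * a n + q * b n) * c \<phi> n) sums (p * (\<Sum>n. a n * c \<phi> n) + q * (\<Sum>n. b n * c \<phi> n))" if "\<phi> \<in> S"
      using sums_add[OF sums_mult[OF summable_sums[OF s[OF that \<open>a \<in> X\<close>]], of p] sums_mult[OF summable_sums[OF s[OF that \<open>b \<in> X\<close>]], of q]]
      by (simp add: algebra_simps)
    then show "?P (\<lambda>n. p * a n + q * b n) \<phi> = p * ?P a \<phi> + q * ?P b \<phi>" by (auto simp: pairing_dist_def sums_iff)
  qed
  show "a \<in> X \<Longrightarrow> b \<in> X \<Longrightarrow> ?P (\<lambda>n. p * a n + q * b n) = (\<lambda>\<phi>. p * ?P a \<phi> + q * ?P b \<phi>)" by (rule lin)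
  have B: "bounded_op X nX Y nY ?P"
  proof (rule bounded_opI[where C = K])
    fix a b p assume a: "a \<in> X"
    show "?P a \<in> Y" using bij a by (auto simp: bij_betw_def)
    show "nY (?P a) \<le> K * nX a" by (rule K(2)[OF a])
    show "?P (\<lambda>n. p * a n) = (\<lambda>\<phi>. p * ?P a \<phi>)" using lin[OF a a, of p 0] by simp
    assume b: "b \<in> X"
    show "?P (\<lambda>n. a n + b n) = (\<lambda>\<phi>. ?P a \<phi> + ?P b \<phi>)" using lin[OF a b, of 1 1] by simp
  qed
  have L: "linear_set X" unfolding X by (rule linear_weighted[OF pos(1)])
  show "bounded_iso X nX Y nY ?P" by (rule bounded_isoI[OF L B bij]) (rule K(3))
  let ?T = "if \<phi> \<in> S then sqrt (\<Sum>n. w n * (cmod (c \<phi> n))^2) else 0"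
  have T: "?T \<ge> 0" using pos c by (auto intro!: suminf_nonneg simp: less_imp_le)
  show ?A
  proof (intro exI[of _ "K * ?T"] conjI ballI)
    show "0 \<le> K * ?T" by (rule mult_nonneg_nonneg[OF K(1) T])
    fix v assume "v \<in> Y"
    then obtain a where a: "a \<in> X" "v = ?P a" using bij by (auto simp: bij_betw_def)
    have "cmod (v \<phi>) \<le> nX a * ?T"
      using weighted_pairing(2)[OF pos uw _ c, of a] a by (simp add: X nX pairing_dist_def)
    also have "\<dots> \<le> K * nY v * ?T" unfolding a(2) by (intro mult_right_mono K(3) a(1) T)
    finally show "cmod (v \<phi>) \<le> K * ?T * nY v" by (simp only: mult_ac)
  qed
qed

lemma continuous_extension_seq:
  assumes w: "\<And>n. w n > (0::real)" and X: "X = {a. summable (\<lambda>n. w n * (cmod (a n))^2)}"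
    and nX: "\<And>a. nX a = sqrt (\<Sum>n. w n * (cmod (a n))^2)"
    and F: "bounded_op X nX Y nY F" and ev: "\<And>j. \<exists>K\<ge>0. \<forall>y\<in>Y. cmod (y j) \<le> K * nY y"
    and R: "\<And>d e. (d, e) \<in> R \<Longrightarrow> F d = e" and dom: "\<And>k. unit_seq k \<in> Domain R" and a: "a \<in> X"
  shows "continuous_extension X nX Y nY R a = F a"
proof (rule continuous_extension_eq[OF F R])
  fix G assume G: "bounded_op X nX Y nY G" and GR: "\<And>d e. (d, e) \<in> R \<Longrightarrow> G d = e"
  show "G a = F a"
  proof (rule bounded_ops_agree[OF w X nX G F ev _ a])
    fix k
    obtain e where "(unit_seq k, e) \<in> R" using dom[of k] by blast
    from GR[OF this] R[OF this] show "G (unit_seq k) = F (unit_seq k)" by simp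
  qed
qed

section \<open>The weighted inner product in Chebyshev coefficients\<close>

lemma tr_lin: "tr (\<lambda>x. u x + c * v x) = (\<lambda>x. tr u x + c * tr v x)"
  by (auto simp: tr_def fun_eq_iff algebra_simps)

lemma L2w_lin: "u \<in> L2w \<Longrightarrow> v \<in> L2w \<Longrightarrow> (\<lambda>x. u x + c * v x) \<in> L2w"
  unfolding L2w_iff tr_lin by (intro sq_int_add sq_int_cmult)

lemma L2w_cmult: "u \<in> L2w \<Longrightarrow> (\<lambda>x. c * u x) \<in> L2w"
  using L2w_lin[of u u "c - 1"] by (simp add: algebra_simps)

lemma innerw_sums:
  assumes u: "u \<in> L2w" and v: "v \<in> L2w"
  shows "(\<lambda>n. cheb_coeff u n * cnj (cheb_coeff v n) * cpx (1 / (pi * cheb_const n))) sums innerw u v"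
proof -
  have s: "sq_int cheb_measure (tr u)" "sq_int cheb_measure (\<lambda>x. cnj (tr v x))"
    using u v unfolding L2w_iff by (auto intro: sq_int_cnj)
  have c: "(LINT x|cheb_measure. ctp n x * cnj (tr v x)) = cnj (LINT x|cheb_measure. tr v x * ctp n x)" for n
  proof -
    have "(LINT x|cheb_measure. ctp n x * cnj (tr v x)) = (LINT x|cheb_measure. cnj (tr v x * ctp n x))" by (simp add: mult.commute)
    also have "\<dots> = cnj (LINT x|cheb_measure. tr v x * ctp n x)" by (rule Bochner_Integration.integral_cnj)
    finally show ?thesis .
  qed
  have "(\<lambda>n. cpx (1 / pi) * (cpx (cheb_const n) * (LINT x|cheb_measure. tr u x * ctp n x) * (LINT x|cheb_measure. ctp n x * cnj (tr v x))))
    sums innerw u v"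
    unfolding innerw_eq[OF u v] by (intro sums_mult cheb_parseval(2) s)
  moreover have "cpx (1 / pi) * (cpx (cheb_const n) * (LINT x|cheb_measure. tr u x * ctp n x) * (LINT x|cheb_measure. ctp n x * cnj (tr v x)))
     = cheb_coeff u n * cnj (cheb_coeff v n) * cpx (1 / (pi * cheb_const n))" for n
    unfolding c cheb_coeff_eq[OF u] cheb_coeff_eq[OF v] using cheb_const_pos[of n] by simp
  ultimately show ?thesis by simp
qed

lemma cheb_coeff_lin:
  assumes u: "u \<in> L2w" and v: "v \<in> L2w"
  shows "cheb_coeff (\<lambda>x. u x + c * v x) n = cheb_coeff u n + c * cheb_coeff v n"
proof -
  have i: "integrable cheb_measure (\<lambda>x. tr f x * ctp n x)" if "f \<in> L2w" for f
    using that unfolding L2w_iff by (intro sq_int_mult sq_int_tpoly)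
  have "(LINT x|cheb_measure. (tr u x + c * tr v x) * ctp n x) = (LINT x|cheb_measure. tr u x * ctp n x + c * (tr v x * ctp n x))"
    by (simp add: algebra_simps)
  also have "\<dots> = (LINT x|cheb_measure. tr u x * ctp n x) + c * (LINT x|cheb_measure. tr v x * ctp n x)"
    using i[OF u] i[OF v] by simp
  finally show ?thesis unfolding cheb_coeff_eq[OF L2w_lin[OF u v]] cheb_coeff_eq[OF u] cheb_coeff_eq[OF v] tr_lin by (simp add: algebra_simps)
qed

lemma cheb_coeff_cmult: "u \<in> L2w \<Longrightarrow> cheb_coeff (\<lambda>x. c * u x) n = c * cheb_coeff u n"
  using cheb_coeff_lin[of u u "c - 1" n] by (simp add: algebra_simps)

lemma cheb_coeff_cheb: "cheb_coeff (cheb m) n = (if n = m then 1 else 0)"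
  using cheb_coeff_cong[OF tr_cheb[of m]] cheb_coeff_ctp[of m n] by simp

lemma innerw_self_zero:
  assumes w: "w \<in> L2w" and 0: "Re (innerw w w) \<le> 0"
  shows "cheb_coeff w n = 0"
proof -
  have "(\<lambda>n. Re (cheb_coeff w n * cnj (cheb_coeff w n) * cpx (1 / (pi * cheb_const n)))) sums Re (innerw w w)"
    by (rule sums_Re[OF innerw_sums[OF w w]])
  then have s: "(\<lambda>n. (cmod (cheb_coeff w n))^2 * (1 / (pi * cheb_const n))) sums Re (innerw w w)"
    by (simp only: norm_square_of_real[symmetric] of_real_mult[symmetric] Re_complex_of_real)
  have p: "0 \<le> (cmod (cheb_coeff w n))^2 * (1 / (pi * cheb_const n))" for n using cheb_const_pos[of n] by simp
  have "(\<Sum>n. (cmod (cheb_coeff w n))^2 * (1 / (pi * cheb_const n))) = 0"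
    using suminf_nonneg[OF sums_summable[OF s] p] sums_unique[OF s] 0 by linarith
  then have "(cmod (cheb_coeff w n))^2 * (1 / (pi * cheb_const n)) = 0"
    using suminf_eq_zero_iff[OF sums_summable[OF s] p] by simp
  then show ?thesis using cheb_const_pos[of n] by simp
qed

section \<open>Self-adjoint diagonal operators\<close>

text \<open>The domain is maximal: all \<open>u\<close> whose multiplied coefficient sequence again
  belongs to a function of \<open>L2w\<close>. Since only coefficients are compared, the graph is
  closed under changes on null sets, like every adjoint.\<close>

definition diag_graph :: "(nat \<Rightarrow> real) \<Rightarrow> graph" where
  "diag_graph \<mu> = {(u, f). u \<in> L2w \<and> f \<in> L2w \<and> (\<forall>n. cheb_coeff f n = cpx (\<mu> n) * cheb_coeff u n)}"

lemma diag_graph_symmetric: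
  assumes "(u, f) \<in> diag_graph \<mu>" "(v, g) \<in> diag_graph \<mu>"
  shows "innerw f v = innerw u g"
proof -
  have "(\<lambda>n. cheb_coeff f n * cnj (cheb_coeff v n) * cpx (1 / (pi * cheb_const n))) =
        (\<lambda>n. cheb_coeff u n * cnj (cheb_coeff g n) * cpx (1 / (pi * cheb_const n)))"
    using assms by (simp add: diag_graph_def mult_ac)
  then show ?thesis using innerw_sums[of f v] innerw_sums[of u g] assms by (auto simp: diag_graph_def intro: sums_unique2)
qed

text \<open>Testing the adjoint relation against \<open>T_n\<close> alone already gives the
  coefficient relation at \<open>n\<close>, as \<open>\<mu> n\<close> is real.\<close>

lemma adjoint_subset_diag:
  assumes G: "\<And>n. \<exists>f. (cheb n, f) \<in> G \<and> f \<in> L2w \<and> (\<forall>m. cheb_coeff f m = cpx (\<mu> n) * cheb_coeff (cheb n) m)"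
  shows "adjoint_graph G \<subseteq> diag_graph \<mu>"
proof (rule subrelI)
  fix v w assume vw: "(v, w) \<in> adjoint_graph G"
  then have L: "v \<in> L2w" "w \<in> L2w" by (auto simp: adjoint_graph_def)
  have pair: "innerw f x = c * cnj (cheb_coeff x n) * cpx (1 / (pi * cheb_const n))"
    if f: "f \<in> L2w" "\<And>m. cheb_coeff f m = c * cheb_coeff (cheb n) m" and x: "x \<in> L2w" for f x c n
  proof -
    have "(\<lambda>m. (cnj (cheb_coeff x m) * cpx (1 / (pi * cheb_const m))) * (if m = n then c else 0)) sums innerw f x"
    proof -
      have "cheb_coeff f m * cnj (cheb_coeff x m) * cpx (1 / (pi * cheb_const m)) = (cnj (cheb_coeff x m) * cpx (1 / (pi * cheb_const m))) * (if m = n then c else 0)" for m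
        by (simp add: f(2) cheb_coeff_cheb)
      then show ?thesis using innerw_sums[OF f(1) x] by (simp only:)
    qed
    from sums_unique2[OF this sum_if_single] show ?thesis by (simp add: mult_ac)
  qed
  have "cheb_coeff w n = cpx (\<mu> n) * cheb_coeff v n" for n
  proof -
    obtain f where f: "(cheb n, f) \<in> G" "f \<in> L2w" "\<And>m. cheb_coeff f m = cpx (\<mu> n) * cheb_coeff (cheb n) m" using G by blast
    have "innerw f v = innerw (cheb n) w" using vw f(1) by (auto simp: adjoint_graph_def)
    then have "cpx (\<mu> n) * cnj (cheb_coeff v n) = cnj (cheb_coeff w n)"
      using pair[OF f(2,3) L(1)] pair[OF cheb_L2w[of n], of 1 n, OF _ L(2)] cheb_const_pos[of n] by simp
    then have "cnj (cpx (\<mu> n) * cheb_coeff v n) = cnj (cheb_coeff w n)" by simp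
    then show ?thesis by (simp only: complex_cnj_cancel_iff)
  qed
  then show "(v, w) \<in> diag_graph \<mu>" using L by (simp add: diag_graph_def)
qed

text \<open>\<open>G\<close> equals its adjoint and so lies inside the diagonal graph; that graph is
  symmetric, so conversely it lies inside the adjoint of \<open>G\<close>, which is
  \<open>G\<close>. Eigenfunctions thus determine a self-adjoint graph.\<close>

lemma selfadjoint_eq_diag:
  assumes sa: "adjoint_graph G = G"
    and G: "\<And>n. \<exists>f. (cheb n, f) \<in> G \<and> f \<in> L2w \<and> (\<forall>m. cheb_coeff f m = cpx (\<mu> n) * cheb_coeff (cheb n) m)"
  shows "G = diag_graph \<mu>"
proof
  show sub: "G \<subseteq> diag_graph \<mu>" using adjoint_subset_diag[OF G] sa by simp
  show "diag_graph \<mu> \<subseteq> G"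
  proof (rule subrelI)
    fix v w assume vw: "(v, w) \<in> diag_graph \<mu>"
    have "(v, w) \<in> adjoint_graph G"
      using vw sub diag_graph_symmetric[OF _ vw] unfolding adjoint_graph_def by (auto simp: diag_graph_def)
    then show "(v, w) \<in> G" using sa by simp
  qed
qed

lemma cheb_diag: "(cheb n, \<lambda>x. cpx (\<mu> n) * cheb n x) \<in> diag_graph \<mu>"
  by (auto simp: diag_graph_def cheb_L2w L2w_cmult cheb_coeff_cmult cheb_coeff_cheb)

lemma nonneg_selfadjoint_diag:
  assumes \<mu>: "\<And>n. \<mu> n \<ge> 0"
  shows "nonneg_selfadjoint (diag_graph \<mu>)"
  unfolding nonneg_selfadjoint_def
proof (intro conjI ballI)
  have e: "\<exists>f. (cheb n, f) \<in> diag_graph \<mu> \<and> f \<in> L2w \<and> (\<forall>m. cheb_coeff f m = cpx (\<mu> n) * cheb_coeff (cheb n) m)" for n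
    using cheb_diag[of n \<mu>] by (intro exI[of _ "\<lambda>x. cpx (\<mu> n) * cheb n x"]) (auto simp: cheb_L2w L2w_cmult cheb_coeff_cmult)
  show "adjoint_graph (diag_graph \<mu>) = diag_graph \<mu>"
  proof
    show "adjoint_graph (diag_graph \<mu>) \<subseteq> diag_graph \<mu>" by (rule adjoint_subset_diag[OF e])
    show "diag_graph \<mu> \<subseteq> adjoint_graph (diag_graph \<mu>)"
      using diag_graph_symmetric by (auto simp: adjoint_graph_def) (auto simp: diag_graph_def)
  qed
  show "densely_defined (diag_graph \<mu>)" unfolding densely_defined_def
  proof (intro ballI impI)
    fix v assume v: "v \<in> L2w" and 0: "\<forall>u\<in>Domain (diag_graph \<mu>). innerw u v = 0"
    have "cheb_coeff v n = 0" for n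
    proof -
      have "innerw (cheb n) v = 0" using 0 cheb_diag[of n \<mu>] by blast
      moreover have "(\<lambda>m. (cnj (cheb_coeff v m) * cpx (1 / (pi * cheb_const m))) * (if m = n then 1 else 0)) sums innerw (cheb n) v"
      proof -
        have "cheb_coeff (cheb n) m * cnj (cheb_coeff v m) * cpx (1 / (pi * cheb_const m)) = (cnj (cheb_coeff v m) * cpx (1 / (pi * cheb_const m))) * (if m = n then 1 else 0)" for m
          by (simp add: cheb_coeff_cheb)
        then show ?thesis using innerw_sums[OF cheb_L2w[of n] v] by (simp only:)
      qed
      ultimately have "cnj (cheb_coeff v n) * cpx (1 / (pi * cheb_const n)) = 0" using sums_unique2[OF _ sum_if_single] by fastforce
      then show ?thesis using cheb_const_pos[of n] by simp
    qed
    then show "innerw v v = 0" using innerw_sums[OF v v] by (simp add: sums_iff)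
  qed
  fix z assume "z \<in> diag_graph \<mu>"
  then obtain u f where z: "z = (u, f)" "u \<in> L2w" "f \<in> L2w" "\<And>n. cheb_coeff f n = cpx (\<mu> n) * cheb_coeff u n"
    by (auto simp: diag_graph_def)
  have "(\<lambda>n. Re (cheb_coeff f n * cnj (cheb_coeff u n) * cpx (1 / (pi * cheb_const n)))) sums Re (innerw f u)"
    by (rule sums_Re[OF innerw_sums[OF z(3,2)]])
  moreover have "Re (cheb_coeff f n * cnj (cheb_coeff u n) * cpx (1 / (pi * cheb_const n))) = \<mu> n * (cmod (cheb_coeff u n))^2 * (1 / (pi * cheb_const n))" for n
    unfolding z(4) by (simp only: mult.assoc[of "cpx (\<mu> n)"] norm_square_of_real[symmetric] of_real_mult[symmetric] Re_complex_of_real)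
  moreover have "0 \<le> \<mu> n * (cmod (cheb_coeff u n))^2 * (1 / (pi * cheb_const n))" for n using \<mu>[of n] cheb_const_pos[of n] by simp
  ultimately have "0 \<le> Re (innerw f u)" by (metis (no_types, lifting) sums_le sums_zero)
  then show "case z of (u, f) \<Rightarrow> 0 \<le> Re (innerw f u)" by (simp add: z(1))
qed

lemma weighted_deriv_cheb:
  assumes "x \<in> {-1<..<1}"
  shows "weighted_deriv (cheb n) x = cpx (real n * sin (real n * arccos x))"
proof -
  have "((\<lambda>x. cos (real n * arccos x)) has_real_derivative - sin (real n * arccos x) * (real n * inverse (- sqrt (1 - x^2)))) (at x)"
    using assms by (auto intro!: derivative_eq_intros DERIV_arccos)
  then have "(cheb n has_vector_derivative cpx (- sin (real n * arccos x) * (real n * inverse (- sqrt (1 - x^2))))) (at x)"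
    unfolding cheb_def[abs_def] by (intro has_vector_derivative_of_real) (simp only: has_real_derivative_iff_has_vector_derivative)
  then show ?thesis using weight_pos[OF assms] unfolding weighted_deriv_def
    by (simp add: vector_derivative_at weight_def field_simps)
qed

lemma weighted_deriv_twice_cheb:
  assumes x: "x \<in> {-1<..<1}"
  shows "- weighted_deriv (weighted_deriv (cheb n)) x = cpx ((real n)^2) * cheb n x"
proof -
  have "((\<lambda>x. real n * sin (real n * arccos x)) has_real_derivative real n * (cos (real n * arccos x) * (real n * inverse (- sqrt (1 - x^2))))) (at x)"
    using assms by (auto intro!: derivative_eq_intros DERIV_arccos)
  then have "((\<lambda>x. cpx (real n * sin (real n * arccos x))) has_vector_derivative cpx (real n * (cos (real n * arccos x) * (real n * inverse (- sqrt (1 - x^2)))))) (at x)"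
    by (intro has_vector_derivative_of_real) (simp only: has_real_derivative_iff_has_vector_derivative)
  then have "(weighted_deriv (cheb n) has_vector_derivative cpx (real n * (cos (real n * arccos x) * (real n * inverse (- sqrt (1 - x^2)))))) (at x)"
    by (rule has_vector_derivative_transform_within_open[OF _ open_greaterThanLessThan x]) (rule weighted_deriv_cheb[symmetric])
  then have "weighted_deriv (weighted_deriv (cheb n)) x = cpx (weight x) * cpx (real n * (cos (real n * arccos x) * (real n * inverse (- weight x))))"
    by (simp only: weighted_deriv_def[of "weighted_deriv (cheb n)"] vector_derivative_at weight_def)
  also have "\<dots> = - (cpx ((real n)^2) * cheb n x)"
    using weight_pos[OF x] by (simp add: cheb_def power2_eq_square field_simps)
  finally show ?thesis by simp
qed

lemma weighted_laplace_eq: "weighted_laplace = diag_graph (\<lambda>n. (real n)^2)"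
  unfolding weighted_laplace_def
proof (rule the_equality)
  \<comment> \<open>The differential expression is computed on the open segment only;
    \<open>tr\<close> discards the values elsewhere, where \<open>arccos\<close> and the derivatives
    carry no meaning.\<close>
  have t: "tr (\<lambda>x. - weighted_deriv (weighted_deriv (cheb n)) x) = tr (\<lambda>x. cpx ((real n)^2) * cheb n x)" for n
    by (rule tr_cong) (rule weighted_deriv_twice_cheb)
  have L: "(\<lambda>x. - weighted_deriv (weighted_deriv (cheb n)) x) \<in> L2w" for n
    using L2w_cmult[OF cheb_L2w[of n]] unfolding L2w_iff t .
  have c: "cheb_coeff (\<lambda>x. - weighted_deriv (weighted_deriv (cheb n)) x) m = cpx ((real n)^2) * cheb_coeff (cheb n) m" for n m
    unfolding cheb_coeff_cong[OF t] by (rule cheb_coeff_cmult[OF cheb_L2w])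
  have "(cheb n, \<lambda>x. - weighted_deriv (weighted_deriv (cheb n)) x) \<in> diag_graph (\<lambda>n. (real n)^2)" for n
    using L c by (simp add: diag_graph_def cheb_L2w cheb_coeff_cheb)
  then show "nonneg_selfadjoint (diag_graph (\<lambda>n. (real n)^2)) \<and>
      (\<forall>n. (cheb n, \<lambda>x. - weighted_deriv (weighted_deriv (cheb n)) x) \<in> diag_graph (\<lambda>n. (real n)^2))"
    using nonneg_selfadjoint_diag[of "\<lambda>n. (real n)^2"] by simp
  fix A assume A: "nonneg_selfadjoint A \<and> (\<forall>n. (cheb n, \<lambda>x. - weighted_deriv (weighted_deriv (cheb n)) x) \<in> A)"
  show "A = diag_graph (\<lambda>n. (real n)^2)"
  proof (rule selfadjoint_eq_diag)
    show "adjoint_graph A = A" using A by (simp add: nonneg_selfadjoint_def)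
    show "\<exists>f. (cheb n, f) \<in> A \<and> f \<in> L2w \<and> (\<forall>m. cheb_coeff f m = cpx ((real n)^2) * cheb_coeff (cheb n) m)" for n
      using A L c by blast
  qed
qed

lemma selfadjointD:
  assumes "adjoint_graph B = B" "(v, w) \<in> B"
  shows "v \<in> L2w" "w \<in> L2w" "\<And>u f. (u, f) \<in> B \<Longrightarrow> innerw f v = innerw u w"
proof -
  have "(v, w) \<in> adjoint_graph B" using assms by simp
  then show "v \<in> L2w" "w \<in> L2w" "\<And>u f. (u, f) \<in> B \<Longrightarrow> innerw f v = innerw u w" unfolding adjoint_graph_def by auto
qed

text \<open>A graph is an arbitrary relation; linearity is a consequence of being its own adjoint,
  because adjoints are linear.\<close>

lemma selfadjoint_lin:
  assumes sa: "adjoint_graph B = B" and 1: "(u, f) \<in> B" and 2: "(v, g) \<in> B"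
  shows "(\<lambda>x. u x + c * v x, \<lambda>x. f x + c * g x) \<in> B"
proof -
  note L = selfadjointD(1,2)[OF sa 1] selfadjointD(1,2)[OF sa 2]
  have lin: "innerw k (\<lambda>x. a x + c * b x) = innerw k a + cnj c * innerw k b" if k: "k \<in> L2w" "a \<in> L2w" "b \<in> L2w" for k a b
  proof -
    have "(\<lambda>n. cheb_coeff k n * cnj (cheb_coeff a n) * cpx (1 / (pi * cheb_const n)) + cnj c * (cheb_coeff k n * cnj (cheb_coeff b n) * cpx (1 / (pi * cheb_const n))))
      sums innerw k (\<lambda>x. a x + c * b x)"
      using innerw_sums[OF k(1) L2w_lin[OF k(2,3)], of c] unfolding cheb_coeff_lin[OF k(2,3)] by (simp add: distrib_left distrib_right mult_ac)
    from sums_unique2[OF this sums_add[OF innerw_sums[OF k(1,2)] sums_mult[OF innerw_sums[OF k(1,3)]]]] show ?thesis .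
  qed
  have "innerw l (\<lambda>x. u x + c * v x) = innerw k (\<lambda>x. f x + c * g x)" if "(k, l) \<in> B" for k l
  proof -
    note kl = selfadjointD(1,2)[OF sa that]
    have "innerw l u = innerw k f" "innerw l v = innerw k g" by (rule selfadjointD(3)[OF sa 1 that], rule selfadjointD(3)[OF sa 2 that])
    then show ?thesis using lin kl L by simp
  qed
  then have "(\<lambda>x. u x + c * v x, \<lambda>x. f x + c * g x) \<in> adjoint_graph B" using L by (auto simp: adjoint_graph_def intro: L2w_lin)
  then show ?thesis using sa by simp
qed

lemma op_sqrt_laplace: "op_sqrt weighted_laplace = diag_graph real"
  unfolding op_sqrt_def weighted_laplace_eq
proof (rule the_equality)
  have "diag_graph real O diag_graph real = diag_graph (\<lambda>n. (real n)^2)"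
  proof
    show "diag_graph real O diag_graph real \<subseteq> diag_graph (\<lambda>n. (real n)^2)"
      by (auto simp: diag_graph_def power2_eq_square mult.assoc)
    show "diag_graph (\<lambda>n. (real n)^2) \<subseteq> diag_graph real O diag_graph real"
    proof (rule subrelI)
      fix u f assume uf: "(u, f) \<in> diag_graph (\<lambda>n. (real n)^2)"
      then have L: "u \<in> L2w" "f \<in> L2w" and c: "\<And>n. cheb_coeff f n = cpx ((real n)^2) * cheb_coeff u n"
        by (auto simp: diag_graph_def)
      \<comment> \<open>Coefficients of the intermediate function of the composition:
        \<open>n^2 \<le> 1 + n^4\<close> bounds them by those of \<open>u\<close> and
        \<open>f\<close>.\<close>
      have "summable (\<lambda>n. (cmod (of_nat n * cheb_coeff u n))^2)"
      proof (rule summable_comparison_test')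
        show "summable (\<lambda>n. (cmod (cheb_coeff u n))^2 + (cmod (cheb_coeff f n))^2)" by (intro summable_add cheb_coeff_summable L)
        fix n
        have le: "x \<le> 1 + x^2" if "0 \<le> x" for x :: real using two_mult_le_squares[of 1 x] that by simp
        have "(real n)^2 \<le> 1 + ((real n)^2)^2" by (rule le[OF zero_le_power2])
        then have "(real n)^2 * (cmod (cheb_coeff u n))^2 \<le> (1 + ((real n)^2)^2) * (cmod (cheb_coeff u n))^2" by (intro mult_right_mono) auto
        then show "norm ((cmod (of_nat n * cheb_coeff u n))^2) \<le> (cmod (cheb_coeff u n))^2 + (cmod (cheb_coeff f n))^2"
          unfolding c by (simp add: norm_mult norm_power power_mult_distrib distrib_right)
      qed
      from cheb_series_coeff_exists[OF this]
      obtain y where y: "sq_int cheb_measure y" "cheb_coeff y = (\<lambda>n. of_nat n * cheb_coeff u n)" by blast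
      have "(u, y) \<in> diag_graph real" "(y, f) \<in> diag_graph real"
        using L sq_int_L2w[OF y(1)] by (auto simp: diag_graph_def y(2) c power2_eq_square mult.assoc)
      then show "(u, f) \<in> diag_graph real O diag_graph real" by blast
    qed
  qed
  then show "nonneg_selfadjoint (diag_graph real) \<and> diag_graph real O diag_graph real = diag_graph (\<lambda>n. (real n)^2)"
    using nonneg_selfadjoint_diag[of real] by simp
  fix B assume B: "nonneg_selfadjoint B \<and> B O B = diag_graph (\<lambda>n. (real n)^2)"
  then have sa: "adjoint_graph B = B" and nn: "\<And>u f. (u, f) \<in> B \<Longrightarrow> 0 \<le> Re (innerw f u)" by (auto simp: nonneg_selfadjoint_def)
  show "B = diag_graph real"
  proof (rule selfadjoint_eq_diag[OF sa])
    fix n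
    let ?e = "cheb n" and ?c = "cpx (real n)"
    obtain y where y: "(?e, y) \<in> B" "(y, \<lambda>x. cpx ((real n)^2) * ?e x) \<in> B"
      using cheb_diag[of n "\<lambda>n. (real n)^2"] B by blast
    have yL: "y \<in> L2w" by (rule selfadjointD(2)[OF sa y(1)])
    \<comment> \<open>\<open>w = B T_n - n T_n\<close> satisfies
      \<open>B w = n^2 T_n - n B T_n = - n w\<close>. Nonnegativity of \<open>B\<close> gives
      \<open>- n ||w||^2 \<ge> 0\<close>, so \<open>w\<close> vanishes for
      \<open>n > 0\<close>.\<close>
    define w where "w = (\<lambda>x. y x + (- ?c) * ?e x)"
    have wL: "w \<in> L2w" unfolding w_def by (rule L2w_lin[OF yL cheb_L2w])
    have wc: "cheb_coeff w m = cheb_coeff y m - ?c * cheb_coeff ?e m" for m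
      unfolding w_def cheb_coeff_lin[OF yL cheb_L2w] by simp
    have "Re (innerw w w) \<le> 0"
    proof (cases "n = 0")
      case True
      \<comment> \<open>For \<open>n = 0\<close> symmetry is enough:
        \<open>||B T_0||^2 = (T_0, B B T_0) = 0\<close>.\<close>
      have "innerw y y = innerw ?e (\<lambda>x. cpx ((real n)^2) * ?e x)" by (rule selfadjointD(3)[OF sa y(2,1)])
      also have "\<dots> = 0" unfolding innerw_def using True by simp
      finally show ?thesis using True by (simp add: w_def)
    next
      case False
      have "(\<lambda>x. y x + (- ?c) * ?e x, \<lambda>x. cpx ((real n)^2) * ?e x + (- ?c) * y x) \<in> B"
        by (rule selfadjoint_lin[OF sa y(2,1)])
      moreover have "(\<lambda>x. cpx ((real n)^2) * ?e x + (- ?c) * y x) = (\<lambda>x. (- ?c) * w x)"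
        by (simp add: fun_eq_iff w_def power2_eq_square algebra_simps)
      ultimately have "(w, \<lambda>x. (- ?c) * w x) \<in> B" by (simp add: w_def)
      then have "0 \<le> Re (innerw (\<lambda>x. (- ?c) * w x) w)" by (rule nn)
      moreover have "innerw (\<lambda>x. (- ?c) * w x) w = (- ?c) * innerw w w"
      proof -
        have "(\<lambda>m. (- ?c) * (cheb_coeff w m * cnj (cheb_coeff w m) * cpx (1 / (pi * cheb_const m)))) sums innerw (\<lambda>x. (- ?c) * w x) w"
          using innerw_sums[OF L2w_cmult[OF wL, of "- ?c"] wL] unfolding cheb_coeff_cmult[OF wL] by (simp only: mult.assoc)
        from sums_unique2[OF this sums_mult[OF innerw_sums[OF wL wL]]] show ?thesis .
      qed
      ultimately have "0 \<le> - (real n * Re (innerw w w))" by simp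
      then show ?thesis using False by (simp add: mult_le_0_iff)
    qed
    then have "cheb_coeff w m = 0" for m by (rule innerw_self_zero[OF wL])
    then have "cheb_coeff y m = ?c * cheb_coeff ?e m" for m using wc[of m] by simp
    then show "\<exists>f. (cheb n, f) \<in> B \<and> f \<in> L2w \<and> (\<forall>m. cheb_coeff f m = cpx (real n) * cheb_coeff (cheb n) m)"
      using y(1) yL by blast
  qed
qed

section \<open>Multipliers between the coefficient spaces\<close>

definition diag_op :: "(nat \<Rightarrow> complex) \<Rightarrow> (nat \<Rightarrow> complex) \<Rightarrow> nat \<Rightarrow> complex" where
  "diag_op m a = (\<lambda>n. m n * a n)"

lemma bounded_diag_op:
  assumes w: "\<And>n. w n > (0::real)" and v: "\<And>n. v n > (0::real)"
    and X: "X = {a. summable (\<lambda>n. w n * (cmod (a n))^2)}" "\<And>a. nX a = sqrt (\<Sum>n. w n * (cmod (a n))^2)"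
    and Y: "Y = {a. summable (\<lambda>n. v n * (cmod (a n))^2)}" "\<And>a. nY a = sqrt (\<Sum>n. v n * (cmod (a n))^2)"
    and m: "\<And>n. v n * (cmod (m n))^2 \<le> K * w n"
  shows "bounded_op X nX Y nY (diag_op m)"
proof (rule bounded_opI[where C = "sqrt K"])
  fix a assume "a \<in> X"
  then have a: "summable (\<lambda>n. w n * (cmod (a n))^2)" by (simp add: X)
  have le: "v n * (cmod (diag_op m a n))^2 \<le> K * (w n * (cmod (a n))^2)" for n
  proof -
    have "v n * (cmod (m n))^2 * (cmod (a n))^2 \<le> K * w n * (cmod (a n))^2" by (intro mult_right_mono m) simp
    then show ?thesis by (simp only: diag_op_def norm_mult power_mult_distrib mult.assoc)
  qed
  have n: "norm (v n * (cmod (diag_op m a n))^2) \<le> K * (w n * (cmod (a n))^2)" for n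
    using le[of n] v[of n] by (simp add: less_imp_le)
  have s: "summable (\<lambda>n. v n * (cmod (diag_op m a n))^2)" by (rule summable_comparison_test'[OF summable_mult[OF a] n])
  then show "diag_op m a \<in> Y" by (simp add: Y)
  have "(\<Sum>n. v n * (cmod (diag_op m a n))^2) \<le> (\<Sum>n. K * (w n * (cmod (a n))^2))" by (rule suminf_le[OF le s summable_mult[OF a]])
  also have "\<dots> = K * (\<Sum>n. w n * (cmod (a n))^2)" by (rule suminf_mult[OF a])
  finally show "nY (diag_op m a) \<le> sqrt K * nX a" unfolding X(2) Y(2) real_sqrt_mult[symmetric] by (rule real_sqrt_le_mono)
qed (auto simp: diag_op_def algebra_simps)

lemma evaluation_weighted:
  assumes w: "\<And>n. w n > (0::real)"
  shows "\<exists>K\<ge>0. \<forall>y\<in>{a. summable (\<lambda>n. w n * (cmod (a n))^2)}. cmod (y j) \<le> K * sqrt (\<Sum>n. w n * (cmod (y n))^2)"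
proof (intro exI[of _ "1 / sqrt (w j)"] conjI ballI)
  show "0 \<le> 1 / sqrt (w j)" using w[of j] by simp
  fix y assume "y \<in> {a. summable (\<lambda>n. w n * (cmod (a n))^2)}"
  then have y: "summable (\<lambda>n. w n * (cmod (y n))^2)" by simp
  have "(\<Sum>n\<in>{j}. w n * (cmod (y n))^2) \<le> (\<Sum>n. w n * (cmod (y n))^2)"
    using w by (intro sum_le_suminf y) (auto simp: less_imp_le)
  then have "sqrt (w j * (cmod (y j))^2) \<le> sqrt (\<Sum>n. w n * (cmod (y n))^2)" by simp
  then have "sqrt (w j) * cmod (y j) \<le> sqrt (\<Sum>n. w n * (cmod (y n))^2)" by (simp add: real_sqrt_mult)
  then show "cmod (y j) \<le> 1 / sqrt (w j) * sqrt (\<Sum>n. w n * (cmod (y n))^2)" using w[of j] by (simp add: field_simps)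
qed

abbreviation "Tm \<equiv> cheb_space (- 1 / 2)"
abbreviation "Tp \<equiv> cheb_space (1 / 2)"
abbreviation "nm \<equiv> cheb_norm (- 1 / 2)"
abbreviation "np \<equiv> cheb_norm (1 / 2)"

lemma linear_Tm: "linear_set Tm" unfolding cheb_space_minus by (rule linear_weighted[OF wminus_pos])

lemma unit_seq_Tp: "unit_seq k \<in> Tp"
  unfolding cheb_space_plus by (rule CollectI, rule summable_finite[of "{k}"]) auto

lemma Tp_subset_Tm: "a \<in> Tp \<Longrightarrow> a \<in> Tm"
  unfolding cheb_space_plus cheb_space_minus using summable_imp_minus summable_plus_imp by blast

lemma cheb_coeff_unit: "cheb_coeff (cheb k) = unit_seq k" "cheb_coeff (ctp k) = unit_seq k"
  by (rule ext, rule cheb_coeff_cheb, rule ext, rule cheb_coeff_ctp)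

text \<open>Multiplication by \<open>n\<close> loses one order, from \<open>wplus\<close> to
  \<open>wminus\<close>. The graph contains every \<open>T_k\<close>, hence all unit sequences,
  which fixes the extension.\<close>

lemma sqrt_laplace_half:
  assumes a: "a \<in> Tp"
  shows "sqrt_laplace (1 / 2) a = diag_op of_nat a" (is ?A) and "diag_op of_nat a \<in> Tm"
proof -
  have e: "(1 / 2 - 1 :: real) = - 1 / 2" by simp
  have F: "bounded_op Tp np Tm nm (diag_op of_nat)"
  proof (rule bounded_diag_op[OF wplus_pos wminus_pos cheb_space_plus cheb_norm_plus cheb_space_minus cheb_norm_minus])
    fix n
    have "(real n)^2 \<le> (wplus n)^2" using wplus_ge(2)[of n] by (intro power_mono) auto
    then have "(real n)^2 / wplus n \<le> (wplus n)^2 / wplus n" using wplus_pos[of n] by (intro divide_right_mono) auto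
    then show "wminus n * (cmod (of_nat n))^2 \<le> 1 * wplus n" using wplus_pos[of n] by (simp add: wminus_eq power2_eq_square)
  qed
  show "diag_op of_nat a \<in> Tm" by (rule bounded_opD(1)[OF F a])
  let ?R = "{(cheb_coeff u, cheb_coeff f) |u f. (u, f) \<in> diag_graph real \<and> cheb_coeff u \<in> Tp}"
  have R: "diag_op of_nat d = e" if "(d, e) \<in> ?R" for d e using that by (auto simp: diag_graph_def diag_op_def)
  show ?A
    unfolding sqrt_laplace_def e op_sqrt_laplace
  proof (rule continuous_extension_seq[OF wplus_pos cheb_space_plus cheb_norm_plus F _ R _ a])
    show "\<exists>K\<ge>0. \<forall>y\<in>Tm. cmod (y j) \<le> K * nm y" for j
      unfolding cheb_space_minus cheb_norm_minus by (rule evaluation_weighted[OF wminus_pos])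
    show "unit_seq k \<in> Domain ?R" for k
    proof -
      have "(cheb_coeff (cheb k), cheb_coeff (\<lambda>x. cpx (real k) * cheb k x)) \<in> ?R"
        using cheb_diag[of k real] unit_seq_Tp[of k] unfolding cheb_coeff_unit(1)[symmetric] by blast
      then show ?thesis unfolding cheb_coeff_unit by (rule DomainI)
    qed
  qed
qed

lemma cheb_coeff_const: "cheb_coeff (\<lambda>x. c) = (\<lambda>n. c * unit_seq 0 n)"
proof
  fix n
  have "cheb_coeff (\<lambda>x. c * ctp 0 x) n = c * unit_seq 0 n" by (simp only: cheb_coeff_cmult[OF tpoly_L2w] cheb_coeff_ctp)
  then show "cheb_coeff (\<lambda>x. c) n = c * unit_seq 0 n" by simp
qed

lemma mean_value_eq:
  assumes "u \<in> L2w"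
  shows "mean_value u = (\<lambda>x. cheb_coeff u 0)"
proof
  fix x
  have t: "sq_int cheb_measure (tr u)" using assms by (simp add: L2w_iff)
  have "(LINT x|lborel. (indicator {-1<..<1} x * (tr u x / cpx (weight x))) * 1) = (LINT x|cheb_measure. tr u x * 1)"
    using sq_int_measurable[OF t] by (intro integral_weighted(1)) auto
  moreover have "(indicator {-1<..<1} x * (tr u x / cpx (weight x))) * 1 = indicator {-1<..<1} x *\<^sub>R (u x / cpx (weight x))" for x
    by (cases "x \<in> {-1<..<1}") (auto simp: tr_def)
  ultimately have "(LINT y:{-1<..<1}|lborel. u y / cpx (weight y)) = (LINT x|cheb_measure. tr u x * ctp 0 x)"
    by (simp add: set_lebesgue_integral_def)
  then show "mean_value u x = cheb_coeff u 0" unfolding mean_value_def cheb_coeff_eq[OF assms] by (simp add: cheb_const_def)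
qed

lemma proj0_half:
  assumes a: "a \<in> Tp"
  shows "proj0 (1 / 2) a = diag_op (unit_seq 0) a" (is ?A) and "diag_op (unit_seq 0) a \<in> Tp"
proof -
  have F: "bounded_op Tp np Tp np (diag_op (unit_seq 0))"
  proof (rule bounded_diag_op[OF wplus_pos wplus_pos cheb_space_plus cheb_norm_plus cheb_space_plus cheb_norm_plus])
    show "wplus n * (cmod (unit_seq 0 n))^2 \<le> 1 * wplus n" for n using wplus_pos[of n] by simp
  qed
  show "diag_op (unit_seq 0) a \<in> Tp" by (rule bounded_opD(1)[OF F a])
  let ?R = "{(cheb_coeff u, cheb_coeff (mean_value u)) |u. u \<in> L2w \<and> cheb_coeff u \<in> Tp}"
  have R: "diag_op (unit_seq 0) d = e" if "(d, e) \<in> ?R" for d e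
    using that by (auto simp: mean_value_eq cheb_coeff_const diag_op_def fun_eq_iff)
  show ?A
    unfolding proj0_def
  proof (rule continuous_extension_seq[OF wplus_pos cheb_space_plus cheb_norm_plus F _ R _ a])
    show "\<exists>K\<ge>0. \<forall>y\<in>Tp. cmod (y j) \<le> K * np y" for j
      unfolding cheb_space_plus cheb_norm_plus by (rule evaluation_weighted[OF wplus_pos])
    show "unit_seq k \<in> Domain ?R" for k
    proof -
      have "(cheb_coeff (cheb k), cheb_coeff (mean_value (cheb k))) \<in> ?R"
        using cheb_L2w[of k] unit_seq_Tp[of k] unfolding cheb_coeff_unit(1)[symmetric] by blast
      then show ?thesis unfolding cheb_coeff_unit by (rule DomainI)
    qed
  qed
qed

section \<open>Identification of division by the weight and of the coefficient isomorphisms\<close>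

lemma div_map_regular_dist:
  assumes f: "sq_int cheb_measure f"
  shows "div_map (cheb_coeff f) = regular_dist UNIV (\<lambda>x. indicator {-1<..<1} x * (f x / cpx (weight x)))"
proof
  fix \<phi>
  have fm: "f \<in> borel_measurable borel" using sq_int_measurable[OF f] by simp
  show "div_map (cheb_coeff f) \<phi> = regular_dist UNIV (\<lambda>x. indicator {-1<..<1} x * (f x / cpx (weight x))) \<phi>"
  proof (cases "\<phi> \<in> test_funs UNIV")
    case True
    have "(\<lambda>n. cheb_coeff f n * test_coeff \<phi> n) sums (LINT x|cheb_measure. f x * \<phi> x)"
      unfolding cheb_coeff_sq_int[OF f] test_coeff_def by (rule cheb_parseval(2)[OF f sq_int_bounded[OF True]])
    then have "div_map (cheb_coeff f) \<phi> = (LINT x|cheb_measure. f x * \<phi> x)" using True by (simp add: div_map_def sums_iff)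
    also have "\<dots> = (LINT x|lborel. (indicator {-1<..<1} x * (f x / cpx (weight x))) * \<phi> x)"
      by (rule integral_weighted(1)[OF fm test_funs_measurable[OF True], symmetric])
    finally show ?thesis using True by (simp add: regular_dist_def set_lebesgue_integral_def)
  qed (simp add: div_map_def regular_dist_def)
qed

lemma div_map_pairing: "div_map = pairing_dist (test_funs UNIV) test_coeff"
  by (auto simp: fun_eq_iff div_map_def pairing_dist_def)

lemma div_map_lin: "a \<in> Tm \<Longrightarrow> b \<in> Tm \<Longrightarrow> div_map (\<lambda>n. c * a n + d * b n) = (\<lambda>\<phi>. c * div_map a \<phi> + d * div_map b \<phi>)"
  and iso_div_map: "bounded_iso Tm nm H_tilde H_tilde_norm div_map"
  and evaluation_H_tilde: "\<exists>K\<ge>0. \<forall>v\<in>H_tilde. cmod (v \<phi>) \<le> K * H_tilde_norm v"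
proof -
  obtain K where K: "K \<ge> 0" "bij_betw div_map Tm H_tilde"
    "\<And>a. a \<in> Tm \<Longrightarrow> H_tilde_norm (div_map a) \<le> K * nm a" "\<And>a. a \<in> Tm \<Longrightarrow> nm a \<le> K * H_tilde_norm (div_map a)"
    using div_map_bijective by blast
  note iso = pairing_dist_iso[where S = "test_funs UNIV" and c = test_coeff, OF wminus_pos wplus_pos wminus_wplus(1)
      cheb_space_minus cheb_norm_minus, folded div_map_pairing, OF test_coeff_summable K(2,1,3,4)]
  show "a \<in> Tm \<Longrightarrow> b \<in> Tm \<Longrightarrow> div_map (\<lambda>n. c * a n + d * b n) = (\<lambda>\<phi>. c * div_map a \<phi> + d * div_map b \<phi>)"
    and "bounded_iso Tm nm H_tilde H_tilde_norm div_map" and "\<exists>K\<ge>0. \<forall>v\<in>H_tilde. cmod (v \<phi>) \<le> K * H_tilde_norm v"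
    by (rule iso; assumption)+
qed

lemma ext_map_pairing: "ext_map = pairing_dist (test_funs {-1<..<1}) plain_coeff"
  by (auto simp: fun_eq_iff ext_map_def pairing_dist_def)

lemma iso_ext_map: "bounded_iso Tp np H_half H_half_norm ext_map" (is ?A)
  and evaluation_H_half: "\<exists>K\<ge>0. \<forall>v\<in>H_half. cmod (v \<phi>) \<le> K * H_half_norm v"
proof -
  obtain K where K: "K \<ge> 0" "bij_betw ext_map Tp H_half"
    "\<And>a. a \<in> Tp \<Longrightarrow> H_half_norm (ext_map a) \<le> K * np a" "\<And>a. a \<in> Tp \<Longrightarrow> np a \<le> K * H_half_norm (ext_map a)"
    using ext_map_bijective by blast
  note iso = pairing_dist_iso[where S = "test_funs {-1<..<1}" and c = plain_coeff, OF wplus_pos wminus_pos wminus_wplus(2)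
      cheb_space_plus cheb_norm_plus, folded ext_map_pairing, OF summable_imp_minus[OF plain_coeff_summable] K(2,1,3,4)]
  show ?A and "\<exists>K\<ge>0. \<forall>v\<in>H_half. cmod (v \<phi>) \<le> K * H_half_norm v"
    by (rule iso; assumption)+
qed

text \<open>The \<open>T_k\<close> are smooth on the whole line and have the unit sequences as
  coefficients, so they already determine the extension from smooth functions.\<close>

lemma div_weight_eq:
  assumes a: "a \<in> Tm"
  shows "div_weight a = div_map a"
proof -
  let ?R = "{(cheb_coeff \<alpha>, regular_dist UNIV (\<lambda>x. indicator {-1<..<1} x * (\<alpha> x / cpx (weight x)))) | \<alpha>. smooth \<alpha>}"
  have F: "bounded_op Tm nm H_tilde H_tilde_norm div_map" using iso_div_map by (simp add: bounded_iso_def)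
  have R: "div_map d = e" if de: "(d, e) \<in> ?R" for d e
  proof -
    obtain \<alpha> where \<alpha>: "smooth \<alpha>" "d = cheb_coeff \<alpha>" "e = regular_dist UNIV (\<lambda>x. indicator {-1<..<1} x * (\<alpha> x / cpx (weight x)))"
      using de by blast
    have "bounded (\<alpha> ` {-1..1})" by (intro compact_imp_bounded compact_continuous_image smooth_continuous \<alpha>(1)) simp
    then obtain B where B: "\<forall>x\<in>{-1..1}. cmod (\<alpha> x) \<le> B" by (auto simp: bounded_iff)
    have "sq_int cheb_measure \<alpha>" by (rule sq_int_cheb_bounded[OF smooth_measurable[OF \<alpha>(1)]]) (use B in auto)
    then show ?thesis unfolding \<alpha>(2,3) by (rule div_map_regular_dist)
  qed
  show ?thesis
    unfolding div_weight_def
  proof (rule continuous_extension_seq[OF wminus_pos cheb_space_minus cheb_norm_minus F evaluation_H_tilde R _ a])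
    show "unit_seq k \<in> Domain ?R" for k
    proof -
      have "(cheb_coeff (ctp k), regular_dist UNIV (\<lambda>x. indicator {-1<..<1} x * (ctp k x / cpx (weight x)))) \<in> ?R"
        using smooth_tpoly[of k] by blast
      then show ?thesis unfolding cheb_coeff_unit by (rule DomainI)
    qed
  qed
qed

section \<open>The single-layer operator\<close>

text \<open>Eigenvalues of the weighted single layer: the values \<open>- pi ln 2\<close> and
  \<open>- pi / n\<close> of \<open>log_kernel\<close>, multiplied by
  \<open>- 1 / (2 pi)\<close>.\<close>

definition lam :: "nat \<Rightarrow> real" where
  "lam n = (if n = 0 then ln 2 / 2 else 1 / (2 * real n))"

lemma lam_pos: "lam n > 0" by (simp add: lam_def)

lemma log_kernel_integrable:
  assumes \<phi>: "\<phi> \<in> test_funs {-1<..<1}"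
  obtains D where "\<And>x. x \<in> {-1<..<1} \<Longrightarrow> integrable lborel (\<lambda>y. cpx (ln \<bar>x - y\<bar>) * \<phi> y)"
    "\<And>x. x \<in> {-1<..<1} \<Longrightarrow> (LINT y|lborel. cmod (cpx (ln \<bar>x - y\<bar>) * \<phi> y)) \<le> D"
proof -
  obtain C where C: "\<And>x. x \<in> {-1..1} \<Longrightarrow> (\<integral>\<^sup>+y. indicator {-1..1} y * ennreal \<bar>ln \<bar>x - y\<bar>\<bar> \<partial>lborel) \<le> ennreal C"
    using ln_abs_integral_bound by blast
  obtain B where B: "\<And>x. cmod (\<phi> x) \<le> B" using test_funs_bounded_integrable(2)[OF \<phi>] by blast
  have B0: "B \<ge> 0" by (rule order_trans[OF norm_ge_zero B[of 0]])
  have m[measurable]: "\<phi> \<in> borel_measurable borel" by (rule test_funs_measurable[OF \<phi>])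
  have nn: "(\<integral>\<^sup>+y. ennreal (norm (cpx (ln \<bar>x - y\<bar>) * \<phi> y)) \<partial>lborel) \<le> ennreal (B * max C 0)" if x: "x \<in> {-1<..<1}" for x
  proof -
    have "(\<integral>\<^sup>+y. ennreal (norm (cpx (ln \<bar>x - y\<bar>) * \<phi> y)) \<partial>lborel) \<le> (\<integral>\<^sup>+y. ennreal B * (indicator {-1..1} y * ennreal \<bar>ln \<bar>x - y\<bar>\<bar>) \<partial>lborel)"
    proof (rule nn_integral_mono)
      fix y
      show "ennreal (norm (cpx (ln \<bar>x - y\<bar>) * \<phi> y)) \<le> ennreal B * (indicator {-1..1} y * ennreal \<bar>ln \<bar>x - y\<bar>\<bar>)"
      proof (cases "y \<in> {-1<..<1}")
        case True
        have "\<bar>ln \<bar>x - y\<bar>\<bar> * cmod (\<phi> y) \<le> \<bar>ln \<bar>x - y\<bar>\<bar> * B" by (intro mult_left_mono B) simp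
        then have "ennreal (norm (cpx (ln \<bar>x - y\<bar>) * \<phi> y)) \<le> ennreal (B * \<bar>ln \<bar>x - y\<bar>\<bar>)"
          by (intro ennreal_leI) (simp add: norm_mult mult.commute)
        also have "\<dots> = ennreal B * (indicator {-1..1} y * ennreal \<bar>ln \<bar>x - y\<bar>\<bar>)" using True B0 by (simp add: ennreal_mult)
        finally show ?thesis .
      qed (simp add: test_funs_outside[OF \<phi>])
    qed
    also have "\<dots> = ennreal B * (\<integral>\<^sup>+y. indicator {-1..1} y * ennreal \<bar>ln \<bar>x - y\<bar>\<bar> \<partial>lborel)" by (rule nn_integral_cmult) measurable
    also have "\<dots> \<le> ennreal B * ennreal (max C 0)" using x by (intro mult_left_mono order_trans[OF C] ennreal_leI) auto
    also have "\<dots> = ennreal (B * max C 0)" using B0 by (simp add: ennreal_mult)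
    finally show ?thesis .
  qed
  have i: "integrable lborel (\<lambda>y. cpx (ln \<bar>x - y\<bar>) * \<phi> y)" if x: "x \<in> {-1<..<1}" for x
    by (rule integrableI_bounded) (use order_le_less_trans[OF nn[OF x] ennreal_less_top] in \<open>measurable, simp\<close>)
  show ?thesis
  proof (rule that[of "B * max C 0"])
    fix x :: real assume x: "x \<in> {-1<..<1}"
    show "integrable lborel (\<lambda>y. cpx (ln \<bar>x - y\<bar>) * \<phi> y)" by (rule i[OF x])
    have "ennreal (LINT y|lborel. cmod (cpx (ln \<bar>x - y\<bar>) * \<phi> y)) \<le> ennreal (B * max C 0)"
      using nn[OF x] nn_integral_eq_integral[OF integrable_norm[OF i[OF x]]] by simp
    then show "(LINT y|lborel. cmod (cpx (ln \<bar>x - y\<bar>) * \<phi> y)) \<le> B * max C 0" using B0 by (simp add: ennreal_le_iff)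
  qed
qed

lemma cheb_log_kernel:
  assumes y: "y \<in> {-1<..<1}"
  shows "(LINT x|cheb_measure. cpx (ln \<bar>x - y\<bar>) * ctp n x) = - cpx (2 * pi * lam n) * ctp n y"
proof -
  have th: "arccos y \<in> {0<..<pi}" "cos (arccos y) = y" using y by (auto simp: arccos_lt_bounded)
  have "(LINT x|cheb_measure. cpx (ln \<bar>x - y\<bar>) * ctp n x) = (LINT t|arc. cpx (ln \<bar>cos t - y\<bar>) * ctp n (cos t))"
    by (intro integral_cheb_measure(1)) measurable
  also have "\<dots> = (LINT t|arc. cpx (cos (real n * t) * ln \<bar>cos (arccos y) - cos t\<bar>))"
    unfolding th(2) by (simp add: tpoly_cos abs_minus_commute mult.commute)
  also have "\<dots> = cpx (if n = 0 then - pi * ln 2 else - (pi / real n) * cos (real n * arccos y))"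
    unfolding integral_complex_of_real log_kernel(2)[OF th(1)] ..
  also have "\<dots> = - cpx (2 * pi * lam n) * ctp n y"
    using tpoly_eq[of y n] y by (auto simp: lam_def)
  finally show ?thesis .
qed

text \<open>Exchanging the integrals lets the logarithm act on \<open>T_n / \<omega>\<close> instead
  of on \<phi>, which yields a multiple of \<open>T_n\<close> by \<open>log_kernel\<close>. The
  exchange is legitimate because the integral of \<open>|ln |x - y| \<phi> y|\<close> over
  \<open>y\<close> is bounded uniformly in \<open>x\<close>.\<close>

lemma log_potential_coeff:
  assumes \<phi>: "\<phi> \<in> test_funs {-1<..<1}"
  shows "log_potential \<phi> \<in> L2w" and "cheb_coeff (log_potential \<phi>) = diag_op (\<lambda>n. cpx (lam n)) (cheb_coeff (wfun \<phi>))" (is ?A)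
proof -
  interpret cm: finite_measure cheb_measure by (rule finite_measure_cheb_measure)
  interpret P: pair_sigma_finite cheb_measure lborel by unfold_locales
  let ?L = "\<lambda>x y. cpx (ln \<bar>x - y\<bar>) * \<phi> y"
  obtain D where D: "\<And>x. x \<in> {-1<..<1} \<Longrightarrow> integrable lborel (?L x)" "\<And>x. x \<in> {-1<..<1} \<Longrightarrow> (LINT y|lborel. cmod (?L x y)) \<le> D"
    using log_kernel_integrable[OF \<phi>] by blast
  have m[measurable]: "\<phi> \<in> borel_measurable borel" by (rule test_funs_measurable[OF \<phi>])
  have lp: "log_potential \<phi> x = - cpx (1 / (2 * pi)) * (LINT y|lborel. ?L x y)" for x
  proof -
    have "indicator {-1<..<1} y *\<^sub>R ?L x y = ?L x y" for y
      using test_funs_outside[OF \<phi>, of y] by (cases "y \<in> {-1<..<1}") auto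
    then show ?thesis by (simp add: log_potential_def set_lebesgue_integral_def)
  qed
  have "(\<lambda>x. LINT y|lborel. ?L x y) \<in> borel_measurable borel"
    by (rule lborel.borel_measurable_lebesgue_integral) measurable
  then have lm: "log_potential \<phi> \<in> borel_measurable borel" unfolding lp[abs_def] by measurable
  have sq: "sq_int cheb_measure (log_potential \<phi>)"
  proof (rule sq_int_cheb_bounded[OF lm])
    fix x :: real assume x: "x \<in> {-1<..<1}"
    have "cmod (log_potential \<phi> x) = 1 / (2 * pi) * cmod (LINT y|lborel. ?L x y)" unfolding lp by (simp add: norm_mult norm_divide)
    also have "\<dots> \<le> 1 / (2 * pi) * D" by (intro mult_left_mono order_trans[OF integral_norm_bound D(2)[OF x]]) simp
    finally show "cmod (log_potential \<phi> x) \<le> 1 / (2 * pi) * D" .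
  qed
  show "log_potential \<phi> \<in> L2w" by (rule sq_int_L2w[OF sq])
  have D0: "D \<ge> 0" by (rule order_trans[OF integral_nonneg D(2)[of 0]]) auto
  have pi: "integrable (cheb_measure \<Otimes>\<^sub>M lborel) (\<lambda>(x, y). ?L x y * ctp n x)" for n
  proof (rule P.Fubini_integrable)
    show "(\<lambda>(x, y). ?L x y * ctp n x) \<in> borel_measurable (cheb_measure \<Otimes>\<^sub>M lborel)" by measurable
    have 1: "(\<lambda>x. LINT y|lborel. cmod (?L x y * ctp n x)) \<in> borel_measurable borel"
      by (rule lborel.borel_measurable_lebesgue_integral) measurable
    show "integrable cheb_measure (\<lambda>x. LINT y|lborel. norm (case (x, y) of (x, y) \<Rightarrow> ?L x y * ctp n x))"
    proof (rule cm.integrable_const_bound[of _ D])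
      show "AE x in cheb_measure. norm (LINT y|lborel. norm (case (x, y) of (x, y) \<Rightarrow> ?L x y * ctp n x)) \<le> D"
        using AE_cheb_measure_open
      proof eventually_elim
        case (elim x)
        have "(LINT y|lborel. cmod (?L x y * ctp n x)) = (LINT y|lborel. \<bar>tpoly n x\<bar> * cmod (?L x y))" by (simp add: norm_mult mult.commute)
        also have "\<dots> = \<bar>tpoly n x\<bar> * (LINT y|lborel. cmod (?L x y))" by (rule integral_mult_right_zero)
        also have "\<dots> \<le> 1 * D" using elim D0 by (intro mult_mono abs_tpoly_le D(2) integral_nonneg) auto
        finally have "(LINT y|lborel. cmod (?L x y * ctp n x)) \<le> D" by simp
        moreover have "0 \<le> (LINT y|lborel. cmod (?L x y * ctp n x))" by (rule integral_nonneg) simp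
        ultimately show ?case unfolding prod.case by (simp only: real_norm_def abs_of_nonneg)
      qed
    qed (use 1 in simp)
    show "AE x in cheb_measure. integrable lborel (\<lambda>y. case (x, y) of (x, y) \<Rightarrow> ?L x y * ctp n x)"
      using AE_cheb_measure_open by eventually_elim (unfold prod.case, intro integrable_mult_left D(1))
  qed
  show ?A
  proof
    fix n
    have "(LINT x|cheb_measure. log_potential \<phi> x * ctp n x) = (LINT x|cheb_measure. - cpx (1 / (2 * pi)) * (LINT y|lborel. ?L x y * ctp n x))"
    proof -
      have "(LINT y|lborel. ?L x y * ctp n x) = (LINT y|lborel. ?L x y) * ctp n x" for x by (rule integral_mult_left_zero)
      then show ?thesis by (simp only: lp mult.assoc)
    qed
    also have "\<dots> = - cpx (1 / (2 * pi)) * (LINT x|cheb_measure. (LINT y|lborel. ?L x y * ctp n x))" by (rule integral_mult_right_zero)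
    also have "(LINT x|cheb_measure. (LINT y|lborel. ?L x y * ctp n x)) = (LINT y|lborel. (LINT x|cheb_measure. ?L x y * ctp n x))"
      by (rule P.Fubini_integral[OF pi, symmetric])
    also have "\<dots> = (LINT y|lborel. - cpx (2 * pi * lam n) * (ctp n y * \<phi> y))"
    proof (intro int_cong)
      fix y
      have "(LINT x|cheb_measure. ?L x y * ctp n x) = (LINT x|cheb_measure. \<phi> y * (cpx (ln \<bar>x - y\<bar>) * ctp n x))" by (simp only: mult_ac)
      also have "\<dots> = \<phi> y * (LINT x|cheb_measure. cpx (ln \<bar>x - y\<bar>) * ctp n x)" by (rule integral_mult_right_zero)
      also have "\<dots> = - cpx (2 * pi * lam n) * (ctp n y * \<phi> y)"
        using test_funs_outside[OF \<phi>, of y] by (cases "y \<in> {-1<..<1}") (simp_all add: cheb_log_kernel)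
      finally show "(LINT x|cheb_measure. ?L x y * ctp n x) = - cpx (2 * pi * lam n) * (ctp n y * \<phi> y)" .
    qed
    also have "\<dots> = - cpx (2 * pi * lam n) * plain_coeff \<phi> n" unfolding plain_coeff_def by (rule integral_mult_right_zero)
    finally have "(LINT x|cheb_measure. log_potential \<phi> x * ctp n x) = cpx (lam n) * plain_coeff \<phi> n" by simp
    then show "cheb_coeff (log_potential \<phi>) n = diag_op (\<lambda>n. cpx (lam n)) (cheb_coeff (wfun \<phi>)) n"
      unfolding cheb_coeff_sq_int[OF sq] diag_op_def cheb_coeff_sq_int[OF sq_int_wfun[OF \<phi>]] wfun_ctp[OF \<phi>] by simp
  qed
qed

lemma wfun_density:
  assumes \<phi>: "\<phi> \<in> test_funs {-1<..<1}"
  shows "regular_dist UNIV \<phi> = div_map (cheb_coeff (wfun \<phi>))"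
proof -
  have "indicator {-1<..<1} x * (wfun \<phi> x / cpx (weight x)) = \<phi> x" for x
    using weight_pos[of x] test_funs_outside[OF \<phi>, of x] by (cases "x \<in> {-1<..<1}") (auto simp: wfun_def)
  then show ?thesis using div_map_regular_dist[OF sq_int_wfun[OF \<phi>]] by simp
qed

abbreviation "Lam \<equiv> diag_op (\<lambda>n. cpx (lam n))"
abbreviation "Inv_lam \<equiv> diag_op (\<lambda>n. cpx (1 / lam n))"

text \<open>\<open>wplus n * lam n\<close> stays between \<open>ln 2 / 2\<close> and 1, so
  \<open>Lam\<close> gains exactly the one order that separates the two spaces.\<close>

lemma iso_Lam: "bounded_iso Tm nm Tp np Lam" and Inv_lam: "a \<in> Tp \<Longrightarrow> Inv_lam a \<in> Tm" "Lam (Inv_lam a) = a" "Inv_lam (Lam a) = a"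
proof -
  have F: "bounded_op Tm nm Tp np Lam"
  proof (rule bounded_diag_op[OF wminus_pos wplus_pos cheb_space_minus cheb_norm_minus cheb_space_plus cheb_norm_plus])
    fix n
    have "wplus n * lam n \<le> 1"
    proof (cases "n = 0")
      case True
      have "ln 2 \<le> (1::real)" using ln_le_minus_one[of 2] by simp
      then show ?thesis using True by (simp add: wplus_def lam_def)
    next
      case False
      then have "wplus n \<le> 2 * real n" using wplus_ge(3)[of n] by simp
      then show ?thesis using False by (simp add: lam_def)
    qed
    then have "(wplus n * lam n)^2 \<le> 1^2" using wplus_pos[of n] lam_pos[of n] by (intro power_mono) auto
    then have "wplus n * (wplus n * (lam n)^2) \<le> 1" by (simp add: power2_eq_square mult_ac)
    then have "wplus n * (lam n)^2 \<le> 1 / wplus n" using wplus_pos[of n] by (simp only: pos_le_divide_eq mult.commute)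
    then show "wplus n * (cmod (cpx (lam n)))^2 \<le> 1 * wminus n" by (simp add: wminus_eq)
  qed
  have G: "bounded_op Tp np Tm nm Inv_lam"
  proof (rule bounded_diag_op[OF wplus_pos wminus_pos cheb_space_plus cheb_norm_plus cheb_space_minus cheb_norm_minus])
    fix n
    have "1 / lam n \<le> 2 / ln 2 * wplus n"
    proof (cases "n = 0")
      case True
      then show ?thesis by (simp add: wplus_def lam_def)
    next
      case False
      have "ln 2 \<le> (1::real)" using ln_le_minus_one[of 2] by simp
      then have "2 \<le> 2 / ln (2::real)" by (simp add: pos_le_divide_eq)
      then have "2 * real n \<le> 2 / ln 2 * wplus n" using wplus_ge(2)[of n] by (intro mult_mono) auto
      then show ?thesis using False by (simp add: lam_def)
    qed
    then have "(1 / lam n)^2 \<le> (2 / ln 2 * wplus n)^2" using lam_pos[of n] by (intro power_mono) auto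
    then have "wminus n * (1 / lam n)^2 \<le> wminus n * (2 / ln 2 * wplus n)^2" using wminus_pos[of n] by (intro mult_left_mono) auto
    also have "\<dots> = (2 / ln 2)^2 * wplus n" using wplus_pos[of n] by (simp add: wminus_eq power2_eq_square)
    finally show "wminus n * (cmod (cpx (1 / lam n)))^2 \<le> (2 / ln 2)^2 * wplus n" by (simp only: norm_of_real power2_abs)
  qed
  have l0: "lam n \<noteq> 0" for n using lam_pos[of n] by simp
  show 1: "Lam (Inv_lam a) = a" "Inv_lam (Lam a) = a" for a using l0 by (auto simp: diag_op_def)
  show 2: "a \<in> Tp \<Longrightarrow> Inv_lam a \<in> Tm" for a by (rule bounded_opD(1)[OF G])
  obtain K where K: "\<And>a. a \<in> Tp \<Longrightarrow> nm (Inv_lam a) \<le> K * np a" using G unfolding bounded_op_def by blast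
  show "bounded_iso Tm nm Tp np Lam"
  proof (rule bounded_isoI[OF linear_Tm F])
    show "bij_betw Lam Tm Tp" using 1 2 bounded_opD(1)[OF F] by (intro bij_betw_byWitness[where f' = Inv_lam]) auto
    show "nm a \<le> K * np (Lam a)" if "a \<in> Tm" for a using K[OF bounded_opD(1)[OF F that]] unfolding 1 .
  qed
qed

section \<open>Composition and inversion of bounded isomorphisms, and the single layer in
  coefficients\<close>

lemma bounded_iso_comp:
  assumes X: "linear_set X" and F: "bounded_iso X nX Y nY F" and G: "bounded_iso Y nY Z nZ G"
    and n: "\<And>y. y \<in> Y \<Longrightarrow> 0 \<le> nY y" "\<And>z. z \<in> Z \<Longrightarrow> 0 \<le> nZ z"
  shows "bounded_iso X nX Z nZ (\<lambda>x. G (F x))"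
proof -
  have Fb: "bounded_op X nX Y nY F" "bij_betw F X Y" and Gb: "bounded_op Y nY Z nZ G" "bij_betw G Y Z"
    using F G by (auto simp: bounded_iso_def)
  obtain C where C: "C \<ge> 0" "\<And>y. y \<in> Y \<Longrightarrow> nX (inv_into X F y) \<le> C * nY y"
    using bounded_op_bound[OF bounded_iso_inverse[OF F] n(1)] by blast
  obtain D where D: "D \<ge> 0" "\<And>z. z \<in> Z \<Longrightarrow> nY (inv_into Y G z) \<le> D * nZ z"
    using bounded_op_bound[OF bounded_iso_inverse[OF G] n(2)] by blast
  show ?thesis
  proof (rule bounded_isoI[OF X bounded_op_comp[OF Fb(1) Gb(1) n(1)]])
    show "bij_betw (\<lambda>x. G (F x)) X Z" using bij_betw_trans[OF Fb(2) Gb(2)] by (simp add: o_def)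
    fix x assume x: "x \<in> X"
    have y: "F x \<in> Y" by (rule bounded_opD(1)[OF Fb(1) x])
    have "nX x \<le> C * nY (F x)" using C(2)[OF y] x Fb(2) by (simp add: bij_betw_def inv_into_f_f)
    also have "nY (F x) \<le> D * nZ (G (F x))" using D(2)[OF bounded_opD(1)[OF Gb(1) y]] y Gb(2) by (simp add: bij_betw_def inv_into_f_f)
    then have "C * nY (F x) \<le> C * (D * nZ (G (F x)))" using C(1) by (rule mult_left_mono)
    finally show "nX x \<le> C * D * nZ (G (F x))" by (simp add: mult.assoc)
  qed
qed

lemma bounded_iso_inv:
  assumes F: "bounded_iso X nX Y nY F" and Y: "linear_set Y" and n: "\<And>x. x \<in> X \<Longrightarrow> 0 \<le> nX x"
  shows "bounded_iso Y nY X nX (inv_into X F)"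
proof -
  have Fb: "bounded_op X nX Y nY F" "bij_betw F X Y" using F by (auto simp: bounded_iso_def)
  obtain C where C: "\<And>x. x \<in> X \<Longrightarrow> nY (F x) \<le> C * nX x" using Fb(1) unfolding bounded_op_def by blast
  show ?thesis
  proof (rule bounded_isoI[OF Y bounded_iso_inverse[OF F] bij_betw_inv_into[OF Fb(2)]])
    fix y assume y: "y \<in> Y"
    then show "nY y \<le> C * nX (inv_into X F y)"
      using C[of "inv_into X F y"] Fb(2) by (simp add: bij_betw_def inv_into_into f_inv_into_f)
  qed
qed

lemma bounded_iso_cong:
  assumes X: "linear_set X" and eq: "\<And>x. x \<in> X \<Longrightarrow> F x = G x" and G: "bounded_iso X nX Y nY G"
  shows "bounded_iso X nX Y nY F"
proof -
  have e: "(y \<in> X \<and> F y = x) = (y \<in> X \<and> G y = x)" for x y using eq by auto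
  have "inv_into X F = inv_into X G" unfolding inv_into_def e ..
  moreover have "bounded_op X nX Y nY F" by (rule bounded_op_cong[OF X eq]) (use G in \<open>auto simp: bounded_iso_def\<close>)
  moreover have "bij_betw F X Y" using G bij_betw_cong[of X F G] eq by (simp add: bounded_iso_def)
  ultimately show ?thesis using G by (simp add: bounded_iso_def)
qed

lemma linear_image:
  assumes X: "linear_set X" and F: "bounded_iso X nX Y nY F"
  shows "linear_set Y"
proof -
  have Fb: "bounded_op X nX Y nY F" "F ` X = Y" using F by (auto simp: bounded_iso_def bij_betw_def)
  have cl: "x \<in> X \<Longrightarrow> y \<in> X \<Longrightarrow> (\<lambda>i. x i + y i) \<in> X" "x \<in> X \<Longrightarrow> (\<lambda>i. c * x i) \<in> X" for x y c
    using X unfolding linear_set_def by blast+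
  show ?thesis unfolding linear_set_def Fb(2)[symmetric]
    by (auto simp: bounded_opD(2,3)[OF Fb(1), symmetric] intro!: imageI cl)
qed

lemma H_tilde_norm_nonneg: "v \<in> H_tilde \<Longrightarrow> 0 \<le> H_tilde_norm v"
  unfolding H_tilde_norm_def H_tilde_def by (intro sobolev_norm_nonneg) simp

lemma H_half_norm_nonneg: "v \<in> H_half \<Longrightarrow> 0 \<le> H_half_norm v"
  by (rule H_half_norm_ge) (auto intro!: integral_nonneg)

text \<open>\<open>Lam\<close> transported through the two coefficient isomorphisms, the candidate
  for \<open>single_layer\<close>.\<close>

definition layer :: "dist \<Rightarrow> dist" where
  "layer v = ext_map (Lam (inv_into Tm div_map v))"

lemma iso_layer: "bounded_iso H_tilde H_tilde_norm H_half H_half_norm layer" (is ?A)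
  and linear_H_tilde: "linear_set H_tilde"
proof -
  show L: "linear_set H_tilde" by (rule linear_image[OF linear_Tm iso_div_map])
  have "bounded_iso H_tilde H_tilde_norm Tm nm (inv_into Tm div_map)"
    by (rule bounded_iso_inv[OF iso_div_map L cheb_norm_nonneg])
  from bounded_iso_comp[OF L this iso_Lam cheb_norm_nonneg cheb_norm_nonneg]
  have "bounded_iso H_tilde H_tilde_norm Tp np (\<lambda>v. Lam (inv_into Tm div_map v))" .
  from bounded_iso_comp[OF L this iso_ext_map cheb_norm_nonneg H_half_norm_nonneg]
  show ?A unfolding layer_def[abs_def] .
qed

lemma layer_div_map: "a \<in> Tm \<Longrightarrow> layer (div_map a) = ext_map (Lam a)"
  using iso_div_map by (simp add: layer_def bounded_iso_def bij_betw_def inv_into_f_f)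

lemma wfun_Tm: "\<phi> \<in> test_funs {-1<..<1} \<Longrightarrow> cheb_coeff (wfun \<phi>) \<in> Tm"
  unfolding cheb_space_minus using summable_imp_minus[OF cheb_coeff_summable[OF sq_int_L2w[OF sq_int_wfun]]] by blast

lemma layer_test:
  assumes \<phi>: "\<phi> \<in> test_funs {-1<..<1}"
  shows "layer (regular_dist UNIV \<phi>) = regular_dist {-1<..<1} (log_potential \<phi>)"
  unfolding wfun_density[OF \<phi>] layer_div_map[OF wfun_Tm[OF \<phi>]] log_potential_coeff(2)[OF \<phi>, symmetric]
  by (rule ext_map_cheb_coeff[OF log_potential_coeff(1)[OF \<phi>]])

lemma single_layer_eq:
  assumes v: "v \<in> H_tilde"
  shows "single_layer v = layer v"
proof -
  let ?R = "{(regular_dist UNIV \<phi>, regular_dist {-1<..<1} (log_potential \<phi>)) | \<phi>. \<phi> \<in> test_funs {-1<..<1}}"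
  have F: "bounded_op H_tilde H_tilde_norm H_half H_half_norm layer" using iso_layer by (simp add: bounded_iso_def)
  have R: "layer d = e" if "(d, e) \<in> ?R" for d e using that layer_test by blast
  show ?thesis
    unfolding single_layer_def
  proof (rule continuous_extension_eq[OF F R])
    fix G assume G: "bounded_op H_tilde H_tilde_norm H_half H_half_norm G" and GR: "\<And>d e. (d, e) \<in> ?R \<Longrightarrow> G d = e"
    have D: "bounded_op Tm nm H_tilde H_tilde_norm div_map" using iso_div_map by (simp add: bounded_iso_def)
    obtain a where a: "a \<in> Tm" "v = div_map a" using v iso_div_map by (auto simp: bounded_iso_def bij_betw_def)
    show "G v = layer v"
    proof
      fix \<psi>
      obtain E where E: "E \<ge> 0" "\<And>u. u \<in> H_half \<Longrightarrow> cmod (u \<psi>) \<le> E * H_half_norm u" using evaluation_H_half by blast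
      \<comment> \<open>The difference of the two operators, read in coefficients and evaluated at
        one \<psi>, so that the duality of weighted \<open>l^2\<close> spaces applies.\<close>
      define H where "H b = G (div_map b) \<psi> - layer (div_map b) \<psi>" for b
      note GD = bounded_op_comp[OF D G H_tilde_norm_nonneg] and FD = bounded_op_comp[OF D F H_tilde_norm_nonneg]
      obtain C1 where C1: "\<And>b. b \<in> Tm \<Longrightarrow> H_half_norm (G (div_map b)) \<le> C1 * nm b" using GD unfolding bounded_op_def by blast
      obtain C2 where C2: "\<And>b. b \<in> Tm \<Longrightarrow> H_half_norm (layer (div_map b)) \<le> C2 * nm b" using FD unfolding bounded_op_def by blast
      have Hb: "cmod (H b) \<le> (E * (C1 + C2)) * sqrt (\<Sum>n. wminus n * (cmod (b n))^2)" if b: "b \<in> Tm" for b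
      proof -
        have "cmod (H b) \<le> cmod (G (div_map b) \<psi>) + cmod (layer (div_map b) \<psi>)" unfolding H_def by (rule norm_triangle_ineq4)
        also have "\<dots> \<le> E * (C1 * nm b) + E * (C2 * nm b)"
          by (intro add_mono order_trans[OF E(2)[OF bounded_opD(1)[OF GD b]] mult_left_mono[OF C1[OF b] E(1)]]
              order_trans[OF E(2)[OF bounded_opD(1)[OF FD b]] mult_left_mono[OF C2[OF b] E(1)]])
        finally show ?thesis unfolding cheb_norm_minus by (simp add: algebra_simps)
      qed
      have H: "b \<in> Tm \<Longrightarrow> (\<lambda>n. b n * H (unit_seq n)) sums H b" "summable (\<lambda>n. (cmod (H (unit_seq n)))^2 / wminus n)" for b
      proof -
        have add: "H (\<lambda>n. b n + c n) = H b + H c" if "b \<in> Tm" "c \<in> Tm" for b c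
          using bounded_opD(2)[OF GD that] bounded_opD(2)[OF FD that] by (simp add: H_def)
        have cm: "H (\<lambda>n. c * b n) = c * H b" if "b \<in> Tm" for b c
          using bounded_opD(3)[OF GD that, of c] bounded_opD(3)[OF FD that, of c] by (simp add: H_def algebra_simps)
        note bf = bounded_functional[where w = wminus and H = H and K = "E * (C1 + C2)", OF wminus_pos, folded cheb_space_minus, OF add cm Hb]
        show "b \<in> Tm \<Longrightarrow> (\<lambda>n. b n * H (unit_seq n)) sums H b" by (rule bf(1))
        show "summable (\<lambda>n. (cmod (H (unit_seq n)))^2 / wminus n)" by (rule bf(2))
      qed
      \<comment> \<open>The factor \<open>cheb_const n\<close> is moved from the coefficients of
        \<open>wfun \<phi>\<close> to the functional, so that vanishing on test functions reads as
        equality of \<open>ext_map ?\<beta>\<close> with the zero distribution. Since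
        \<open>?\<beta>\<close> is square summable, \<open>cheb_series\<close> recovers it, and it
        is zero.\<close>
      let ?\<beta> = "\<lambda>n. cpx (cheb_const n) * H (unit_seq n)"
      have "summable (\<lambda>n. wplus n * (cmod (H (unit_seq n)))^2)" using H(2) by (simp add: wminus_eq mult.commute)
      then have \<beta>: "summable (\<lambda>n. (cmod (?\<beta> n))^2)"
        using cheb_const_le_1 cheb_const_pos by (intro summable_scaled_square summable_plus_imp) (simp_all add: abs_of_pos)
      have z: "ext_map ?\<beta> = ext_map (\<lambda>n. 0)"
      proof
        fix \<phi>
        show "ext_map ?\<beta> \<phi> = ext_map (\<lambda>n. 0) \<phi>"
        proof (cases "\<phi> \<in> test_funs {-1<..<1}")
          case True
          have "(regular_dist UNIV \<phi>, regular_dist {-1<..<1} (log_potential \<phi>)) \<in> ?R" using True by blast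
          then have "H (cheb_coeff (wfun \<phi>)) = 0" using GR layer_test[OF True] unfolding H_def wfun_density[OF True, symmetric] by simp
          then have "(\<lambda>n. cheb_coeff (wfun \<phi>) n * H (unit_seq n)) sums 0" using H(1)[OF wfun_Tm[OF True]] by simp
          moreover have "cheb_coeff (wfun \<phi>) n * H (unit_seq n) = ?\<beta> n * plain_coeff \<phi> n" for n
            unfolding cheb_coeff_sq_int[OF sq_int_wfun[OF True]] wfun_ctp[OF True] by simp
          ultimately have "(\<lambda>n. ?\<beta> n * plain_coeff \<phi> n) sums 0" by simp
          then show ?thesis using True by (simp only: ext_map_def if_True sums_iff mult_zero_left suminf_zero)
        qed (simp add: ext_map_def)
      qed
      have "?\<beta> = cheb_series (ext_map ?\<beta>)" by (rule cheb_series_ext_map[OF \<beta>, symmetric])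
      also have "\<dots> = cheb_series (ext_map (\<lambda>n. 0))" by (simp only: z)
      also have "\<dots> = (\<lambda>n. 0)" by (rule cheb_series_ext_map) simp
      finally have "H (unit_seq n) = 0" for n using cheb_const_pos[of n] by (auto dest: fun_cong[where x = n])
      then have "H a = 0" using sums_unique2[OF H(1)[OF a(1)]] by simp
      then show "G v \<psi> = layer v \<psi>" by (simp add: H_def a(2))
    qed
  qed
qed

lemma weighted_single_layer_eq:
  assumes a: "a \<in> Tm"
  shows "weighted_single_layer a = Lam a"
proof -
  have "bounded_op Tm nm Tp np Lam" using iso_Lam by (simp add: bounded_iso_def)
  then have "Lam a \<in> Tp" using a by (rule bounded_opD(1))
  then have "summable (\<lambda>n. (cmod (Lam a n))^2)" unfolding cheb_space_plus by (intro summable_plus_imp) simp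
  then show ?thesis
    unfolding weighted_single_layer_def div_weight_eq[OF a] single_layer_eq[OF div_map_H_tilde[OF a]] layer_div_map[OF a]
    by (rule cheb_series_ext_map)
qed

text \<open>\<open>1 / lam n\<close> is \<open>2 n\<close> for \<open>n > 0\<close> and
  \<open>2 / ln 2\<close> for \<open>n = 0\<close>, where the square root vanishes and the
  projection supplies the missing value.\<close>

lemma Inv_lam_eq:
  assumes "a \<in> Tp"
  shows "Inv_lam a = (\<lambda>n. 2 * sqrt_laplace (1 / 2) a n + cpx (2 / ln 2) * proj0 (1 / 2) a n)"
  unfolding sqrt_laplace_half(1)[OF assms] proj0_half(1)[OF assms] by (auto simp: diag_op_def lam_def fun_eq_iff)

theorem theorem1:
  shows
    "bounded_iso (cheb_space (-1/2)) (cheb_norm (-1/2)) (cheb_space (1/2)) (cheb_norm (1/2))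
           weighted_single_layer \<and>
     (\<forall>u\<in>cheb_space (1/2).
           inv_into (cheb_space (-1/2)) weighted_single_layer u =
             (\<lambda>n. 2 * sqrt_laplace (1/2) u n + complex_of_real (2 / ln 2) * proj0 (1/2) u n)) \<and>
     bounded_iso H_tilde H_tilde_norm H_half H_half_norm single_layer \<and>
     (\<forall>v\<in>H_half.
           inv_into H_tilde single_layer v =
             (\<lambda>\<phi>. 2 * div_weight (sqrt_laplace (1/2) (cheb_series v)) \<phi>
                 + complex_of_real (2 / ln 2) * div_weight (proj0 (1/2) (cheb_series v)) \<phi>))"
proof (intro conjI ballI)
  show W: "bounded_iso Tm nm Tp np weighted_single_layer"
    by (rule bounded_iso_cong[OF linear_Tm weighted_single_layer_eq iso_Lam])
  show S: "bounded_iso H_tilde H_tilde_norm H_half H_half_norm single_layer"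
    by (rule bounded_iso_cong[OF linear_H_tilde single_layer_eq iso_layer])
  fix u assume u: "u \<in> Tp"
  have "inv_into Tm weighted_single_layer u = Inv_lam u"
    using W Inv_lam(1)[OF u] weighted_single_layer_eq[OF Inv_lam(1)[OF u]] Inv_lam(2)[of u]
    by (intro inv_into_f_eq) (auto simp: bounded_iso_def bij_betw_def)
  then show "inv_into Tm weighted_single_layer u = (\<lambda>n. 2 * sqrt_laplace (1/2) u n + complex_of_real (2 / ln 2) * proj0 (1/2) u n)"
    unfolding Inv_lam_eq[OF u] .
next
  have S: "bounded_iso H_tilde H_tilde_norm H_half H_half_norm single_layer"
    by (rule bounded_iso_cong[OF linear_H_tilde single_layer_eq iso_layer])
  fix v assume "v \<in> H_half"
  then obtain b where b: "b \<in> Tp" "v = ext_map b" using iso_ext_map by (auto simp: bounded_iso_def bij_betw_def)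
  have cs: "cheb_series v = b"
    unfolding b(2) using b(1) unfolding cheb_space_plus by (intro cheb_series_ext_map summable_plus_imp) simp
  have m: "diag_op of_nat b \<in> Tm" "diag_op (unit_seq 0) b \<in> Tm"
    by (rule sqrt_laplace_half(2)[OF b(1)], rule Tp_subset_Tm[OF proj0_half(2)[OF b(1)]])
  have "single_layer (div_map (Inv_lam b)) = v"
    unfolding single_layer_eq[OF div_map_H_tilde[OF Inv_lam(1)[OF b(1)]]] layer_div_map[OF Inv_lam(1)[OF b(1)]] Inv_lam(2) b(2) ..
  then have "inv_into H_tilde single_layer v = div_map (Inv_lam b)"
    using S div_map_H_tilde[OF Inv_lam(1)[OF b(1)]] by (intro inv_into_f_eq) (auto simp: bounded_iso_def bij_betw_def)
  also have "\<dots> = (\<lambda>\<phi>. 2 * div_map (diag_op of_nat b) \<phi> + complex_of_real (2 / ln 2) * div_map (diag_op (unit_seq 0) b) \<phi>)"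
    unfolding Inv_lam_eq[OF b(1)] sqrt_laplace_half(1)[OF b(1)] proj0_half(1)[OF b(1)] by (rule div_map_lin[OF m])
  finally show "inv_into H_tilde single_layer v = (\<lambda>\<phi>. 2 * div_weight (sqrt_laplace (1/2) (cheb_series v)) \<phi>
                 + complex_of_real (2 / ln 2) * div_weight (proj0 (1/2) (cheb_series v)) \<phi>)"
    unfolding cs sqrt_laplace_half(1)[OF b(1)] proj0_half(1)[OF b(1)] div_weight_eq[OF m(1)] div_weight_eq[OF m(2)] .
qed

end
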